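(* Let $G$ be a finite group, let $\underline{S}$ be a $G$-Tambara functor and let $\underline{R}$ be an $\underline{S}$-Tambara functor. If $\underline{M}$ is an $\underline{R}$-module, then there is a natural isomorphism $$\mathrm{Der}^{1,G}_{\underline{S}}(\underline{R},\underline{M})\cong\mathrm{Hom}_{\underline{R}}\big(\Omega^{1,G}_{\underline{R}/\underline{S}},\underline{M}\big),$$ where $\mathrm{Der}^{1,G}_{\underline{S}}(\underline{R},\underline{M})$ is the set of genuine $\underline{S}$-derivations from $\underline{R}$ to $\underline{M}$ and $\Omega^{1,G}_{\underline{R}/\underline{S}}$ is the $\underline{R}$-module of genuine K\"ahler differentials.
   Context: **Tambara functors.** A $G$-Tambara functor $\underline{R}$ assigns to each finite $G$-set $T$ a commutative ring $\underline{R}(T)$ and to each map $f\colon T\to T'$ of finite $G$-sets a restriction $R_f\colon\underline{R}(T')\to\underline{R}(T)$ (ring map), a transfer $T_f\colon\underline{R}(T)\to\underline{R}(T')$ (additive) and a norm $N_f\colon\underline{R}(T)\to\underline{R}(T')$ (multiplicative), each functorial, taking disjoint unions to products, satisfying base change for pullback squares and the usual relation $N_gT_h=T_{h'}N_{g'}R_{f'}$ for exponential diagrams. Write $tr_H^K,N_H^K$ for $T_f,N_f$ with $f\colon G/H\to G/K$ the canonical projection, $H\subset K\subset G$. For $K\subset G$, $i_K^\ast\underline{R}(T)=\underline{R}(G\times_KT)$. An $\underline{S}$-Tambara functor is a Tambara functor $\underline{R}$ with a map of Tambara functors $\eta\colon\underline{S}\to\underline{R}$. An $\underline{R}$-module is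 a module, in Mackey functors with the box product $\Box$, over the underlying commutative Green functor of $\underline{R}$. **Genuine derivations.** For an $\underline{R}$-module $\underline{M}$, a map of Mackey functors $d\colon\underline{R}\to\underline{M}$ is a genuine $\underline{S}$-derivation if: (1) $d(r_1r_2)=r_1d(r_2)+d(r_1)r_2$ in $\underline{M}(T)$ for all finite $G$-sets $T$ and $r_1,r_2\in\underline{R}(T)$; (2) for all $H\subset K\subset G$ and $a\in\underline{R}(G/H)$, $d(N_H^Ka)=tr_H^K\big(N_{d_2}R_{d_1}(a)\cdot d(a)\big)$, where $d_1,d_2\colon(K/H\times K/H)\setminus\Delta\to K/H$ are the restrictions of the two projections to the complement of the diagonal, and $N_{d_2}R_{d_1}(a)\in i_K^\ast\underline{R}(K/H)=\underline{R}(G/H)$ is computed in $i_K^\ast\underline{R}$; (3) $d\circ\eta=0$. **Genuine K\"ahler differentials.** Let $\underline{I}$ be the kernel of the multiplication map $\underline{R}\Box_{\underline{S}}\underline{R}\to\underline{R}$ (a map of Tambara functors; $\underline{R}\Box_{\underline{S}}\underline{R}$ is the coproduct of $\underline{S}$-Tambara functors). It is an $\underline{R}$-module via the left unit $\underline R\to \underline{R}\Box_{\underline{S}}\underline{R}$ and is closed under norms $N_f$ along surjections $f$. Let $$\underline{I}^{>1}=\sum_{H\subset G,\ T\in\mathrm{Set}^H,\ |T|>1}\mathrm{Ind}_H^G N^Ti_H^\ast\underline{I}\ \subset\ \underline{I},$$ where each term stands for the image of the corresponding structure map in $\underline{I}$ (norms taken in modules); concretely, $\underline{I}^{>1}$ is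 the $\underline{R}$-submodule of $\underline{I}$ generated by all $N_f(x)$ with $f\colon X\to Y$ a map of finite $G$-sets all of whose fibers have more than one element and $x\in\underline{I}(X)$. Then $\Omega^{1,G}_{\underline{R}/\underline{S}}:=\underline{I}/\underline{I}^{>1}$. *)

theory Defs
  imports "HOL-Algebra.Group_Action" "HOL-Algebra.AbelCoset" "HOL-Algebra.Module" "HOL-Library.FSet"
begin

section \<open>Finite G-sets\<close>

text \<open>
  A Tambara functor is defined on all finite \<open>G\<close>-sets.  The points of our \<open>G\<close>-sets are taken from the
  infinite universe of hereditarily finite sets over \<open>G\<close>, which is closed under cosets, pairs
  and quotients; every finite \<open>G\<close>-set is isomorphic to one of this kind
  (lemma \<open>finite_gset_in_universe\<close> below), so this is (equivalent to) the category of all finite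
  \<open>G\<close>-sets.
\<close>

datatype 'g hf = HElt 'g | HPair "'g hf" "'g hf" | HSet "'g hf fset"

definition hset :: "'g hf set \<Rightarrow> 'g hf" where
  "hset A = HSet (Abs_fset A)"

fun members :: "'g hf \<Rightarrow> 'g hf set" where
  "members (HSet A) = fset A"
| "members _ = {}"

record ('g, 'u) act_set =
  pts :: "'u set"
  act :: "'g \<Rightarrow> 'u \<Rightarrow> 'u"

type_synonym 'g gset = "('g, 'g hf) act_set"

definition finite_gset :: "('g, 'k) monoid_scheme \<Rightarrow> ('g, 'u) act_set \<Rightarrow> bool" where
  "finite_gset G X \<longleftrightarrow> finite (pts X) \<and> group_action G (pts X) (act X)"

definition gmaps :: "('g, 'k) monoid_scheme \<Rightarrow> ('g, 'u) act_set \<Rightarrow> ('g, 'v) act_set \<Rightarrow> ('u \<Rightarrow> 'v) set" where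
  "gmaps G X Y = {f \<in> pts X \<rightarrow>\<^sub>E pts Y.
     finite_gset G X \<and> finite_gset G Y \<and>
     (\<forall>g\<in>carrier G. \<forall>x\<in>pts X. f (act X g x) = act Y g (f x))}"

definition gid :: "('g, 'u) act_set \<Rightarrow> 'u \<Rightarrow> 'u" where
  "gid X = (\<lambda>x\<in>pts X. x)"

definition gcomp :: "('g, 'u) act_set \<Rightarrow> ('v \<Rightarrow> 'w) \<Rightarrow> ('u \<Rightarrow> 'v) \<Rightarrow> 'u \<Rightarrow> 'w" where
  "gcomp X g f = compose (pts X) g f"

definition is_coproduct ::
  "('g, 'k) monoid_scheme \<Rightarrow> 'g gset \<Rightarrow> 'g gset \<Rightarrow> 'g gset \<Rightarrow> ('g hf \<Rightarrow> 'g hf) \<Rightarrow> ('g hf \<Rightarrow> 'g hf) \<Rightarrow> bool" where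
  "is_coproduct G X1 X2 X j1 j2 \<longleftrightarrow>
     j1 \<in> gmaps G X1 X \<and> j2 \<in> gmaps G X2 X \<and>
     inj_on j1 (pts X1) \<and> inj_on j2 (pts X2) \<and>
     j1 ` pts X1 \<inter> j2 ` pts X2 = {} \<and> j1 ` pts X1 \<union> j2 ` pts X2 = pts X"

text \<open>The square \<open>P \<rightarrow>p X \<rightarrow>f Z\<close>, \<open>P \<rightarrow>q Y \<rightarrow>g Z\<close> is a pullback.\<close>

definition is_pullback ::
  "('g, 'k) monoid_scheme \<Rightarrow> 'g gset \<Rightarrow> 'g gset \<Rightarrow> 'g gset \<Rightarrow> 'g gset \<Rightarrow>
   ('g hf \<Rightarrow> 'g hf) \<Rightarrow> ('g hf \<Rightarrow> 'g hf) \<Rightarrow> ('g hf \<Rightarrow> 'g hf) \<Rightarrow> ('g hf \<Rightarrow> 'g hf) \<Rightarrow> bool" where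
  "is_pullback G P X Y Z p q f g \<longleftrightarrow>
     p \<in> gmaps G P X \<and> q \<in> gmaps G P Y \<and> f \<in> gmaps G X Z \<and> g \<in> gmaps G Y Z \<and>
     bij_betw (\<lambda>w. (p w, q w)) (pts P) {(x, y). x \<in> pts X \<and> y \<in> pts Y \<and> f x = g y}"

text \<open>
  The exponential diagram
  \[ X \xleftarrow{h} A \xleftarrow{e} E \xrightarrow{g'} D \xrightarrow{h'} Y \]
  of \<open>h : A \<rightarrow> X\<close> and \<open>g : X \<rightarrow> Y\<close>, up to isomorphism: \<open>D\<close> is the dependent product \<open>\<Pi>\<^sub>g A\<close>, the set of
  pairs of \<open>y \<in> Y\<close> and a section \<open>s\<close> of \<open>h\<close> over the fibre of \<open>g\<close> at \<open>y\<close>; \<open>E\<close> is the pullback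
  \<open>X \<times>\<^sub>Y D\<close>, and \<open>e\<close> is the evaluation \<open>(x, (y, s)) \<mapsto> s x\<close>.
\<close>

definition is_exponential ::
  "('g, 'k) monoid_scheme \<Rightarrow> 'g gset \<Rightarrow> 'g gset \<Rightarrow> 'g gset \<Rightarrow> 'g gset \<Rightarrow> 'g gset \<Rightarrow>
   ('g hf \<Rightarrow> 'g hf) \<Rightarrow> ('g hf \<Rightarrow> 'g hf) \<Rightarrow> ('g hf \<Rightarrow> 'g hf) \<Rightarrow> ('g hf \<Rightarrow> 'g hf) \<Rightarrow> ('g hf \<Rightarrow> 'g hf) \<Rightarrow> bool" where
  "is_exponential G A X Y E D h g e g' h' \<longleftrightarrow>
     h \<in> gmaps G A X \<and> g \<in> gmaps G X Y \<and> e \<in> gmaps G E A \<and>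
     is_pullback G E X D Y (gcomp E h e) g' g h' \<and>
     (\<forall>y\<in>pts Y. \<forall>s \<in> (\<Pi>\<^sub>E x\<in>{x \<in> pts X. g x = y}. {a \<in> pts A. h a = x}).
        \<exists>!d. d \<in> pts D \<and> h' d = y \<and> (\<forall>p\<in>pts E. g' p = d \<longrightarrow> e p = s (h (e p))))"

text \<open>\<open>G/H\<close> for a subgroup \<open>H\<close>, its points being the left cosets.\<close>

definition coset_pt :: "'g set \<Rightarrow> 'g hf" where
  "coset_pt C = hset (HElt ` C)"

definition elts :: "'g hf \<Rightarrow> 'g set" where
  "elts c = {x. HElt x \<in> members c}"

definition orbit_set :: "('g, 'k) monoid_scheme \<Rightarrow> 'g set \<Rightarrow> 'g gset" where
  "orbit_set G H =
    (let P = (\<lambda>g. coset_pt (g <#\<^bsub>G\<^esub> H)) ` carrier G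
     in \<lparr>pts = P, act = \<lambda>g. \<lambda>c\<in>P. coset_pt (g <#\<^bsub>G\<^esub> elts c)\<rparr>)"

definition orbit_proj :: "('g, 'k) monoid_scheme \<Rightarrow> 'g set \<Rightarrow> 'g set \<Rightarrow> 'g hf \<Rightarrow> 'g hf" where
  "orbit_proj G H K = (\<lambda>c\<in>pts (orbit_set G H). coset_pt (elts c <#>\<^bsub>G\<^esub> K))"

text \<open>The complement of the diagonal in \<open>T \<times> T\<close>.\<close>

definition off_diag :: "('g, 'g hf) act_set \<Rightarrow> 'g gset" where
  "off_diag T =
    (let P = {HPair x y | x y. x \<in> pts T \<and> y \<in> pts T \<and> x \<noteq> y}
     in \<lparr>pts = P, act = \<lambda>g. \<lambda>p\<in>P. (case p of HPair x y \<Rightarrow> HPair (act T g x) (act T g y))\<rparr>)"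

definition off_fst :: "('g, 'g hf) act_set \<Rightarrow> 'g hf \<Rightarrow> 'g hf" where
  "off_fst T = (\<lambda>p\<in>pts (off_diag T). case p of HPair x y \<Rightarrow> x)"

definition off_snd :: "('g, 'g hf) act_set \<Rightarrow> 'g hf \<Rightarrow> 'g hf" where
  "off_snd T = (\<lambda>p\<in>pts (off_diag T). case p of HPair x y \<Rightarrow> y)"

text \<open>
  The induced \<open>G\<close>-set \<open>G \<times>\<^sub>K T\<close> of a \<open>K\<close>-set \<open>T\<close>: the class of \<open>(g, t)\<close> is
  \<open>{(g k\<inverse>, k t) | k \<in> K}\<close>.
\<close>

abbreviation subgrp :: "('g, 'k) monoid_scheme \<Rightarrow> 'g set \<Rightarrow> ('g, 'k) monoid_scheme" where
  "subgrp G K \<equiv> G\<lparr>carrier := K\<rparr>"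

definition ind_pt :: "('g, 'k) monoid_scheme \<Rightarrow> 'g set \<Rightarrow> 'g gset \<Rightarrow> 'g \<Rightarrow> 'g hf \<Rightarrow> 'g hf" where
  "ind_pt G K T g t = hset ((\<lambda>k. HPair (HElt (g \<otimes>\<^bsub>G\<^esub> inv\<^bsub>G\<^esub> k)) (act T k t)) ` K)"

definition ind :: "('g, 'k) monoid_scheme \<Rightarrow> 'g set \<Rightarrow> 'g gset \<Rightarrow> 'g gset" where
  "ind G K T =
    (let P = {ind_pt G K T g t | g t. g \<in> carrier G \<and> t \<in> pts T}
     in \<lparr>pts = P,
         act = \<lambda>h. \<lambda>p\<in>P. hset {HPair (HElt (h \<otimes>\<^bsub>G\<^esub> g)) t | g t. HPair (HElt g) t \<in> members p}\<rparr>)"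

definition ind_map ::
  "('g, 'k) monoid_scheme \<Rightarrow> 'g set \<Rightarrow> 'g gset \<Rightarrow> ('g hf \<Rightarrow> 'g hf) \<Rightarrow> 'g hf \<Rightarrow> 'g hf" where
  "ind_map G K T f =
    (\<lambda>p\<in>pts (ind G K T). hset {HPair a (f t) | a t. HPair a t \<in> members p})"

text \<open>The canonical isomorphism \<open>G \<times>\<^sub>K K/H \<cong> G/H\<close>, \<open>[g, kH] \<mapsto> gkH\<close>, and its inverse.\<close>

definition ind_orbit :: "('g, 'k) monoid_scheme \<Rightarrow> 'g set \<Rightarrow> 'g set \<Rightarrow> 'g hf \<Rightarrow> 'g hf" where
  "ind_orbit G H K =
    (\<lambda>p\<in>pts (ind G K (orbit_set (subgrp G K) H)).
        coset_pt {g \<otimes>\<^bsub>G\<^esub> x | g x c. HPair (HElt g) c \<in> members p \<and> x \<in> elts c})"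

definition ind_orbit_inv :: "('g, 'k) monoid_scheme \<Rightarrow> 'g set \<Rightarrow> 'g set \<Rightarrow> 'g hf \<Rightarrow> 'g hf" where
  "ind_orbit_inv G H K =
    (\<lambda>c\<in>pts (orbit_set G H).
        inv_into (pts (ind G K (orbit_set (subgrp G K) H))) (ind_orbit G H K) c)"


subsection \<open>These are finite \<open>G\<close>-sets\<close>

lemma members_hset [simp]: "finite A \<Longrightarrow> members (hset A) = A"
  by (simp add: hset_def Abs_fset_inverse)

lemma elts_coset_pt [simp]: "finite C \<Longrightarrow> elts (coset_pt C) = C"
  by (auto simp: elts_def coset_pt_def)

lemma finite_gsetI:
  fixes G (structure)
  assumes "group G" "finite (pts X)"
    and ext: "\<And>g. g \<in> carrier G \<Longrightarrow> act X g \<in> extensional (pts X)"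
    and cl: "\<And>g x. g \<in> carrier G \<Longrightarrow> x \<in> pts X \<Longrightarrow> act X g x \<in> pts X"
    and one: "\<And>x. x \<in> pts X \<Longrightarrow> act X \<one>\<^bsub>G\<^esub> x = x"
    and mult: "\<And>g h x. \<lbrakk>g \<in> carrier G; h \<in> carrier G; x \<in> pts X\<rbrakk> \<Longrightarrow>
      act X (g \<otimes>\<^bsub>G\<^esub> h) x = act X g (act X h x)"
  shows "finite_gset G X"
proof -
  interpret group G by fact
  have bij: "act X g \<in> Bij (pts X)" if g: "g \<in> carrier G" for g
  proof -
    have "bij_betw (act X g) (pts X) (pts X)"
    proof (rule bij_betw_byWitness[where f' = "act X (inv g)"])
      show "\<forall>x\<in>pts X. act X (inv g) (act X g x) = x" "\<forall>x\<in>pts X. act X g (act X (inv g) x) = x"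
        using g mult[of "inv g" g] mult[of g "inv g"] one by auto
    qed (use g cl in auto)
    then show ?thesis using ext[OF g] by (simp add: Bij_def)
  qed
  have "act X \<in> hom G (BijGroup (pts X))"
  proof (rule homI)
    fix g h assume gh: "g \<in> carrier G" "h \<in> carrier G"
    have "act X (g \<otimes> h) = compose (pts X) (act X g) (act X h)"
      using gh mult by (intro extensionalityI[where A = "pts X"] ext) (auto simp: compose_def)
    then show "act X (g \<otimes> h) = act X g \<otimes>\<^bsub>BijGroup (pts X)\<^esub> act X h"
      using bij gh by (simp add: BijGroup_def)
  qed (simp add: BijGroup_def bij)
  then show ?thesis
    using assms(2) group_BijGroup[of "pts X"]
    by (simp add: finite_gset_def group_action_def group_hom_def group_hom_axioms_def is_group)
qed

lemma finite_gsetD: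
  assumes "finite_gset G X"
  shows "group G" "finite (pts X)"
    and "\<And>g x. g \<in> carrier G \<Longrightarrow> x \<in> pts X \<Longrightarrow> act X g x \<in> pts X"
    and "\<And>x. x \<in> pts X \<Longrightarrow> act X \<one>\<^bsub>G\<^esub> x = x"
    and "\<And>g h x. \<lbrakk>g \<in> carrier G; h \<in> carrier G; x \<in> pts X\<rbrakk> \<Longrightarrow>
      act X (g \<otimes>\<^bsub>G\<^esub> h) x = act X g (act X h x)"
proof -
  interpret group_action G "pts X" "act X" using assms by (simp add: finite_gset_def)
  show "group G" "finite (pts X)" using assms group_hom by (simp_all add: finite_gset_def group_hom_def)
  show "\<And>g x. g \<in> carrier G \<Longrightarrow> x \<in> pts X \<Longrightarrow> act X g x \<in> pts X" by (rule element_image) auto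
  show "\<And>x. x \<in> pts X \<Longrightarrow> act X \<one>\<^bsub>G\<^esub> x = x" using id_eq_one by (metis restrict_apply')
  show "\<And>g h x. \<lbrakk>g \<in> carrier G; h \<in> carrier G; x \<in> pts X\<rbrakk> \<Longrightarrow>
      act X (g \<otimes>\<^bsub>G\<^esub> h) x = act X g (act X h x)" by (rule composition_rule)
qed

lemma infinite_hf: "infinite (UNIV :: 'g hf set)"
proof -
  have "inj (\<lambda>n. ((\<lambda>x :: 'g hf. HPair x x) ^^ n) (HSet fempty))"
  proof (rule injI)
    fix m n :: nat
    show "((\<lambda>x :: 'g hf. HPair x x) ^^ m) (HSet fempty) = ((\<lambda>x. HPair x x) ^^ n) (HSet fempty) \<Longrightarrow> m = n"
    proof (induction m arbitrary: n)
      case 0 then show ?case by (cases n) auto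
    next
      case (Suc m) then show ?case by (cases n) auto
    qed
  qed
  then show ?thesis using finite_imageD[of _ UNIV] finite_subset[OF subset_UNIV] by blast
qed

lemma finite_gset_in_universe:
  fixes X :: "('g, 'u) act_set"
  assumes X: "finite_gset G X"
  shows "\<exists>(Y :: 'g gset) f. f \<in> gmaps G X Y \<and> bij_betw f (pts X) (pts Y)"
proof -
  note D = finite_gsetD[OF X]
  obtain P :: "'g hf set" where P: "finite P" "card P = card (pts X)"
    using infinite_arbitrarily_large[OF infinite_hf] by blast
  then obtain h where h: "bij_betw h (pts X) P"
    using finite_same_card_bij[OF D(2) P(1)] by auto
  define h' where "h' = inv_into (pts X) h"
  have h': "h' y \<in> pts X" "h (h' y) = y" if "y \<in> P" for y
    using h that by (auto simp: h'_def bij_betw_def inv_into_into f_inv_into_f)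
  have h'': "h' (h x) = x" "h x \<in> P" if "x \<in> pts X" for x
    using h that by (auto simp: h'_def bij_betw_def)
  define Y where "Y = \<lparr>pts = P, act = \<lambda>g. \<lambda>y\<in>P. h (act X g (h' y))\<rparr>"
  have Y: "finite_gset G Y"
    by (rule finite_gsetI) (use P D h' h'' in \<open>auto simp: Y_def\<close>)
  have "restrict h (pts X) \<in> gmaps G X Y"
    using X Y D h'' by (auto simp: gmaps_def Y_def)
  moreover have "bij_betw (restrict h (pts X)) (pts X) (pts Y)"
    using h by (simp add: Y_def bij_betw_restrict_eq)
  ultimately show ?thesis by blast
qed

context
  fixes G :: "('g, 'k) monoid_scheme" (structure)
  assumes grp: "group G" and fin: "finite (carrier G)"
begin

interpretation group G by (rule grp)

lemma finite_lcos: "H \<subseteq> carrier G \<Longrightarrow> finite (g <#\<^bsub>G\<^esub> H)"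
  using finite_subset[OF _ fin] by (auto simp: l_coset_def)

lemma orbit_act:
  assumes "H \<subseteq> carrier G" "x \<in> carrier G" "g \<in> carrier G"
  shows "act (orbit_set G H) g (coset_pt (x <#\<^bsub>G\<^esub> H)) = coset_pt ((g \<otimes>\<^bsub>G\<^esub> x) <#\<^bsub>G\<^esub> H)"
  using assms finite_lcos by (auto simp: orbit_set_def Let_def lcos_m_assoc)

lemma orbit_pts: "pts (orbit_set G H) = (\<lambda>g. coset_pt (g <#\<^bsub>G\<^esub> H)) ` carrier G"
  by (simp add: orbit_set_def Let_def)

lemma orbit_set_gset:
  assumes "subgroup H G"
  shows "finite_gset G (orbit_set G H)"
proof -
  have H: "H \<subseteq> carrier G" by (rule subgroup.subset[OF assms])
  show ?thesis
  proof (rule finite_gsetI)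
    show "act (orbit_set G H) g \<in> extensional (pts (orbit_set G H))" for g
      by (simp add: orbit_set_def Let_def)
  qed (auto simp: grp fin orbit_pts orbit_act[OF H] m_assoc)
qed

lemma orbit_proj:
  assumes "subgroup H G" "subgroup K G" "H \<subseteq> K"
  shows "orbit_proj G H K \<in> gmaps G (orbit_set G H) (orbit_set G K)"
    and "g \<in> carrier G \<Longrightarrow> orbit_proj G H K (coset_pt (g <#\<^bsub>G\<^esub> H)) = coset_pt (g <#\<^bsub>G\<^esub> K)"
proof -
  note H = subgroup.subset[OF assms(1)] and K = subgroup.subset[OF assms(2)]
  have HK: "H <#>\<^bsub>G\<^esub> K = K"
  proof
    show "H <#>\<^bsub>G\<^esub> K \<subseteq> K"
      using assms(3) subgroup.m_closed[OF assms(2)] by (auto simp: set_mult_def)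
    show "K \<subseteq> H <#>\<^bsub>G\<^esub> K"
    proof
      fix k assume "k \<in> K"
      then have "k = \<one> \<otimes> k" using K by auto
      then show "k \<in> H <#>\<^bsub>G\<^esub> K"
        using subgroup.one_closed[OF assms(1)] \<open>k \<in> K\<close> unfolding set_mult_def by blast
    qed
  qed
  have *: "orbit_proj G H K (coset_pt (g <#\<^bsub>G\<^esub> H)) = coset_pt (g <#\<^bsub>G\<^esub> K)" if "g \<in> carrier G" for g
  proof -
    have "(g <#\<^bsub>G\<^esub> H) <#>\<^bsub>G\<^esub> K = g <#\<^bsub>G\<^esub> (H <#>\<^bsub>G\<^esub> K)"
      using that H K by (simp add: l_coset_eq_set_mult set_mult_assoc)
    then show ?thesis using that finite_lcos[OF H] by (auto simp: orbit_proj_def orbit_pts HK)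
  qed
  then show "g \<in> carrier G \<Longrightarrow> orbit_proj G H K (coset_pt (g <#\<^bsub>G\<^esub> H)) = coset_pt (g <#\<^bsub>G\<^esub> K)" .
  show "orbit_proj G H K \<in> gmaps G (orbit_set G H) (orbit_set G K)"
    unfolding gmaps_def
  proof (intro CollectI conjI ballI orbit_set_gset assms)
    show "orbit_proj G H K \<in> pts (orbit_set G H) \<rightarrow>\<^sub>E pts (orbit_set G K)"
      using * by (auto simp: orbit_pts orbit_proj_def[of G H K])
    fix g c assume "g \<in> carrier G" "c \<in> pts (orbit_set G H)"
    then show "orbit_proj G H K (act (orbit_set G H) g c) = act (orbit_set G K) g (orbit_proj G H K c)"
      using * H K by (auto simp: orbit_pts orbit_act)
  qed
qed

lemma off_diag_gset:
  assumes T: "finite_gset G T"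
  shows "finite_gset G (off_diag T)" "off_fst T \<in> gmaps G (off_diag T) T" "off_snd T \<in> gmaps G (off_diag T) T"
proof -
  note D = finite_gsetD[OF T]
  have P: "pts (off_diag T) = {HPair x y | x y. x \<in> pts T \<and> y \<in> pts T \<and> x \<noteq> y}"
    by (simp add: off_diag_def Let_def)
  have A: "act (off_diag T) g (HPair x y) = HPair (act T g x) (act T g y)"
    if "x \<in> pts T" "y \<in> pts T" "x \<noteq> y" for g x y
    using that by (auto simp: off_diag_def Let_def)
  have inj: "act T g x \<noteq> act T g y" if "g \<in> carrier G" "x \<in> pts T" "y \<in> pts T" "x \<noteq> y" for g x y
    using that D(4)[of x] D(4)[of y] D(5)[of "inv g" g x] D(5)[of "inv g" g y] by auto
  have fin: "finite (pts (off_diag T))"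
    using finite_subset[of "pts (off_diag T)" "(\<lambda>(x, y). HPair x y) ` (pts T \<times> pts T)"] D(2) by (auto simp: P)
  show gs: "finite_gset G (off_diag T)"
  proof (rule finite_gsetI)
    show "act (off_diag T) g \<in> extensional (pts (off_diag T))" for g
      by (simp add: off_diag_def Let_def)
    show "act (off_diag T) g p \<in> pts (off_diag T)" if "g \<in> carrier G" "p \<in> pts (off_diag T)" for g p
      using that inj D(3) by (auto simp: P A)
    show "act (off_diag T) \<one> p = p" if "p \<in> pts (off_diag T)" for p
      using that D(4) by (auto simp: P A)
    show "act (off_diag T) (g \<otimes> h) p = act (off_diag T) g (act (off_diag T) h p)"
      if "g \<in> carrier G" "h \<in> carrier G" "p \<in> pts (off_diag T)" for g h p
      using that inj D(3,5) by (auto simp: P A)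
  qed (use grp fin in auto)
  show "off_fst T \<in> gmaps G (off_diag T) T" "off_snd T \<in> gmaps G (off_diag T) T"
    using gs T inj D(3) by (auto simp: gmaps_def off_fst_def off_snd_def P A)
qed

end

context
  fixes G :: "('g, 'k) monoid_scheme" (structure)
  assumes grp: "group G" and fin: "finite (carrier G)"
begin

interpretation group G by (rule grp)

lemmas fin_lcos = finite_lcos[OF grp fin]
lemmas orbit_act' = orbit_act[OF grp fin]
lemmas orbit_pts' = orbit_pts[OF grp fin]

context
  fixes K assumes K: "subgroup K G"
begin

lemma finite_K: "finite K" and K_carrier: "k \<in> K \<Longrightarrow> k \<in> carrier G"
  using subgroup.subset[OF K] finite_subset[OF _ fin] by auto

lemma members_ind_pt: "members (ind_pt G K T g t) = (\<lambda>k. HPair (HElt (g \<otimes> inv k)) (act T k t)) ` K"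
  using finite_K by (simp add: ind_pt_def)

lemma ind_pts: "pts (ind G K T) = {ind_pt G K T g t | g t. g \<in> carrier G \<and> t \<in> pts T}"
  by (simp add: ind_def Let_def)

lemma ind_act:
  assumes "h \<in> carrier G" "g \<in> carrier G" "t \<in> pts T"
  shows "act (ind G K T) h (ind_pt G K T g t) = ind_pt G K T (h \<otimes> g) t"
proof -
  have "{HPair (HElt (h \<otimes> g')) t' | g' t'. HPair (HElt g') t' \<in> members (ind_pt G K T g t)} =
      (\<lambda>k. HPair (HElt (h \<otimes> g \<otimes> inv k)) (act T k t)) ` K"
    using assms K_carrier by (auto simp: members_ind_pt m_assoc)
  then show ?thesis
    using assms by (auto simp: ind_def Let_def) (auto simp: ind_pt_def)
qed

lemma ind_gset:
  assumes T: "finite_gset (subgrp G K) T"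
  shows "finite_gset G (ind G K T)"
proof (rule finite_gsetI)
  have "pts (ind G K T) = (\<lambda>(g, t). ind_pt G K T g t) ` (carrier G \<times> pts T)"
    by (auto simp: ind_pts)
  then show "finite (pts (ind G K T))" using fin finite_gsetD(2)[OF T] by simp
  show "act (ind G K T) g \<in> extensional (pts (ind G K T))" for g
    by (simp add: ind_def Let_def)
  show "act (ind G K T) g p \<in> pts (ind G K T)" if "g \<in> carrier G" "p \<in> pts (ind G K T)" for g p
    using that by (auto simp: ind_pts ind_act) blast
  show "act (ind G K T) \<one> p = p" if "p \<in> pts (ind G K T)" for p
    using that by (auto simp: ind_pts ind_act)
  show "act (ind G K T) (g \<otimes> h) p = act (ind G K T) g (act (ind G K T) h p)"
    if "g \<in> carrier G" "h \<in> carrier G" "p \<in> pts (ind G K T)" for g h p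
    using that by (auto simp: ind_pts ind_act m_assoc)
qed (rule grp)

lemma ind_pt_shift:
  assumes T: "finite_gset (subgrp G K) T" and g: "g \<in> carrier G" and k: "k \<in> K" and t: "t \<in> pts T"
  shows "ind_pt G K T (g \<otimes> k) t = ind_pt G K T g (act T k t)"
proof -
  note D = finite_gsetD[OF T, simplified]
  note c = K_carrier[OF k]
  have inv: "inv k \<in> K" by (rule subgroup.m_inv_closed[OF K k])
  have "(\<lambda>j. HPair (HElt (g \<otimes> k \<otimes> inv j)) (act T j t)) ` K =
      (\<lambda>j. HPair (HElt (g \<otimes> inv j)) (act T j (act T k t))) ` K" (is "?L = ?R")
  proof
    show "?L \<subseteq> ?R"
    proof (rule image_subsetI)
      fix j assume j: "j \<in> K"
      have "j \<otimes> inv k \<in> K" by (rule subgroup.m_closed[OF K j inv])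
      moreover have "inv (j \<otimes> inv k) = k \<otimes> inv j"
        using c K_carrier[OF j] by (simp add: inv_mult_group)
      moreover have "act T (j \<otimes> inv k) (act T k t) = act T j t"
        using D(5)[of "j \<otimes> inv k" k t] \<open>j \<otimes> inv k \<in> K\<close> k t c K_carrier[OF j] by (simp add: m_assoc)
      ultimately show "HPair (HElt (g \<otimes> k \<otimes> inv j)) (act T j t) \<in> ?R"
        using g c K_carrier[OF j] by (intro image_eqI[where x = "j \<otimes> inv k"]) (simp_all add: m_assoc)
    qed
    show "?R \<subseteq> ?L"
    proof (rule image_subsetI)
      fix j assume j: "j \<in> K"
      have "j \<otimes> k \<in> K" by (rule subgroup.m_closed[OF K j k])
      moreover have "g \<otimes> k \<otimes> inv (j \<otimes> k) = g \<otimes> inv j"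
        using g c K_carrier[OF j] by (simp add: inv_mult_group m_assoc[symmetric]) (simp add: m_assoc)
      moreover have "act T (j \<otimes> k) t = act T j (act T k t)"
        using D(5)[OF j k t] .
      ultimately show "HPair (HElt (g \<otimes> inv j)) (act T j (act T k t)) \<in> ?L"
        by (intro image_eqI[where x = "j \<otimes> k"]) simp_all
    qed
  qed
  then show ?thesis by (simp add: ind_pt_def)
qed

lemma ind_map:
  assumes f: "f \<in> gmaps (subgrp G K) T T'"
  shows "g \<in> carrier G \<Longrightarrow> t \<in> pts T \<Longrightarrow> ind_map G K T f (ind_pt G K T g t) = ind_pt G K T' g (f t)"
    and "ind_map G K T f \<in> gmaps G (ind G K T) (ind G K T')"
proof -
  have T: "finite_gset (subgrp G K) T" "finite_gset (subgrp G K) T'" and ft: "\<And>t. t \<in> pts T \<Longrightarrow> f t \<in> pts T'"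
    and eq: "\<And>k t. k \<in> K \<Longrightarrow> t \<in> pts T \<Longrightarrow> f (act T k t) = act T' k (f t)"
    using f by (auto simp: gmaps_def)
  have *: "ind_map G K T f (ind_pt G K T g t) = ind_pt G K T' g (f t)" if "g \<in> carrier G" "t \<in> pts T" for g t
  proof -
    have "{HPair a (f t') | a t'. HPair a t' \<in> members (ind_pt G K T g t)} =
       (\<lambda>k. HPair (HElt (g \<otimes> inv k)) (act T' k (f t))) ` K"
      using eq that(2) by (auto simp: members_ind_pt image_iff) metis+
    then show ?thesis using that by (auto simp: ind_map_def ind_pts) (auto simp: ind_pt_def)
  qed
  then show "g \<in> carrier G \<Longrightarrow> t \<in> pts T \<Longrightarrow> ind_map G K T f (ind_pt G K T g t) = ind_pt G K T' g (f t)" .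
  have "ind_map G K T f p \<in> pts (ind G K T')" if "p \<in> pts (ind G K T)" for p
    using that * ft by (auto simp: ind_pts) blast
  moreover have "ind_map G K T f (act (ind G K T) h p) = act (ind G K T') h (ind_map G K T f p)"
    if "h \<in> carrier G" "p \<in> pts (ind G K T)" for h p
    using that * ft by (auto simp: ind_pts ind_act)
  moreover have "ind_map G K T f \<in> extensional (pts (ind G K T))"
    by (simp add: ind_map_def)
  ultimately show "ind_map G K T f \<in> gmaps G (ind G K T) (ind G K T')"
    using ind_gset T by (auto simp: gmaps_def PiE_def)
qed

lemma subgrp_group: "group (subgrp G K)"
  by (rule subgroup.subgroup_is_group[OF K grp])

context
  fixes H assumes H: "subgroup H G" and HK: "H \<subseteq> K"
begin

lemma orbit_sub_pts: "pts (orbit_set (subgrp G K) H) = (\<lambda>k. coset_pt (k <#\<^bsub>G\<^esub> H)) ` K"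
  by (simp add: orbit_set_def Let_def l_coset_def)

lemma orbit_sub_gset: "finite_gset (subgrp G K) (orbit_set (subgrp G K) H)"
  by (rule orbit_set_gset) (use subgrp_group finite_K subgroup_incl[OF H K HK] in auto)

lemma orbit_sub_act:
  assumes "k \<in> K" "j \<in> K"
  shows "act (orbit_set (subgrp G K) H) j (coset_pt (k <#\<^bsub>G\<^esub> H)) = coset_pt ((j \<otimes> k) <#\<^bsub>G\<^esub> H)"
  using orbit_act[OF subgrp_group, of H k j] finite_K HK assms by (simp add: l_coset_def)

lemma ind_orbit_eq:
  assumes "g \<in> carrier G" "k \<in> K"
  shows "ind_orbit G H K (ind_pt G K (orbit_set (subgrp G K) H) g (coset_pt (k <#\<^bsub>G\<^esub> H))) =
    coset_pt ((g \<otimes> k) <#\<^bsub>G\<^esub> H)"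
proof -
  let ?T = "orbit_set (subgrp G K) H" and ?p = "ind_pt G K (orbit_set (subgrp G K) H) g (coset_pt (k <#\<^bsub>G\<^esub> H))"
  note Hc = subgroup.subset[OF H]
  have "{g' \<otimes> x | g' x c. HPair (HElt g') c \<in> members ?p \<and> x \<in> elts c} = (g \<otimes> k) <#\<^bsub>G\<^esub> H"
  proof (intro equalityI subsetI)
    fix y assume "y \<in> {g' \<otimes> x | g' x c. HPair (HElt g') c \<in> members ?p \<and> x \<in> elts c}"
    then obtain j h where j: "j \<in> K" "h \<in> H" "y = g \<otimes> inv j \<otimes> (j \<otimes> k \<otimes> h)"
      using assms Hc by (auto simp: members_ind_pt orbit_sub_act fin_lcos elts_coset_pt) (auto simp: l_coset_def)
    note c = assms(1) K_carrier[OF assms(2)] K_carrier[OF j(1)] subsetD[OF Hc j(2)]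
    have "y = g \<otimes> k \<otimes> h"
      using c unfolding j(3) by (simp add: m_assoc m_assoc[of "inv j" j "k \<otimes> h", symmetric])
    then show "y \<in> (g \<otimes> k) <#\<^bsub>G\<^esub> H" using j by (auto simp: l_coset_def)
  next
    fix y assume "y \<in> (g \<otimes> k) <#\<^bsub>G\<^esub> H"
    then obtain h where h: "h \<in> H" "y = g \<otimes> k \<otimes> h" by (auto simp: l_coset_def)
    note c = assms(1) K_carrier[OF assms(2)] subsetD[OF Hc h(1)]
    have 1: "\<one> \<in> K" by (rule subgroup.one_closed[OF K])
    have "HPair (HElt g) (coset_pt (k <#\<^bsub>G\<^esub> H)) \<in> members ?p"
      unfolding members_ind_pt using assms c orbit_sub_act[OF assms(2) 1] 
      by (intro image_eqI[OF _ 1]) simp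
    moreover have "k \<otimes> h \<in> elts (coset_pt (k <#\<^bsub>G\<^esub> H))"
      using h Hc c fin_lcos by (auto simp: l_coset_def)
    moreover have "y = g \<otimes> (k \<otimes> h)" using c h by (simp add: m_assoc)
    ultimately show "y \<in> {g' \<otimes> x | g' x c. HPair (HElt g') c \<in> members ?p \<and> x \<in> elts c}" by blast
  qed
  moreover have "?p \<in> pts (ind G K ?T)"
    using assms by (auto simp: ind_pts orbit_sub_pts)
  ultimately show ?thesis by (simp add: ind_orbit_def)
qed

lemma ind_orbit_iso:
  shows "ind_orbit G H K \<in> gmaps G (ind G K (orbit_set (subgrp G K) H)) (orbit_set G H)"
    and "bij_betw (ind_orbit G H K) (pts (ind G K (orbit_set (subgrp G K) H))) (pts (orbit_set G H))"
proof -
  let ?T = "orbit_set (subgrp G K) H"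
  note Hc = subgroup.subset[OF H]
  have p: "\<exists>g k. g \<in> carrier G \<and> k \<in> K \<and> p = ind_pt G K ?T g (coset_pt (k <#\<^bsub>G\<^esub> H))" if "p \<in> pts (ind G K ?T)" for p
    using that by (auto simp: ind_pts orbit_sub_pts)
  have norm: "ind_pt G K ?T g (coset_pt (k <#\<^bsub>G\<^esub> H)) = ind_pt G K ?T (g \<otimes> k) (coset_pt H)"
    if "g \<in> carrier G" "k \<in> K" for g k
  proof -
    have 1: "coset_pt H = coset_pt (\<one> <#\<^bsub>G\<^esub> H)" "\<one> \<in> K"
      using Hc subgroup.one_closed[OF K] by (auto simp: lcos_mult_one)
    then have "coset_pt H \<in> pts ?T" by (auto simp: orbit_sub_pts)
    then show ?thesis
      using ind_pt_shift[OF orbit_sub_gset that, of "coset_pt H"] orbit_sub_act[OF 1(2) that(2)] 1 that K_carrier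
      by simp
  qed
  have absorb: "ind_pt G K ?T (g \<otimes> h) (coset_pt H) = ind_pt G K ?T g (coset_pt H)"
    if "g \<in> carrier G" "h \<in> H" for g h
    using norm[of g h] that HK coset_join3[of h H] H Hc by (auto simp: subset_iff)
  show "ind_orbit G H K \<in> gmaps G (ind G K ?T) (orbit_set G H)"
  proof -
    have "ind_orbit G H K q \<in> pts (orbit_set G H)" if q: "q \<in> pts (ind G K ?T)" for q
      using p[OF q] K_carrier by (auto simp: ind_orbit_eq orbit_pts')
    moreover have "ind_orbit G H K (act (ind G K ?T) x q) = act (orbit_set G H) x (ind_orbit G H K q)"
      if x: "x \<in> carrier G" and q: "q \<in> pts (ind G K ?T)" for x q
      using p[OF q] K_carrier x Hc
      by (auto simp: ind_orbit_eq ind_act orbit_sub_pts orbit_act' m_assoc)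
    moreover have "ind_orbit G H K \<in> extensional (pts (ind G K ?T))" by (simp add: ind_orbit_def)
    ultimately show ?thesis
      using ind_gset[OF orbit_sub_gset] orbit_set_gset[OF grp fin H] by (auto simp: gmaps_def PiE_def)
  qed
  show "bij_betw (ind_orbit G H K) (pts (ind G K ?T)) (pts (orbit_set G H))"
  proof (rule bij_betw_imageI)
    show "inj_on (ind_orbit G H K) (pts (ind G K ?T))"
    proof (rule inj_onI)
      fix q q' assume q: "q \<in> pts (ind G K ?T)" "q' \<in> pts (ind G K ?T)" and e: "ind_orbit G H K q = ind_orbit G H K q'"
      obtain g k g' k' where gk: "g \<in> carrier G" "k \<in> K" "q = ind_pt G K ?T g (coset_pt (k <#\<^bsub>G\<^esub> H))"
        "g' \<in> carrier G" "k' \<in> K" "q' = ind_pt G K ?T g' (coset_pt (k' <#\<^bsub>G\<^esub> H))"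
        using p[OF q(1)] p[OF q(2)] by blast
      have "coset_pt ((g \<otimes> k) <#\<^bsub>G\<^esub> H) = coset_pt ((g' \<otimes> k') <#\<^bsub>G\<^esub> H)"
        using e gk by (simp add: ind_orbit_eq)
      then have "(g \<otimes> k) <#\<^bsub>G\<^esub> H = (g' \<otimes> k') <#\<^bsub>G\<^esub> H"
        using elts_coset_pt fin_lcos[OF Hc] by metis
      moreover have "g \<otimes> k \<in> (g \<otimes> k) <#\<^bsub>G\<^esub> H"
        using subgroup.one_closed[OF H] gk K_carrier by (force simp: l_coset_def)
      ultimately obtain h where "h \<in> H" "g \<otimes> k = g' \<otimes> k' \<otimes> h" by (auto simp: l_coset_def)
      then show "q = q'" using gk norm absorb K_carrier by simp
    qed
    have "coset_pt (g <#\<^bsub>G\<^esub> H) \<in> ind_orbit G H K ` pts (ind G K ?T)" if "g \<in> carrier G" for g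
    proof (rule image_eqI)
      have 1: "\<one> \<in> K" by (rule subgroup.one_closed[OF K])
      show "coset_pt (g <#\<^bsub>G\<^esub> H) = ind_orbit G H K (ind_pt G K ?T g (coset_pt (\<one> <#\<^bsub>G\<^esub> H)))"
        using that by (simp add: ind_orbit_eq[OF that 1])
      show "ind_pt G K ?T g (coset_pt (\<one> <#\<^bsub>G\<^esub> H)) \<in> pts (ind G K ?T)"
        using that 1 by (auto simp: ind_pts orbit_sub_pts)
    qed
    moreover have "ind_orbit G H K q \<in> pts (orbit_set G H)" if q: "q \<in> pts (ind G K ?T)" for q
      using p[OF q] K_carrier by (auto simp: ind_orbit_eq orbit_pts')
    ultimately show "ind_orbit G H K ` pts (ind G K ?T) = pts (orbit_set G H)"
      by (auto simp: orbit_pts')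
  qed
qed

end

end

end


section \<open>Mackey functors, Tambara functors and modules\<close>

text \<open>
  For \<open>f : X \<rightarrow> Y\<close>, \<open>r X Y f\<close> is the restriction \<open>A(Y) \<rightarrow> A(X)\<close> and \<open>t X Y f\<close> the transfer
  \<open>A(X) \<rightarrow> A(Y)\<close>.  Of the ring structure on \<open>A X\<close> only the additive part is used in
  \<open>mackey_functor\<close>, so that it applies to modules as well.
\<close>

type_synonym ('g, 'a) arrows = "'g gset \<Rightarrow> 'g gset \<Rightarrow> ('g hf \<Rightarrow> 'g hf) \<Rightarrow> 'a \<Rightarrow> 'a"

locale mackey_functor =
  fixes G :: "('g, 'k) monoid_scheme"
    and A :: "'g gset \<Rightarrow> ('a, 'z) ring_scheme"
    and r :: "('g, 'a) arrows"
    and t :: "('g, 'a) arrows"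
  assumes group_G: "group G"
    and finite_G: "finite (carrier G)"
    and abelian_lev: "finite_gset G X \<Longrightarrow> abelian_group (A X)"
    and res_add_hom: "f \<in> gmaps G X Y \<Longrightarrow> r X Y f \<in> hom (add_monoid (A Y)) (add_monoid (A X))"
    and tr_add_hom: "f \<in> gmaps G X Y \<Longrightarrow> t X Y f \<in> hom (add_monoid (A X)) (add_monoid (A Y))"
    and res_id: "\<lbrakk>finite_gset G X; a \<in> carrier (A X)\<rbrakk> \<Longrightarrow> r X X (gid X) a = a"
    and tr_id: "\<lbrakk>finite_gset G X; a \<in> carrier (A X)\<rbrakk> \<Longrightarrow> t X X (gid X) a = a"
    and res_comp: "\<lbrakk>f \<in> gmaps G X Y; g \<in> gmaps G Y Z; a \<in> carrier (A Z)\<rbrakk> \<Longrightarrow>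
        r X Z (gcomp X g f) a = r X Y f (r Y Z g a)"
    and tr_comp: "\<lbrakk>f \<in> gmaps G X Y; g \<in> gmaps G Y Z; a \<in> carrier (A X)\<rbrakk> \<Longrightarrow>
        t X Z (gcomp X g f) a = t Y Z g (t X Y f a)"
    and empty_lev: "\<lbrakk>finite_gset G X; pts X = {}\<rbrakk> \<Longrightarrow> carrier (A X) = {\<zero>\<^bsub>A X\<^esub>}"
    and coproduct_lev: "is_coproduct G X1 X2 X j1 j2 \<Longrightarrow>
        bij_betw (\<lambda>a. (r X1 X j1 a, r X2 X j2 a)) (carrier (A X)) (carrier (A X1) \<times> carrier (A X2))"
    and tr_base_change: "\<lbrakk>is_pullback G P X Y Z p q f g; a \<in> carrier (A X)\<rbrakk> \<Longrightarrow>
        r Y Z g (t X Z f a) = t P Y q (r P X p a)"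

lemma gid_gmaps: "finite_gset G X \<Longrightarrow> gid X \<in> gmaps G X X"
  unfolding gmaps_def gid_def finite_gset_def
  by (auto simp: group_action.element_image)

lemma gcomp_gmaps:
  assumes f: "f \<in> gmaps G X Y" and g: "g \<in> gmaps G Y Z"
  shows "gcomp X g f \<in> gmaps G X Z"
proof -
  have fX: "f x \<in> pts Y" if "x \<in> pts X" for x
    using f that by (auto simp: gmaps_def)
  have gY: "g y \<in> pts Z" if "y \<in> pts Y" for y
    using g that by (auto simp: gmaps_def)
  have aX: "act X k x \<in> pts X" if "k \<in> carrier G" "x \<in> pts X" for k x
    using f that group_action.element_image by (fastforce simp: gmaps_def finite_gset_def)
  have "gcomp X g f (act X k x) = act Z k (gcomp X g f x)" if "k \<in> carrier G" "x \<in> pts X" for k x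
    using f g that aX[OF that] fX[OF that(2)] by (simp add: gmaps_def gcomp_def compose_def)
  moreover have "gcomp X g f \<in> pts X \<rightarrow>\<^sub>E pts Z"
    using fX gY by (auto simp: gcomp_def compose_def)
  ultimately show ?thesis
    using f g by (simp add: gmaps_def)
qed

lemma gmaps_gset:
  "f \<in> gmaps G X Y \<Longrightarrow> finite_gset G X" "f \<in> gmaps G X Y \<Longrightarrow> finite_gset G Y"
  by (simp_all add: gmaps_def)

lemma is_pullbackD:
  assumes "is_pullback G P X Y Z p q f g"
  shows "p \<in> gmaps G P X" "q \<in> gmaps G P Y" "f \<in> gmaps G X Z" "g \<in> gmaps G Y Z"
  using assms by (simp_all add: is_pullback_def)

lemma is_exponentialD:
  assumes "is_exponential G A X Y E D h g e g' h'"
  shows "h \<in> gmaps G A X" "g \<in> gmaps G X Y" "e \<in> gmaps G E A" "g' \<in> gmaps G E D" "h' \<in> gmaps G D Y"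
  using assms by (auto simp: is_exponential_def is_pullback_def)

lemma is_coproductD:
  assumes "is_coproduct G X1 X2 X j1 j2"
  shows "j1 \<in> gmaps G X1 X" "j2 \<in> gmaps G X2 X" "is_coproduct G X2 X1 X j2 j1"
    "is_pullback G X1 X1 X1 X (gid X1) (gid X1) j1 j1"
proof -
  show *: "j1 \<in> gmaps G X1 X" "j2 \<in> gmaps G X2 X" "is_coproduct G X2 X1 X j2 j1"
    using assms by (auto simp: is_coproduct_def)
  have "bij_betw (\<lambda>w. (gid X1 w, gid X1 w)) (pts X1) {(x, y). x \<in> pts X1 \<and> y \<in> pts X1 \<and> j1 x = j1 y}"
    using assms by (auto simp: is_coproduct_def bij_betw_def inj_on_def gid_def)
  then show "is_pullback G X1 X1 X1 X (gid X1) (gid X1) j1 j1"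
    using * gid_gmaps gmaps_gset(1)[OF *(1)] by (auto simp: is_pullback_def)
qed

definition gempty :: "'g gset" where
  "gempty = \<lparr>pts = {}, act = \<lambda>g x. undefined\<rparr>"

lemma gempty_gset:
  fixes G :: "('g, 'k) monoid_scheme"
  assumes "group G" shows "finite_gset G gempty"
proof -
  have 1: "(\<lambda>x. undefined) \<in> Bij ({} :: 'g hf set)"
    by (auto simp: Bij_def bij_betw_def extensional_def)
  have 2: "compose ({} :: 'g hf set) (\<lambda>x. undefined :: 'g hf) (\<lambda>x. undefined) = (\<lambda>x. undefined)"
    by (auto simp: compose_def)
  have "(\<lambda>g x. undefined) \<in> hom G (BijGroup ({} :: 'g hf set))"
    by (rule homI) (simp_all add: BijGroup_def 1 2)
  then show ?thesis
    using assms group_BijGroup unfolding finite_gset_def gempty_def group_action_def group_hom_def group_hom_axioms_def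
    by simp
qed

lemma gempty_gmaps:
  assumes "group G" "finite_gset G X" shows "(\<lambda>x. undefined) \<in> gmaps G gempty X"
  using assms gempty_gset by (auto simp: gmaps_def gempty_def)

lemma is_coproduct_pullback_empty:
  assumes "group G" "is_coproduct G X1 X2 X j1 j2"
  shows "is_pullback G gempty X1 X2 X (\<lambda>x. undefined) (\<lambda>x. undefined) j1 j2"
proof -
  note j = is_coproductD(1,2)[OF assms(2)]
  have "{(x, y). x \<in> pts X1 \<and> y \<in> pts X2 \<and> j1 x = j2 y} = {}"
    using assms(2) by (auto simp: is_coproduct_def)
  then show ?thesis
    using j gempty_gmaps[OF assms(1) gmaps_gset(1)[OF j(1)]] gempty_gmaps[OF assms(1) gmaps_gset(1)[OF j(2)]]
    by (simp add: is_pullback_def bij_betw_def) (simp add: gempty_def)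
qed

lemma hom_zero:
  assumes "abelian_group A" "abelian_group B" "h \<in> hom (add_monoid A) (add_monoid B)"
  shows "h \<zero>\<^bsub>A\<^esub> = \<zero>\<^bsub>B\<^esub>"
  using group_hom.hom_one[of "add_monoid A" "add_monoid B" h] assms
    abelian_group.a_group[OF assms(1)] abelian_group.a_group[OF assms(2)]
  by (simp add: group_hom_def group_hom_axioms_def)

lemma ring_hom_add_hom: "h \<in> ring_hom A B \<Longrightarrow> h \<in> hom (add_monoid A) (add_monoid B)"
  by (auto simp: ring_hom_def hom_def)

text \<open>
  For a candidate Mackey functor satisfying the other axioms, surjectivity onto the product over a
  disjoint union follows from base change.
\<close>

lemma coproduct_levI:
  fixes A :: "'g gset \<Rightarrow> ('a, 'z) ring_scheme" and r t :: "('g, 'a) arrows"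
  assumes G: "group G"
    and ab: "\<And>X. finite_gset G X \<Longrightarrow> abelian_group (A X)"
    and r: "\<And>X Y f. f \<in> gmaps G X Y \<Longrightarrow> r X Y f \<in> hom (add_monoid (A Y)) (add_monoid (A X))"
    and t: "\<And>X Y f. f \<in> gmaps G X Y \<Longrightarrow> t X Y f \<in> hom (add_monoid (A X)) (add_monoid (A Y))"
    and rid: "\<And>X a. finite_gset G X \<Longrightarrow> a \<in> carrier (A X) \<Longrightarrow> r X X (gid X) a = a"
    and tid: "\<And>X a. finite_gset G X \<Longrightarrow> a \<in> carrier (A X) \<Longrightarrow> t X X (gid X) a = a"
    and emp: "\<And>X. finite_gset G X \<Longrightarrow> pts X = {} \<Longrightarrow> carrier (A X) = {\<zero>\<^bsub>A X\<^esub>}"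
    and bc: "\<And>P X Y Z p q f g a. is_pullback G P X Y Z p q f g \<Longrightarrow> a \<in> carrier (A X) \<Longrightarrow>
        r Y Z g (t X Z f a) = t P Y q (r P X p a)"
    and cop: "is_coproduct G X1 X2 X j1 j2"
    and inj: "\<And>a b. \<lbrakk>a \<in> carrier (A X); b \<in> carrier (A X);
        r X1 X j1 a = r X1 X j1 b; r X2 X j2 a = r X2 X j2 b\<rbrakk> \<Longrightarrow> a = b"
  shows "bij_betw (\<lambda>a. (r X1 X j1 a, r X2 X j2 a)) (carrier (A X)) (carrier (A X1) \<times> carrier (A X2))"
proof -
  have cl: "r X Y f b \<in> carrier (A X)" if "f \<in> gmaps G X Y" "b \<in> carrier (A Y)" for X Y f b
    using hom_in_carrier[OF r[OF that(1)]] that(2) by simp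
  have ct: "t X Y f a \<in> carrier (A Y)" if "f \<in> gmaps G X Y" "a \<in> carrier (A X)" for X Y f a
    using hom_in_carrier[OF t[OF that(1)]] that(2) by simp
  have key: "r X1 X j1 (t X1 X j1 a1 \<oplus>\<^bsub>A X\<^esub> t X2 X j2 a2) = a1"
    if cop: "is_coproduct G X1 X2 X j1 j2" and a: "a1 \<in> carrier (A X1)" "a2 \<in> carrier (A X2)"
    for X1 X2 X j1 j2 a1 a2
  proof -
    note j = is_coproductD[OF cop]
    note gs = gmaps_gset(1)[OF j(1)] gmaps_gset(1)[OF j(2)] gmaps_gset(2)[OF j(1)]
    interpret X1: abelian_group "A X1" by (rule ab[OF gs(1)])
    have e: "(\<lambda>x. undefined) \<in> gmaps G gempty X2" "(\<lambda>x. undefined) \<in> gmaps G gempty X1"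
      using gempty_gmaps[OF G] gs by auto
    have 1: "r X1 X j1 (t X1 X j1 a1) = a1"
      using bc[OF j(4) a(1)] rid[OF gs(1) a(1)] tid[OF gs(1) a(1)] by simp
    have "r gempty X2 (\<lambda>x. undefined) a2 \<in> carrier (A gempty)" by (rule cl[OF e(1) a(2)])
    then have "r gempty X2 (\<lambda>x. undefined) a2 = \<zero>\<^bsub>A gempty\<^esub>"
      using emp[OF gempty_gset[OF G]] by (auto simp: gempty_def)
    then have 2: "r X1 X j1 (t X2 X j2 a2) = \<zero>\<^bsub>A X1\<^esub>"
      using bc[OF is_coproduct_pullback_empty[OF G j(3)] a(2)]
        hom_zero[OF ab ab t[OF e(2)]] gempty_gset[OF G] gs by simp
    have "r X1 X j1 (t X1 X j1 a1 \<oplus>\<^bsub>A X\<^esub> t X2 X j2 a2) = a1 \<oplus>\<^bsub>A X1\<^esub> \<zero>\<^bsub>A X1\<^esub>"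
      using hom_mult[OF r[OF j(1)]] ct[OF j(1) a(1)] ct[OF j(2) a(2)] 1 2 by simp
    then show ?thesis using a by simp
  qed
  note j = is_coproductD[OF cop]
  interpret X: abelian_group "A X" by (rule ab[OF gmaps_gset(2)[OF j(1)]])
  show ?thesis
  proof (rule bij_betw_imageI)
    show "inj_on (\<lambda>a. (r X1 X j1 a, r X2 X j2 a)) (carrier (A X))"
      using inj by (auto simp: inj_on_def)
    have "w \<in> (\<lambda>a. (r X1 X j1 a, r X2 X j2 a)) ` carrier (A X)"
      if w': "w \<in> carrier (A X1) \<times> carrier (A X2)" for w
    proof -
      obtain a1 a2 where w: "w = (a1, a2)" "a1 \<in> carrier (A X1)" "a2 \<in> carrier (A X2)"
        using w' by blast
      have c: "t X1 X j1 a1 \<in> carrier (A X)" "t X2 X j2 a2 \<in> carrier (A X)"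
        using ct[OF j(1)] ct[OF j(2)] w by simp_all
      have "(\<lambda>a. (r X1 X j1 a, r X2 X j2 a)) (t X1 X j1 a1 \<oplus>\<^bsub>A X\<^esub> t X2 X j2 a2) = w"
        using key[OF cop w(2,3)] key[OF j(3) w(3,2)] w(1) X.a_comm[OF c] by simp
      then show ?thesis using X.a_closed[OF c] by (rule image_eqI[OF sym])
    qed
    then show "(\<lambda>a. (r X1 X j1 a, r X2 X j2 a)) ` carrier (A X) = carrier (A X1) \<times> carrier (A X2)"
      using cl[OF j(1)] cl[OF j(2)] by auto
  qed
qed

lemma UN_const: "a \<in> A \<Longrightarrow> (\<And>x. x \<in> A \<Longrightarrow> F x = c) \<Longrightarrow> (\<Union>x\<in>A. F x) = c"
  by auto

record ('g, 'r) tambara =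
  lev :: "'g gset \<Rightarrow> 'r ring"
  res :: "('g, 'r) arrows"
  tr :: "('g, 'r) arrows"
  nm :: "('g, 'r) arrows"

locale tambara_functor = mackey_functor G "lev R" "res R" "tr R"
  for G :: "('g, 'k) monoid_scheme" and R :: "('g, 'r) tambara" +
  assumes cring_lev: "finite_gset G X \<Longrightarrow> cring (lev R X)"
    and res_ring_hom: "f \<in> gmaps G X Y \<Longrightarrow> res R X Y f \<in> ring_hom (lev R Y) (lev R X)"
    and nm_hom: "f \<in> gmaps G X Y \<Longrightarrow> nm R X Y f \<in> hom (lev R X) (lev R Y)"
    and nm_one: "f \<in> gmaps G X Y \<Longrightarrow> nm R X Y f \<one>\<^bsub>lev R X\<^esub> = \<one>\<^bsub>lev R Y\<^esub>"
    and nm_id: "\<lbrakk>finite_gset G X; a \<in> carrier (lev R X)\<rbrakk> \<Longrightarrow> nm R X X (gid X) a = a"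
    and nm_comp: "\<lbrakk>f \<in> gmaps G X Y; g \<in> gmaps G Y Z; a \<in> carrier (lev R X)\<rbrakk> \<Longrightarrow>
        nm R X Z (gcomp X g f) a = nm R Y Z g (nm R X Y f a)"
    and nm_base_change: "\<lbrakk>is_pullback G P X Y Z p q f g; a \<in> carrier (lev R X)\<rbrakk> \<Longrightarrow>
        res R Y Z g (nm R X Z f a) = nm R P Y q (res R P X p a)"
    and nm_tr: "\<lbrakk>is_exponential G A X Y E D h g e g' h'; a \<in> carrier (lev R A)\<rbrakk> \<Longrightarrow>
        nm R X Y g (tr R A X h a) = tr R D Y h' (nm R E D g' (res R E A e a))"

definition mackey_map ::
  "('g, 'k) monoid_scheme \<Rightarrow>
   ('g gset \<Rightarrow> ('a, 'z) ring_scheme) \<Rightarrow> ('g, 'a) arrows \<Rightarrow> ('g, 'a) arrows \<Rightarrow>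
   ('g gset \<Rightarrow> ('b, 'y) ring_scheme) \<Rightarrow> ('g, 'b) arrows \<Rightarrow> ('g, 'b) arrows \<Rightarrow>
   ('g gset \<Rightarrow> 'a \<Rightarrow> 'b) \<Rightarrow> bool" where
  "mackey_map G A rA tA B rB tB \<phi> \<longleftrightarrow>
     (\<forall>X. finite_gset G X \<longrightarrow> \<phi> X \<in> hom (add_monoid (A X)) (add_monoid (B X))) \<and>
     (\<forall>X Y. \<forall>f\<in>gmaps G X Y.
        (\<forall>a\<in>carrier (A Y). \<phi> X (rA X Y f a) = rB X Y f (\<phi> Y a)) \<and>
        (\<forall>a\<in>carrier (A X). \<phi> Y (tA X Y f a) = tB X Y f (\<phi> X a)))"

definition tambara_map ::
  "('g, 'k) monoid_scheme \<Rightarrow> ('g, 'r) tambara \<Rightarrow> ('g, 's) tambara \<Rightarrow> ('g gset \<Rightarrow> 'r \<Rightarrow> 's) \<Rightarrow> bool" where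
  "tambara_map G R Q \<phi> \<longleftrightarrow>
     (\<forall>X. finite_gset G X \<longrightarrow> \<phi> X \<in> ring_hom (lev R X) (lev Q X)) \<and>
     (\<forall>X Y. \<forall>f\<in>gmaps G X Y.
        (\<forall>a\<in>carrier (lev R Y). \<phi> X (res R X Y f a) = res Q X Y f (\<phi> Y a)) \<and>
        (\<forall>a\<in>carrier (lev R X). \<phi> Y (tr R X Y f a) = tr Q X Y f (\<phi> X a)) \<and>
        (\<forall>a\<in>carrier (lev R X). \<phi> Y (nm R X Y f a) = nm Q X Y f (\<phi> X a)))"

definition tambara_algebra ::
  "('g, 'k) monoid_scheme \<Rightarrow> ('g, 's) tambara \<Rightarrow> ('g, 'r) tambara \<Rightarrow> ('g gset \<Rightarrow> 's \<Rightarrow> 'r) \<Rightarrow> bool" where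
  "tambara_algebra G S R \<eta> \<longleftrightarrow> tambara_functor G S \<and> tambara_functor G R \<and> tambara_map G S R \<eta>"

text \<open>
  Modules over the underlying commutative Green functor, in Dress's form: an action map
  \<open>R \<box> M \<rightarrow> M\<close> of Mackey functors is a family of biadditive maps \<open>R(X) \<times> M(X) \<rightarrow> M(X)\<close> compatible with
  restrictions and satisfying the two Frobenius reciprocity relations.  Theorem
  \<open>green_module_iff_box_action\<close> proves that this is the notion of a module for the box product.
\<close>

record ('g, 'r, 'm) gmodule =
  mlev :: "'g gset \<Rightarrow> ('r, 'm) module"
  mres :: "('g, 'm) arrows"
  mtr :: "('g, 'm) arrows"

locale green_module = mackey_functor G "mlev M" "mres M" "mtr M"
  for G :: "('g, 'k) monoid_scheme" and R :: "('g, 'r) tambara" and M :: "('g, 'r, 'm) gmodule" +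
  assumes module_lev: "finite_gset G X \<Longrightarrow> module (lev R X) (mlev M X)"
    and res_smult: "\<lbrakk>f \<in> gmaps G X Y; a \<in> carrier (lev R Y); m \<in> carrier (mlev M Y)\<rbrakk> \<Longrightarrow>
        mres M X Y f (a \<odot>\<^bsub>mlev M Y\<^esub> m) = res R X Y f a \<odot>\<^bsub>mlev M X\<^esub> mres M X Y f m"
    and frobenius_left: "\<lbrakk>f \<in> gmaps G X Y; a \<in> carrier (lev R X); m \<in> carrier (mlev M Y)\<rbrakk> \<Longrightarrow>
        mtr M X Y f (a \<odot>\<^bsub>mlev M X\<^esub> mres M X Y f m) = tr R X Y f a \<odot>\<^bsub>mlev M Y\<^esub> m"
    and frobenius_right: "\<lbrakk>f \<in> gmaps G X Y; a \<in> carrier (lev R Y); m \<in> carrier (mlev M X)\<rbrakk> \<Longrightarrow>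
        mtr M X Y f (res R X Y f a \<odot>\<^bsub>mlev M X\<^esub> m) = a \<odot>\<^bsub>mlev M Y\<^esub> mtr M X Y f m"

subsection \<open>The box product\<close>

text \<open>
  The box product of two Mackey functors, presented by the generators \<open>a \<boxtimes> b\<close> for \<open>a \<in> A(X)\<close>,
  \<open>b \<in> B(X)\<close>, subject to biadditivity, compatibility with restrictions and Frobenius reciprocity.
  It is the universal recipient of pairings (theorem \<open>box_universal\<close>), and \<open>green_module\<close> is the
  notion of a module in Mackey functors with \<open>\<box>\<close> (theorem \<open>green_module_iff_box_action\<close>).
\<close>

datatype ('g, 'a, 'b) bexp =
    BGen "'g gset" 'a 'b
  | BZero "'g gset"
  | BNeg "'g gset" "('g, 'a, 'b) bexp"
  | BAdd "'g gset" "('g, 'a, 'b) bexp" "('g, 'a, 'b) bexp"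
  | BRes "'g gset" "'g gset" "'g hf \<Rightarrow> 'g hf" "('g, 'a, 'b) bexp"
  | BTr "'g gset" "'g gset" "'g hf \<Rightarrow> 'g hf" "('g, 'a, 'b) bexp"

primrec beval ::
  "('g gset \<Rightarrow> ('c, 'x) ring_scheme) \<Rightarrow> ('g, 'c) arrows \<Rightarrow> ('g, 'c) arrows \<Rightarrow>
   ('g gset \<Rightarrow> 'a \<Rightarrow> 'b \<Rightarrow> 'c) \<Rightarrow> ('g, 'a, 'b) bexp \<Rightarrow> 'c" where
  "beval C rC tC \<mu> (BGen X a b) = \<mu> X a b"
| "beval C rC tC \<mu> (BZero X) = \<zero>\<^bsub>C X\<^esub>"
| "beval C rC tC \<mu> (BNeg X u) = \<ominus>\<^bsub>C X\<^esub> beval C rC tC \<mu> u"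
| "beval C rC tC \<mu> (BAdd X u v) = beval C rC tC \<mu> u \<oplus>\<^bsub>C X\<^esub> beval C rC tC \<mu> v"
| "beval C rC tC \<mu> (BRes X Y f u) = rC X Y f (beval C rC tC \<mu> u)"
| "beval C rC tC \<mu> (BTr X Y f u) = tC X Y f (beval C rC tC \<mu> u)"

context
  fixes G :: "('g, 'k) monoid_scheme"
    and A :: "'g gset \<Rightarrow> ('a, 'y) ring_scheme" and rA tA :: "('g, 'a) arrows"
    and B :: "'g gset \<Rightarrow> ('b, 'z) ring_scheme" and rB tB :: "('g, 'b) arrows"
begin

inductive beq :: "'g gset \<Rightarrow> ('g, 'a, 'b) bexp \<Rightarrow> ('g, 'a, 'b) bexp \<Rightarrow> bool" where
  beq_sym: "beq X u v \<Longrightarrow> beq X v u"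
| beq_trans: "beq X u v \<Longrightarrow> beq X v w \<Longrightarrow> beq X u w"
| beq_wf_gen: "finite_gset G X \<Longrightarrow> a \<in> carrier (A X) \<Longrightarrow> b \<in> carrier (B X) \<Longrightarrow>
    beq X (BGen X a b) (BGen X a b)"
| beq_wf_zero: "finite_gset G X \<Longrightarrow> beq X (BZero X) (BZero X)"
| beq_cong_neg: "beq X u v \<Longrightarrow> beq X (BNeg X u) (BNeg X v)"
| beq_cong_add: "beq X u v \<Longrightarrow> beq X u' v' \<Longrightarrow> beq X (BAdd X u u') (BAdd X v v')"
| beq_cong_res: "f \<in> gmaps G X Y \<Longrightarrow> beq Y u v \<Longrightarrow> beq X (BRes X Y f u) (BRes X Y f v)"
| beq_cong_tr: "f \<in> gmaps G X Y \<Longrightarrow> beq X u v \<Longrightarrow> beq Y (BTr X Y f u) (BTr X Y f v)"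
\<comment> \<open>Mackey functors\<close>
| beq_add_assoc: "beq X u u \<Longrightarrow> beq X v v \<Longrightarrow> beq X w w \<Longrightarrow>
    beq X (BAdd X (BAdd X u v) w) (BAdd X u (BAdd X v w))"
| beq_add_comm: "beq X u u \<Longrightarrow> beq X v v \<Longrightarrow> beq X (BAdd X u v) (BAdd X v u)"
| beq_add_zero: "beq X u u \<Longrightarrow> beq X (BAdd X (BZero X) u) u"
| beq_add_neg: "beq X u u \<Longrightarrow> beq X (BAdd X (BNeg X u) u) (BZero X)"
| beq_res_add: "f \<in> gmaps G X Y \<Longrightarrow> beq Y u u \<Longrightarrow> beq Y v v \<Longrightarrow>
    beq X (BRes X Y f (BAdd Y u v)) (BAdd X (BRes X Y f u) (BRes X Y f v))"
| beq_tr_add: "f \<in> gmaps G X Y \<Longrightarrow> beq X u u \<Longrightarrow> beq X v v \<Longrightarrow>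
    beq Y (BTr X Y f (BAdd X u v)) (BAdd Y (BTr X Y f u) (BTr X Y f v))"
| beq_res_id: "beq X u u \<Longrightarrow> beq X (BRes X X (gid X) u) u"
| beq_tr_id: "beq X u u \<Longrightarrow> beq X (BTr X X (gid X) u) u"
| beq_res_comp: "f \<in> gmaps G X Y \<Longrightarrow> g \<in> gmaps G Y Z \<Longrightarrow> beq Z u u \<Longrightarrow>
    beq X (BRes X Z (gcomp X g f) u) (BRes X Y f (BRes Y Z g u))"
| beq_tr_comp: "f \<in> gmaps G X Y \<Longrightarrow> g \<in> gmaps G Y Z \<Longrightarrow> beq X u u \<Longrightarrow>
    beq Z (BTr X Z (gcomp X g f) u) (BTr Y Z g (BTr X Y f u))"
| beq_empty: "beq X u u \<Longrightarrow> pts X = {} \<Longrightarrow> beq X u (BZero X)"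
| beq_coproduct: "is_coproduct G X1 X2 X j1 j2 \<Longrightarrow> beq X u u \<Longrightarrow> beq X v v \<Longrightarrow>
    beq X1 (BRes X1 X j1 u) (BRes X1 X j1 v) \<Longrightarrow> beq X2 (BRes X2 X j2 u) (BRes X2 X j2 v) \<Longrightarrow> beq X u v"
| beq_tr_base_change: "is_pullback G P X Y Z p q f g \<Longrightarrow> beq X u u \<Longrightarrow>
    beq Y (BRes Y Z g (BTr X Z f u)) (BTr P Y q (BRes P X p u))"
\<comment> \<open>\<open>(a, b) \<mapsto> a \<boxtimes> b\<close> is a pairing\<close>
| beq_gen_addl: "finite_gset G X \<Longrightarrow> a \<in> carrier (A X) \<Longrightarrow> a' \<in> carrier (A X) \<Longrightarrow> b \<in> carrier (B X) \<Longrightarrow>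
    beq X (BGen X (a \<oplus>\<^bsub>A X\<^esub> a') b) (BAdd X (BGen X a b) (BGen X a' b))"
| beq_gen_addr: "finite_gset G X \<Longrightarrow> a \<in> carrier (A X) \<Longrightarrow> b \<in> carrier (B X) \<Longrightarrow> b' \<in> carrier (B X) \<Longrightarrow>
    beq X (BGen X a (b \<oplus>\<^bsub>B X\<^esub> b')) (BAdd X (BGen X a b) (BGen X a b'))"
| beq_gen_res: "f \<in> gmaps G X Y \<Longrightarrow> a \<in> carrier (A Y) \<Longrightarrow> b \<in> carrier (B Y) \<Longrightarrow>
    beq X (BRes X Y f (BGen Y a b)) (BGen X (rA X Y f a) (rB X Y f b))"
| beq_gen_frobl: "f \<in> gmaps G X Y \<Longrightarrow> a \<in> carrier (A X) \<Longrightarrow> b \<in> carrier (B Y) \<Longrightarrow>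
    beq Y (BTr X Y f (BGen X a (rB X Y f b))) (BGen Y (tA X Y f a) b)"
| beq_gen_frobr: "f \<in> gmaps G X Y \<Longrightarrow> a \<in> carrier (A Y) \<Longrightarrow> b \<in> carrier (B X) \<Longrightarrow>
    beq Y (BTr X Y f (BGen X (rA X Y f a) b)) (BGen Y a (tB X Y f b))"

definition bcls :: "'g gset \<Rightarrow> ('g, 'a, 'b) bexp \<Rightarrow> ('g, 'a, 'b) bexp set" where
  "bcls X u = {v. beq X u v}"

definition box_lev :: "'g gset \<Rightarrow> ('g, 'a, 'b) bexp set ring" where
  "box_lev X = \<lparr>carrier = {bcls X u | u. beq X u u}, mult = (\<lambda>c c'. undefined), one = undefined,
     zero = bcls X (BZero X), add = \<lambda>c c'. \<Union>u\<in>c. \<Union>v\<in>c'. bcls X (BAdd X u v)\<rparr>"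

definition box_res :: "('g, ('g, 'a, 'b) bexp set) arrows" where
  "box_res X Y f c = (\<Union>u\<in>c. bcls X (BRes X Y f u))"

definition box_tr :: "('g, ('g, 'a, 'b) bexp set) arrows" where
  "box_tr X Y f c = (\<Union>u\<in>c. bcls Y (BTr X Y f u))"

definition box_gen :: "'g gset \<Rightarrow> 'a \<Rightarrow> 'b \<Rightarrow> ('g, 'a, 'b) bexp set" where
  "box_gen X a b = bcls X (BGen X a b)"

lemma beq_refl: "beq X u v \<Longrightarrow> beq X u u" "beq X u v \<Longrightarrow> beq X v v"
  by (blast intro: beq_sym beq_trans)+

lemma beq_gset: "beq X u v \<Longrightarrow> finite_gset G X"
  by (induction rule: beq.induct) (auto simp: gmaps_def is_pullback_def is_coproduct_def)

lemma bcls_eqI: "beq X u v \<Longrightarrow> bcls X u = bcls X v"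
  unfolding bcls_def by (blast intro: beq_sym beq_trans)

lemma bcls_eqD: "beq X v v \<Longrightarrow> bcls X u = bcls X v \<Longrightarrow> beq X u v"
  unfolding bcls_def by blast

lemma bcls_self: "beq X u u \<Longrightarrow> u \<in> bcls X u"
  by (simp add: bcls_def)

lemma box_carrierI: "beq X u u \<Longrightarrow> bcls X u \<in> carrier (box_lev X)"
  by (auto simp: box_lev_def)

lemma box_carrierE:
  assumes "c \<in> carrier (box_lev X)"
  obtains u where "c = bcls X u" "beq X u u"
  using assms by (auto simp: box_lev_def)

lemma box_zero: "\<zero>\<^bsub>box_lev X\<^esub> = bcls X (BZero X)"
  by (simp add: box_lev_def)

lemma box_add:
  assumes "beq X u u" "beq X v v"
  shows "bcls X u \<oplus>\<^bsub>box_lev X\<^esub> bcls X v = bcls X (BAdd X u v)"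
proof -
  have "(\<Union>u'\<in>bcls X u. \<Union>v'\<in>bcls X v. bcls X (BAdd X u' v')) = bcls X (BAdd X u v)"
    by (rule UN_const[OF bcls_self[OF assms(1)]], rule UN_const[OF bcls_self[OF assms(2)]],
        rule bcls_eqI, unfold bcls_def) (blast intro: beq_cong_add beq_sym)
  then show ?thesis by (simp add: box_lev_def)
qed

lemma box_res_cls:
  assumes "f \<in> gmaps G X Y" "beq Y u u"
  shows "box_res X Y f (bcls Y u) = bcls X (BRes X Y f u)"
  unfolding box_res_def
  by (rule UN_const[OF bcls_self[OF assms(2)]], rule bcls_eqI, unfold bcls_def)
    (blast intro: beq_cong_res[OF assms(1)] beq_sym)

lemma box_tr_cls:
  assumes "f \<in> gmaps G X Y" "beq X u u"
  shows "box_tr X Y f (bcls X u) = bcls Y (BTr X Y f u)"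
  unfolding box_tr_def
  by (rule UN_const[OF bcls_self[OF assms(2)]], rule bcls_eqI, unfold bcls_def)
    (blast intro: beq_cong_tr[OF assms(1)] beq_sym)

lemma beq_wf_ops:
  "beq X u u \<Longrightarrow> beq X v v \<Longrightarrow> beq X (BAdd X u v) (BAdd X u v)"
  "beq X u u \<Longrightarrow> beq X (BNeg X u) (BNeg X u)"
  "f \<in> gmaps G X Y \<Longrightarrow> beq Y u u \<Longrightarrow> beq X (BRes X Y f u) (BRes X Y f u)"
  "f \<in> gmaps G X Y \<Longrightarrow> beq X u u \<Longrightarrow> beq Y (BTr X Y f u) (BTr X Y f u)"
  by (blast intro: beq_cong_add beq_cong_neg beq_cong_res beq_cong_tr)+

lemmas box_simps = box_zero box_add box_res_cls box_tr_cls box_carrierI beq_wf_ops beq_wf_zero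

lemma box_abelian:
  assumes X: "finite_gset G X"
  shows "abelian_group (box_lev X)"
proof (rule abelian_groupI)
  fix x assume "x \<in> carrier (box_lev X)"
  then obtain u where u: "x = bcls X u" "beq X u u" by (rule box_carrierE)
  have "bcls X (BNeg X u) \<oplus>\<^bsub>box_lev X\<^esub> x = \<zero>\<^bsub>box_lev X\<^esub>"
    using u by (simp add: box_simps X bcls_eqI[OF beq_add_neg])
  then show "\<exists>y\<in>carrier (box_lev X). y \<oplus>\<^bsub>box_lev X\<^esub> x = \<zero>\<^bsub>box_lev X\<^esub>"
    using u by (blast intro: box_simps)
qed (((elim box_carrierE)?, (simp add: box_simps X bcls_eqI[OF beq_add_assoc]
    bcls_eqI[OF beq_add_zero]; fail)) |
    (elim box_carrierE, (simp add: box_simps bcls_eqI[OF beq_add_comm]; fail)))+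

lemma box_res_hom:
  "f \<in> gmaps G X Y \<Longrightarrow> box_res X Y f \<in> hom (add_monoid (box_lev Y)) (add_monoid (box_lev X))"
  by (rule homI; simp; (elim box_carrierE)?; simp add: box_simps bcls_eqI[OF beq_res_add])

lemma box_tr_hom:
  "f \<in> gmaps G X Y \<Longrightarrow> box_tr X Y f \<in> hom (add_monoid (box_lev X)) (add_monoid (box_lev Y))"
  by (rule homI; simp; (elim box_carrierE)?; simp add: box_simps bcls_eqI[OF beq_tr_add])

lemma box_base_change:
  assumes "is_pullback G P X Y Z p q f g" "a \<in> carrier (box_lev X)"
  shows "box_res Y Z g (box_tr X Z f a) = box_tr P Y q (box_res P X p a)"
  using assms(2) is_pullbackD[OF assms(1)]
  by (auto elim!: box_carrierE simp: box_simps bcls_eqI[OF beq_tr_base_change[OF assms(1)]])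

lemma box_gid:
  assumes "finite_gset G X" "a \<in> carrier (box_lev X)"
  shows "box_res X X (gid X) a = a" "box_tr X X (gid X) a = a"
  using assms gid_gmaps[OF assms(1)]
  by (auto elim!: box_carrierE simp: box_simps bcls_eqI[OF beq_res_id] bcls_eqI[OF beq_tr_id])

lemma box_empty:
  assumes "finite_gset G X" "pts X = {}" shows "carrier (box_lev X) = {\<zero>\<^bsub>box_lev X\<^esub>}"
proof -
  interpret abelian_group "box_lev X" by (rule box_abelian[OF assms(1)])
  have "a = \<zero>\<^bsub>box_lev X\<^esub>" if "a \<in> carrier (box_lev X)" for a
    using that assms by (auto elim!: box_carrierE simp: box_zero bcls_eqI[OF beq_empty])
  then show ?thesis by blast
qed

lemma box_coproduct:
  assumes "group G" "is_coproduct G X1 X2 X j1 j2"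
  shows "bij_betw (\<lambda>a. (box_res X1 X j1 a, box_res X2 X j2 a)) (carrier (box_lev X))
           (carrier (box_lev X1) \<times> carrier (box_lev X2))"
proof (rule coproduct_levI[where t = "box_tr"])
  note j = is_coproductD[OF assms(2)]
  show "a = b" if "a \<in> carrier (box_lev X)" "b \<in> carrier (box_lev X)"
    "box_res X1 X j1 a = box_res X1 X j1 b" "box_res X2 X j2 a = box_res X2 X j2 b" for a b
  proof -
    from that obtain u v where uv: "a = bcls X u" "beq X u u" "b = bcls X v" "beq X v v"
      by (auto elim!: box_carrierE)
    have "beq X1 (BRes X1 X j1 u) (BRes X1 X j1 v)" "beq X2 (BRes X2 X j2 u) (BRes X2 X j2 v)"
      using that uv j by (auto simp: box_res_cls intro!: bcls_eqD beq_wf_ops)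
    then show "a = b"
      using uv bcls_eqI[OF beq_coproduct[OF assms(2)]] by blast
  qed
qed (use assms box_tr_hom box_res_hom in \<open>simp_all only: box_abelian box_gid box_empty box_base_change\<close>)

theorem box_mackey:
  assumes "group G" "finite (carrier G)"
  shows "mackey_functor G box_lev box_res box_tr"
proof (intro mackey_functor.intro)
  show "box_res X Z (gcomp X g f) a = box_res X Y f (box_res Y Z g a)"
    if "f \<in> gmaps G X Y" "g \<in> gmaps G Y Z" "a \<in> carrier (box_lev Z)" for X Y Z f g a
    using that by (auto elim!: box_carrierE simp: box_simps gcomp_gmaps bcls_eqI[OF beq_res_comp])
  show "box_tr X Z (gcomp X g f) a = box_tr Y Z g (box_tr X Y f a)"
    if "f \<in> gmaps G X Y" "g \<in> gmaps G Y Z" "a \<in> carrier (box_lev X)" for X Y Z f g a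
    using that by (auto elim!: box_carrierE simp: box_simps gcomp_gmaps bcls_eqI[OF beq_tr_comp])
next
  fix X1 X2 X j1 j2 assume "is_coproduct G X1 X2 X j1 j2"
  then show "bij_betw (\<lambda>a. (box_res X1 X j1 a, box_res X2 X j2 a)) (carrier (box_lev X))
      (carrier (box_lev X1) \<times> carrier (box_lev X2))"
    by (rule box_coproduct[OF assms(1)])
next
  fix X Y :: "'g gset" and f assume f: "f \<in> gmaps G X Y"
  show "box_res X Y f \<in> hom (add_monoid (box_lev Y)) (add_monoid (box_lev X))" by (rule box_res_hom[OF f])
  show "box_tr X Y f \<in> hom (add_monoid (box_lev X)) (add_monoid (box_lev Y))" by (rule box_tr_hom[OF f])
next
  fix X :: "'g gset" assume X: "finite_gset G X"
  show "abelian_group (box_lev X)" by (rule box_abelian[OF X])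
  show "carrier (box_lev X) = {\<zero>\<^bsub>box_lev X\<^esub>}" if "pts X = {}" by (rule box_empty[OF X that])
  fix a assume a: "a \<in> carrier (box_lev X)"
  show "box_res X X (gid X) a = a" "box_tr X X (gid X) a = a" by (rule box_gid[OF X a])+
next
  fix P X Y Z p q f g a
  assume pb: "is_pullback G P X Y Z p q f g" and a: "a \<in> carrier (box_lev X)"
  show "box_res Y Z g (box_tr X Z f a) = box_tr P Y q (box_res P X p a)"
    by (rule box_base_change[OF pb a])
qed (use assms in simp_all)

context
  fixes C :: "'g gset \<Rightarrow> ('c, 'x) ring_scheme" and rC tC :: "('g, 'c) arrows"
    and \<mu> :: "'g gset \<Rightarrow> 'a \<Rightarrow> 'b \<Rightarrow> 'c"
  assumes C: "mackey_functor G C rC tC"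
    and closed: "\<And>X a b. \<lbrakk>finite_gset G X; a \<in> carrier (A X); b \<in> carrier (B X)\<rbrakk> \<Longrightarrow>
      \<mu> X a b \<in> carrier (C X)"
    and addl: "\<And>X a a' b. \<lbrakk>finite_gset G X; a \<in> carrier (A X); a' \<in> carrier (A X); b \<in> carrier (B X)\<rbrakk> \<Longrightarrow>
      \<mu> X (a \<oplus>\<^bsub>A X\<^esub> a') b = \<mu> X a b \<oplus>\<^bsub>C X\<^esub> \<mu> X a' b"
    and addr: "\<And>X a b b'. \<lbrakk>finite_gset G X; a \<in> carrier (A X); b \<in> carrier (B X); b' \<in> carrier (B X)\<rbrakk> \<Longrightarrow>
      \<mu> X a (b \<oplus>\<^bsub>B X\<^esub> b') = \<mu> X a b \<oplus>\<^bsub>C X\<^esub> \<mu> X a b'"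
    and res: "\<And>X Y f a b. \<lbrakk>f \<in> gmaps G X Y; a \<in> carrier (A Y); b \<in> carrier (B Y)\<rbrakk> \<Longrightarrow>
      rC X Y f (\<mu> Y a b) = \<mu> X (rA X Y f a) (rB X Y f b)"
    and frobl: "\<And>X Y f a b. \<lbrakk>f \<in> gmaps G X Y; a \<in> carrier (A X); b \<in> carrier (B Y)\<rbrakk> \<Longrightarrow>
      tC X Y f (\<mu> X a (rB X Y f b)) = \<mu> Y (tA X Y f a) b"
    and frobr: "\<And>X Y f a b. \<lbrakk>f \<in> gmaps G X Y; a \<in> carrier (A Y); b \<in> carrier (B X)\<rbrakk> \<Longrightarrow>
      tC X Y f (\<mu> X (rA X Y f a) b) = \<mu> Y a (tB X Y f b)"
    and A: "mackey_functor G A rA tA" and B: "mackey_functor G B rB tB"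
begin

lemma beval_beq:
  assumes "beq X u v"
  shows "beval C rC tC \<mu> u = beval C rC tC \<mu> v \<and>
    beval C rC tC \<mu> u \<in> carrier (C X) \<and> beval C rC tC \<mu> v \<in> carrier (C X)"
proof -
  interpret A: mackey_functor G A rA tA by (rule A)
  interpret B: mackey_functor G B rB tB by (rule B)
  interpret C: mackey_functor G C rC tC by (rule C)
  have ra: "rA X Y f a \<in> carrier (A X)" if "f \<in> gmaps G X Y" "a \<in> carrier (A Y)" for X Y f a
    using hom_in_carrier[OF A.res_add_hom[OF that(1)]] that(2) by simp
  have ta: "tA X Y f a \<in> carrier (A Y)" if "f \<in> gmaps G X Y" "a \<in> carrier (A X)" for X Y f a
    using hom_in_carrier[OF A.tr_add_hom[OF that(1)]] that(2) by simp
  have rb: "rB X Y f a \<in> carrier (B X)" if "f \<in> gmaps G X Y" "a \<in> carrier (B Y)" for X Y f a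
    using hom_in_carrier[OF B.res_add_hom[OF that(1)]] that(2) by simp
  have tb: "tB X Y f a \<in> carrier (B Y)" if "f \<in> gmaps G X Y" "a \<in> carrier (B X)" for X Y f a
    using hom_in_carrier[OF B.tr_add_hom[OF that(1)]] that(2) by simp
  have rc: "rC X Y f a \<in> carrier (C X)" if "f \<in> gmaps G X Y" "a \<in> carrier (C Y)" for X Y f a
    using hom_in_carrier[OF C.res_add_hom[OF that(1)]] that(2) by simp
  have tc: "tC X Y f a \<in> carrier (C Y)" if "f \<in> gmaps G X Y" "a \<in> carrier (C X)" for X Y f a
    using hom_in_carrier[OF C.tr_add_hom[OF that(1)]] that(2) by simp
  have rh: "rC X Y f (a \<oplus>\<^bsub>C Y\<^esub> a') = rC X Y f a \<oplus>\<^bsub>C X\<^esub> rC X Y f a'"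
    if "f \<in> gmaps G X Y" "a \<in> carrier (C Y)" "a' \<in> carrier (C Y)" for X Y f a a'
    using hom_mult[OF C.res_add_hom[OF that(1)]] that(2,3) by simp
  have th: "tC X Y f (a \<oplus>\<^bsub>C X\<^esub> a') = tC X Y f a \<oplus>\<^bsub>C Y\<^esub> tC X Y f a'"
    if "f \<in> gmaps G X Y" "a \<in> carrier (C X)" "a' \<in> carrier (C X)" for X Y f a a'
    using hom_mult[OF C.tr_add_hom[OF that(1)]] that(2,3) by simp
  have am: "abelian_monoid (C X)" if "finite_gset G X" for X
    using C.abelian_lev[OF that] by (simp add: abelian_group_def)
  from assms show ?thesis
  proof (induction rule: beq.induct)
    case (beq_coproduct X1 X2 X j1 j2 u v)
    have "inj_on (\<lambda>a. (rC X1 X j1 a, rC X2 X j2 a)) (carrier (C X))"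
      using C.coproduct_lev[OF beq_coproduct.hyps(1)] by (rule bij_betw_imp_inj_on)
    then show ?case
      using beq_coproduct.IH by (auto dest!: inj_onD)
  next
    case (beq_empty X u)
    then show ?case
      using C.empty_lev[OF beq_gset[OF beq_empty.hyps(1)] beq_empty.hyps(2)] by auto
  next
    case (beq_tr_base_change P X Y Z p q f g u)
    then show ?case using C.tr_base_change[OF beq_tr_base_change.hyps(1), of "beval C rC tC \<mu> u"]
      is_pullbackD[OF beq_tr_base_change.hyps(1)] by (simp add: rc tc)
  next
    case (beq_res_comp f X Y g Z u)
    then show ?case using C.res_comp[of f X Y g Z "beval C rC tC \<mu> u"] by (simp add: rc tc)
  next
    case (beq_tr_comp f X Y g Z u)
    then show ?case using C.tr_comp[of f X Y g Z "beval C rC tC \<mu> u"] by (simp add: rc tc)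
  next
    case (beq_add_neg X u)
    have X: "finite_gset G X" using beq_gset[OF beq_add_neg.hyps] .
    show ?case using beq_add_neg.IH abelian_group.l_neg[OF C.abelian_lev[OF X], of "beval C rC tC \<mu> u"]
        abelian_monoid.zero_closed[OF am[OF X]] by simp
  next
    case (beq_add_assoc X u v w)
    interpret c: abelian_group "C X" by (rule C.abelian_lev[OF beq_gset[OF beq_add_assoc.hyps(1)]])
    show ?case using beq_add_assoc.IH by (simp add: c.a_assoc)
  next
    case (beq_add_comm X u v)
    interpret c: abelian_group "C X" by (rule C.abelian_lev[OF beq_gset[OF beq_add_comm.hyps(1)]])
    show ?case using beq_add_comm.IH by (simp add: c.a_comm)
  next
    case (beq_add_zero X u)
    interpret c: abelian_group "C X" by (rule C.abelian_lev[OF beq_gset[OF beq_add_zero.hyps(1)]])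
    show ?case using beq_add_zero.IH by simp
  next
    case (beq_sym X u v) then show ?case by metis
  next
    case (beq_trans X u v w) then show ?case by metis
  next
    case (beq_gen_addl X a a' b)
    then show ?case
      using closed[of X "a \<oplus>\<^bsub>A X\<^esub> a'" b] abelian_monoid.a_closed[OF am] closed addl by simp
  next
    case (beq_gen_addr X a b b')
    then show ?case
      using closed[of X a "b \<oplus>\<^bsub>B X\<^esub> b'"] abelian_monoid.a_closed[OF am] closed addr by simp
  next
    case (beq_gen_res f X Y a b)
    then show ?case using res[of f X Y a b] rc[of f X Y "\<mu> Y a b"] closed gmaps_gset[OF beq_gen_res.hyps(1)] by simp
  next
    case (beq_gen_frobl f X Y a b)
    then show ?case using frobl[of f X Y a b] tc[of f X Y "\<mu> X a (rB X Y f b)"] closed rb gmaps_gset[OF beq_gen_frobl.hyps(1)]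
      by (simp add: ta)
  next
    case (beq_gen_frobr f X Y a b)
    then show ?case using frobr[of f X Y a b] tc[of f X Y "\<mu> X (rA X Y f a) b"] closed ra gmaps_gset[OF beq_gen_frobr.hyps(1)]
      by (simp add: tb)
  qed (simp_all add: closed rc tc rh th C.res_id C.tr_id beq_gset gmaps_gset abelian_monoid.zero_closed[OF am]
      abelian_monoid.a_closed[OF am] abelian_group.a_inv_closed[OF C.abelian_lev])
qed

definition box_lift :: "'g gset \<Rightarrow> ('g, 'a, 'b) bexp set \<Rightarrow> 'c" where
  "box_lift X c = beval C rC tC \<mu> (SOME u. u \<in> c)"

lemma box_lift_cls: "beq X u u \<Longrightarrow> box_lift X (bcls X u) = beval C rC tC \<mu> u"
proof -
  assume u: "beq X u u"
  have "beq X u (SOME v. v \<in> bcls X u)"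
    using someI[of "\<lambda>v. v \<in> bcls X u" u] bcls_self[OF u] by (simp add: bcls_def)
  then show ?thesis using beval_beq by (simp add: box_lift_def)
qed

theorem box_universal:
  shows "mackey_map G box_lev box_res box_tr C rC tC box_lift"
    and "\<lbrakk>finite_gset G X; a \<in> carrier (A X); b \<in> carrier (B X)\<rbrakk> \<Longrightarrow> box_lift X (box_gen X a b) = \<mu> X a b"
    and "\<lbrakk>mackey_map G box_lev box_res box_tr C rC tC \<theta>;
      \<And>X a b. \<lbrakk>finite_gset G X; a \<in> carrier (A X); b \<in> carrier (B X)\<rbrakk> \<Longrightarrow> \<theta> X (box_gen X a b) = \<mu> X a b;
      c \<in> carrier (box_lev X)\<rbrakk> \<Longrightarrow> \<theta> X c = box_lift X c"
proof -
  interpret A: mackey_functor G A rA tA by (rule A)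
  interpret B: mackey_functor G B rB tB by (rule B)
  interpret C: mackey_functor G C rC tC by (rule C)
  have ev: "beval C rC tC \<mu> u \<in> carrier (C X)" if "beq X u u" for X u
    using beval_beq[OF that] by simp
  show "mackey_map G box_lev box_res box_tr C rC tC box_lift"
    unfolding mackey_map_def
  proof (intro conjI allI impI ballI)
    fix X :: "'g gset" assume X: "finite_gset G X"
    show "box_lift X \<in> hom (add_monoid (box_lev X)) (add_monoid (C X))"
      by (rule homI; simp; (elim box_carrierE)?; simp add: box_lift_cls ev box_simps X)
  qed (elim box_carrierE, simp add: box_lift_cls box_simps)+
  show "box_lift X (box_gen X a b) = \<mu> X a b" if "finite_gset G X" "a \<in> carrier (A X)" "b \<in> carrier (B X)"
    using that by (simp add: box_gen_def box_lift_cls beq_wf_gen)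
  assume \<theta>: "mackey_map G box_lev box_res box_tr C rC tC \<theta>"
    and g: "\<And>X a b. \<lbrakk>finite_gset G X; a \<in> carrier (A X); b \<in> carrier (B X)\<rbrakk> \<Longrightarrow> \<theta> X (box_gen X a b) = \<mu> X a b"
    and c: "c \<in> carrier (box_lev X)"
  have h: "\<theta> X \<in> hom (add_monoid (box_lev X)) (add_monoid (C X))" if "finite_gset G X" for X
    using \<theta> that by (simp add: mackey_map_def)
  have cl: "\<theta> X (bcls X v) \<in> carrier (C X)" if "beq X v v" for X v
    using hom_in_carrier[OF h[OF beq_gset[OF that]]] box_carrierI[OF that] by simp
  have zero: "\<theta> X (bcls X (BZero X)) = \<zero>\<^bsub>C X\<^esub>" if X: "finite_gset G X" for X
    using hom_zero[OF box_abelian C.abelian_lev h] X by (simp add: box_zero)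
  have add: "\<theta> X (bcls X (BAdd X u v)) = \<theta> X (bcls X u) \<oplus>\<^bsub>C X\<^esub> \<theta> X (bcls X v)"
    if "beq X u u" "beq X v v" for X u v
    using hom_mult[OF h[OF beq_gset[OF that(1)]], simplified, OF box_carrierI[OF that(1)] box_carrierI[OF that(2)]]
    unfolding box_add[OF that] .
  have neg: "\<theta> X (bcls X (BNeg X u)) = \<ominus>\<^bsub>C X\<^esub> \<theta> X (bcls X u)" if u: "beq X u u" for X u
  proof -
    note X = beq_gset[OF u]
    have "\<theta> X (bcls X (BNeg X u)) \<oplus>\<^bsub>C X\<^esub> \<theta> X (bcls X u) = \<zero>\<^bsub>C X\<^esub>"
      using add[OF beq_wf_ops(2)[OF u] u] bcls_eqI[OF beq_add_neg[OF u]] zero[OF X] by simp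
    then show ?thesis
      using abelian_group.minus_equality[OF C.abelian_lev[OF X]] cl u beq_wf_ops(2)[OF u] by metis
  qed
  have rs: "\<theta> X (bcls X (BRes X Y f v)) = rC X Y f (\<theta> Y (bcls Y v))"
    if "f \<in> gmaps G X Y" "beq Y v v" for X Y f v
  proof -
    have "\<theta> X (box_res X Y f (bcls Y v)) = rC X Y f (\<theta> Y (bcls Y v))"
      using \<theta> that box_carrierI[OF that(2)] unfolding mackey_map_def by blast
    then show ?thesis using box_res_cls[OF that] by simp
  qed
  have tr: "\<theta> Y (bcls Y (BTr X Y f u)) = tC X Y f (\<theta> X (bcls X u))"
    if "f \<in> gmaps G X Y" "beq X u u" for X Y f u
  proof -
    have "\<theta> Y (box_tr X Y f (bcls X u)) = tC X Y f (\<theta> X (bcls X u))"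
      using \<theta> that box_carrierI[OF that(2)] unfolding mackey_map_def by blast
    then show ?thesis using box_tr_cls[OF that] by simp
  qed
  have gg: "\<theta> X (bcls X (BGen X a b)) = \<mu> X a b" if "finite_gset G X" "a \<in> carrier (A X)" "b \<in> carrier (B X)" for X a b
    using g[OF that] by (simp add: box_gen_def)
  have ac: "a \<oplus>\<^bsub>A X\<^esub> a' \<in> carrier (A X)" if "finite_gset G X" "a \<in> carrier (A X)" "a' \<in> carrier (A X)" for X a a'
    using abelian_monoid.a_closed[OF abelian_group.axioms(1)[OF A.abelian_lev]] that by blast
  have bc: "b \<oplus>\<^bsub>B X\<^esub> b' \<in> carrier (B X)" if "finite_gset G X" "b \<in> carrier (B X)" "b' \<in> carrier (B X)" for X b b'
    using abelian_monoid.a_closed[OF abelian_group.axioms(1)[OF B.abelian_lev]] that by blast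
  have ra: "rA X Y f a \<in> carrier (A X)" if "f \<in> gmaps G X Y" "a \<in> carrier (A Y)" for X Y f a
    using hom_in_carrier[OF A.res_add_hom[OF that(1)]] that(2) by simp
  have ta: "tA X Y f a \<in> carrier (A Y)" if "f \<in> gmaps G X Y" "a \<in> carrier (A X)" for X Y f a
    using hom_in_carrier[OF A.tr_add_hom[OF that(1)]] that(2) by simp
  have rb: "rB X Y f a \<in> carrier (B X)" if "f \<in> gmaps G X Y" "a \<in> carrier (B Y)" for X Y f a
    using hom_in_carrier[OF B.res_add_hom[OF that(1)]] that(2) by simp
  have tb: "tB X Y f a \<in> carrier (B Y)" if "f \<in> gmaps G X Y" "a \<in> carrier (B X)" for X Y f a
    using hom_in_carrier[OF B.tr_add_hom[OF that(1)]] that(2) by simp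
  have main: "\<theta> X (bcls X u) = beval C rC tC \<mu> u \<and> \<theta> X (bcls X v) = beval C rC tC \<mu> v"
    if "beq X u v" for X u v
    using that
  proof (induction rule: beq.induct)
    case (beq_coproduct X1 X2 X j1 j2 u v) then show ?case by simp
  next
    case (beq_tr_base_change P X Y Z p q f g u)
    show ?case using beq_tr_base_change is_pullbackD[OF beq_tr_base_change.hyps(1)]
      by (simp add: rs tr beq_wf_ops)
  next
    case (beq_cong_neg X u v) then show ?case using beq_refl[OF beq_cong_neg.hyps(1)] by (simp add: neg)
  next
    case (beq_cong_add X u v u' v') then show ?case
      using beq_refl[OF beq_cong_add.hyps(1)] beq_refl[OF beq_cong_add.hyps(2)] by (simp add: add)
  next
    case (beq_cong_res f X Y u v) then show ?case using beq_refl[OF beq_cong_res.hyps(2)] by (simp add: rs)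
  next
    case (beq_cong_tr f X Y u v) then show ?case using beq_refl[OF beq_cong_tr.hyps(2)] by (simp add: tr)
  qed (simp_all add: zero add neg rs tr gg ac bc ra ta rb tb gid_gmaps gcomp_gmaps beq_gset beq_wf_ops
      gmaps_gset beq_wf_zero beq_wf_gen)
  obtain u where "c = bcls X u" "beq X u u" using c by (rule box_carrierE)
  then show "\<theta> X c = box_lift X c" using main box_lift_cls by simp
qed

end

end

text \<open>
  A module over the Green functor underlying \<open>R\<close> is the same thing as a Mackey functor \<open>M\<close> with a
  unital and associative action map \<open>\<alpha> : R \<box> M \<rightarrow> M\<close>, where \<open>a \<odot> m = \<alpha> (a \<boxtimes> m)\<close>.
\<close>

theorem green_module_iff_box_action:
  fixes G :: "('g, 'k) monoid_scheme" and R :: "('g, 'r) tambara" and M :: "('g, 'r, 'm) gmodule"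
  assumes R: "tambara_functor G R" and M: "mackey_functor G (mlev M) (mres M) (mtr M)"
  defines "gen \<equiv> box_gen G (lev R) (res R) (tr R) (mlev M) (mres M) (mtr M)"
  shows "green_module G R M \<longleftrightarrow>
    (\<exists>\<alpha>. mackey_map G (box_lev G (lev R) (res R) (tr R) (mlev M) (mres M) (mtr M))
            (box_res G (lev R) (res R) (tr R) (mlev M) (mres M) (mtr M))
            (box_tr G (lev R) (res R) (tr R) (mlev M) (mres M) (mtr M))
            (mlev M) (mres M) (mtr M) \<alpha> \<and>
       (\<forall>X. finite_gset G X \<longrightarrow> (\<forall>m\<in>carrier (mlev M X).
          \<alpha> X (gen X \<one>\<^bsub>lev R X\<^esub> m) = m \<and>
          (\<forall>a\<in>carrier (lev R X). a \<odot>\<^bsub>mlev M X\<^esub> m = \<alpha> X (gen X a m) \<and>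
             (\<forall>b\<in>carrier (lev R X).
                \<alpha> X (gen X (a \<otimes>\<^bsub>lev R X\<^esub> b) m) = \<alpha> X (gen X a (\<alpha> X (gen X b m))))))))"
    (is "_ \<longleftrightarrow> (\<exists>\<alpha>. ?P \<alpha>)")
proof
  interpret R: tambara_functor G R by (rule R)
  interpret M: mackey_functor G "mlev M" "mres M" "mtr M" by (rule M)
  show "\<exists>\<alpha>. ?P \<alpha>" if GM: "green_module G R M"
  proof -
    interpret GM: green_module G R M by (rule GM)
    define \<mu> where "\<mu> X a m = a \<odot>\<^bsub>mlev M X\<^esub> m" for X a m
    define \<alpha> where "\<alpha> = box_lift (mlev M) (mres M) (mtr M) \<mu>"
    have p1: "\<mu> X a m \<in> carrier (mlev M X)"
      if "finite_gset G X" "a \<in> carrier (lev R X)" "m \<in> carrier (mlev M X)" for X a m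
      unfolding \<mu>_def by (rule module.smult_closed[OF GM.module_lev[OF that(1)] that(2,3)])
    have p2: "\<mu> X (a \<oplus>\<^bsub>lev R X\<^esub> b) m = \<mu> X a m \<oplus>\<^bsub>mlev M X\<^esub> \<mu> X b m"
      if "finite_gset G X" "a \<in> carrier (lev R X)" "b \<in> carrier (lev R X)" "m \<in> carrier (mlev M X)" for X a b m
      unfolding \<mu>_def by (rule module.smult_l_distr[OF GM.module_lev[OF that(1)] that(2-4)])
    have p3: "\<mu> X a (m \<oplus>\<^bsub>mlev M X\<^esub> n) = \<mu> X a m \<oplus>\<^bsub>mlev M X\<^esub> \<mu> X a n"
      if "finite_gset G X" "a \<in> carrier (lev R X)" "m \<in> carrier (mlev M X)" "n \<in> carrier (mlev M X)" for X a m n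
      unfolding \<mu>_def by (rule module.smult_r_distr[OF GM.module_lev[OF that(1)] that(2-4)])
    note p = M p1 p2 p3 GM.res_smult[folded \<mu>_def] GM.frobenius_left[folded \<mu>_def]
      GM.frobenius_right[folded \<mu>_def] R.mackey_functor_axioms
    have U1: "mackey_map G (box_lev G (lev R) (res R) (tr R) (mlev M) (mres M) (mtr M))
            (box_res G (lev R) (res R) (tr R) (mlev M) (mres M) (mtr M))
            (box_tr G (lev R) (res R) (tr R) (mlev M) (mres M) (mtr M))
            (mlev M) (mres M) (mtr M) \<alpha>"
      unfolding \<alpha>_def by (rule box_universal(1)) (fact p)+
    have U2: "\<alpha> X (gen X a m) = \<mu> X a m"
      if "finite_gset G X" "a \<in> carrier (lev R X)" "m \<in> carrier (mlev M X)" for X a m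
      unfolding \<alpha>_def gen_def by (rule box_universal(2)) (fact p that)+
    have g: "\<alpha> X (gen X a m) = a \<odot>\<^bsub>mlev M X\<^esub> m"
      if "finite_gset G X" "a \<in> carrier (lev R X)" "m \<in> carrier (mlev M X)" for X a m
      using U2[OF that] by (simp add: \<mu>_def)
    have "?P \<alpha>"
    proof (intro conjI allI impI ballI)
      fix X m assume X: "finite_gset G X" and m: "m \<in> carrier (mlev M X)"
      interpret module "lev R X" "mlev M X" by (rule GM.module_lev[OF X])
      show "\<alpha> X (gen X \<one>\<^bsub>lev R X\<^esub> m) = m" using X m by (simp add: g)
      fix a assume a: "a \<in> carrier (lev R X)"
      show "a \<odot>\<^bsub>mlev M X\<^esub> m = \<alpha> X (gen X a m)" using X m a by (simp add: g)
      fix b assume b: "b \<in> carrier (lev R X)"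
      show "\<alpha> X (gen X (a \<otimes>\<^bsub>lev R X\<^esub> b) m) = \<alpha> X (gen X a (\<alpha> X (gen X b m)))"
        using X m a b by (simp add: g smult_assoc1)
    qed (rule U1)
    then show ?thesis by blast
  qed
  show "green_module G R M" if ex: "\<exists>\<alpha>. ?P \<alpha>"
  proof -
    obtain \<alpha> where P: "?P \<alpha>" using ex by blast
    let ?beq = "beq G (lev R) (res R) (tr R) (mlev M) (mres M) (mtr M)"
    let ?bcls = "bcls G (lev R) (res R) (tr R) (mlev M) (mres M) (mtr M)"
    note wg = beq_wf_gen
      [where G = G and A = "lev R" and rA = "res R" and tA = "tr R" and B = "mlev M" and rB = "mres M" and tB = "mtr M"]
    note gal = beq_gen_addl
      [where G = G and A = "lev R" and rA = "res R" and tA = "tr R" and B = "mlev M" and rB = "mres M" and tB = "mtr M"]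
    note gar = beq_gen_addr
      [where G = G and A = "lev R" and rA = "res R" and tA = "tr R" and B = "mlev M" and rB = "mres M" and tB = "mtr M"]
    note gre = beq_gen_res
      [where G = G and A = "lev R" and rA = "res R" and tA = "tr R" and B = "mlev M" and rB = "mres M" and tB = "mtr M"]
    note gfl = beq_gen_frobl
      [where G = G and A = "lev R" and rA = "res R" and tA = "tr R" and B = "mlev M" and rB = "mres M" and tB = "mtr M"]
    note gfr = beq_gen_frobr
      [where G = G and A = "lev R" and rA = "res R" and tA = "tr R" and B = "mlev M" and rB = "mres M" and tB = "mtr M"]
    have e: "a \<odot>\<^bsub>mlev M X\<^esub> m = \<alpha> X (?bcls X (BGen X a m))"
      if "finite_gset G X" "a \<in> carrier (lev R X)" "m \<in> carrier (mlev M X)" for X a m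
      using P that by (simp add: gen_def box_gen_def)
    have h: "\<alpha> X \<in> hom (add_monoid (box_lev G (lev R) (res R) (tr R) (mlev M) (mres M) (mtr M) X)) (add_monoid (mlev M X))"
      if "finite_gset G X" for X using P that by (simp add: mackey_map_def)
    have cl: "\<alpha> X (?bcls X u) \<in> carrier (mlev M X)" if "?beq X u u" for X u
      using hom_in_carrier[OF h[OF beq_gset[OF that]]] box_carrierI[OF that] by simp
    have add: "\<alpha> X (?bcls X (BAdd X u v)) = \<alpha> X (?bcls X u) \<oplus>\<^bsub>mlev M X\<^esub> \<alpha> X (?bcls X v)"
      if "?beq X u u" "?beq X v v" for X u v
      using hom_mult[OF h[OF beq_gset[OF that(1)]], simplified, OF box_carrierI[OF that(1)] box_carrierI[OF that(2)]]
      unfolding box_add[OF that] .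
    have rs: "\<alpha> X (?bcls X (BRes X Y f v)) = mres M X Y f (\<alpha> Y (?bcls Y v))"
      if "f \<in> gmaps G X Y" "?beq Y v v" for X Y f v
    proof -
      have "\<alpha> X (box_res G (lev R) (res R) (tr R) (mlev M) (mres M) (mtr M) X Y f (?bcls Y v)) =
          mres M X Y f (\<alpha> Y (?bcls Y v))"
        using P that box_carrierI[OF that(2)] unfolding mackey_map_def by blast
      then show ?thesis using box_res_cls[OF that] by simp
    qed
    have tr: "\<alpha> Y (?bcls Y (BTr X Y f u)) = mtr M X Y f (\<alpha> X (?bcls X u))"
      if "f \<in> gmaps G X Y" "?beq X u u" for X Y f u
    proof -
      have "\<alpha> Y (box_tr G (lev R) (res R) (tr R) (mlev M) (mres M) (mtr M) X Y f (?bcls X u)) =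
          mtr M X Y f (\<alpha> X (?bcls X u))"
        using P that box_carrierI[OF that(2)] unfolding mackey_map_def by blast
      then show ?thesis using box_tr_cls[OF that] by simp
    qed
    have rc: "res R X Y f a \<in> carrier (lev R X)" if "f \<in> gmaps G X Y" "a \<in> carrier (lev R Y)" for X Y f a
      using ring_hom_closed[OF R.res_ring_hom[OF that(1)] that(2)] .
    have tc: "tr R X Y f a \<in> carrier (lev R Y)" if "f \<in> gmaps G X Y" "a \<in> carrier (lev R X)" for X Y f a
      using hom_in_carrier[OF R.tr_add_hom[OF that(1)]] that(2) by simp
    have mrc: "mres M X Y f a \<in> carrier (mlev M X)" if "f \<in> gmaps G X Y" "a \<in> carrier (mlev M Y)" for X Y f a
      using hom_in_carrier[OF M.res_add_hom[OF that(1)]] that(2) by simp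
    have mtc: "mtr M X Y f a \<in> carrier (mlev M Y)" if "f \<in> gmaps G X Y" "a \<in> carrier (mlev M X)" for X Y f a
      using hom_in_carrier[OF M.tr_add_hom[OF that(1)]] that(2) by simp
    show ?thesis
    proof (intro green_module.intro M green_module_axioms.intro)
      fix X :: "'g gset" assume X: "finite_gset G X"
      interpret r: cring "lev R X" by (rule R.cring_lev[OF X])
      interpret m: abelian_group "mlev M X" by (rule M.abelian_lev[OF X])
      have ec: "a \<odot>\<^bsub>mlev M X\<^esub> m \<in> carrier (mlev M X)"
        if "a \<in> carrier (lev R X)" "m \<in> carrier (mlev M X)" for a m
        using that cl[OF wg[OF X that]] by (simp add: e[OF X])
      show "module (lev R X) (mlev M X)"
      proof (rule moduleI)
        show "\<one>\<^bsub>lev R X\<^esub> \<odot>\<^bsub>mlev M X\<^esub> m = m" if "m \<in> carrier (mlev M X)" for m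
          using P X that by simp
      next
        fix a b m n
        assume *: "a \<in> carrier (lev R X)" "m \<in> carrier (mlev M X)"
        show "a \<odot>\<^bsub>mlev M X\<^esub> m \<in> carrier (mlev M X)" by (rule ec[OF *])
        show "(a \<otimes>\<^bsub>lev R X\<^esub> b) \<odot>\<^bsub>mlev M X\<^esub> m = a \<odot>\<^bsub>mlev M X\<^esub> (b \<odot>\<^bsub>mlev M X\<^esub> m)" if "b \<in> carrier (lev R X)"
          using P X * that ec[OF that *(2)] r.m_closed[OF *(1) that] by metis
        show "(a \<oplus>\<^bsub>lev R X\<^esub> b) \<odot>\<^bsub>mlev M X\<^esub> m = a \<odot>\<^bsub>mlev M X\<^esub> m \<oplus>\<^bsub>mlev M X\<^esub> b \<odot>\<^bsub>mlev M X\<^esub> m" if "b \<in> carrier (lev R X)"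
          using bcls_eqI[OF gal[OF X *(1) that *(2)]] * that X
          by (simp add: e add wg)
        show "a \<odot>\<^bsub>mlev M X\<^esub> (m \<oplus>\<^bsub>mlev M X\<^esub> n) = a \<odot>\<^bsub>mlev M X\<^esub> m \<oplus>\<^bsub>mlev M X\<^esub> a \<odot>\<^bsub>mlev M X\<^esub> n" if "n \<in> carrier (mlev M X)"
          using bcls_eqI[OF gar[OF X *(1,2) that]] * that X
          by (simp add: e add wg)
      qed (rule r.is_cring m.abelian_group_axioms)+
    next
      fix X Y :: "'g gset" and f a m
      assume f: "f \<in> gmaps G X Y"
      note gs = gmaps_gset[OF f]
      show "mres M X Y f (a \<odot>\<^bsub>mlev M Y\<^esub> m) = res R X Y f a \<odot>\<^bsub>mlev M X\<^esub> mres M X Y f m"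
        if a: "a \<in> carrier (lev R Y)" and m: "m \<in> carrier (mlev M Y)"
        using bcls_eqI[OF gre[OF f a m]] rs[OF f wg[OF gs(2) a m]] f a m gs by (simp add: e rc mrc)
      show "mtr M X Y f (a \<odot>\<^bsub>mlev M X\<^esub> mres M X Y f m) = tr R X Y f a \<odot>\<^bsub>mlev M Y\<^esub> m"
        if a: "a \<in> carrier (lev R X)" and m: "m \<in> carrier (mlev M Y)"
        using bcls_eqI[OF gfl[OF f a m]] tr[OF f wg[OF gs(1) a mrc[OF f m]]] f a m gs by (simp add: e tc mrc)
      show "mtr M X Y f (res R X Y f a \<odot>\<^bsub>mlev M X\<^esub> m) = a \<odot>\<^bsub>mlev M Y\<^esub> mtr M X Y f m"
        if a: "a \<in> carrier (lev R Y)" and m: "m \<in> carrier (mlev M X)"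
        using bcls_eqI[OF gfr[OF f a m]] tr[OF f wg[OF gs(1) rc[OF f a] m]] f a m gs by (simp add: e rc mtc)
    qed
  qed
qed

text \<open>
  Elements of the hom-sets below are required to be undefined outside the carriers, so that equality
  of functions is equality of morphisms.
\<close>

definition lev_extensional ::
  "('g, 'k) monoid_scheme \<Rightarrow> ('g gset \<Rightarrow> ('a, 'z) ring_scheme) \<Rightarrow> ('g gset \<Rightarrow> 'a \<Rightarrow> 'b) \<Rightarrow> bool" where
  "lev_extensional G A \<phi> \<longleftrightarrow>
     (\<forall>X. \<phi> X \<in> extensional (if finite_gset G X then carrier (A X) else {}))"

definition lev_comp ::
  "('g, 'k) monoid_scheme \<Rightarrow> ('g gset \<Rightarrow> ('a, 'z) ring_scheme) \<Rightarrow>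
   ('g gset \<Rightarrow> 'b \<Rightarrow> 'c) \<Rightarrow> ('g gset \<Rightarrow> 'a \<Rightarrow> 'b) \<Rightarrow> 'g gset \<Rightarrow> 'a \<Rightarrow> 'c" where
  "lev_comp G A \<psi> \<phi> = (\<lambda>X. compose (if finite_gset G X then carrier (A X) else {}) (\<psi> X) (\<phi> X))"

definition module_Hom ::
  "('g, 'k) monoid_scheme \<Rightarrow> ('g, 'r) tambara \<Rightarrow> ('g, 'r, 'm) gmodule \<Rightarrow> ('g, 'r, 'n) gmodule \<Rightarrow>
   ('g gset \<Rightarrow> 'm \<Rightarrow> 'n) set" where
  "module_Hom G R M N = {\<phi>. lev_extensional G (mlev M) \<phi> \<and>
     mackey_map G (mlev M) (mres M) (mtr M) (mlev N) (mres N) (mtr N) \<phi> \<and>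
     (\<forall>X. finite_gset G X \<longrightarrow> (\<forall>a\<in>carrier (lev R X). \<forall>m\<in>carrier (mlev M X).
        \<phi> X (a \<odot>\<^bsub>mlev M X\<^esub> m) = a \<odot>\<^bsub>mlev N X\<^esub> \<phi> X m))}"


section \<open>Genuine derivations\<close>

definition res_sub :: "('g, 'k) monoid_scheme \<Rightarrow> 'g set \<Rightarrow> ('g, 'r) tambara \<Rightarrow> ('g, 'r) tambara" where
  "res_sub G K R =
    \<lparr>lev = \<lambda>T. lev R (ind G K T),
     res = \<lambda>T T' f. res R (ind G K T) (ind G K T') (ind_map G K T f),
     tr = \<lambda>T T' f. tr R (ind G K T) (ind G K T') (ind_map G K T f),
     nm = \<lambda>T T' f. nm R (ind G K T) (ind G K T') (ind_map G K T f)\<rparr>"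

text \<open>
  \<open>N\<^bsub>d\<^sub>2\<^esub> R\<^bsub>d\<^sub>1\<^esub> (a)\<close>, computed in \<open>i\<^sub>K\<^sup>* R\<close>, for \<open>a \<in> R(G/H)\<close>, where \<open>R(G/H)\<close> and
  \<open>i\<^sub>K\<^sup>* R(K/H) = R(G \<times>\<^sub>K K/H)\<close> are identified along \<open>G \<times>\<^sub>K K/H \<cong> G/H\<close>.
\<close>

definition conorm ::
  "('g, 'k) monoid_scheme \<Rightarrow> ('g, 'r) tambara \<Rightarrow> 'g set \<Rightarrow> 'g set \<Rightarrow> 'r \<Rightarrow> 'r" where
  "conorm G R H K a =
    (let T = orbit_set (subgrp G K) H; D = off_diag T; Q = res_sub G K R
     in res R (orbit_set G H) (ind G K T) (ind_orbit_inv G H K)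
          (nm Q D T (off_snd T) (res Q D T (off_fst T)
             (res R (ind G K T) (orbit_set G H) (ind_orbit G H K) a))))"

definition genuine_Der ::
  "('g, 'k) monoid_scheme \<Rightarrow> ('g, 's) tambara \<Rightarrow> ('g, 'r) tambara \<Rightarrow> ('g gset \<Rightarrow> 's \<Rightarrow> 'r) \<Rightarrow>
   ('g, 'r, 'm) gmodule \<Rightarrow> ('g gset \<Rightarrow> 'r \<Rightarrow> 'm) set" where
  "genuine_Der G S R \<eta> M = {d. lev_extensional G (lev R) d \<and>
     mackey_map G (lev R) (res R) (tr R) (mlev M) (mres M) (mtr M) d \<and>
     (\<forall>X. finite_gset G X \<longrightarrow> (\<forall>a\<in>carrier (lev R X). \<forall>b\<in>carrier (lev R X).
        d X (a \<otimes>\<^bsub>lev R X\<^esub> b) = a \<odot>\<^bsub>mlev M X\<^esub> d X b \<oplus>\<^bsub>mlev M X\<^esub> b \<odot>\<^bsub>mlev M X\<^esub> d X a)) \<and>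
     (\<forall>H K. subgroup H G \<and> subgroup K G \<and> H \<subseteq> K \<longrightarrow> (\<forall>a\<in>carrier (lev R (orbit_set G H)).
        d (orbit_set G K) (nm R (orbit_set G H) (orbit_set G K) (orbit_proj G H K) a) =
        mtr M (orbit_set G H) (orbit_set G K) (orbit_proj G H K)
          (conorm G R H K a \<odot>\<^bsub>mlev M (orbit_set G H)\<^esub> d (orbit_set G H) a))) \<and>
     (\<forall>X. finite_gset G X \<longrightarrow> (\<forall>s\<in>carrier (lev S X). d X (\<eta> X s) = \<zero>\<^bsub>mlev M X\<^esub>))}"


section \<open>The coproduct of Tambara functors under \<open>S\<close>\<close>

text \<open>
  \<open>R\<^sub>1 \<box>\<^sub>S R\<^sub>2\<close> as the coproduct of \<open>R\<^sub>1\<close> and \<open>R\<^sub>2\<close> in \<open>S\<close>-Tambara functors, by generators and relations: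
  formal expressions in elements of \<open>R\<^sub>1\<close> and \<open>R\<^sub>2\<close>, modulo the smallest congruence making the quotient
  a Tambara functor receiving maps from \<open>R\<^sub>1\<close> and \<open>R\<^sub>2\<close> that agree on \<open>S\<close>.  That this is a Tambara
  functor and has the universal property of the coproduct is proved in \<open>coprod_tambara\<close> and
  \<open>coprod_universal\<close>.
\<close>

datatype ('g, 'a, 'b) texp =
    TL "'g gset" 'a
  | TR "'g gset" 'b
  | TZero "'g gset"
  | TOne "'g gset"
  | TNeg "'g gset" "('g, 'a, 'b) texp"
  | TAdd "'g gset" "('g, 'a, 'b) texp" "('g, 'a, 'b) texp"
  | TMul "'g gset" "('g, 'a, 'b) texp" "('g, 'a, 'b) texp"
  | TRes "'g gset" "'g gset" "'g hf \<Rightarrow> 'g hf" "('g, 'a, 'b) texp"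
  | TTr "'g gset" "'g gset" "'g hf \<Rightarrow> 'g hf" "('g, 'a, 'b) texp"
  | TNm "'g gset" "'g gset" "'g hf \<Rightarrow> 'g hf" "('g, 'a, 'b) texp"

primrec teval ::
  "('g, 'c) tambara \<Rightarrow> ('g gset \<Rightarrow> 'a \<Rightarrow> 'c) \<Rightarrow> ('g gset \<Rightarrow> 'b \<Rightarrow> 'c) \<Rightarrow> ('g, 'a, 'b) texp \<Rightarrow> 'c" where
  "teval Q \<phi> \<psi> (TL X a) = \<phi> X a"
| "teval Q \<phi> \<psi> (TR X b) = \<psi> X b"
| "teval Q \<phi> \<psi> (TZero X) = \<zero>\<^bsub>lev Q X\<^esub>"
| "teval Q \<phi> \<psi> (TOne X) = \<one>\<^bsub>lev Q X\<^esub>"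
| "teval Q \<phi> \<psi> (TNeg X u) = \<ominus>\<^bsub>lev Q X\<^esub> teval Q \<phi> \<psi> u"
| "teval Q \<phi> \<psi> (TAdd X u v) = teval Q \<phi> \<psi> u \<oplus>\<^bsub>lev Q X\<^esub> teval Q \<phi> \<psi> v"
| "teval Q \<phi> \<psi> (TMul X u v) = teval Q \<phi> \<psi> u \<otimes>\<^bsub>lev Q X\<^esub> teval Q \<phi> \<psi> v"
| "teval Q \<phi> \<psi> (TRes X Y f u) = res Q X Y f (teval Q \<phi> \<psi> u)"
| "teval Q \<phi> \<psi> (TTr X Y f u) = tr Q X Y f (teval Q \<phi> \<psi> u)"
| "teval Q \<phi> \<psi> (TNm X Y f u) = nm Q X Y f (teval Q \<phi> \<psi> u)"

text \<open>The map out of the coproduct given by \<open>\<phi>\<close> and \<open>\<psi>\<close>.\<close>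

definition copair ::
  "('g, 'c) tambara \<Rightarrow> ('g gset \<Rightarrow> 'a \<Rightarrow> 'c) \<Rightarrow> ('g gset \<Rightarrow> 'b \<Rightarrow> 'c) \<Rightarrow>
   'g gset \<Rightarrow> ('g, 'a, 'b) texp set \<Rightarrow> 'c" where
  "copair Q \<phi> \<psi> X c = teval Q \<phi> \<psi> (SOME u. u \<in> c)"

context
  fixes G :: "('g, 'k) monoid_scheme"
    and S :: "('g, 's) tambara"
    and R1 :: "('g, 'a) tambara" and \<eta>1 :: "'g gset \<Rightarrow> 's \<Rightarrow> 'a"
    and R2 :: "('g, 'b) tambara" and \<eta>2 :: "'g gset \<Rightarrow> 's \<Rightarrow> 'b"
begin

text \<open>
  \<open>teq X u v\<close>: \<open>u\<close> and \<open>v\<close> are well-formed expressions at level \<open>X\<close> and are equal in the coproduct.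
  In particular \<open>u\<close> is well-formed at level \<open>X\<close> iff \<open>teq X u u\<close>.
\<close>

inductive teq :: "'g gset \<Rightarrow> ('g, 'a, 'b) texp \<Rightarrow> ('g, 'a, 'b) texp \<Rightarrow> bool" where
  teq_sym: "teq X u v \<Longrightarrow> teq X v u"
| teq_trans: "teq X u v \<Longrightarrow> teq X v w \<Longrightarrow> teq X u w"
\<comment> \<open>well-formedness and congruence\<close>
| teq_wf_L: "finite_gset G X \<Longrightarrow> a \<in> carrier (lev R1 X) \<Longrightarrow> teq X (TL X a) (TL X a)"
| teq_wf_R: "finite_gset G X \<Longrightarrow> b \<in> carrier (lev R2 X) \<Longrightarrow> teq X (TR X b) (TR X b)"
| teq_wf_zero: "finite_gset G X \<Longrightarrow> teq X (TZero X) (TZero X)"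
| teq_wf_one: "finite_gset G X \<Longrightarrow> teq X (TOne X) (TOne X)"
| teq_cong_neg: "teq X u v \<Longrightarrow> teq X (TNeg X u) (TNeg X v)"
| teq_cong_add: "teq X u v \<Longrightarrow> teq X u' v' \<Longrightarrow> teq X (TAdd X u u') (TAdd X v v')"
| teq_cong_mul: "teq X u v \<Longrightarrow> teq X u' v' \<Longrightarrow> teq X (TMul X u u') (TMul X v v')"
| teq_cong_res: "f \<in> gmaps G X Y \<Longrightarrow> teq Y u v \<Longrightarrow> teq X (TRes X Y f u) (TRes X Y f v)"
| teq_cong_tr: "f \<in> gmaps G X Y \<Longrightarrow> teq X u v \<Longrightarrow> teq Y (TTr X Y f u) (TTr X Y f v)"
| teq_cong_nm: "f \<in> gmaps G X Y \<Longrightarrow> teq X u v \<Longrightarrow> teq Y (TNm X Y f u) (TNm X Y f v)"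
\<comment> \<open>commutative rings\<close>
| teq_add_assoc: "teq X u u \<Longrightarrow> teq X v v \<Longrightarrow> teq X w w \<Longrightarrow>
    teq X (TAdd X (TAdd X u v) w) (TAdd X u (TAdd X v w))"
| teq_add_comm: "teq X u u \<Longrightarrow> teq X v v \<Longrightarrow> teq X (TAdd X u v) (TAdd X v u)"
| teq_add_zero: "teq X u u \<Longrightarrow> teq X (TAdd X (TZero X) u) u"
| teq_add_neg: "teq X u u \<Longrightarrow> teq X (TAdd X (TNeg X u) u) (TZero X)"
| teq_mul_assoc: "teq X u u \<Longrightarrow> teq X v v \<Longrightarrow> teq X w w \<Longrightarrow>
    teq X (TMul X (TMul X u v) w) (TMul X u (TMul X v w))"
| teq_mul_comm: "teq X u u \<Longrightarrow> teq X v v \<Longrightarrow> teq X (TMul X u v) (TMul X v u)"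
| teq_mul_one: "teq X u u \<Longrightarrow> teq X (TMul X (TOne X) u) u"
| teq_distr: "teq X u u \<Longrightarrow> teq X v v \<Longrightarrow> teq X w w \<Longrightarrow>
    teq X (TMul X (TAdd X u v) w) (TAdd X (TMul X u w) (TMul X v w))"
\<comment> \<open>restrictions are ring maps, transfers additive and norms multiplicative\<close>
| teq_res_add: "f \<in> gmaps G X Y \<Longrightarrow> teq Y u u \<Longrightarrow> teq Y v v \<Longrightarrow>
    teq X (TRes X Y f (TAdd Y u v)) (TAdd X (TRes X Y f u) (TRes X Y f v))"
| teq_res_mul: "f \<in> gmaps G X Y \<Longrightarrow> teq Y u u \<Longrightarrow> teq Y v v \<Longrightarrow>
    teq X (TRes X Y f (TMul Y u v)) (TMul X (TRes X Y f u) (TRes X Y f v))"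
| teq_res_one: "f \<in> gmaps G X Y \<Longrightarrow> teq X (TRes X Y f (TOne Y)) (TOne X)"
| teq_tr_add: "f \<in> gmaps G X Y \<Longrightarrow> teq X u u \<Longrightarrow> teq X v v \<Longrightarrow>
    teq Y (TTr X Y f (TAdd X u v)) (TAdd Y (TTr X Y f u) (TTr X Y f v))"
| teq_nm_mul: "f \<in> gmaps G X Y \<Longrightarrow> teq X u u \<Longrightarrow> teq X v v \<Longrightarrow>
    teq Y (TNm X Y f (TMul X u v)) (TMul Y (TNm X Y f u) (TNm X Y f v))"
| teq_nm_one: "f \<in> gmaps G X Y \<Longrightarrow> teq Y (TNm X Y f (TOne X)) (TOne Y)"
\<comment> \<open>functoriality\<close>
| teq_res_id: "teq X u u \<Longrightarrow> teq X (TRes X X (gid X) u) u"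
| teq_tr_id: "teq X u u \<Longrightarrow> teq X (TTr X X (gid X) u) u"
| teq_nm_id: "teq X u u \<Longrightarrow> teq X (TNm X X (gid X) u) u"
| teq_res_comp: "f \<in> gmaps G X Y \<Longrightarrow> g \<in> gmaps G Y Z \<Longrightarrow> teq Z u u \<Longrightarrow>
    teq X (TRes X Z (gcomp X g f) u) (TRes X Y f (TRes Y Z g u))"
| teq_tr_comp: "f \<in> gmaps G X Y \<Longrightarrow> g \<in> gmaps G Y Z \<Longrightarrow> teq X u u \<Longrightarrow>
    teq Z (TTr X Z (gcomp X g f) u) (TTr Y Z g (TTr X Y f u))"
| teq_nm_comp: "f \<in> gmaps G X Y \<Longrightarrow> g \<in> gmaps G Y Z \<Longrightarrow> teq X u u \<Longrightarrow>
    teq Z (TNm X Z (gcomp X g f) u) (TNm Y Z g (TNm X Y f u))"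
\<comment> \<open>disjoint unions to products; surjectivity onto the product follows from base change\<close>
| teq_empty: "teq X u u \<Longrightarrow> pts X = {} \<Longrightarrow> teq X u (TZero X)"
| teq_coproduct: "is_coproduct G X1 X2 X j1 j2 \<Longrightarrow> teq X u u \<Longrightarrow> teq X v v \<Longrightarrow>
    teq X1 (TRes X1 X j1 u) (TRes X1 X j1 v) \<Longrightarrow> teq X2 (TRes X2 X j2 u) (TRes X2 X j2 v) \<Longrightarrow> teq X u v"
\<comment> \<open>base change and the exponential relation\<close>
| teq_tr_base_change: "is_pullback G P X Y Z p q f g \<Longrightarrow> teq X u u \<Longrightarrow>
    teq Y (TRes Y Z g (TTr X Z f u)) (TTr P Y q (TRes P X p u))"
| teq_nm_base_change: "is_pullback G P X Y Z p q f g \<Longrightarrow> teq X u u \<Longrightarrow>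
    teq Y (TRes Y Z g (TNm X Z f u)) (TNm P Y q (TRes P X p u))"
| teq_nm_tr: "is_exponential G A X Y E D h g e g' h' \<Longrightarrow> teq A u u \<Longrightarrow>
    teq Y (TNm X Y g (TTr A X h u)) (TTr D Y h' (TNm E D g' (TRes E A e u)))"
\<comment> \<open>the inclusions of \<open>R\<^sub>1\<close> and \<open>R\<^sub>2\<close> are maps of Tambara functors\<close>
| teq_L_add: "finite_gset G X \<Longrightarrow> a \<in> carrier (lev R1 X) \<Longrightarrow> a' \<in> carrier (lev R1 X) \<Longrightarrow>
    teq X (TL X (a \<oplus>\<^bsub>lev R1 X\<^esub> a')) (TAdd X (TL X a) (TL X a'))"
| teq_L_mul: "finite_gset G X \<Longrightarrow> a \<in> carrier (lev R1 X) \<Longrightarrow> a' \<in> carrier (lev R1 X) \<Longrightarrow>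
    teq X (TL X (a \<otimes>\<^bsub>lev R1 X\<^esub> a')) (TMul X (TL X a) (TL X a'))"
| teq_L_one: "finite_gset G X \<Longrightarrow> teq X (TL X \<one>\<^bsub>lev R1 X\<^esub>) (TOne X)"
| teq_L_res: "f \<in> gmaps G X Y \<Longrightarrow> a \<in> carrier (lev R1 Y) \<Longrightarrow>
    teq X (TL X (res R1 X Y f a)) (TRes X Y f (TL Y a))"
| teq_L_tr: "f \<in> gmaps G X Y \<Longrightarrow> a \<in> carrier (lev R1 X) \<Longrightarrow>
    teq Y (TL Y (tr R1 X Y f a)) (TTr X Y f (TL X a))"
| teq_L_nm: "f \<in> gmaps G X Y \<Longrightarrow> a \<in> carrier (lev R1 X) \<Longrightarrow>
    teq Y (TL Y (nm R1 X Y f a)) (TNm X Y f (TL X a))"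
| teq_R_add: "finite_gset G X \<Longrightarrow> b \<in> carrier (lev R2 X) \<Longrightarrow> b' \<in> carrier (lev R2 X) \<Longrightarrow>
    teq X (TR X (b \<oplus>\<^bsub>lev R2 X\<^esub> b')) (TAdd X (TR X b) (TR X b'))"
| teq_R_mul: "finite_gset G X \<Longrightarrow> b \<in> carrier (lev R2 X) \<Longrightarrow> b' \<in> carrier (lev R2 X) \<Longrightarrow>
    teq X (TR X (b \<otimes>\<^bsub>lev R2 X\<^esub> b')) (TMul X (TR X b) (TR X b'))"
| teq_R_one: "finite_gset G X \<Longrightarrow> teq X (TR X \<one>\<^bsub>lev R2 X\<^esub>) (TOne X)"
| teq_R_res: "f \<in> gmaps G X Y \<Longrightarrow> b \<in> carrier (lev R2 Y) \<Longrightarrow>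
    teq X (TR X (res R2 X Y f b)) (TRes X Y f (TR Y b))"
| teq_R_tr: "f \<in> gmaps G X Y \<Longrightarrow> b \<in> carrier (lev R2 X) \<Longrightarrow>
    teq Y (TR Y (tr R2 X Y f b)) (TTr X Y f (TR X b))"
| teq_R_nm: "f \<in> gmaps G X Y \<Longrightarrow> b \<in> carrier (lev R2 X) \<Longrightarrow>
    teq Y (TR Y (nm R2 X Y f b)) (TNm X Y f (TR X b))"
\<comment> \<open>and agree on \<open>S\<close>\<close>
| teq_agree: "finite_gset G X \<Longrightarrow> s \<in> carrier (lev S X) \<Longrightarrow> teq X (TL X (\<eta>1 X s)) (TR X (\<eta>2 X s))"

definition tcls :: "'g gset \<Rightarrow> ('g, 'a, 'b) texp \<Rightarrow> ('g, 'a, 'b) texp set" where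
  "tcls X u = {v. teq X u v}"

definition coprod :: "('g, ('g, 'a, 'b) texp set) tambara" where
  "coprod =
    \<lparr>lev = \<lambda>X. \<lparr>carrier = {tcls X u | u. teq X u u},
                mult = \<lambda>c c'. \<Union>u\<in>c. \<Union>v\<in>c'. tcls X (TMul X u v),
                one = tcls X (TOne X),
                zero = tcls X (TZero X),
                add = \<lambda>c c'. \<Union>u\<in>c. \<Union>v\<in>c'. tcls X (TAdd X u v)\<rparr>,
     res = \<lambda>X Y f c. \<Union>u\<in>c. tcls X (TRes X Y f u),
     tr = \<lambda>X Y f c. \<Union>u\<in>c. tcls Y (TTr X Y f u),
     nm = \<lambda>X Y f c. \<Union>u\<in>c. tcls Y (TNm X Y f u)\<rparr>"

definition coprod_inl :: "'g gset \<Rightarrow> 'a \<Rightarrow> ('g, 'a, 'b) texp set" where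
  "coprod_inl X a = tcls X (TL X a)"

definition coprod_inr :: "'g gset \<Rightarrow> 'b \<Rightarrow> ('g, 'a, 'b) texp set" where
  "coprod_inr X b = tcls X (TR X b)"

lemma teq_refl: "teq X u v \<Longrightarrow> teq X u u" "teq X u v \<Longrightarrow> teq X v v"
  by (blast intro: teq_sym teq_trans)+

lemma teq_gset: "teq X u v \<Longrightarrow> finite_gset G X"
  by (induction rule: teq.induct)
    (auto simp: gmaps_def is_pullback_def is_exponential_def is_coproduct_def)

lemma tcls_eqI: "teq X u v \<Longrightarrow> tcls X u = tcls X v"
  unfolding tcls_def by (blast intro: teq_sym teq_trans)

lemma tcls_eqD: "teq X v v \<Longrightarrow> tcls X u = tcls X v \<Longrightarrow> teq X u v"
  unfolding tcls_def by blast

lemma tcls_self: "teq X u u \<Longrightarrow> u \<in> tcls X u"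
  by (simp add: tcls_def)


lemma coprod_carrier: "carrier (lev coprod X) = {tcls X u | u. teq X u u}"
  by (simp add: coprod_def)

lemma coprod_carrierI: "teq X u u \<Longrightarrow> tcls X u \<in> carrier (lev coprod X)"
  by (auto simp: coprod_def)

lemma coprod_carrierE:
  assumes "c \<in> carrier (lev coprod X)"
  obtains u where "c = tcls X u" "teq X u u"
  using assms by (auto simp: coprod_def)

lemma coprod_zero: "\<zero>\<^bsub>lev coprod X\<^esub> = tcls X (TZero X)"
  by (simp add: coprod_def)

lemma coprod_one: "\<one>\<^bsub>lev coprod X\<^esub> = tcls X (TOne X)"
  by (simp add: coprod_def)

lemma coprod_add:
  assumes "teq X u u" "teq X v v"
  shows "tcls X u \<oplus>\<^bsub>lev coprod X\<^esub> tcls X v = tcls X (TAdd X u v)"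
proof -
  have "(\<Union>u'\<in>tcls X u. \<Union>v'\<in>tcls X v. tcls X (TAdd X u' v')) = tcls X (TAdd X u v)"
    by (rule UN_const[OF tcls_self[OF assms(1)]], rule UN_const[OF tcls_self[OF assms(2)]],
        rule tcls_eqI, unfold tcls_def) (blast intro: teq_cong_add teq_sym)
  then show ?thesis by (simp add: coprod_def)
qed

lemma coprod_mult:
  assumes "teq X u u" "teq X v v"
  shows "tcls X u \<otimes>\<^bsub>lev coprod X\<^esub> tcls X v = tcls X (TMul X u v)"
proof -
  have "(\<Union>u'\<in>tcls X u. \<Union>v'\<in>tcls X v. tcls X (TMul X u' v')) = tcls X (TMul X u v)"
    by (rule UN_const[OF tcls_self[OF assms(1)]], rule UN_const[OF tcls_self[OF assms(2)]],
        rule tcls_eqI, unfold tcls_def) (blast intro: teq_cong_mul teq_sym)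
  then show ?thesis by (simp add: coprod_def)
qed

lemma coprod_res:
  assumes "f \<in> gmaps G X Y" "teq Y u u"
  shows "res coprod X Y f (tcls Y u) = tcls X (TRes X Y f u)"
proof -
  have "(\<Union>u'\<in>tcls Y u. tcls X (TRes X Y f u')) = tcls X (TRes X Y f u)"
    by (rule UN_const[OF tcls_self[OF assms(2)]], rule tcls_eqI, unfold tcls_def)
      (blast intro: teq_cong_res[OF assms(1)] teq_sym)
  then show ?thesis by (simp add: coprod_def)
qed

lemma coprod_tr:
  assumes "f \<in> gmaps G X Y" "teq X u u"
  shows "tr coprod X Y f (tcls X u) = tcls Y (TTr X Y f u)"
proof -
  have "(\<Union>u'\<in>tcls X u. tcls Y (TTr X Y f u')) = tcls Y (TTr X Y f u)"
    by (rule UN_const[OF tcls_self[OF assms(2)]], rule tcls_eqI, unfold tcls_def)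
      (blast intro: teq_cong_tr[OF assms(1)] teq_sym)
  then show ?thesis by (simp add: coprod_def)
qed

lemma coprod_nm:
  assumes "f \<in> gmaps G X Y" "teq X u u"
  shows "nm coprod X Y f (tcls X u) = tcls Y (TNm X Y f u)"
proof -
  have "(\<Union>u'\<in>tcls X u. tcls Y (TNm X Y f u')) = tcls Y (TNm X Y f u)"
    by (rule UN_const[OF tcls_self[OF assms(2)]], rule tcls_eqI, unfold tcls_def)
      (blast intro: teq_cong_nm[OF assms(1)] teq_sym)
  then show ?thesis by (simp add: coprod_def)
qed

lemmas coprod_ops = coprod_zero coprod_one coprod_add coprod_mult coprod_res coprod_tr coprod_nm

lemma teq_wf_ops:
  "teq X u u \<Longrightarrow> teq X v v \<Longrightarrow> teq X (TAdd X u v) (TAdd X u v)"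
  "teq X u u \<Longrightarrow> teq X v v \<Longrightarrow> teq X (TMul X u v) (TMul X u v)"
  "teq X u u \<Longrightarrow> teq X (TNeg X u) (TNeg X u)"
  "f \<in> gmaps G X Y \<Longrightarrow> teq Y u u \<Longrightarrow> teq X (TRes X Y f u) (TRes X Y f u)"
  "f \<in> gmaps G X Y \<Longrightarrow> teq X u u \<Longrightarrow> teq Y (TTr X Y f u) (TTr X Y f u)"
  "f \<in> gmaps G X Y \<Longrightarrow> teq X u u \<Longrightarrow> teq Y (TNm X Y f u) (TNm X Y f u)"
  by (blast intro: teq_cong_add teq_cong_mul teq_cong_neg teq_cong_res teq_cong_tr teq_cong_nm)+

lemmas coprod_simps = coprod_ops coprod_carrierI teq_wf_ops teq_wf_zero teq_wf_one

lemma coprod_cring: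
  assumes X: "finite_gset G X"
  shows "cring (lev coprod X)"
proof (rule cringI)
  show "abelian_group (lev coprod X)"
  proof (rule abelian_groupI)
    fix x assume "x \<in> carrier (lev coprod X)"
    then obtain u where u: "x = tcls X u" "teq X u u" by (rule coprod_carrierE)
    have "tcls X (TNeg X u) \<oplus>\<^bsub>lev coprod X\<^esub> x = \<zero>\<^bsub>lev coprod X\<^esub>"
      using u by (simp add: coprod_simps X tcls_eqI[OF teq_add_neg])
    then show "\<exists>y\<in>carrier (lev coprod X). y \<oplus>\<^bsub>lev coprod X\<^esub> x = \<zero>\<^bsub>lev coprod X\<^esub>"
      using u by (blast intro: coprod_simps)
  qed (((elim coprod_carrierE)?, (simp add: coprod_simps X tcls_eqI[OF teq_add_assoc]
      tcls_eqI[OF teq_add_zero]; fail)) |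
      (elim coprod_carrierE, (simp add: coprod_simps tcls_eqI[OF teq_add_comm]; fail)))+
  show "comm_monoid (lev coprod X)"
    by (rule comm_monoidI) (((elim coprod_carrierE)?, (simp add: coprod_simps X tcls_eqI[OF teq_mul_assoc]
      tcls_eqI[OF teq_mul_one]; fail)) |
      (elim coprod_carrierE, (simp add: coprod_simps tcls_eqI[OF teq_mul_comm]; fail)))+
qed ((elim coprod_carrierE)?, simp add: coprod_simps tcls_eqI[OF teq_distr])

lemma coprod_abelian: "finite_gset G X \<Longrightarrow> abelian_group (lev coprod X)"
  using coprod_cring by (simp add: cring_def ring_def)

lemma coprod_res_hom: "f \<in> gmaps G X Y \<Longrightarrow> res coprod X Y f \<in> ring_hom (lev coprod Y) (lev coprod X)"
  by (rule ring_hom_memI; (elim coprod_carrierE)?;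
      simp add: coprod_simps gmaps_gset tcls_eqI[OF teq_res_add] tcls_eqI[OF teq_res_mul]
        tcls_eqI[OF teq_res_one])

lemma coprod_tr_hom:
  "f \<in> gmaps G X Y \<Longrightarrow> tr coprod X Y f \<in> hom (add_monoid (lev coprod X)) (add_monoid (lev coprod Y))"
  by (rule homI; simp; (elim coprod_carrierE)?;
      simp add: coprod_simps gmaps_gset tcls_eqI[OF teq_tr_add])

lemma coprod_nm_hom: "f \<in> gmaps G X Y \<Longrightarrow> nm coprod X Y f \<in> hom (lev coprod X) (lev coprod Y)"
  by (rule homI; (elim coprod_carrierE)?;
      simp add: coprod_simps gmaps_gset tcls_eqI[OF teq_nm_mul])

lemma coprod_base_change:
  assumes "is_pullback G P X Y Z p q f g" "a \<in> carrier (lev coprod X)"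
  shows "res coprod Y Z g (tr coprod X Z f a) = tr coprod P Y q (res coprod P X p a)"
    "res coprod Y Z g (nm coprod X Z f a) = nm coprod P Y q (res coprod P X p a)"
  using assms(2) is_pullbackD[OF assms(1)]
  by (auto elim!: coprod_carrierE simp: coprod_simps tcls_eqI[OF teq_tr_base_change[OF assms(1)]]
        tcls_eqI[OF teq_nm_base_change[OF assms(1)]])

lemma coprod_gid:
  assumes "finite_gset G X" "a \<in> carrier (lev coprod X)"
  shows "res coprod X X (gid X) a = a" "tr coprod X X (gid X) a = a" "nm coprod X X (gid X) a = a"
  using assms gid_gmaps[OF assms(1)]
  by (auto elim!: coprod_carrierE simp: coprod_simps tcls_eqI[OF teq_res_id] tcls_eqI[OF teq_tr_id]
      tcls_eqI[OF teq_nm_id])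

lemma coprod_empty:
  assumes "finite_gset G X" "pts X = {}" shows "carrier (lev coprod X) = {\<zero>\<^bsub>lev coprod X\<^esub>}"
proof -
  interpret cring "lev coprod X" by (rule coprod_cring[OF assms(1)])
  have "a = \<zero>\<^bsub>lev coprod X\<^esub>" if "a \<in> carrier (lev coprod X)" for a
    using that assms by (auto elim!: coprod_carrierE simp: coprod_zero tcls_eqI[OF teq_empty])
  then show ?thesis by blast
qed

lemma coprod_coproduct:
  assumes "group G" "is_coproduct G X1 X2 X j1 j2"
  shows "bij_betw (\<lambda>a. (res coprod X1 X j1 a, res coprod X2 X j2 a)) (carrier (lev coprod X))
           (carrier (lev coprod X1) \<times> carrier (lev coprod X2))"
proof (rule coproduct_levI[where t = "tr coprod"])
  note j = is_coproductD[OF assms(2)]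
  show "a = b" if "a \<in> carrier (lev coprod X)" "b \<in> carrier (lev coprod X)"
    "res coprod X1 X j1 a = res coprod X1 X j1 b" "res coprod X2 X j2 a = res coprod X2 X j2 b" for a b
  proof -
    from that obtain u v where uv: "a = tcls X u" "teq X u u" "b = tcls X v" "teq X v v"
      by (auto elim!: coprod_carrierE)
    have "teq X1 (TRes X1 X j1 u) (TRes X1 X j1 v)" "teq X2 (TRes X2 X j2 u) (TRes X2 X j2 v)"
      using that uv j by (auto simp: coprod_res intro!: tcls_eqD teq_wf_ops)
    then show "a = b"
      using uv tcls_eqI[OF teq_coproduct[OF assms(2)]] by blast
  qed
qed (use assms coprod_tr_hom ring_hom_add_hom[OF coprod_res_hom] in
    \<open>simp_all only: coprod_abelian coprod_gid coprod_empty coprod_base_change(1)\<close>)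

theorem coprod_tambara:
  assumes "group G" "finite (carrier G)"
  shows "tambara_functor G coprod"
proof (intro tambara_functor.intro mackey_functor.intro tambara_functor_axioms.intro)
  show "res coprod X Z (gcomp X g f) a = res coprod X Y f (res coprod Y Z g a)"
    if "f \<in> gmaps G X Y" "g \<in> gmaps G Y Z" "a \<in> carrier (lev coprod Z)" for X Y Z f g a
    using that by (auto elim!: coprod_carrierE simp: coprod_simps gcomp_gmaps tcls_eqI[OF teq_res_comp])
  show "tr coprod X Z (gcomp X g f) a = tr coprod Y Z g (tr coprod X Y f a)"
    if "f \<in> gmaps G X Y" "g \<in> gmaps G Y Z" "a \<in> carrier (lev coprod X)" for X Y Z f g a
    using that by (auto elim!: coprod_carrierE simp: coprod_simps gcomp_gmaps tcls_eqI[OF teq_tr_comp])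
  show "nm coprod X Z (gcomp X g f) a = nm coprod Y Z g (nm coprod X Y f a)"
    if "f \<in> gmaps G X Y" "g \<in> gmaps G Y Z" "a \<in> carrier (lev coprod X)" for X Y Z f g a
    using that by (auto elim!: coprod_carrierE simp: coprod_simps gcomp_gmaps tcls_eqI[OF teq_nm_comp])
  show "nm coprod X Y f \<one>\<^bsub>lev coprod X\<^esub> = \<one>\<^bsub>lev coprod Y\<^esub>" if "f \<in> gmaps G X Y" for X Y f
    using that gmaps_gset[OF that] by (simp add: coprod_simps tcls_eqI[OF teq_nm_one])
  show "nm coprod X Y g (tr coprod A X h a) = tr coprod D Y h' (nm coprod E D g' (res coprod E A e a))"
    if ex: "is_exponential G A X Y E D h g e g' h'" and a: "a \<in> carrier (lev coprod A)"
    for A X Y E D h g e g' h' a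
    using a is_exponentialD[OF ex]
    by (auto elim!: coprod_carrierE simp: coprod_simps tcls_eqI[OF teq_nm_tr[OF ex]])
next
  fix X1 X2 X j1 j2 assume "is_coproduct G X1 X2 X j1 j2"
  then show "bij_betw (\<lambda>a. (res coprod X1 X j1 a, res coprod X2 X j2 a)) (carrier (lev coprod X))
      (carrier (lev coprod X1) \<times> carrier (lev coprod X2))"
    by (rule coprod_coproduct[OF assms(1)])
next
  fix X Y :: "'g gset" and f assume f: "f \<in> gmaps G X Y"
  show "res coprod X Y f \<in> ring_hom (lev coprod Y) (lev coprod X)" by (rule coprod_res_hom[OF f])
  then show "res coprod X Y f \<in> hom (add_monoid (lev coprod Y)) (add_monoid (lev coprod X))"
    by (rule ring_hom_add_hom)
  show "tr coprod X Y f \<in> hom (add_monoid (lev coprod X)) (add_monoid (lev coprod Y))" by (rule coprod_tr_hom[OF f])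
  show "nm coprod X Y f \<in> hom (lev coprod X) (lev coprod Y)" by (rule coprod_nm_hom[OF f])
next
  fix X :: "'g gset" assume X: "finite_gset G X"
  show "abelian_group (lev coprod X)" by (rule coprod_abelian[OF X])
  show "cring (lev coprod X)" by (rule coprod_cring[OF X])
  show "carrier (lev coprod X) = {\<zero>\<^bsub>lev coprod X\<^esub>}" if "pts X = {}" by (rule coprod_empty[OF X that])
  fix a assume a: "a \<in> carrier (lev coprod X)"
  show "res coprod X X (gid X) a = a" "tr coprod X X (gid X) a = a" "nm coprod X X (gid X) a = a"
    by (rule coprod_gid[OF X a])+
next
  fix P X Y Z p q f g a
  assume pb: "is_pullback G P X Y Z p q f g" and a: "a \<in> carrier (lev coprod X)"
  show "res coprod Y Z g (tr coprod X Z f a) = tr coprod P Y q (res coprod P X p a)"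
    "res coprod Y Z g (nm coprod X Z f a) = nm coprod P Y q (res coprod P X p a)"
    by (rule coprod_base_change[OF pb a])+
qed (use assms in simp_all)

lemma coprod_inl_map:
  assumes "tambara_functor G R1"
  shows "tambara_map G R1 coprod coprod_inl"
proof -
  interpret R1: tambara_functor G R1 by (rule assms)
  have "coprod_inl X \<in> ring_hom (lev R1 X) (lev coprod X)" if X: "finite_gset G X" for X
  proof -
    interpret cring "lev R1 X" by (rule R1.cring_lev[OF X])
    show ?thesis
      by (rule ring_hom_memI; simp add: coprod_inl_def coprod_simps X teq_wf_L
          tcls_eqI[OF teq_L_add] tcls_eqI[OF teq_L_mul] tcls_eqI[OF teq_L_one])
  qed
  then show ?thesis
    unfolding tambara_map_def coprod_inl_def
    by (auto simp: coprod_simps gmaps_gset teq_wf_L tcls_eqI[OF teq_L_res]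
        tcls_eqI[OF teq_L_tr] tcls_eqI[OF teq_L_nm])
qed

lemma coprod_inr_map:
  assumes "tambara_functor G R2"
  shows "tambara_map G R2 coprod coprod_inr"
proof -
  interpret R2: tambara_functor G R2 by (rule assms)
  have "coprod_inr X \<in> ring_hom (lev R2 X) (lev coprod X)" if X: "finite_gset G X" for X
  proof -
    interpret cring "lev R2 X" by (rule R2.cring_lev[OF X])
    show ?thesis
      by (rule ring_hom_memI; simp add: coprod_inr_def coprod_simps X teq_wf_R
          tcls_eqI[OF teq_R_add] tcls_eqI[OF teq_R_mul] tcls_eqI[OF teq_R_one])
  qed
  then show ?thesis
    unfolding tambara_map_def coprod_inr_def
    by (auto simp: coprod_simps gmaps_gset teq_wf_R tcls_eqI[OF teq_R_res]
        tcls_eqI[OF teq_R_tr] tcls_eqI[OF teq_R_nm])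
qed

lemma coprod_agree:
  "finite_gset G X \<Longrightarrow> s \<in> carrier (lev S X) \<Longrightarrow> coprod_inl X (\<eta>1 X s) = coprod_inr X (\<eta>2 X s)"
  by (simp add: coprod_inl_def coprod_inr_def tcls_eqI[OF teq_agree])

lemma teval_teq:
  assumes Q: "tambara_functor G Q"
    and \<phi>: "tambara_map G R1 Q \<phi>" and \<psi>: "tambara_map G R2 Q \<psi>"
    and ag: "\<And>X s. finite_gset G X \<Longrightarrow> s \<in> carrier (lev S X) \<Longrightarrow> \<phi> X (\<eta>1 X s) = \<psi> X (\<eta>2 X s)"
    and mem: "\<And>X s. finite_gset G X \<Longrightarrow> s \<in> carrier (lev S X) \<Longrightarrow> \<eta>1 X s \<in> carrier (lev R1 X)"
    and "teq X u v"
  shows "teval Q \<phi> \<psi> u = teval Q \<phi> \<psi> v \<and> teval Q \<phi> \<psi> u \<in> carrier (lev Q X)"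
proof -
  interpret Q: tambara_functor G Q by (rule Q)
  have aQ: "abelian_group (lev Q X)" if "finite_gset G X" for X by (rule Q.abelian_lev[OF that])
  have cm: "comm_monoid (lev Q X)" if "finite_gset G X" for X
    using Q.cring_lev[OF that] by (simp add: cring_def)
  have am: "abelian_monoid (lev Q X)" if "finite_gset G X" for X
    using aQ[OF that] by (simp add: abelian_group_def)
  have mo: "monoid (lev Q X)" if "finite_gset G X" for X
    using cm[OF that] by (simp add: comm_monoid_def)
  have qc1: "res Q X Y f b \<in> carrier (lev Q X)"
    if "f \<in> gmaps G X Y" "b \<in> carrier (lev Q Y)" for X Y f b
    using ring_hom_closed[OF Q.res_ring_hom[OF that(1)] that(2)] .
  have qc2: "tr Q X Y f a \<in> carrier (lev Q Y)" "nm Q X Y f a \<in> carrier (lev Q Y)"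
    if "f \<in> gmaps G X Y" "a \<in> carrier (lev Q X)" for X Y f a
    using hom_in_carrier[OF Q.tr_add_hom[OF that(1)]] hom_in_carrier[OF Q.nm_hom[OF that(1)]] that(2)
    by simp_all
  note qc = qc1 qc2
  have qh1: "res Q X Y f (b \<oplus>\<^bsub>lev Q Y\<^esub> b') = res Q X Y f b \<oplus>\<^bsub>lev Q X\<^esub> res Q X Y f b'"
    "res Q X Y f (b \<otimes>\<^bsub>lev Q Y\<^esub> b') = res Q X Y f b \<otimes>\<^bsub>lev Q X\<^esub> res Q X Y f b'"
    if "f \<in> gmaps G X Y" "b \<in> carrier (lev Q Y)" "b' \<in> carrier (lev Q Y)" for X Y f b b'
    using ring_hom_add[OF Q.res_ring_hom[OF that(1)] that(2,3)]
      ring_hom_mult[OF Q.res_ring_hom[OF that(1)] that(2,3)] by auto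
  have qh2: "tr Q X Y f (a \<oplus>\<^bsub>lev Q X\<^esub> a') = tr Q X Y f a \<oplus>\<^bsub>lev Q Y\<^esub> tr Q X Y f a'"
    "nm Q X Y f (a \<otimes>\<^bsub>lev Q X\<^esub> a') = nm Q X Y f a \<otimes>\<^bsub>lev Q Y\<^esub> nm Q X Y f a'"
    if "f \<in> gmaps G X Y" "a \<in> carrier (lev Q X)" "a' \<in> carrier (lev Q X)" for X Y f a a'
    using hom_mult[OF Q.tr_add_hom[OF that(1)]] hom_mult[OF Q.nm_hom[OF that(1)]] that(2,3) by simp_all
  have qone: "res Q X Y f \<one>\<^bsub>lev Q Y\<^esub> = \<one>\<^bsub>lev Q X\<^esub>" if "f \<in> gmaps G X Y" for X Y f
    using ring_hom_one[OF Q.res_ring_hom[OF that]] .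
  note qh = qh1 qh2
  have c: "\<phi> X a \<in> carrier (lev Q X)" if "finite_gset G X" "a \<in> carrier (lev R1 X)" for X a
    using \<phi> that by (auto simp: tambara_map_def intro: ring_hom_closed)
  have d: "\<psi> X a \<in> carrier (lev Q X)" if "finite_gset G X" "a \<in> carrier (lev R2 X)" for X a
    using \<psi> that by (auto simp: tambara_map_def intro: ring_hom_closed)
  have ch: "\<phi> X \<in> ring_hom (lev R1 X) (lev Q X)" if "finite_gset G X" for X
    using \<phi> that by (simp add: tambara_map_def)
  have c': "\<phi> X (a \<oplus>\<^bsub>lev R1 X\<^esub> b) = \<phi> X a \<oplus>\<^bsub>lev Q X\<^esub> \<phi> X b"
    "\<phi> X (a \<otimes>\<^bsub>lev R1 X\<^esub> b) = \<phi> X a \<otimes>\<^bsub>lev Q X\<^esub> \<phi> X b"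
    if "finite_gset G X" "a \<in> carrier (lev R1 X)" "b \<in> carrier (lev R1 X)" for X a b
    using ring_hom_add[OF ch[OF that(1)] that(2,3)] ring_hom_mult[OF ch[OF that(1)] that(2,3)] by auto
  have cone: "\<phi> X \<one>\<^bsub>lev R1 X\<^esub> = \<one>\<^bsub>lev Q X\<^esub>" if "finite_gset G X" for X
    using ring_hom_one[OF ch[OF that]] .
  have cp: "\<phi> X (res R1 X Y f b) = res Q X Y f (\<phi> Y b)"
    if "f \<in> gmaps G X Y" "b \<in> carrier (lev R1 Y)" for X Y f b
    using \<phi> that by (auto simp: tambara_map_def)
  have cq: "\<phi> Y (tr R1 X Y f a) = tr Q X Y f (\<phi> X a)"
    "\<phi> Y (nm R1 X Y f a) = nm Q X Y f (\<phi> X a)"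
    if "f \<in> gmaps G X Y" "a \<in> carrier (lev R1 X)" for X Y f a
    using \<phi> that by (auto simp: tambara_map_def)
  have dh: "\<psi> X \<in> ring_hom (lev R2 X) (lev Q X)" if "finite_gset G X" for X
    using \<psi> that by (simp add: tambara_map_def)
  have d': "\<psi> X (a \<oplus>\<^bsub>lev R2 X\<^esub> b) = \<psi> X a \<oplus>\<^bsub>lev Q X\<^esub> \<psi> X b"
    "\<psi> X (a \<otimes>\<^bsub>lev R2 X\<^esub> b) = \<psi> X a \<otimes>\<^bsub>lev Q X\<^esub> \<psi> X b"
    if "finite_gset G X" "a \<in> carrier (lev R2 X)" "b \<in> carrier (lev R2 X)" for X a b
    using ring_hom_add[OF dh[OF that(1)] that(2,3)] ring_hom_mult[OF dh[OF that(1)] that(2,3)] by auto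
  have d1: "\<psi> X \<one>\<^bsub>lev R2 X\<^esub> = \<one>\<^bsub>lev Q X\<^esub>" if "finite_gset G X" for X
    using ring_hom_one[OF dh[OF that]] .
  have dp: "\<psi> X (res R2 X Y f b) = res Q X Y f (\<psi> Y b)"
    if "f \<in> gmaps G X Y" "b \<in> carrier (lev R2 Y)" for X Y f b
    using \<psi> that by (auto simp: tambara_map_def)
  have dq: "\<psi> Y (tr R2 X Y f a) = tr Q X Y f (\<psi> X a)"
    "\<psi> Y (nm R2 X Y f a) = nm Q X Y f (\<psi> X a)"
    if "f \<in> gmaps G X Y" "a \<in> carrier (lev R2 X)" for X Y f a
    using \<psi> that by (auto simp: tambara_map_def)
  from \<open>teq X u v\<close> have "teval Q \<phi> \<psi> u = teval Q \<phi> \<psi> v \<and>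
      teval Q \<phi> \<psi> u \<in> carrier (lev Q X) \<and> teval Q \<phi> \<psi> v \<in> carrier (lev Q X)"
  proof (induction rule: teq.induct)
    case (teq_coproduct X1 X2 X j1 j2 u v)
    have "inj_on (\<lambda>a. (res Q X1 X j1 a, res Q X2 X j2 a)) (carrier (lev Q X))"
      using Q.coproduct_lev[OF teq_coproduct.hyps(1)] by (rule bij_betw_imp_inj_on)
    then show ?case
      using teq_coproduct.IH by (auto dest!: inj_onD)
  next
    case (teq_empty X u)
    then show ?case
      using Q.empty_lev[OF teq_gset[OF teq_empty.hyps(1)] teq_empty.hyps(2)] by auto
  next
    case (teq_agree X s)
    then show ?case using ag[of X s] c[of X "\<eta>1 X s"] mem[of X s] by simp
  next
    case (teq_tr_base_change P X Y Z p q f g u)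
    then show ?case using Q.tr_base_change[OF teq_tr_base_change.hyps(1), of "teval Q \<phi> \<psi> u"]
      is_pullbackD[OF teq_tr_base_change.hyps(1)] by (simp add: qc)
  next
    case (teq_nm_base_change P X Y Z p q f g u)
    then show ?case using Q.nm_base_change[OF teq_nm_base_change.hyps(1), of "teval Q \<phi> \<psi> u"]
      is_pullbackD[OF teq_nm_base_change.hyps(1)] by (simp add: qc)
  next
    case (teq_nm_tr A X Y E D h g e g' h' u)
    then show ?case using Q.nm_tr[OF teq_nm_tr.hyps(1), of "teval Q \<phi> \<psi> u"]
      is_exponentialD[OF teq_nm_tr.hyps(1)] by (simp add: qc)
  next
    case (teq_res_comp f X Y g Z u)
    then show ?case using Q.res_comp[of f X Y g Z "teval Q \<phi> \<psi> u"] by (simp add: qc)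
  next
    case (teq_tr_comp f X Y g Z u)
    then show ?case using Q.tr_comp[of f X Y g Z "teval Q \<phi> \<psi> u"] by (simp add: qc)
  next
    case (teq_nm_comp f X Y g Z u)
    then show ?case using Q.nm_comp[of f X Y g Z "teval Q \<phi> \<psi> u"] by (simp add: qc)
  next
    case (teq_add_neg X u)
    have X: "finite_gset G X" using teq_gset[OF teq_add_neg.hyps] .
    show ?case using teq_add_neg.IH abelian_group.l_neg[OF aQ[OF X], of "teval Q \<phi> \<psi> u"]
        abelian_monoid.zero_closed[OF am[OF X]] by simp
  next
    case (teq_distr X u v w)
    interpret r: cring "lev Q X" by (rule Q.cring_lev[OF teq_gset[OF teq_distr.hyps(1)]])
    show ?case using teq_distr.IH by (simp add: r.l_distr)
  next
    case (teq_add_assoc X u v w)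
    interpret r: cring "lev Q X" by (rule Q.cring_lev[OF teq_gset[OF teq_add_assoc.hyps(1)]])
    show ?case using teq_add_assoc.IH by (simp add: r.a_assoc)
  next
    case (teq_add_comm X u v)
    interpret r: cring "lev Q X" by (rule Q.cring_lev[OF teq_gset[OF teq_add_comm.hyps(1)]])
    show ?case using teq_add_comm.IH by (simp add: r.a_comm)
  next
    case (teq_mul_assoc X u v w)
    interpret r: cring "lev Q X" by (rule Q.cring_lev[OF teq_gset[OF teq_mul_assoc.hyps(1)]])
    show ?case using teq_mul_assoc.IH by (simp add: r.m_assoc)
  next
    case (teq_mul_comm X u v)
    interpret r: cring "lev Q X" by (rule Q.cring_lev[OF teq_gset[OF teq_mul_comm.hyps(1)]])
    show ?case using teq_mul_comm.IH by (simp add: r.m_comm)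
  next
    case (teq_add_zero X u)
    interpret r: cring "lev Q X" by (rule Q.cring_lev[OF teq_gset[OF teq_add_zero.hyps(1)]])
    show ?case using teq_add_zero.IH by simp
  next
    case (teq_mul_one X u)
    interpret r: cring "lev Q X" by (rule Q.cring_lev[OF teq_gset[OF teq_mul_one.hyps(1)]])
    show ?case using teq_mul_one.IH by simp
  next
    case (teq_sym X u v) then show ?case by metis
  next
    case (teq_trans X u v w) then show ?case by metis
  qed (simp_all add: c d c' d' cone d1 cp cq dp dq qc qh qone Q.nm_one Q.res_id Q.tr_id Q.nm_id
      teq_gset gmaps_gset abelian_monoid.zero_closed[OF am] abelian_monoid.a_closed[OF am]
      abelian_group.a_inv_closed[OF aQ] monoid.one_closed[OF mo] monoid.m_closed[OF mo])
  then show ?thesis by simp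
qed

lemma copair_tcls:
  assumes "tambara_functor G Q" "tambara_map G R1 Q \<phi>" "tambara_map G R2 Q \<psi>"
    and "\<And>X s. finite_gset G X \<Longrightarrow> s \<in> carrier (lev S X) \<Longrightarrow> \<phi> X (\<eta>1 X s) = \<psi> X (\<eta>2 X s)"
    and "\<And>X s. finite_gset G X \<Longrightarrow> s \<in> carrier (lev S X) \<Longrightarrow> \<eta>1 X s \<in> carrier (lev R1 X)"
    and u: "teq X u u"
  shows "copair Q \<phi> \<psi> X (tcls X u) = teval Q \<phi> \<psi> u"
    "copair Q \<phi> \<psi> X (tcls X u) \<in> carrier (lev Q X)"
proof -
  have "teq X u (SOME v. v \<in> tcls X u)"
    using someI[of "\<lambda>v. v \<in> tcls X u" u] tcls_self[OF u] by (simp add: tcls_def)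
  then show 1: "copair Q \<phi> \<psi> X (tcls X u) = teval Q \<phi> \<psi> u"
    using teval_teq[OF assms(1-5)] by (simp add: copair_def)
  then show "copair Q \<phi> \<psi> X (tcls X u) \<in> carrier (lev Q X)"
    using teval_teq[OF assms(1-5) u] by simp
qed

theorem coprod_universal:
  assumes alg: "tambara_algebra G S R1 \<eta>1" "tambara_algebra G S R2 \<eta>2"
    and Q: "tambara_functor G Q" and \<phi>: "tambara_map G R1 Q \<phi>" and \<psi>: "tambara_map G R2 Q \<psi>"
    and ag: "\<And>X s. finite_gset G X \<Longrightarrow> s \<in> carrier (lev S X) \<Longrightarrow> \<phi> X (\<eta>1 X s) = \<psi> X (\<eta>2 X s)"
  shows "tambara_map G coprod Q (copair Q \<phi> \<psi>)"
    and "finite_gset G X \<Longrightarrow> a \<in> carrier (lev R1 X) \<Longrightarrow> copair Q \<phi> \<psi> X (coprod_inl X a) = \<phi> X a"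
    and "finite_gset G X \<Longrightarrow> b \<in> carrier (lev R2 X) \<Longrightarrow> copair Q \<phi> \<psi> X (coprod_inr X b) = \<psi> X b"
    and "\<lbrakk>tambara_map G coprod Q \<theta>;
      \<And>X a. finite_gset G X \<Longrightarrow> a \<in> carrier (lev R1 X) \<Longrightarrow> \<theta> X (coprod_inl X a) = \<phi> X a;
      \<And>X b. finite_gset G X \<Longrightarrow> b \<in> carrier (lev R2 X) \<Longrightarrow> \<theta> X (coprod_inr X b) = \<psi> X b;
      c \<in> carrier (lev coprod X)\<rbrakk> \<Longrightarrow> \<theta> X c = copair Q \<phi> \<psi> X c"
proof -
  have mem: "\<eta>1 X s \<in> carrier (lev R1 X)" if "finite_gset G X" "s \<in> carrier (lev S X)" for X s
    using alg(1) that ring_hom_closed[of "\<eta>1 X" "lev S X" "lev R1 X" s]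
    by (simp add: tambara_algebra_def tambara_map_def)
  note cc = copair_tcls(1)[OF Q \<phi> \<psi> ag mem]
  have tc: "teval Q \<phi> \<psi> u \<in> carrier (lev Q X)" if "teq X u u" for X u
    using teval_teq[OF Q \<phi> \<psi> ag mem that] by simp
  show "tambara_map G coprod Q (copair Q \<phi> \<psi>)"
    unfolding tambara_map_def
  proof (intro conjI allI impI ballI)
    fix X :: "'g gset" assume X: "finite_gset G X"
    show "copair Q \<phi> \<psi> X \<in> ring_hom (lev coprod X) (lev Q X)"
      by (rule ring_hom_memI; (elim coprod_carrierE)?; simp add: cc tc coprod_simps X)
  qed (elim coprod_carrierE, simp add: cc coprod_simps)+
  show "copair Q \<phi> \<psi> X (coprod_inl X a) = \<phi> X a" if "finite_gset G X" "a \<in> carrier (lev R1 X)"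
    using that by (simp add: coprod_inl_def cc teq_wf_L)
  show "copair Q \<phi> \<psi> X (coprod_inr X b) = \<psi> X b" if "finite_gset G X" "b \<in> carrier (lev R2 X)"
    using that by (simp add: coprod_inr_def cc teq_wf_R)
  assume \<theta>: "tambara_map G coprod Q \<theta>"
    and l: "\<And>X a. finite_gset G X \<Longrightarrow> a \<in> carrier (lev R1 X) \<Longrightarrow> \<theta> X (coprod_inl X a) = \<phi> X a"
    and r: "\<And>X b. finite_gset G X \<Longrightarrow> b \<in> carrier (lev R2 X) \<Longrightarrow> \<theta> X (coprod_inr X b) = \<psi> X b"
    and c: "c \<in> carrier (lev coprod X)"
  have h: "\<theta> X \<in> ring_hom (lev coprod X) (lev Q X)" if "finite_gset G X" for X
    using \<theta> that by (simp add: tambara_map_def)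
  interpret Q: tambara_functor G Q by (rule Q)
  have zero: "\<theta> X (tcls X (TZero X)) = \<zero>\<^bsub>lev Q X\<^esub>" if X: "finite_gset G X" for X
    using hom_zero[OF coprod_abelian Q.abelian_lev ring_hom_add_hom[OF h]] X by (simp add: coprod_zero)
  have one: "\<theta> X (tcls X (TOne X)) = \<one>\<^bsub>lev Q X\<^esub>" if X: "finite_gset G X" for X
    using ring_hom_one[OF h[OF X]] by (simp add: coprod_one)
  have add: "\<theta> X (tcls X (TAdd X u v)) = \<theta> X (tcls X u) \<oplus>\<^bsub>lev Q X\<^esub> \<theta> X (tcls X v)"
    if "teq X u u" "teq X v v" for X u v
    using ring_hom_add[OF h[OF teq_gset[OF that(1)]] coprod_carrierI coprod_carrierI] that
    by (simp add: coprod_add)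
  have mul: "\<theta> X (tcls X (TMul X u v)) = \<theta> X (tcls X u) \<otimes>\<^bsub>lev Q X\<^esub> \<theta> X (tcls X v)"
    if "teq X u u" "teq X v v" for X u v
    using ring_hom_mult[OF h[OF teq_gset[OF that(1)]] coprod_carrierI coprod_carrierI] that
    by (simp add: coprod_mult)
  have neg: "\<theta> X (tcls X (TNeg X u)) = \<ominus>\<^bsub>lev Q X\<^esub> \<theta> X (tcls X u)" if u: "teq X u u" for X u
  proof -
    note X = teq_gset[OF u]
    have cl: "\<theta> X (tcls X v) \<in> carrier (lev Q X)" if "teq X v v" for v
      using ring_hom_closed[OF h[OF X] coprod_carrierI[OF that]] .
    have "\<theta> X (tcls X (TNeg X u)) \<oplus>\<^bsub>lev Q X\<^esub> \<theta> X (tcls X u) = \<zero>\<^bsub>lev Q X\<^esub>"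
      using add[OF teq_wf_ops(3)[OF u] u] tcls_eqI[OF teq_add_neg[OF u]] zero[OF X] by simp
    then show ?thesis
      using abelian_group.minus_equality[OF Q.abelian_lev[OF X]] cl u teq_wf_ops(3)[OF u] by metis
  qed
  have res: "\<theta> X (tcls X (TRes X Y f v)) = res Q X Y f (\<theta> Y (tcls Y v))"
    if "f \<in> gmaps G X Y" "teq Y v v" for X Y f v
  proof -
    have "\<theta> X (res coprod X Y f (tcls Y v)) = res Q X Y f (\<theta> Y (tcls Y v))"
      using \<theta> that coprod_carrierI[OF that(2)] unfolding tambara_map_def by blast
    then show ?thesis using coprod_res[OF that] by simp
  qed
  have trn: "\<theta> Y (tcls Y (TTr X Y f u)) = tr Q X Y f (\<theta> X (tcls X u))"
    "\<theta> Y (tcls Y (TNm X Y f u)) = nm Q X Y f (\<theta> X (tcls X u))"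
    if "f \<in> gmaps G X Y" "teq X u u" for X Y f u
  proof -
    have "\<theta> Y (tr coprod X Y f (tcls X u)) = tr Q X Y f (\<theta> X (tcls X u))"
      "\<theta> Y (nm coprod X Y f (tcls X u)) = nm Q X Y f (\<theta> X (tcls X u))"
      using \<theta> that coprod_carrierI[OF that(2)] unfolding tambara_map_def by blast+
    then show "\<theta> Y (tcls Y (TTr X Y f u)) = tr Q X Y f (\<theta> X (tcls X u))"
      "\<theta> Y (tcls Y (TNm X Y f u)) = nm Q X Y f (\<theta> X (tcls X u))"
      using coprod_tr[OF that] coprod_nm[OF that] by simp_all
  qed
  interpret R1: tambara_functor G R1 using alg(1) by (simp add: tambara_algebra_def)
  interpret R2: tambara_functor G R2 using alg(2) by (simp add: tambara_algebra_def)
  have lL: "\<theta> X (tcls X (TL X a)) = \<phi> X a" if "finite_gset G X" "a \<in> carrier (lev R1 X)" for X a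
    using l[OF that] by (simp add: coprod_inl_def)
  have rR: "\<theta> X (tcls X (TR X b)) = \<psi> X b" if "finite_gset G X" "b \<in> carrier (lev R2 X)" for X b
    using r[OF that] by (simp add: coprod_inr_def)
  have closed1: "\<lbrakk>finite_gset G X; a \<in> carrier (lev R1 X); b \<in> carrier (lev R1 X)\<rbrakk> \<Longrightarrow>
       a \<oplus>\<^bsub>lev R1 X\<^esub> b \<in> carrier (lev R1 X) \<and> a \<otimes>\<^bsub>lev R1 X\<^esub> b \<in> carrier (lev R1 X)"
     "finite_gset G X \<Longrightarrow> \<one>\<^bsub>lev R1 X\<^esub> \<in> carrier (lev R1 X)" for X a b
    using cring.cring_simprules(1,5,6)[OF R1.cring_lev[of X]] by auto
  have closed2: "\<lbrakk>finite_gset G X; a \<in> carrier (lev R2 X); b \<in> carrier (lev R2 X)\<rbrakk> \<Longrightarrow>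
       a \<oplus>\<^bsub>lev R2 X\<^esub> b \<in> carrier (lev R2 X) \<and> a \<otimes>\<^bsub>lev R2 X\<^esub> b \<in> carrier (lev R2 X)"
     "finite_gset G X \<Longrightarrow> \<one>\<^bsub>lev R2 X\<^esub> \<in> carrier (lev R2 X)" for X a b
    using cring.cring_simprules(1,5,6)[OF R2.cring_lev[of X]] by auto
  have closed3: "res R1 X Y f b \<in> carrier (lev R1 X)" if "f \<in> gmaps G X Y" "b \<in> carrier (lev R1 Y)" for X Y f b
    using ring_hom_closed[OF R1.res_ring_hom[OF that(1)] that(2)] .
  have closed4: "tr R1 X Y f a \<in> carrier (lev R1 Y)" "nm R1 X Y f a \<in> carrier (lev R1 Y)"
    if "f \<in> gmaps G X Y" "a \<in> carrier (lev R1 X)" for X Y f a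
    using hom_in_carrier[OF R1.tr_add_hom[OF that(1)]] hom_in_carrier[OF R1.nm_hom[OF that(1)]] that(2)
    by simp_all
  have closed5: "res R2 X Y f b \<in> carrier (lev R2 X)" if "f \<in> gmaps G X Y" "b \<in> carrier (lev R2 Y)" for X Y f b
    using ring_hom_closed[OF R2.res_ring_hom[OF that(1)] that(2)] .
  have closed6: "tr R2 X Y f a \<in> carrier (lev R2 Y)" "nm R2 X Y f a \<in> carrier (lev R2 Y)"
    if "f \<in> gmaps G X Y" "a \<in> carrier (lev R2 X)" for X Y f a
    using hom_in_carrier[OF R2.tr_add_hom[OF that(1)]] hom_in_carrier[OF R2.nm_hom[OF that(1)]] that(2)
    by simp_all
  have main: "\<theta> X (tcls X u) = teval Q \<phi> \<psi> u \<and> \<theta> X (tcls X v) = teval Q \<phi> \<psi> v"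
    if "teq X u v" for X u v
    using that
  proof (induction rule: teq.induct)
    case (teq_coproduct X1 X2 X j1 j2 u v) then show ?case by simp
  next
    case (teq_agree X s) then show ?case
      using lL[of X "\<eta>1 X s"] mem[of X s] coprod_agree[of X s] ag[of X s]
      by (simp add: coprod_inl_def coprod_inr_def)
  next
    case (teq_tr_base_change P X Y Z p q f g u)
    note d = is_pullbackD[OF teq_tr_base_change.hyps(1)]
    show ?case using teq_tr_base_change d by (simp add: res trn teq_wf_ops)
  next
    case (teq_nm_base_change P X Y Z p q f g u)
    note d = is_pullbackD[OF teq_nm_base_change.hyps(1)]
    show ?case using teq_nm_base_change d by (simp add: res trn teq_wf_ops)
  next
    case (teq_nm_tr A X Y E D h g e g' h' u)
    note d = is_exponentialD[OF teq_nm_tr.hyps(1)]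
    show ?case using teq_nm_tr d by (simp add: res trn teq_wf_ops)
  next
    case (teq_cong_neg X u v) then show ?case using teq_refl[OF teq_cong_neg.hyps(1)] by (simp add: neg)
  next
    case (teq_cong_add X u v u' v') then show ?case
      using teq_refl[OF teq_cong_add.hyps(1)] teq_refl[OF teq_cong_add.hyps(2)] by (simp add: add)
  next
    case (teq_cong_mul X u v u' v') then show ?case
      using teq_refl[OF teq_cong_mul.hyps(1)] teq_refl[OF teq_cong_mul.hyps(2)] by (simp add: mul)
  next
    case (teq_cong_res f X Y u v) then show ?case using teq_refl[OF teq_cong_res.hyps(2)] by (simp add: res)
  next
    case (teq_cong_tr f X Y u v) then show ?case using teq_refl[OF teq_cong_tr.hyps(2)] by (simp add: trn)
  next
    case (teq_cong_nm f X Y u v) then show ?case using teq_refl[OF teq_cong_nm.hyps(2)] by (simp add: trn)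
  qed (simp_all add: zero one add mul neg res trn lL rR closed1 closed2 closed3 closed4 closed5 closed6
      gid_gmaps gcomp_gmaps teq_gset teq_wf_ops gmaps_gset teq_wf_zero teq_wf_one teq_wf_L teq_wf_R)
  obtain u where "c = tcls X u" "teq X u u" using c by (rule coprod_carrierE)
  then show "\<theta> X c = copair Q \<phi> \<psi> X c" using main cc by simp
qed

end

section \<open>Genuine Kaehler differentials\<close>

definition box_square ::
  "('g, 'k) monoid_scheme \<Rightarrow> ('g, 's) tambara \<Rightarrow> ('g, 'r) tambara \<Rightarrow> ('g gset \<Rightarrow> 's \<Rightarrow> 'r) \<Rightarrow>
   ('g, ('g, 'r, 'r) texp set) tambara" where
  "box_square G S R \<eta> = coprod G S R \<eta> R \<eta>"

definition mult_map ::
  "('g, 'r) tambara \<Rightarrow> 'g gset \<Rightarrow> ('g, 'r, 'r) texp set \<Rightarrow> 'r" where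
  "mult_map R = copair R (\<lambda>X a. a) (\<lambda>X a. a)"

text \<open>The kernel \<open>I\<close>, as an \<open>R\<close>-module via the left unit.\<close>

definition aug_ideal ::
  "('g, 'k) monoid_scheme \<Rightarrow> ('g, 's) tambara \<Rightarrow> ('g, 'r) tambara \<Rightarrow> ('g gset \<Rightarrow> 's \<Rightarrow> 'r) \<Rightarrow>
   ('g, 'r, ('g, 'r, 'r) texp set) gmodule" where
  "aug_ideal G S R \<eta> =
    (let P = box_square G S R \<eta>
     in \<lparr>mlev = \<lambda>X. \<lparr>carrier = a_kernel (lev P X) (lev R X) (mult_map R X),
                     mult = mult (lev P X), one = one (lev P X),
                     zero = zero (lev P X), add = add (lev P X),
                     smult = \<lambda>a x. coprod_inl G S R \<eta> R \<eta> X a \<otimes>\<^bsub>lev P X\<^esub> x\<rparr>,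
         mres = res P, mtr = tr P\<rparr>)"

definition is_submodule ::
  "('g, 'k) monoid_scheme \<Rightarrow> ('g, 'r) tambara \<Rightarrow> ('g, 'r, 'm) gmodule \<Rightarrow> ('g gset \<Rightarrow> 'm set) \<Rightarrow> bool" where
  "is_submodule G R M N \<longleftrightarrow>
     (\<forall>X. finite_gset G X \<longrightarrow> submodule (N X) (lev R X) (mlev M X)) \<and>
     (\<forall>X Y. \<forall>f\<in>gmaps G X Y. mres M X Y f ` N Y \<subseteq> N X \<and> mtr M X Y f ` N X \<subseteq> N Y)"

definition gen_submodule ::
  "('g, 'k) monoid_scheme \<Rightarrow> ('g, 'r) tambara \<Rightarrow> ('g, 'r, 'm) gmodule \<Rightarrow> ('g gset \<Rightarrow> 'm set) \<Rightarrow>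
   'g gset \<Rightarrow> 'm set" where
  "gen_submodule G R M B X =
     \<Inter> {N X | N. is_submodule G R M N \<and> (\<forall>Y. finite_gset G Y \<longrightarrow> B Y \<subseteq> N Y)}"

definition quot_module ::
  "('g, 'r, 'm) gmodule \<Rightarrow> ('g gset \<Rightarrow> 'm set) \<Rightarrow> ('g, 'r, 'm set) gmodule" where
  "quot_module M N =
    \<lparr>mlev = \<lambda>X. \<lparr>carrier = a_rcosets\<^bsub>mlev M X\<^esub> (N X),
                 mult = (\<lambda>c c'. undefined), one = undefined,
                 zero = N X, add = set_add (mlev M X),
                 smult = \<lambda>a c. \<Union>m\<in>c. N X +>\<^bsub>mlev M X\<^esub> (a \<odot>\<^bsub>mlev M X\<^esub> m)\<rparr>,
     mres = \<lambda>X Y f c. \<Union>m\<in>c. N X +>\<^bsub>mlev M X\<^esub> mres M X Y f m,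
     mtr = \<lambda>X Y f c. \<Union>m\<in>c. N Y +>\<^bsub>mlev M Y\<^esub> mtr M X Y f m\<rparr>"

text \<open>The norms \<open>N\<^sub>f(x)\<close> of \<open>x \<in> I(X)\<close> for maps \<open>f\<close> all of whose fibres have more than one element.\<close>

definition big_norms ::
  "('g, 'k) monoid_scheme \<Rightarrow> ('g, 's) tambara \<Rightarrow> ('g, 'r) tambara \<Rightarrow> ('g gset \<Rightarrow> 's \<Rightarrow> 'r) \<Rightarrow>
   'g gset \<Rightarrow> ('g, 'r, 'r) texp set set" where
  "big_norms G S R \<eta> Y =
     {nm (box_square G S R \<eta>) X Y f x | X f x.
        f \<in> gmaps G X Y \<and> (\<forall>y\<in>pts Y. 1 < card {z \<in> pts X. f z = y}) \<and>
        x \<in> carrier (mlev (aug_ideal G S R \<eta>) X)}"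

definition genuine_Kahler ::
  "('g, 'k) monoid_scheme \<Rightarrow> ('g, 's) tambara \<Rightarrow> ('g, 'r) tambara \<Rightarrow> ('g gset \<Rightarrow> 's \<Rightarrow> 'r) \<Rightarrow>
   ('g, 'r, ('g, 'r, 'r) texp set set) gmodule" where
  "genuine_Kahler G S R \<eta> =
     quot_module (aug_ideal G S R \<eta>)
       (gen_submodule G R (aug_ideal G S R \<eta>) (big_norms G S R \<eta>))"

end

theory Submission
  imports Defs
begin

text \<open>
  Write \<open>P = R \<box>\<^sub>S R\<close>, with units \<open>left, right : R \<rightarrow> P\<close>, multiplication \<open>\<mu> : P \<rightarrow> R\<close> and augmentation
  ideal \<open>I = ker \<mu>\<close>, and put \<open>diff a = right a - left a \<in> I\<close>.  The class of \<open>diff a\<close> in \<open>\<Omega> = I / I\<^sup>>\<^sup>1\<close> is the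
  universal genuine derivation, and the isomorphism sends a module map \<open>\<phi> : \<Omega> \<rightarrow> M\<close> to its composite
  with this derivation.  Everything rests on the derivative of a norm.  For \<open>f : X \<rightarrow> Y\<close> let
  \<open>cofactor a = N\<^bsub>d\<^sub>2\<^esub> R\<^bsub>d\<^sub>1\<^esub> a\<close>, where \<open>d\<^sub>1\<close>, \<open>d\<^sub>2\<close> are the projections of the complement of the diagonal in
  \<open>X \<times>\<^sub>Y X\<close>.  For the projection \<open>G/H \<rightarrow> G/K\<close> this is the coefficient in the definition of a genuine
  derivation (\<open>conorm_cofactor\<close>).  The exponential formula for the fold map \<open>X \<squnion> X \<rightarrow> X\<close> gives
  \<^item> \<open>N\<^sub>f (a + x) = N\<^sub>f a + T\<^sub>f (cofactor a \<cdot> x) + T (N x \<cdot> N a)\<close>, where in the last term the norm of \<open>x\<close> (restricted)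
    is taken along a map all of whose fibres have more than one element (\<open>nm_add\<close>).

  Three consequences make up the theorem.

  First, the composite of a module map with the class of \<open>diff\<close> is a genuine derivation (\<open>univ_comp_Der\<close>).  Indeed
  \<open>right a = left a + diff a\<close>, so the formula with \<open>x = diff a\<close> is the condition on norms up to a transfer of a
  multiple of a norm with large fibres, and the Leibniz rule holds up to \<open>diff a \<cdot> diff b\<close>, which is the norm of
  \<open>(diff a, diff b)\<close> along the fold map.

  Second, \<open>I\<close> is generated as a module by the elements \<open>diff a\<close> and the norms with large fibres, so a module map is
  determined by its composite (\<open>univ_comp_inj\<close>).  The elements \<open>left a + x\<close> of \<open>P\<close>, with \<open>x\<close> in the submodule generated by
  these, form a sub-Tambara functor that contains both copies of \<open>R\<close>; for norms this is again the formula
  (\<open>I_generated\<close>).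

  Third, every genuine derivation \<open>d : R \<rightarrow> M\<close> arises (\<open>Der_factors\<close>).  The square-zero extension \<open>R \<oplus> M\<close>
  with the norms \<open>N\<^sub>f (a, m) = (N\<^sub>f a, T\<^sub>f (cofactor a \<cdot> m))\<close> is a Tambara functor (\<open>square_zero_tambara\<close>), because the
  cofactor satisfies a chain rule, base change and an exponential formula.  The maps
  \<open>a \<mapsto> (a, 0)\<close> and \<open>a \<mapsto> (a, d a)\<close> are maps of Tambara functors \<open>R \<rightarrow> R \<oplus> M\<close> that agree on \<open>S\<close>; for the norms of the
  second it is enough to look at projections of orbits, since all other norms are built from them
  (\<open>tambara_map_orbitsI\<close>).  The induced map \<open>P \<rightarrow> R \<oplus> M\<close> sends \<open>I\<close> to \<open>M\<close> and \<open>diff a\<close> to \<open>d a\<close>, and it kills the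
  norms with large fibres, because for such an \<open>f\<close> the cofactor of \<open>0\<close> is \<open>0\<close>.
\<close>

section \<open>Finite G-sets\<close>

lemma gmapsI:
  assumes "finite_gset G X" "finite_gset G Y"
    and "\<And>x. x \<in> pts X \<Longrightarrow> f x \<in> pts Y" "f \<in> extensional (pts X)"
    and "\<And>g x. g \<in> carrier G \<Longrightarrow> x \<in> pts X \<Longrightarrow> f (act X g x) = act Y g (f x)"
  shows "f \<in> gmaps G X Y"
  using assms by (auto simp: gmaps_def PiE_def)

lemma gmapsD:
  assumes "f \<in> gmaps G X Y"
  shows "x \<in> pts X \<Longrightarrow> f x \<in> pts Y" "f \<in> extensional (pts X)"
    "g \<in> carrier G \<Longrightarrow> x \<in> pts X \<Longrightarrow> f (act X g x) = act Y g (f x)"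
  using assms by (auto simp: gmaps_def PiE_def)

lemma gmaps_eqI:
  assumes "f \<in> gmaps G X Y" "f' \<in> gmaps G X Y'" "\<And>x. x \<in> pts X \<Longrightarrow> f x = f' x"
  shows "f = f'"
  using assms gmapsD(2) by (metis extensionalityI)

lemma gid_apply [simp]: "x \<in> pts X \<Longrightarrow> gid X x = x"
  by (simp add: gid_def)

lemma gcomp_apply [simp]: "x \<in> pts X \<Longrightarrow> gcomp X g f x = g (f x)"
  by (simp add: gcomp_def compose_def)

lemma gcomp_assoc:
  "f \<in> gmaps G X Y \<Longrightarrow> gcomp X h (gcomp X g f) = gcomp X (gcomp Y h g) f"
  by (auto simp: gcomp_def compose_def gmapsD(1) intro!: restrict_ext)


lemma act_inj:
  assumes "finite_gset G X" "g \<in> carrier G" "x \<in> pts X" "y \<in> pts X" "act X g x = act X g y"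
  shows "x = y"
proof -
  interpret group_action G "pts X" "act X" using assms(1) by (simp add: finite_gset_def)
  show ?thesis using inj_prop[OF assms(2)] assms(3-) by (auto simp: inj_on_def)
qed

text \<open>
  The \<open>G\<close>-sets needed below (parts of products, disjoint unions, sets of subsets of fibres) are written
  with ordinary pairs, sums and sets and then transported to the universe of points; \<open>b\<close> translates
  back.
\<close>

lemma realize_gset:
  fixes G :: "('g, 'k) monoid_scheme" and P :: "'u set" and a :: "'g \<Rightarrow> 'u \<Rightarrow> 'u"
  assumes "group G" "finite P"
    and cl: "\<And>g x. g \<in> carrier G \<Longrightarrow> x \<in> P \<Longrightarrow> a g x \<in> P"
    and one: "\<And>x. x \<in> P \<Longrightarrow> a \<one>\<^bsub>G\<^esub> x = x"
    and mult: "\<And>g h x. \<lbrakk>g \<in> carrier G; h \<in> carrier G; x \<in> P\<rbrakk> \<Longrightarrow> a (g \<otimes>\<^bsub>G\<^esub> h) x = a g (a h x)"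
  obtains W :: "'g gset" and b where "finite_gset G W" "bij_betw b (pts W) P"
    "\<And>g w. g \<in> carrier G \<Longrightarrow> w \<in> pts W \<Longrightarrow> b (act W g w) = a g (b w)"
proof -
  define X where "X = \<lparr>pts = P, act = \<lambda>g. \<lambda>x\<in>P. a g x\<rparr>"
  have X: "finite_gset G X"
    by (rule finite_gsetI) (auto simp: X_def assms)
  obtain W :: "'g gset" and f where f: "f \<in> gmaps G X W" "bij_betw f (pts X) (pts W)"
    using finite_gset_in_universe[OF X] by blast
  define b where "b = inv_into (pts X) f"
  have bb: "bij_betw b (pts W) (pts X)" unfolding b_def by (rule bij_betw_inv_into[OF f(2)])
  have fb: "f (b w) = w" "b w \<in> pts X" if "w \<in> pts W" for w
    using f(2) that bij_betwE[OF bb] by (auto simp: b_def bij_betw_def f_inv_into_f)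
  have W: "finite_gset G W" by (rule gmaps_gset(2)[OF f(1)])
  have "b (act W g w) = a g (b w)" if "g \<in> carrier G" "w \<in> pts W" for g w
  proof -
    have "f (act X g (b w)) = act W g w" using gmapsD(3)[OF f(1) that(1) fb(2)[OF that(2)]] fb that by simp
    then have "b (act W g w) = act X g (b w)"
      using f(2) finite_gsetD(3)[OF X that(1) fb(2)[OF that(2)]]
      by (metis b_def bij_betw_inv_into_left)
    then show ?thesis using fb[OF that(2)] by (simp add: X_def)
  qed
  then show thesis using that W bb by (simp add: X_def)
qed

text \<open>
  Parts of products are used only through their two projections: being jointly a bijection onto \<open>B\<close>
  determines them up to isomorphism (\<open>joint_iso\<close> below), and pullbacks are the case where \<open>B\<close> is the set
  of pairs with equal images.
\<close>

lemma pair_gset: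
  fixes G :: "('g, 'k) monoid_scheme" and X Y :: "'g gset"
  assumes X: "finite_gset G X" and Y: "finite_gset G Y" and B: "B \<subseteq> pts X \<times> pts Y"
    and inv: "\<And>g x y. g \<in> carrier G \<Longrightarrow> (x, y) \<in> B \<Longrightarrow> (act X g x, act Y g y) \<in> B"
  obtains W :: "'g gset" and p q where "p \<in> gmaps G W X" "q \<in> gmaps G W Y"
    "bij_betw (\<lambda>w. (p w, q w)) (pts W) B"
proof -
  note D = finite_gsetD[OF X] finite_gsetD[OF Y]
  have fB: "finite B" using B D(2,7) finite_subset by blast
  obtain W :: "'g gset" and b where W: "finite_gset G W" "bij_betw b (pts W) B"
    "\<And>g w. g \<in> carrier G \<Longrightarrow> w \<in> pts W \<Longrightarrow> b (act W g w) = (act X g (fst (b w)), act Y g (snd (b w)))"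
    by (rule realize_gset[of G B "\<lambda>g p. (act X g (fst p), act Y g (snd p))", OF D(1) fB])
      (use B inv D in auto)
  have b: "fst (b w) \<in> pts X" "snd (b w) \<in> pts Y" if "w \<in> pts W" for w
    using bij_betwE[OF W(2)] that B by (auto dest!: bspec subsetD)
  have aW: "act W g w \<in> pts W" if "g \<in> carrier G" "w \<in> pts W" for g w
    by (rule finite_gsetD(3)[OF W(1) that])
  show thesis
  proof (rule that)
    show "restrict (fst \<circ> b) (pts W) \<in> gmaps G W X"
      by (rule gmapsI) (use X W b aW in auto)
    show "restrict (snd \<circ> b) (pts W) \<in> gmaps G W Y"
      by (rule gmapsI) (use Y W b aW in auto)
    show "bij_betw (\<lambda>w. (restrict (fst \<circ> b) (pts W) w, restrict (snd \<circ> b) (pts W) w)) (pts W) B"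
      using W(2) by (rule bij_betw_cong[THEN iffD1, rotated]) auto
  qed
qed

lemma pullback_exists:
  fixes X Y Z :: "'g gset"
  assumes f: "f \<in> gmaps G X Z" and g: "g \<in> gmaps G Y Z"
  obtains P p q where "is_pullback G P X Y Z p q f g"
proof -
  obtain W :: "'g gset" and p q where "p \<in> gmaps G W X" "q \<in> gmaps G W Y"
    "bij_betw (\<lambda>w. (p w, q w)) (pts W) {(x, y). x \<in> pts X \<and> y \<in> pts Y \<and> f x = g y}"
    by (rule pair_gset[of G X Y "{(x, y). x \<in> pts X \<and> y \<in> pts Y \<and> f x = g y}",
          OF gmaps_gset(1)[OF f] gmaps_gset(1)[OF g]])
      (auto simp: gmapsD[OF f] gmapsD[OF g] finite_gsetD(3)[OF gmaps_gset(1)[OF f]]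
         finite_gsetD(3)[OF gmaps_gset(1)[OF g]])
  then show thesis using that f g by (auto simp: is_pullback_def)
qed


lemma sub_gset:
  fixes G :: "('g, 'k) monoid_scheme" and X :: "'g gset"
  assumes X: "finite_gset G X" and B: "B \<subseteq> pts X"
    and inv: "\<And>g x. g \<in> carrier G \<Longrightarrow> x \<in> B \<Longrightarrow> act X g x \<in> B"
  obtains W :: "'g gset" and j where "j \<in> gmaps G W X" "inj_on j (pts W)" "j ` pts W = B"
proof -
  note D = finite_gsetD[OF X]
  have fB: "finite B" using B D(2) finite_subset by blast
  obtain W :: "'g gset" and b where W: "finite_gset G W" "bij_betw b (pts W) B"
    "\<And>g w. g \<in> carrier G \<Longrightarrow> w \<in> pts W \<Longrightarrow> b (act W g w) = act X g (b w)"
    by (rule realize_gset[of G B "act X", OF D(1) fB]) (use B inv D in auto)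
  have "restrict b (pts W) \<in> gmaps G W X"
    by (rule gmapsI) (use X W B bij_betwE[OF W(2)] finite_gsetD(3)[OF W(1)] in auto)
  moreover have "inj_on (restrict b (pts W)) (pts W)" "restrict b (pts W) ` pts W = B"
    using W(2) by (auto simp: bij_betw_def)
  ultimately show thesis by (rule that)
qed

lemma act_complement:
  assumes j: "j \<in> gmaps G W X" and "g \<in> carrier G" "x \<in> pts X" "x \<notin> j ` pts W"
  shows "act X g x \<notin> j ` pts W"
proof
  note W = gmaps_gset(1)[OF j] and X = gmaps_gset(2)[OF j]
  interpret group G by (rule finite_gsetD(1)[OF X])
  assume "act X g x \<in> j ` pts W"
  then obtain w where w: "w \<in> pts W" "act X g x = j w" by blast
  have ig: "inv\<^bsub>G\<^esub> g \<in> carrier G" using assms(2) by simp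
  have "act X (inv\<^bsub>G\<^esub> g \<otimes>\<^bsub>G\<^esub> g) x = act X (inv\<^bsub>G\<^esub> g) (act X g x)"
    by (rule finite_gsetD(5)[OF X ig assms(2,3)])
  then have "x = act X (inv\<^bsub>G\<^esub> g) (j w)" using w assms finite_gsetD(4)[OF X] by simp
  also have "\<dots> = j (act W (inv\<^bsub>G\<^esub> g) w)" using gmapsD(3)[OF j ig w(1)] by simp
  finally show False using finite_gsetD(3)[OF W ig w(1)] assms(4) by blast
qed

lemma complement_coproduct:
  fixes Z Y :: "'g gset"
  assumes m: "m \<in> gmaps G Z Y" and inj: "inj_on m (pts Z)"
  obtains W w where "is_coproduct G Z W Y m w" "card (pts W) + card (pts Z) = card (pts Y)"
proof -
  note Y = gmaps_gset(2)[OF m]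
  obtain W :: "'g gset" and w where w: "w \<in> gmaps G W Y" "inj_on w (pts W)" "w ` pts W = pts Y - m ` pts Z"
    by (rule sub_gset[OF Y, of "pts Y - m ` pts Z"])
      (use act_complement[OF m] finite_gsetD(3)[OF Y] in auto)
  have "is_coproduct G Z W Y m w"
    using m w inj gmapsD(1)[OF m] by (auto simp: is_coproduct_def)
  moreover have "card (pts W) + card (pts Z) = card (pts Y)"
  proof -
    have "card (pts W) = card (pts Y - m ` pts Z)" "card (pts Z) = card (m ` pts Z)"
      using w inj card_image by metis+
    moreover have "card (m ` pts Z) \<le> card (pts Y)" "m ` pts Z \<subseteq> pts Y"
      using gmapsD(1)[OF m] finite_gsetD(2)[OF Y] by (auto intro!: card_mono)
    ultimately show ?thesis
      using finite_gsetD(2)[OF Y] by (simp add: card_Diff_subset finite_subset)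
  qed
  ultimately show thesis by (rule that)
qed

lemma coproduct_exists:
  fixes X Y :: "'g gset"
  assumes X: "finite_gset G X" and Y: "finite_gset G Y"
  obtains Z i j where "is_coproduct G X Y Z i j"
proof -
  note D = finite_gsetD[OF X] finite_gsetD[OF Y]
  define a where "a g = map_sum (act X g) (act Y g)" for g
  obtain Z :: "'g gset" and b where Z: "finite_gset G Z" "bij_betw b (pts Z) (pts X <+> pts Y)"
    "\<And>g w. g \<in> carrier G \<Longrightarrow> w \<in> pts Z \<Longrightarrow> b (act Z g w) = a g (b w)"
    by (rule realize_gset[of G "pts X <+> pts Y" a]) (use D in \<open>auto simp: a_def\<close>)
  define b' where "b' = inv_into (pts Z) b"
  have b': "b' u \<in> pts Z" "b (b' u) = u" if "u \<in> pts X <+> pts Y" for u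
    using Z(2) that by (auto simp: b'_def bij_betw_def inv_into_into f_inv_into_f)
  have bb': "b' (b w) = w" if "w \<in> pts Z" for w
    using Z(2) that by (auto simp: b'_def bij_betw_def)
  have eq: "b' (a g u) = act Z g (b' u)" if "u \<in> pts X <+> pts Y" "g \<in> carrier G" for g u
    using Z(3)[OF that(2) b'(1)[OF that(1)]] b'[OF that(1)] bb'[OF finite_gsetD(3)[OF Z(1) that(2) b'(1)[OF that(1)]]]
    by simp
  have inj: "u = v" if "b' u = b' v" "u \<in> pts X <+> pts Y" "v \<in> pts X <+> pts Y" for u v
    using that b'(2) by metis
  define i where "i = restrict (\<lambda>x. b' (Inl x)) (pts X)"
  define j where "j = restrict (\<lambda>x. b' (Inr x)) (pts Y)"
  have i: "i \<in> gmaps G X Z"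
  proof (rule gmapsI[OF X Z(1)])
    fix g x assume g: "g \<in> carrier G" "x \<in> pts X"
    show "i (act X g x) = act Z g (i x)" using eq[OF InlI, OF g(2,1)] g D(3) by (simp add: i_def a_def)
  qed (auto simp: i_def b' InlI)
  have j: "j \<in> gmaps G Y Z"
  proof (rule gmapsI[OF Y Z(1)])
    fix g x assume g: "g \<in> carrier G" "x \<in> pts Y"
    show "j (act Y g x) = act Z g (j x)" using eq[OF InrI, OF g(2,1)] g D(8) by (simp add: j_def a_def)
  qed (auto simp: j_def b' InrI)
  have "inj_on i (pts X)" "inj_on j (pts Y)"
  proof -
    show "inj_on i (pts X)"
      by (rule inj_onI) (metis (mono_tags) i_def restrict_apply' inj InlI sum.inject(1))
    show "inj_on j (pts Y)"
      by (rule inj_onI) (metis (mono_tags) j_def restrict_apply' inj InrI sum.inject(2))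
  qed
  moreover have "i ` pts X \<inter> j ` pts Y = {}"
  proof -
    have "i x \<noteq> j y" if "x \<in> pts X" "y \<in> pts Y" for x y
    proof
      assume "i x = j y"
      then have "Inl x = Inr y" by (intro inj) (use that in \<open>auto simp: i_def j_def\<close>)
      then show False by simp
    qed
    then show ?thesis by blast
  qed
  moreover have "i ` pts X \<union> j ` pts Y = pts Z"
  proof -
    have "z \<in> i ` pts X \<union> j ` pts Y" if z: "z \<in> pts Z" for z
    proof -
      have "b z \<in> pts X <+> pts Y" using Z(2) z by (rule bij_betw_apply)
      then show ?thesis using bb'[OF z] by (elim PlusE) (force simp: i_def j_def)+
    qed
    then show ?thesis using gmapsD(1)[OF i] gmapsD(1)[OF j] by blast
  qed
  ultimately show thesis using that i j by (auto simp: is_coproduct_def)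
qed

lemma copair_gmap:
  assumes c: "is_coproduct G X1 X2 X j1 j2" and f: "f1 \<in> gmaps G X1 Y" "f2 \<in> gmaps G X2 Y"
  obtains f where "f \<in> gmaps G X Y" "gcomp X1 f j1 = f1" "gcomp X2 f j2 = f2"
proof -
  note j = is_coproductD(1,2)[OF c]
  have inj: "inj_on j1 (pts X1)" "inj_on j2 (pts X2)" "j1 ` pts X1 \<inter> j2 ` pts X2 = {}"
    and un: "j1 ` pts X1 \<union> j2 ` pts X2 = pts X" using c by (auto simp: is_coproduct_def)
  define f where "f = (\<lambda>x\<in>pts X. if x \<in> j1 ` pts X1 then f1 (inv_into (pts X1) j1 x) else f2 (inv_into (pts X2) j2 x))"
  have 1: "f (j1 x) = f1 x" if "x \<in> pts X1" for x
    using that inj un by (auto simp: f_def)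
  have 2: "f (j2 x) = f2 x" if "x \<in> pts X2" for x
  proof -
    have "j2 x \<notin> j1 ` pts X1" using that inj(3) by blast
    then show ?thesis using that inj un by (auto simp: f_def)
  qed
  have cases: "(\<exists>u\<in>pts X1. x = j1 u) \<or> (\<exists>u\<in>pts X2. x = j2 u)" if "x \<in> pts X" for x using that un by blast
  have "f \<in> gmaps G X Y"
  proof (rule gmapsI)
    show "f x \<in> pts Y" if "x \<in> pts X" for x using cases[OF that] 1 2 f gmapsD(1) by metis
    show "f (act X g x) = act Y g (f x)" if g: "g \<in> carrier G" and x: "x \<in> pts X" for g x
      using cases[OF x]
    proof (elim disjE bexE)
      fix u assume u: "u \<in> pts X1" "x = j1 u"
      have "f (act X g x) = f (j1 (act X1 g u))" using gmapsD(3)[OF j(1) g u(1)] u by simp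
      also have "\<dots> = f1 (act X1 g u)" by (rule 1[OF finite_gsetD(3)[OF gmaps_gset(1)[OF j(1)] g u(1)]])
      finally show ?thesis using gmapsD(3)[OF f(1) g u(1)] u 1 by simp
    next
      fix u assume u: "u \<in> pts X2" "x = j2 u"
      have "f (act X g x) = f (j2 (act X2 g u))" using gmapsD(3)[OF j(2) g u(1)] u by simp
      also have "\<dots> = f2 (act X2 g u)" by (rule 2[OF finite_gsetD(3)[OF gmaps_gset(1)[OF j(2)] g u(1)]])
      finally show ?thesis using gmapsD(3)[OF f(2) g u(1)] u 2 by simp
    qed
  qed (use j f gmaps_gset in \<open>auto simp: f_def\<close>)
  moreover have "gcomp X1 f j1 = f1"
    by (rule gmaps_eqI[OF gcomp_gmaps[OF j(1) \<open>f \<in> gmaps G X Y\<close>] f(1)]) (simp add: 1)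
  moreover have "gcomp X2 f j2 = f2"
    by (rule gmaps_eqI[OF gcomp_gmaps[OF j(2) \<open>f \<in> gmaps G X Y\<close>] f(2)]) (simp add: 2)
  ultimately show thesis by (rule that)
qed


lemma joint_iso:
  assumes p: "p \<in> gmaps G W X" "q \<in> gmaps G W Y" "bij_betw (\<lambda>w. (p w, q w)) (pts W) B"
    and p': "p' \<in> gmaps G W' X" "q' \<in> gmaps G W' Y" "bij_betw (\<lambda>w. (p' w, q' w)) (pts W') B"
  obtains i where "i \<in> gmaps G W' W" "bij_betw i (pts W') (pts W)" "gcomp W' p i = p'" "gcomp W' q i = q'"
proof -
  define k where "k w = (p w, q w)" for w
  define k' where "k' w = (p' w, q' w)" for w
  note gs = gmaps_gset(1)[OF p(1)] gmaps_gset(1)[OF p'(1)]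
  define i where "i = (\<lambda>w\<in>pts W'. inv_into (pts W) k (k' w))"
  have kb: "bij_betw k (pts W) B" "bij_betw k' (pts W') B" using p p' by (simp_all add: k_def[abs_def] k'_def[abs_def])
  have ki: "k (i w) = k' w" "i w \<in> pts W" if "w \<in> pts W'" for w
  proof -
    have "k' w \<in> k ` pts W" using that kb bij_betwE[OF kb(2)] by (auto simp: bij_betw_def)
    then show "k (i w) = k' w" "i w \<in> pts W" using that by (auto simp: i_def f_inv_into_f inv_into_into)
  qed
  have "bij_betw (inv_into (pts W) k \<circ> k') (pts W') (pts W)"
    by (rule bij_betw_trans[OF kb(2) bij_betw_inv_into[OF kb(1)]])
  then have bij: "bij_betw i (pts W') (pts W)"
    by (rule bij_betw_cong[THEN iffD1, rotated]) (simp add: i_def)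
  have kinj: "u = v" if "k u = k v" "u \<in> pts W" "v \<in> pts W" for u v
    using that kb(1) by (auto simp: bij_betw_def inj_on_def)
  have pq: "p (i w) = p' w" "q (i w) = q' w" if "w \<in> pts W'" for w
    using ki(1)[OF that] by (simp_all add: k_def k'_def)
  have i: "i \<in> gmaps G W' W"
  proof (rule gmapsI[OF gs(2,1)])
    fix g w assume gw: "g \<in> carrier G" "w \<in> pts W'"
    note aw = finite_gsetD(3)[OF gs(2) gw] and aiw = finite_gsetD(3)[OF gs(1) gw(1) ki(2)[OF gw(2)]]
    show "i (act W' g w) = act W g (i w)"
      by (rule kinj[OF _ ki(2)[OF aw] aiw])
        (simp add: k_def pq[OF aw] gmapsD(3)[OF p(1) gw(1) ki(2)[OF gw(2)]] gmapsD(3)[OF p(2) gw(1) ki(2)[OF gw(2)]]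
          gmapsD(3)[OF p'(1) gw] gmapsD(3)[OF p'(2) gw] pq[OF gw(2)])
  qed (auto simp: ki, simp add: i_def)
  have "gcomp W' p i = p'" by (rule gmaps_eqI[OF gcomp_gmaps[OF i p(1)] p'(1)]) (simp add: pq)
  moreover have "gcomp W' q i = q'" by (rule gmaps_eqI[OF gcomp_gmaps[OF i p(2)] p'(2)]) (simp add: pq)
  ultimately show thesis by (rule that[OF i bij])
qed

lemma iso_pullback:
  assumes i: "i \<in> gmaps G W' W" "bij_betw i (pts W') (pts W)"
  shows "is_pullback G W' W W W i i (gid W) (gid W)" "is_pullback G W' W' W' W (gid W') (gid W') i i"
proof -
  note gs = gmaps_gset[OF i(1)]
  have "bij_betw (\<lambda>w. (i w, i w)) (pts W') {(x, y). x \<in> pts W \<and> y \<in> pts W \<and> gid W x = gid W y}"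
    using i(2) unfolding bij_betw_def inj_on_def by (fastforce simp: image_iff)
  then show "is_pullback G W' W W W i i (gid W) (gid W)"
    using i gid_gmaps[OF gs(2)] by (simp add: is_pullback_def)
  have "bij_betw (\<lambda>w. (gid W' w, gid W' w)) (pts W') {(x, y). x \<in> pts W' \<and> y \<in> pts W' \<and> i x = i y}"
    using i(2) by (auto simp: bij_betw_def inj_on_def image_iff)
  then show "is_pullback G W' W' W' W (gid W') (gid W') i i"
    using i gid_gmaps[OF gs(1)] by (simp add: is_pullback_def)
qed

lemma is_pullback_commute:
  "is_pullback G P X Y Z p q f g \<Longrightarrow> gcomp P f p = gcomp P g q"
  unfolding gcomp_def compose_def is_pullback_def
  by (auto intro!: restrict_ext dest!: bij_betwE bspec)

section \<open>Mackey functors and Tambara functors\<close>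

context mackey_functor begin

lemma res_closed: "f \<in> gmaps G X Y \<Longrightarrow> a \<in> carrier (A Y) \<Longrightarrow> r X Y f a \<in> carrier (A X)"
  using hom_in_carrier[OF res_add_hom] by fastforce

lemma tr_closed: "f \<in> gmaps G X Y \<Longrightarrow> a \<in> carrier (A X) \<Longrightarrow> t X Y f a \<in> carrier (A Y)"
  using hom_in_carrier[OF tr_add_hom] by fastforce

lemma res_add:
  "\<lbrakk>f \<in> gmaps G X Y; a \<in> carrier (A Y); b \<in> carrier (A Y)\<rbrakk> \<Longrightarrow> r X Y f (a \<oplus>\<^bsub>A Y\<^esub> b) = r X Y f a \<oplus>\<^bsub>A X\<^esub> r X Y f b"
  using hom_mult[OF res_add_hom] by fastforce

lemma tr_add:
  "\<lbrakk>f \<in> gmaps G X Y; a \<in> carrier (A X); b \<in> carrier (A X)\<rbrakk> \<Longrightarrow> t X Y f (a \<oplus>\<^bsub>A X\<^esub> b) = t X Y f a \<oplus>\<^bsub>A Y\<^esub> t X Y f b"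
  using hom_mult[OF tr_add_hom] by fastforce

lemma res_zero: "f \<in> gmaps G X Y \<Longrightarrow> r X Y f \<zero>\<^bsub>A Y\<^esub> = \<zero>\<^bsub>A X\<^esub>"
  by (rule hom_zero[OF abelian_lev abelian_lev res_add_hom]) (auto simp: gmaps_gset)

lemma tr_zero: "f \<in> gmaps G X Y \<Longrightarrow> t X Y f \<zero>\<^bsub>A X\<^esub> = \<zero>\<^bsub>A Y\<^esub>"
  by (rule hom_zero[OF abelian_lev abelian_lev tr_add_hom]) (auto simp: gmaps_gset)


lemma coproduct_eqI:
  assumes "is_coproduct G X1 X2 X j1 j2" "a \<in> carrier (A X)" "b \<in> carrier (A X)"
    and "r X1 X j1 a = r X1 X j1 b" "r X2 X j2 a = r X2 X j2 b"
  shows "a = b"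
  using coproduct_lev[OF assms(1)] assms(2-) by (auto simp: bij_betw_def inj_on_def)

lemma coproduct_elem:
  assumes "is_coproduct G X1 X2 X j1 j2" "a \<in> carrier (A X1)" "b \<in> carrier (A X2)"
  obtains c where "c \<in> carrier (A X)" "r X1 X j1 c = a" "r X2 X j2 c = b"
proof -
  have "(a, b) \<in> (\<lambda>a. (r X1 X j1 a, r X2 X j2 a)) ` carrier (A X)"
    using coproduct_lev[OF assms(1)] assms(2-) by (simp add: bij_betw_def)
  then show thesis using that by auto
qed

text \<open>The inclusions of the two summands pull back to the identity and to the empty set.\<close>

lemma res_tr_coproduct:
  assumes c: "is_coproduct G X1 X2 X j1 j2" and a: "a \<in> carrier (A X1)"
  shows "r X1 X j1 (t X1 X j1 a) = a" "r X2 X j2 (t X1 X j1 a) = \<zero>\<^bsub>A X2\<^esub>"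
proof -
  note j = is_coproductD[OF c]
  note e = gempty_gmaps[OF group_G gmaps_gset(1)[OF j(1)]] gempty_gmaps[OF group_G gmaps_gset(1)[OF j(2)]]
  show "r X1 X j1 (t X1 X j1 a) = a"
    using tr_base_change[OF j(4) a] res_id tr_id gmaps_gset(1)[OF j(1)] a by simp
  have "r gempty X1 (\<lambda>x. undefined) a = \<zero>\<^bsub>A gempty\<^esub>"
    using res_closed[OF e(1) a] empty_lev[OF gempty_gset[OF group_G]] by (simp add: gempty_def)
  then show "r X2 X j2 (t X1 X j1 a) = \<zero>\<^bsub>A X2\<^esub>"
    using tr_base_change[OF is_coproduct_pullback_empty[OF group_G c] a] tr_zero[OF e(2)] by simp
qed

lemma tr_coproduct:
  assumes c: "is_coproduct G X1 X2 X j1 j2" and f: "f \<in> gmaps G X Y" and a: "a \<in> carrier (A X)"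
  shows "t X Y f a = t X1 Y (gcomp X1 f j1) (r X1 X j1 a) \<oplus>\<^bsub>A Y\<^esub> t X2 Y (gcomp X2 f j2) (r X2 X j2 a)"
proof -
  note j = is_coproductD[OF c]
  note cl = res_closed[OF j(1) a] res_closed[OF j(2) a]
  note cl' = tr_closed[OF j(1) cl(1)] tr_closed[OF j(2) cl(2)]
  interpret X: abelian_group "A X" by (rule abelian_lev[OF gmaps_gset(1)[OF f]])
  interpret X1: abelian_group "A X1" by (rule abelian_lev[OF gmaps_gset(1)[OF j(1)]])
  interpret X2: abelian_group "A X2" by (rule abelian_lev[OF gmaps_gset(1)[OF j(2)]])
  have "a = t X1 X j1 (r X1 X j1 a) \<oplus>\<^bsub>A X\<^esub> t X2 X j2 (r X2 X j2 a)"
    by (rule coproduct_eqI[OF c a])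
      (simp_all add: cl cl' res_add[OF j(1)] res_add[OF j(2)] res_tr_coproduct[OF c] res_tr_coproduct[OF j(3)])
  then have "t X Y f a = t X Y f (t X1 X j1 (r X1 X j1 a) \<oplus>\<^bsub>A X\<^esub> t X2 X j2 (r X2 X j2 a))" by simp
  then show ?thesis
    using tr_add[OF f cl'] tr_comp[OF j(1) f cl(1)] tr_comp[OF j(2) f cl(2)] by simp
qed

end

context tambara_functor begin

lemma nm_closed: "f \<in> gmaps G X Y \<Longrightarrow> a \<in> carrier (lev R X) \<Longrightarrow> nm R X Y f a \<in> carrier (lev R Y)"
  using hom_in_carrier[OF nm_hom] by fastforce

lemma nm_mult:
  "\<lbrakk>f \<in> gmaps G X Y; a \<in> carrier (lev R X); b \<in> carrier (lev R X)\<rbrakk> \<Longrightarrow>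
    nm R X Y f (a \<otimes>\<^bsub>lev R X\<^esub> b) = nm R X Y f a \<otimes>\<^bsub>lev R Y\<^esub> nm R X Y f b"
  using hom_mult[OF nm_hom] by fastforce

lemma res_mult:
  "\<lbrakk>f \<in> gmaps G X Y; a \<in> carrier (lev R Y); b \<in> carrier (lev R Y)\<rbrakk> \<Longrightarrow>
    res R X Y f (a \<otimes>\<^bsub>lev R Y\<^esub> b) = res R X Y f a \<otimes>\<^bsub>lev R X\<^esub> res R X Y f b"
  using ring_hom_mult[OF res_ring_hom] by fastforce

lemma res_one: "f \<in> gmaps G X Y \<Longrightarrow> res R X Y f \<one>\<^bsub>lev R Y\<^esub> = \<one>\<^bsub>lev R X\<^esub>"
  using ring_hom_one[OF res_ring_hom] by fastforce

lemma nm_res_iso: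
  assumes i: "i \<in> gmaps G W' W" "bij_betw i (pts W') (pts W)" and a: "a \<in> carrier (lev R W)"
  shows "nm R W' W i (res R W' W i a) = a"
  using nm_base_change[OF iso_pullback(1)[OF i] a] res_id nm_id gmaps_gset[OF i(1)] a by simp

text \<open>The ring of the empty set is zero, so that its only element is also \<open>1\<close>; hence empty norms are \<open>1\<close>.\<close>

lemma lev_empty_one:
  assumes "finite_gset G X" "pts X = {}" "a \<in> carrier (lev R X)"
  shows "a = \<one>\<^bsub>lev R X\<^esub>"
proof -
  interpret cring "lev R X" by (rule cring_lev[OF assms(1)])
  show ?thesis using empty_lev[OF assms(1,2)] assms(3) one_closed by (metis singletonD)
qed

lemma nm_empty:
  assumes "f \<in> gmaps G X Y" "pts X = {}" "a \<in> carrier (lev R X)"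
  shows "nm R X Y f a = \<one>\<^bsub>lev R Y\<^esub>"
  using lev_empty_one[OF gmaps_gset(1)[OF assms(1)] assms(2,3)] nm_one[OF assms(1)] by simp

lemma res_nm_coproduct:
  assumes c: "is_coproduct G X1 X2 X j1 j2" and a: "a \<in> carrier (lev R X1)"
  shows "res R X1 X j1 (nm R X1 X j1 a) = a" "res R X2 X j2 (nm R X1 X j1 a) = \<one>\<^bsub>lev R X2\<^esub>"
proof -
  note j = is_coproductD[OF c]
  note e = gempty_gmaps[OF group_G gmaps_gset(1)[OF j(1)]] gempty_gmaps[OF group_G gmaps_gset(1)[OF j(2)]]
  show "res R X1 X j1 (nm R X1 X j1 a) = a"
    using nm_base_change[OF j(4) a] res_id nm_id gmaps_gset(1)[OF j(1)] a by simp
  show "res R X2 X j2 (nm R X1 X j1 a) = \<one>\<^bsub>lev R X2\<^esub>"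
    using nm_base_change[OF is_coproduct_pullback_empty[OF group_G c] a]
      nm_empty[OF e(2) _ res_closed[OF e(1) a]] by (simp add: gempty_def)
qed

text \<open>
  An element \<open>a\<close> of a disjoint union is the product of the norms of its two restrictions, as a norm along
  the inclusion of a summand is \<open>1\<close> on the other summand.
\<close>

lemma nm_coproduct:
  assumes c: "is_coproduct G X1 X2 X j1 j2" and f: "f \<in> gmaps G X Y" and a: "a \<in> carrier (lev R X)"
  shows "nm R X Y f a =
    nm R X1 Y (gcomp X1 f j1) (res R X1 X j1 a) \<otimes>\<^bsub>lev R Y\<^esub> nm R X2 Y (gcomp X2 f j2) (res R X2 X j2 a)"
proof -
  note j = is_coproductD[OF c]
  note cl = res_closed[OF j(1) a] res_closed[OF j(2) a]
  note cl' = nm_closed[OF j(1) cl(1)] nm_closed[OF j(2) cl(2)]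
  interpret X: cring "lev R X" by (rule cring_lev[OF gmaps_gset(1)[OF f]])
  interpret X1: cring "lev R X1" by (rule cring_lev[OF gmaps_gset(1)[OF j(1)]])
  interpret X2: cring "lev R X2" by (rule cring_lev[OF gmaps_gset(1)[OF j(2)]])
  have "a = nm R X1 X j1 (res R X1 X j1 a) \<otimes>\<^bsub>lev R X\<^esub> nm R X2 X j2 (res R X2 X j2 a)"
    by (rule coproduct_eqI[OF c a])
      (simp_all add: cl cl' res_mult[OF j(1)] res_mult[OF j(2)] res_nm_coproduct[OF c] res_nm_coproduct[OF j(3)])
  then have "nm R X Y f a = nm R X Y f (nm R X1 X j1 (res R X1 X j1 a) \<otimes>\<^bsub>lev R X\<^esub> nm R X2 X j2 (res R X2 X j2 a))" by simp
  then show ?thesis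
    using nm_mult[OF f cl'] nm_comp[OF j(1) f cl(1)] nm_comp[OF j(2) f cl(2)] by simp
qed

text \<open>The exponential diagram of \<open>\<emptyset> \<rightarrow> X \<rightarrow> Y\<close> has \<open>D = \<emptyset>\<close>, as no fibre has a section.\<close>

lemma nm_zero:
  assumes f: "f \<in> gmaps G X Y" and surj: "f ` pts X = pts Y"
  shows "nm R X Y f \<zero>\<^bsub>lev R X\<^esub> = \<zero>\<^bsub>lev R Y\<^esub>"
proof -
  let ?u = "\<lambda>x::'g hf. undefined :: 'g hf"
  note gs = gmaps_gset[OF f]
  have e: "?u \<in> gmaps G gempty X" "?u \<in> gmaps G gempty Y" "?u \<in> gmaps G gempty gempty"
    using gempty_gmaps[OF group_G] gs gempty_gset[OF group_G] by auto
  have ce: "gcomp gempty ?u ?u = ?u"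
    by (rule gmaps_eqI[OF gcomp_gmaps[OF e(3) e(1)] e(1)]) (simp add: gempty_def)
  have ex: "is_exponential G gempty X Y gempty gempty ?u f ?u ?u ?u"
    unfolding is_exponential_def
  proof (intro conjI ballI)
    show "is_pullback G gempty X gempty Y (gcomp gempty ?u ?u) ?u f ?u"
      unfolding ce is_pullback_def using f e by (intro conjI) (simp_all, simp add: gempty_def bij_betw_def)
    fix y s assume y: "y \<in> pts Y"
      and s: "s \<in> (\<Pi>\<^sub>E x\<in>{x \<in> pts X. f x = y}. {a \<in> pts gempty. ?u a = x})"
    have "y \<in> f ` pts X" using y surj by simp
    then obtain x where "x \<in> pts X" "f x = y" by (elim imageE) simp
    then have "s x \<in> pts (gempty :: 'g gset)" using s by (auto simp: PiE_def Pi_def)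
    then show "\<exists>!d. d \<in> pts gempty \<and> ?u d = y \<and> (\<forall>p\<in>pts gempty. ?u p = d \<longrightarrow> ?u p = s (?u (?u p)))"
      by (simp add: gempty_def)
  qed (use f e in auto)
  have z: "\<zero>\<^bsub>lev R gempty\<^esub> \<in> carrier (lev R gempty)"
    using cring.cring_simprules(2)[OF cring_lev[OF gempty_gset[OF group_G]]] .
  have "nm R gempty gempty ?u (res R gempty gempty ?u \<zero>\<^bsub>lev R gempty\<^esub>) = \<zero>\<^bsub>lev R gempty\<^esub>"
    using nm_closed[OF e(3) res_closed[OF e(3) z]] empty_lev[OF gempty_gset[OF group_G]] by (simp add: gempty_def)
  then show ?thesis using nm_tr[OF ex z] tr_zero[OF e(1)] tr_zero[OF e(2)] by simp
qed

end


section \<open>The cofactor of a norm\<close>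

lemma joint_eqI:
  assumes "bij_betw (\<lambda>w. (p w, q w)) (pts W) B" "u \<in> pts W" "v \<in> pts W" "p u = p v" "q u = q v"
  shows "u = v"
  using assms by (auto simp: bij_betw_def inj_on_def)

lemma joint_point:
  assumes "bij_betw (\<lambda>w. (p w, q w)) (pts W) B" "(x, y) \<in> B"
  obtains w where "w \<in> pts W" "p w = x" "q w = y"
  using assms by (auto simp: bij_betw_def image_iff)

lemma joint_mem:
  assumes "bij_betw (\<lambda>w. (p w, q w)) (pts W) B" "w \<in> pts W"
  shows "(p w, q w) \<in> B"
  using assms by (auto simp: bij_betw_def)

lemma joint_lift:
  assumes p: "p \<in> gmaps G W X" "q \<in> gmaps G W Y" and bij: "bij_betw (\<lambda>w. (p w, q w)) (pts W) B"
    and u: "u \<in> gmaps G V X" "v \<in> gmaps G V Y" "\<And>z. z \<in> pts V \<Longrightarrow> (u z, v z) \<in> B"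
  obtains m where "m \<in> gmaps G V W" "gcomp V p m = u" "gcomp V q m = v"
    "\<And>z. z \<in> pts V \<Longrightarrow> p (m z) = u z" "\<And>z. z \<in> pts V \<Longrightarrow> q (m z) = v z"
proof -
  note gs = gmaps_gset(1)[OF p(1)] gmaps_gset(1)[OF u(1)]
  have "\<forall>z\<in>pts V. \<exists>w. w \<in> pts W \<and> p w = u z \<and> q w = v z"
    using joint_point[OF bij u(3)] by metis
  then obtain m0 where m0: "\<And>z. z \<in> pts V \<Longrightarrow> m0 z \<in> pts W \<and> p (m0 z) = u z \<and> q (m0 z) = v z"
    by metis
  define m where "m = restrict m0 (pts V)"
  have m: "m z \<in> pts W" "p (m z) = u z" "q (m z) = v z" if "z \<in> pts V" for z
    using m0 that by (auto simp: m_def)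
  have mg: "m \<in> gmaps G V W"
  proof (rule gmapsI[OF gs(2,1)])
    fix g z assume gz: "g \<in> carrier G" "z \<in> pts V"
    note az = finite_gsetD(3)[OF gs(2) gz] and am = finite_gsetD(3)[OF gs(1) gz(1) m(1)[OF gz(2)]]
    show "m (act V g z) = act W g (m z)"
      by (rule joint_eqI[OF bij m(1)[OF az] am])
        (simp_all add: m(2,3)[OF az] gmapsD(3)[OF p(1) gz(1) m(1)[OF gz(2)]] gmapsD(3)[OF p(2) gz(1) m(1)[OF gz(2)]]
          gmapsD(3)[OF u(1) gz] gmapsD(3)[OF u(2) gz] m(2,3)[OF gz(2)])
  qed (auto simp: m, simp add: m_def)
  have "gcomp V p m = u" by (rule gmaps_eqI[OF gcomp_gmaps[OF mg p(1)] u(1)]) (simp add: m)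
  moreover have "gcomp V q m = v" by (rule gmaps_eqI[OF gcomp_gmaps[OF mg p(2)] u(2)]) (simp add: m)
  ultimately show thesis using m(2,3) by (rule that[OF mg])
qed

lemma coproduct_bij:
  assumes c: "is_coproduct G X1 X2 X j1 j2"
    and b: "bij_betw (\<lambda>x. k (j1 x)) (pts X1) B1" "bij_betw (\<lambda>x. k (j2 x)) (pts X2) B2" "B1 \<inter> B2 = {}"
  shows "bij_betw k (pts X) (B1 \<union> B2)"
proof -
  have j: "bij_betw j1 (pts X1) (j1 ` pts X1)" "bij_betw j2 (pts X2) (j2 ` pts X2)" "pts X = j1 ` pts X1 \<union> j2 ` pts X2"
    using c by (auto simp: is_coproduct_def bij_betw_def)
  have "bij_betw k (j1 ` pts X1) B1" "bij_betw k (j2 ` pts X2) B2"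
    using bij_betw_comp_iff[OF j(1), of k B1] bij_betw_comp_iff[OF j(2), of k B2] b(1,2) by (simp_all add: comp_def)
  then show ?thesis unfolding j(3) by (rule bij_betw_combine[OF _ _ b(3)])
qed

text \<open>
  The complement of the diagonal in \<open>X \<times>\<^sub>Y X\<close> is characterised up to isomorphism, because it occurs below in many
  models: as a pullback, as a disjoint union, and as an induced \<open>G\<close>-set.
\<close>

definition is_off_diag ::
  "('g, 'k) monoid_scheme \<Rightarrow> 'g gset \<Rightarrow> 'g gset \<Rightarrow> ('g hf \<Rightarrow> 'g hf) \<Rightarrow> ('g hf \<Rightarrow> 'g hf) \<Rightarrow> ('g hf \<Rightarrow> 'g hf) \<Rightarrow> bool" where
  "is_off_diag G W X f p q \<longleftrightarrow> p \<in> gmaps G W X \<and> q \<in> gmaps G W X \<and>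
     bij_betw (\<lambda>w. (p w, q w)) (pts W) {(x, x'). x \<in> pts X \<and> x' \<in> pts X \<and> x \<noteq> x' \<and> f x = f x'}"

lemma is_off_diagD:
  assumes "is_off_diag G W X f p q"
  shows "p \<in> gmaps G W X" "q \<in> gmaps G W X"
    "bij_betw (\<lambda>w. (p w, q w)) (pts W) {(x, x'). x \<in> pts X \<and> x' \<in> pts X \<and> x \<noteq> x' \<and> f x = f x'}"
  using assms by (simp_all add: is_off_diag_def)

text \<open>
  If \<open>a\<close> is thought of as a function on \<open>X\<close>, the value of its cofactor at a point is the product of the
  values of \<open>a\<close> at the other points of the same fibre of \<open>f\<close>.  It is the derivative of the norm \<open>N\<^sub>f\<close>: to
  first order in \<open>x\<close>, the difference \<open>N\<^sub>f (a + x) - N\<^sub>f a\<close> is \<open>T\<^sub>f (cofactor a \<cdot> x)\<close>.  The choice of a model is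
  immaterial by \<open>cofactor_eq\<close> below.
\<close>

definition cofactor ::
  "('g, 'k) monoid_scheme \<Rightarrow> ('g, 'r) tambara \<Rightarrow> 'g gset \<Rightarrow> ('g hf \<Rightarrow> 'g hf) \<Rightarrow> 'r \<Rightarrow> 'r" where
  "cofactor G R X f a = (SOME c. \<exists>W p q. is_off_diag G W X f p q \<and> c = nm R W X q (res R W X p a))"

lemma off_diag_exists:
  fixes X Y :: "'g gset"
  assumes f: "f \<in> gmaps G X Y"
  obtains W p q where "is_off_diag G W X f p q"
proof -
  note X = gmaps_gset(1)[OF f]
  obtain W :: "'g gset" and p q where "p \<in> gmaps G W X" "q \<in> gmaps G W X"
    "bij_betw (\<lambda>w. (p w, q w)) (pts W) {(x, x'). x \<in> pts X \<and> x' \<in> pts X \<and> x \<noteq> x' \<and> f x = f x'}"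
    by (rule pair_gset[OF X X, of "{(x, x'). x \<in> pts X \<and> x' \<in> pts X \<and> x \<noteq> x' \<and> f x = f x'}"])
      (auto simp: gmapsD[OF f] finite_gsetD(3)[OF X] dest: act_inj[OF X])
  then show thesis using that by (simp add: is_off_diag_def)
qed

context tambara_functor begin

lemma cofactor_eq:
  assumes W: "is_off_diag G W X f p q" and a: "a \<in> carrier (lev R X)"
  shows "cofactor G R X f a = nm R W X q (res R W X p a)"
proof -
  have "nm R W' X q' (res R W' X p' a) = nm R W X q (res R W X p a)" if W': "is_off_diag G W' X f p' q'" for W' p' q'
  proof -
    note d = is_off_diagD[OF W] and d' = is_off_diagD[OF W']
    obtain i where i: "i \<in> gmaps G W' W" "bij_betw i (pts W') (pts W)" "gcomp W' p i = p'" "gcomp W' q i = q'"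
      by (rule joint_iso[OF d d'])
    note ra = res_closed[OF d(1) a]
    have "nm R W' X q' (res R W' X p' a) = nm R W X q (nm R W' W i (res R W' W i (res R W X p a)))"
      using nm_comp[OF i(1) d(2) res_closed[OF i(1) ra]] res_comp[OF i(1) d(1) a] i(3,4) by simp
    then show ?thesis using nm_res_iso[OF i(1,2) ra] by simp
  qed
  then show ?thesis unfolding cofactor_def using W by (intro some_equality) blast+
qed

lemma cofactor_closed:
  assumes f: "f \<in> gmaps G X Y" and a: "a \<in> carrier (lev R X)"
  shows "cofactor G R X f a \<in> carrier (lev R X)"
proof -
  obtain W p q where W: "is_off_diag G W X f p q" by (rule off_diag_exists[OF f])
  show ?thesis using cofactor_eq[OF W a] is_off_diagD[OF W] a by (simp add: nm_closed res_closed)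
qed

lemma cofactor_mult:
  assumes f: "f \<in> gmaps G X Y" and a: "a \<in> carrier (lev R X)" "b \<in> carrier (lev R X)"
  shows "cofactor G R X f (a \<otimes>\<^bsub>lev R X\<^esub> b) = cofactor G R X f a \<otimes>\<^bsub>lev R X\<^esub> cofactor G R X f b"
proof -
  obtain W p q where W: "is_off_diag G W X f p q" by (rule off_diag_exists[OF f])
  interpret cring "lev R X" by (rule cring_lev[OF gmaps_gset(1)[OF f]])
  show ?thesis using is_off_diagD[OF W] a
    by (simp add: cofactor_eq[OF W] res_mult nm_mult res_closed)
qed

lemma cofactor_inj:
  assumes f: "f \<in> gmaps G X Y" "inj_on f (pts X)" and a: "a \<in> carrier (lev R X)"
  shows "cofactor G R X f a = \<one>\<^bsub>lev R X\<^esub>"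
proof -
  obtain W p q where W: "is_off_diag G W X f p q" by (rule off_diag_exists[OF f(1)])
  note d = is_off_diagD[OF W]
  have "w \<notin> pts W" for w
    using joint_mem[OF d(3), of w] inj_onD[OF f(2), of "p w" "q w"] by auto
  then have "pts W = {}" by blast
  then show ?thesis using nm_empty[OF d(2) _ res_closed[OF d(1) a]] by (simp add: cofactor_eq[OF W a])
qed

text \<open>If every fibre has a second point, the cofactor of \<open>0\<close> is a product of nonempty products of zeros.\<close>

lemma cofactor_zero:
  assumes f: "f \<in> gmaps G X Y" and big: "\<And>y. y \<in> pts Y \<Longrightarrow> 1 < card {z \<in> pts X. f z = y}"
  shows "cofactor G R X f \<zero>\<^bsub>lev R X\<^esub> = \<zero>\<^bsub>lev R X\<^esub>"
proof -
  obtain W p q where W: "is_off_diag G W X f p q" by (rule off_diag_exists[OF f])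
  note d = is_off_diagD[OF W]
  interpret cring "lev R X" by (rule cring_lev[OF gmaps_gset(1)[OF f]])
  have "x \<in> q ` pts W" if x: "x \<in> pts X" for x
  proof -
    have "\<not> {z \<in> pts X. f z = f x} \<subseteq> {x}"
      using big[OF gmapsD(1)[OF f x]] card_mono[of "{x}" "{z \<in> pts X. f z = f x}"] by auto
    then obtain z where "z \<in> pts X" "f z = f x" "z \<noteq> x" by auto
    with x have "(z, x) \<in> {(x, x'). x \<in> pts X \<and> x' \<in> pts X \<and> x \<noteq> x' \<and> f x = f x'}" by simp
    then obtain w where "w \<in> pts W" "p w = z" "q w = x" by (rule joint_point[OF d(3)])
    then show ?thesis by (intro image_eqI[of _ _ w]) simp_all
  qed
  moreover have "q x \<in> pts X" if "x \<in> pts W" for x by (rule gmapsD(1)[OF d(2) that])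
  ultimately have "q ` pts W = pts X" by (intro equalityI image_subsetI subsetI)
  then show ?thesis by (simp add: cofactor_eq[OF W] res_zero[OF d(1)] nm_zero[OF d(2)])
qed

text \<open>Base change along \<open>f\<close> itself: \<open>X \<times>\<^sub>Y X\<close> is the disjoint union of the diagonal and its complement.\<close>

lemma res_nm:
  assumes f: "f \<in> gmaps G X Y" and a: "a \<in> carrier (lev R X)"
  shows "res R X Y f (nm R X Y f a) = a \<otimes>\<^bsub>lev R X\<^esub> cofactor G R X f a"
proof -
  obtain W p q where W: "is_off_diag G W X f p q" by (rule off_diag_exists[OF f])
  note d = is_off_diagD[OF W]
  note X = gmaps_gset(1)[OF f] and gW = gmaps_gset(1)[OF d(1)]
  obtain P i j where c: "is_coproduct G X W P i j" by (rule coproduct_exists[OF X gW])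
  note ij = is_coproductD(1,2)[OF c]
  obtain u where u: "u \<in> gmaps G P X" "gcomp X u i = gid X" "gcomp W u j = p"
    by (rule copair_gmap[OF c gid_gmaps[OF X] d(1)])
  obtain v where v: "v \<in> gmaps G P X" "gcomp X v i = gid X" "gcomp W v j = q"
    by (rule copair_gmap[OF c gid_gmaps[OF X] d(2)])
  have ui: "u (i x) = x" "v (i x) = x" if "x \<in> pts X" for x
    using fun_cong[OF u(2), of x] fun_cong[OF v(2), of x] that by simp_all
  have uj: "u (j x) = p x" "v (j x) = q x" if "x \<in> pts W" for x
    using fun_cong[OF u(3), of x] fun_cong[OF v(3), of x] that by simp_all
  have "bij_betw (\<lambda>w. (u w, v w)) (pts P)
      ({(x, x'). x \<in> pts X \<and> x' = x} \<union> {(x, x'). x \<in> pts X \<and> x' \<in> pts X \<and> x \<noteq> x' \<and> f x = f x'})"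
  proof (rule coproduct_bij[OF c])
    have "bij_betw (\<lambda>x. (x, x)) (pts X) {(x, x'). x \<in> pts X \<and> x' = x}"
      by (auto simp: bij_betw_def inj_on_def)
    then show "bij_betw (\<lambda>x. (u (i x), v (i x))) (pts X) {(x, x'). x \<in> pts X \<and> x' = x}"
      by (rule bij_betw_cong[THEN iffD1, rotated]) (simp add: ui)
    show "bij_betw (\<lambda>x. (u (j x), v (j x))) (pts W) {(x, x'). x \<in> pts X \<and> x' \<in> pts X \<and> x \<noteq> x' \<and> f x = f x'}"
      using d(3) by (rule bij_betw_cong[THEN iffD1, rotated]) (simp add: uj)
  qed auto
  also have "{(x, x'). x \<in> pts X \<and> x' = x} \<union> {(x, x'). x \<in> pts X \<and> x' \<in> pts X \<and> x \<noteq> x' \<and> f x = f x'}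
      = {(x, y). x \<in> pts X \<and> y \<in> pts X \<and> f x = f y}"
    by auto
  finally have pb: "is_pullback G P X X Y u v f f" using u(1) v(1) f by (simp add: is_pullback_def)
  have "res R X Y f (nm R X Y f a) = nm R P X v (res R P X u a)" by (rule nm_base_change[OF pb a])
  also have "\<dots> = nm R X X (gid X) (res R X P i (res R P X u a)) \<otimes>\<^bsub>lev R X\<^esub> nm R W X q (res R W P j (res R P X u a))"
    using nm_coproduct[OF c v(1) res_closed[OF u(1) a]] v by simp
  also have "\<dots> = a \<otimes>\<^bsub>lev R X\<^esub> cofactor G R X f a"
    using res_comp[OF ij(1) u(1) a] res_comp[OF ij(2) u(1) a] u(2,3) a X
    by (simp add: res_id nm_id cofactor_eq[OF W])
  finally show ?thesis .
qed

text \<open>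
  Two distinct points in a fibre of \<open>g \<circ> f\<close> either lie in one fibre of \<open>f\<close>, or lie over two distinct points
  in a fibre of \<open>g\<close>.
\<close>

lemma cofactor_comp:
  assumes f: "f \<in> gmaps G X Y" and g: "g \<in> gmaps G Y Z" and a: "a \<in> carrier (lev R X)"
  shows "cofactor G R X (gcomp X g f) a =
    cofactor G R X f a \<otimes>\<^bsub>lev R X\<^esub> res R X Y f (cofactor G R Y g (nm R X Y f a))"
proof -
  obtain W p q where W: "is_off_diag G W X f p q" by (rule off_diag_exists[OF f])
  note d = is_off_diagD[OF W]
  obtain V m n where V: "is_off_diag G V Y g m n" by (rule off_diag_exists[OF g])
  note e = is_off_diagD[OF V]
  obtain P u v where P: "is_pullback G P X V Y u v f m" by (rule pullback_exists[OF f e(1)])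
  note Pd = is_pullbackD[OF P]
  have nv: "gcomp P n v \<in> gmaps G P Y" by (rule gcomp_gmaps[OF Pd(2) e(2)])
  \<comment> \<open>\<open>Q\<close> is the set of pairs of points of \<open>X\<close> lying over distinct points of a fibre of \<open>g\<close>.\<close>
  obtain Q s t where Q: "is_pullback G Q P X Y s t (gcomp P n v) f" by (rule pullback_exists[OF nv f])
  note Qd = is_pullbackD[OF Q]
  have Pb: "bij_betw (\<lambda>w. (u w, v w)) (pts P) {(x, y). x \<in> pts X \<and> y \<in> pts V \<and> f x = m y}"
    and Qb: "bij_betw (\<lambda>w. (s w, t w)) (pts Q) {(x, y). x \<in> pts P \<and> y \<in> pts X \<and> gcomp P n v x = f y}"
    using P Q by (simp_all add: is_pullback_def)
  have us: "gcomp Q u s \<in> gmaps G Q X" by (rule gcomp_gmaps[OF Qd(1) Pd(1)])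
  have Qbij: "bij_betw (\<lambda>w. (gcomp Q u s w, t w)) (pts Q)
      {(x, x'). x \<in> pts X \<and> x' \<in> pts X \<and> f x \<noteq> f x' \<and> g (f x) = g (f x')}"
  proof (rule bij_betw_imageI)
    show "inj_on (\<lambda>w. (gcomp Q u s w, t w)) (pts Q)"
    proof (rule inj_onI)
      fix z z' assume z: "z \<in> pts Q" "z' \<in> pts Q" and eq: "(gcomp Q u s z, t z) = (gcomp Q u s z', t z')"
      have sz: "s z \<in> pts P" "s z' \<in> pts P" using gmapsD(1)[OF Qd(1)] z by auto
      have vz: "v (s z) \<in> pts V" "v (s z') \<in> pts V" using gmapsD(1)[OF Pd(2)] sz by auto
      have "m (v (s z)) = m (v (s z'))"
        using joint_mem[OF Pb sz(1)] joint_mem[OF Pb sz(2)] eq z by auto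
      moreover have "n (v (s z)) = n (v (s z'))"
        using joint_mem[OF Qb z(1)] joint_mem[OF Qb z(2)] eq z sz by auto
      ultimately have "v (s z) = v (s z')" by (rule joint_eqI[OF e(3) vz])
      then have "s z = s z'" using eq z by (intro joint_eqI[OF Pb sz]) auto
      then show "z = z'" using eq by (intro joint_eqI[OF Qb z]) auto
    qed
    have "(x, x') \<in> (\<lambda>w. (gcomp Q u s w, t w)) ` pts Q"
      if xx: "x \<in> pts X" "x' \<in> pts X" "f x \<noteq> f x'" "g (f x) = g (f x')" for x x'
    proof -
      obtain y where y: "y \<in> pts V" "m y = f x" "n y = f x'"
        by (rule joint_point[OF e(3), of "f x" "f x'"]) (use xx gmapsD(1)[OF f] in auto)
      obtain z where z: "z \<in> pts P" "u z = x" "v z = y"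
        by (rule joint_point[OF Pb, of x y]) (use xx y in auto)
      obtain w where w: "w \<in> pts Q" "s w = z" "t w = x'"
        by (rule joint_point[OF Qb, of z x']) (use xx y z in auto)
      show ?thesis using w z by (intro image_eqI[of _ _ w]) auto
    qed
    moreover have "(gcomp Q u s w, t w) \<in> {(x, x'). x \<in> pts X \<and> x' \<in> pts X \<and> f x \<noteq> f x' \<and> g (f x) = g (f x')}"
      if w: "w \<in> pts Q" for w
    proof -
      have sw: "s w \<in> pts P" using gmapsD(1)[OF Qd(1)] w by auto
      then have vw: "v (s w) \<in> pts V" using gmapsD(1)[OF Pd(2)] by auto
      show ?thesis
        using joint_mem[OF Qb w] joint_mem[OF Pb sw] joint_mem[OF e(3) vw] w sw by auto
    qed
    ultimately show "(\<lambda>w. (gcomp Q u s w, t w)) ` pts Q =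
        {(x, x'). x \<in> pts X \<and> x' \<in> pts X \<and> f x \<noteq> f x' \<and> g (f x) = g (f x')}"
      by auto
  qed
  obtain T i j where c: "is_coproduct G W Q T i j"
    by (rule coproduct_exists[OF gmaps_gset(1)[OF d(1)] gmaps_gset(1)[OF us]])
  note ij = is_coproductD(1,2)[OF c]
  obtain p' where p': "p' \<in> gmaps G T X" "gcomp W p' i = p" "gcomp Q p' j = gcomp Q u s"
    by (rule copair_gmap[OF c d(1) us])
  obtain q' where q': "q' \<in> gmaps G T X" "gcomp W q' i = q" "gcomp Q q' j = t"
    by (rule copair_gmap[OF c d(2) Qd(2)])
  have pi: "p' (i x) = p x" "q' (i x) = q x" if "x \<in> pts W" for x
    using fun_cong[OF p'(2), of x] fun_cong[OF q'(2), of x] that by simp_all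
  have pj: "p' (j x) = gcomp Q u s x" "q' (j x) = t x" if "x \<in> pts Q" for x
    using fun_cong[OF p'(3), of x] fun_cong[OF q'(3), of x] that by simp_all
  have "bij_betw (\<lambda>w. (p' w, q' w)) (pts T)
      ({(x, x'). x \<in> pts X \<and> x' \<in> pts X \<and> x \<noteq> x' \<and> f x = f x'} \<union>
       {(x, x'). x \<in> pts X \<and> x' \<in> pts X \<and> f x \<noteq> f x' \<and> g (f x) = g (f x')})"
  proof (rule coproduct_bij[OF c])
    show "bij_betw (\<lambda>x. (p' (i x), q' (i x))) (pts W) {(x, x'). x \<in> pts X \<and> x' \<in> pts X \<and> x \<noteq> x' \<and> f x = f x'}"
      using d(3) by (rule bij_betw_cong[THEN iffD1, rotated]) (simp add: pi)
    show "bij_betw (\<lambda>x. (p' (j x), q' (j x))) (pts Q)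
        {(x, x'). x \<in> pts X \<and> x' \<in> pts X \<and> f x \<noteq> f x' \<and> g (f x) = g (f x')}"
      using Qbij by (rule bij_betw_cong[THEN iffD1, rotated]) (simp add: pj)
  qed auto
  also have "{(x, x'). x \<in> pts X \<and> x' \<in> pts X \<and> x \<noteq> x' \<and> f x = f x'} \<union>
       {(x, x'). x \<in> pts X \<and> x' \<in> pts X \<and> f x \<noteq> f x' \<and> g (f x) = g (f x')} =
      {(x, x'). x \<in> pts X \<and> x' \<in> pts X \<and> x \<noteq> x' \<and> gcomp X g f x = gcomp X g f x'}"
    by auto
  finally have T: "is_off_diag G T X (gcomp X g f) p' q'" using p' q' by (simp add: is_off_diag_def)
  note na = nm_closed[OF f a] and rp = res_closed[OF p'(1) a]
  have "res R X Y f (cofactor G R Y g (nm R X Y f a)) =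
      res R X Y f (nm R V Y n (res R V Y m (nm R X Y f a)))"
    by (simp add: cofactor_eq[OF V na])
  also have "\<dots> = res R X Y f (nm R P Y (gcomp P n v) (res R P X u a))"
    using nm_base_change[OF P a] nm_comp[OF Pd(2) e(2) res_closed[OF Pd(1) a]] by simp
  also have "\<dots> = nm R Q X t (res R Q X (gcomp Q u s) a)"
    using nm_base_change[OF Q res_closed[OF Pd(1) a]] res_comp[OF Qd(1) Pd(1) a] by simp
  finally have 2: "res R X Y f (cofactor G R Y g (nm R X Y f a)) = nm R Q X t (res R Q X (gcomp Q u s) a)" .
  show ?thesis
    unfolding 2 cofactor_eq[OF T a] cofactor_eq[OF W a] nm_coproduct[OF c q'(1) rp]
    using res_comp[OF ij(1) p'(1) a] res_comp[OF ij(2) p'(1) a] p' q' by simp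
qed

text \<open>The complement of the relative diagonal is stable under pullback along \<open>g : Y \<rightarrow> Z\<close>.\<close>

lemma cofactor_base_change:
  assumes P: "is_pullback G P X Y Z p q f g" and a: "a \<in> carrier (lev R X)"
  shows "res R P X p (cofactor G R X f a) = cofactor G R P q (res R P X p a)"
proof -
  note Pd = is_pullbackD[OF P]
  have Pb: "bij_betw (\<lambda>w. (p w, q w)) (pts P) {(x, y). x \<in> pts X \<and> y \<in> pts Y \<and> f x = g y}"
    using P by (simp add: is_pullback_def)
  obtain W d1 d2 where W: "is_off_diag G W X f d1 d2" by (rule off_diag_exists[OF Pd(3)])
  note d = is_off_diagD[OF W]
  obtain V v1 v2 where V: "is_pullback G V W P X v1 v2 d2 p" by (rule pullback_exists[OF d(2) Pd(1)])
  note Vd = is_pullbackD[OF V]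
  have Vb: "bij_betw (\<lambda>w. (v1 w, v2 w)) (pts V) {(x, y). x \<in> pts W \<and> y \<in> pts P \<and> d2 x = p y}"
    using V by (simp add: is_pullback_def)
  have dv: "gcomp V d1 v1 \<in> gmaps G V X" and qv: "gcomp V q v2 \<in> gmaps G V Y"
    by (rule gcomp_gmaps[OF Vd(1) d(1)], rule gcomp_gmaps[OF Vd(2) Pd(2)])
  have mem: "v1 z \<in> pts W" "v2 z \<in> pts P" "d2 (v1 z) = p (v2 z)" "d1 (v1 z) \<in> pts X" "d1 (v1 z) \<noteq> d2 (v1 z)"
    "f (d1 (v1 z)) = f (d2 (v1 z))" "f (p (v2 z)) = g (q (v2 z))" "q (v2 z) \<in> pts Y" if z: "z \<in> pts V" for z
  proof -
    have "v1 z \<in> pts W" "v2 z \<in> pts P" "d2 (v1 z) = p (v2 z)" using joint_mem[OF Vb z] by auto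
    then show "v1 z \<in> pts W" "v2 z \<in> pts P" "d2 (v1 z) = p (v2 z)" "d1 (v1 z) \<in> pts X" "d1 (v1 z) \<noteq> d2 (v1 z)"
      "f (d1 (v1 z)) = f (d2 (v1 z))" "f (p (v2 z)) = g (q (v2 z))" "q (v2 z) \<in> pts Y"
      using joint_mem[OF d(3), of "v1 z"] joint_mem[OF Pb, of "v2 z"] by auto
  qed
  \<comment> \<open>A point of \<open>V\<close> is a pair of points of \<open>X\<close> with a point of \<open>P\<close> over the second; \<open>m\<close> lifts the first one.\<close>
  obtain m where m: "m \<in> gmaps G V P" "gcomp V p m = gcomp V d1 v1" "gcomp V q m = gcomp V q v2"
    "\<And>z. z \<in> pts V \<Longrightarrow> p (m z) = gcomp V d1 v1 z" "\<And>z. z \<in> pts V \<Longrightarrow> q (m z) = gcomp V q v2 z"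
    by (rule joint_lift[OF Pd(1,2) Pb dv qv]) (auto simp: mem)
  have mm: "m z \<in> pts P" "p (m z) = d1 (v1 z)" "q (m z) = q (v2 z)" if z: "z \<in> pts V" for z
    using m(4)[OF z] m(5)[OF z] z gmapsD(1)[OF m(1) z] by simp_all
  have "bij_betw (\<lambda>w. (m w, v2 w)) (pts V) {(x, x'). x \<in> pts P \<and> x' \<in> pts P \<and> x \<noteq> x' \<and> q x = q x'}"
  proof (rule bij_betw_imageI)
    show "inj_on (\<lambda>w. (m w, v2 w)) (pts V)"
    proof (rule inj_onI)
      fix z z' assume z: "z \<in> pts V" "z' \<in> pts V" and eq: "(m z, v2 z) = (m z', v2 z')"
      have "d1 (v1 z) = d1 (v1 z')" "d2 (v1 z) = d2 (v1 z')"
        using eq mm(2)[OF z(1)] mm(2)[OF z(2)] mem(3)[OF z(1)] mem(3)[OF z(2)] by auto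
      then have "v1 z = v1 z'" by (rule joint_eqI[OF d(3) mem(1)[OF z(1)] mem(1)[OF z(2)]])
      then show "z = z'" using eq by (intro joint_eqI[OF Vb z]) auto
    qed
    have "(m z, v2 z) \<in> {(x, x'). x \<in> pts P \<and> x' \<in> pts P \<and> x \<noteq> x' \<and> q x = q x'}" if z: "z \<in> pts V" for z
      using mm[OF z] mem[OF z] by auto
    moreover have "(x, x') \<in> (\<lambda>w. (m w, v2 w)) ` pts V"
      if x: "x \<in> pts P" "x' \<in> pts P" "x \<noteq> x'" "q x = q x'" for x x'
    proof -
      have "p x \<noteq> p x'" using joint_eqI[OF Pb x(1,2) _ x(4)] x(3) by blast
      moreover have "f (p x) = f (p x')" "p x \<in> pts X" "p x' \<in> pts X"
        using joint_mem[OF Pb x(1)] joint_mem[OF Pb x(2)] x by auto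
      ultimately obtain w where w: "w \<in> pts W" "d1 w = p x" "d2 w = p x'"
        by (auto intro: joint_point[OF d(3), of "p x" "p x'"])
      obtain z where z: "z \<in> pts V" "v1 z = w" "v2 z = x'"
        by (rule joint_point[OF Vb, of w x']) (use w x in auto)
      have "m z = x" by (rule joint_eqI[OF Pb]) (use mm[OF z(1)] z w x in auto)
      then show ?thesis using z by (intro image_eqI[of _ _ z]) auto
    qed
    ultimately show "(\<lambda>w. (m w, v2 w)) ` pts V = {(x, x'). x \<in> pts P \<and> x' \<in> pts P \<and> x \<noteq> x' \<and> q x = q x'}"
      by auto
  qed
  then have O: "is_off_diag G V P q m v2" using m(1) Vd(2) by (simp add: is_off_diag_def)
  note ra = res_closed[OF d(1) a]
  have "res R P X p (cofactor G R X f a) = nm R V P v2 (res R V W v1 (res R W X d1 a))"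
    using nm_base_change[OF V ra] cofactor_eq[OF W a] by simp
  also have "res R V W v1 (res R W X d1 a) = res R V P m (res R P X p a)"
    using res_comp[OF Vd(1) d(1) a] res_comp[OF m(1) Pd(1) a] m(2) by simp
  finally show ?thesis using cofactor_eq[OF O res_closed[OF Pd(1) a]] by simp
qed

end

lemma tambara_mapD:
  assumes "tambara_map G R Q \<phi>"
  shows "finite_gset G X \<Longrightarrow> \<phi> X \<in> ring_hom (lev R X) (lev Q X)"
    "f \<in> gmaps G X Y \<Longrightarrow> b \<in> carrier (lev R Y) \<Longrightarrow> \<phi> X (res R X Y f b) = res Q X Y f (\<phi> Y b)"
    "f \<in> gmaps G X Y \<Longrightarrow> a \<in> carrier (lev R X) \<Longrightarrow> \<phi> Y (tr R X Y f a) = tr Q X Y f (\<phi> X a)"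
    "f \<in> gmaps G X Y \<Longrightarrow> a \<in> carrier (lev R X) \<Longrightarrow> \<phi> Y (nm R X Y f a) = nm Q X Y f (\<phi> X a)"
    "finite_gset G X \<Longrightarrow> a \<in> carrier (lev R X) \<Longrightarrow> \<phi> X a \<in> carrier (lev Q X)"
  using assms by (auto simp: tambara_map_def intro: ring_hom_closed)

lemma cofactor_tambara_map:
  assumes R: "tambara_functor G R" and Q: "tambara_functor G Q" and \<phi>: "tambara_map G R Q \<phi>"
    and f: "f \<in> gmaps G X Y" and a: "a \<in> carrier (lev R X)"
  shows "\<phi> X (cofactor G R X f a) = cofactor G Q X f (\<phi> X a)"
proof -
  obtain W p q where W: "is_off_diag G W X f p q" by (rule off_diag_exists[OF f])
  note d = is_off_diagD[OF W] and t = tambara_mapD[OF \<phi>]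
  interpret R: tambara_functor G R by (rule R)
  show ?thesis
    using tambara_functor.cofactor_eq[OF R W a] tambara_functor.cofactor_eq[OF Q W t(5)[OF gmaps_gset(1)[OF f] a]]
      t(2)[OF d(1) a] t(4)[OF d(2) R.res_closed[OF d(1) a]] by simp
qed


text \<open>
  The derivative of the exponential formula.  The left side is a norm of a transfer, over the base \<open>A\<close>: at a point \<open>a\<close>
  one multiplies over the fibre of \<open>g\<close> through \<open>h a\<close> with \<open>h a\<close> removed.  Sections of \<open>h\<close> over this
  punctured fibre are the same as sections over the whole fibre with value \<open>a\<close> at \<open>h a\<close>, that is, as points of
  \<open>E\<close> over \<open>a\<close>.  Hence \<open>E \<rightarrow> A\<close> is the dependent product of the new exponential diagram, whose evaluation is defined
  on the complement of the relative diagonal of \<open>g'\<close>.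
\<close>

lemma (in tambara_functor) cofactor_tr:
  assumes ex: "is_exponential G A X Y E D h g e g' h'" and a: "a \<in> carrier (lev R A)"
  shows "res R A X h (cofactor G R X g (tr R A X h a)) = tr R E A e (cofactor G R E g' (res R E A e a))"
proof -
  note ed = is_exponentialD[OF ex]
  define k where "k = gcomp E h e"
  have k: "k \<in> gmaps G E X" unfolding k_def by (rule gcomp_gmaps[OF ed(3,1)])
  have Eb: "bij_betw (\<lambda>w. (k w, g' w)) (pts E) {(x, y). x \<in> pts X \<and> y \<in> pts D \<and> g x = h' y}"
    using ex by (simp add: is_exponential_def is_pullback_def k_def)
  have ke: "k z = h (e z)" if "z \<in> pts E" for z using that by (simp add: k_def)
  have kE: "k z \<in> pts X" "g' z \<in> pts D" "g (k z) = h' (g' z)" "e z \<in> pts A" if "z \<in> pts E" for z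
    using joint_mem[OF Eb that] gmapsD(1)[OF ed(3) that] by auto
  have sec: "\<exists>!d. d \<in> pts D \<and> h' d = y \<and> (\<forall>p\<in>pts E. g' p = d \<longrightarrow> e p = s (h (e p)))"
    if "y \<in> pts Y" "s \<in> (\<Pi>\<^sub>E x\<in>{x \<in> pts X. g x = y}. {a \<in> pts A. h a = x})" for y s
    using ex that by (simp add: is_exponential_def)
  obtain W d1 d2 where W: "is_off_diag G W X g d1 d2" by (rule off_diag_exists[OF ed(2)])
  note d = is_off_diagD[OF W]
  have dW: "d1 w \<in> pts X" "d2 w \<in> pts X" "d1 w \<noteq> d2 w" "g (d1 w) = g (d2 w)" if "w \<in> pts W" for w
    using joint_mem[OF d(3) that] by auto
  \<comment> \<open>A point of \<open>X'\<close> is a point \<open>a\<close> of \<open>A\<close> with another point of the fibre of \<open>g\<close> through \<open>h a\<close>; \<open>A'\<close> is the pullback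
    of \<open>A\<close> to it.\<close>
  obtain X' v1 v2 where X': "is_pullback G X' W A X v1 v2 d2 h" by (rule pullback_exists[OF d(2) ed(1)])
  note Xd = is_pullbackD[OF X']
  have Xb: "bij_betw (\<lambda>w. (v1 w, v2 w)) (pts X') {(x, y). x \<in> pts W \<and> y \<in> pts A \<and> d2 x = h y}"
    using X' by (simp add: is_pullback_def)
  have vX: "v1 w \<in> pts W" "v2 w \<in> pts A" "d2 (v1 w) = h (v2 w)" if "w \<in> pts X'" for w
    using joint_mem[OF Xb that] by auto
  have dv: "gcomp X' d1 v1 \<in> gmaps G X' X" by (rule gcomp_gmaps[OF Xd(1) d(1)])
  obtain A' u1 u2 where A': "is_pullback G A' A X' X u1 u2 h (gcomp X' d1 v1)"
    by (rule pullback_exists[OF ed(1) dv])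
  note Ad = is_pullbackD[OF A']
  have Ab: "bij_betw (\<lambda>w. (u1 w, u2 w)) (pts A') {(x, y). x \<in> pts A \<and> y \<in> pts X' \<and> h x = gcomp X' d1 v1 y}"
    using A' by (simp add: is_pullback_def)
  have uA: "u1 w \<in> pts A" "u2 w \<in> pts X'" "h (u1 w) = d1 (v1 (u2 w))" if "w \<in> pts A'" for w
    using joint_mem[OF Ab that] by auto
  obtain V o1 o2 where V: "is_off_diag G V E g' o1 o2" by (rule off_diag_exists[OF ed(4)])
  note od = is_off_diagD[OF V]
  have oV: "o1 z \<in> pts E" "o2 z \<in> pts E" "o1 z \<noteq> o2 z" "g' (o1 z) = g' (o2 z)" if "z \<in> pts V" for z
    using joint_mem[OF od(3) that] by auto
  have ko: "k (o1 z) \<noteq> k (o2 z)" "g (k (o1 z)) = g (k (o2 z))" if "z \<in> pts V" for z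
    using oV[OF that] joint_eqI[OF Eb oV(1,2)[OF that] _ oV(4)[OF that]] kE(3) by auto
  obtain m1 where m1: "m1 \<in> gmaps G V W" "\<And>z. z \<in> pts V \<Longrightarrow> d1 (m1 z) = gcomp V k o1 z"
    "\<And>z. z \<in> pts V \<Longrightarrow> d2 (m1 z) = gcomp V k o2 z"
    by (rule joint_lift[OF d gcomp_gmaps[OF od(1) k] gcomp_gmaps[OF od(2) k]]) (auto simp: oV kE ko)
  obtain m2 where m2: "m2 \<in> gmaps G V X'" "\<And>z. z \<in> pts V \<Longrightarrow> v1 (m2 z) = m1 z"
    "\<And>z. z \<in> pts V \<Longrightarrow> v2 (m2 z) = gcomp V e o2 z"
    by (rule joint_lift[OF Xd(1,2) Xb m1(1) gcomp_gmaps[OF od(2) ed(3)]])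
      (auto simp: gmapsD(1)[OF m1(1)] m1 oV kE ke)
  obtain m where m: "m \<in> gmaps G V A'" "\<And>z. z \<in> pts V \<Longrightarrow> u1 (m z) = gcomp V e o1 z"
    "\<And>z. z \<in> pts V \<Longrightarrow> u2 (m z) = m2 z" "gcomp V u1 m = gcomp V e o1" "gcomp V u2 m = m2"
    by (rule joint_lift[OF Ad(1,2) Ab gcomp_gmaps[OF od(1) ed(3)] m2(1)])
      (auto simp: gmapsD(1)[OF m2(1)] m1 m2 oV kE ke)
  note mV = gmapsD(1)[OF m(1)] gmapsD(1)[OF m2(1)]
  have ex': "is_exponential G A' X' A V E u2 v2 m o2 e"
    unfolding is_exponential_def
  proof (intro conjI ballI)
    have "bij_betw (\<lambda>w. (gcomp V u2 m w, o2 w)) (pts V) {(x, y). x \<in> pts X' \<and> y \<in> pts E \<and> v2 x = e y}"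
    proof (rule bij_betw_imageI)
      show "inj_on (\<lambda>w. (gcomp V u2 m w, o2 w)) (pts V)"
      proof (rule inj_onI)
        fix z z' assume z: "z \<in> pts V" "z' \<in> pts V" and eq: "(gcomp V u2 m z, o2 z) = (gcomp V u2 m z', o2 z')"
        have "k (o1 z) = k (o1 z')"
          using eq z m(3)[OF z(1)] m(3)[OF z(2)] m2(2)[OF z(1)] m2(2)[OF z(2)] m1(2)[OF z(1)] m1(2)[OF z(2)]
          by simp
        moreover have "g' (o1 z) = g' (o1 z')" using eq oV(4)[OF z(1)] oV(4)[OF z(2)] by simp
        ultimately have "o1 z = o1 z'" by (rule joint_eqI[OF Eb oV(1)[OF z(1)] oV(1)[OF z(2)]])
        then show "z = z'" using eq by (intro joint_eqI[OF od(3) z]) auto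
      qed
      have "(gcomp V u2 m w, o2 w) \<in> {(x, y). x \<in> pts X' \<and> y \<in> pts E \<and> v2 x = e y}" if w: "w \<in> pts V" for w
        using w mV m oV m2 by simp
      moreover have "(x, y) \<in> (\<lambda>w. (gcomp V u2 m w, o2 w)) ` pts V" if x: "x \<in> pts X'" "y \<in> pts E" "v2 x = e y" for x y
      proof -
        note wx = vX[OF x(1)] dW[OF vX(1)[OF x(1)]]
        obtain y' where y': "y' \<in> pts E" "k y' = d1 (v1 x)" "g' y' = g' y"
          by (rule joint_point[OF Eb, of "d1 (v1 x)" "g' y"]) (use wx kE[OF x(2)] ke[OF x(2)] x in auto)
        have "y' \<noteq> y" using y' wx x ke[OF x(2)] by auto
        then obtain z where z: "z \<in> pts V" "o1 z = y'" "o2 z = y"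
          using joint_point[OF od(3), of y' y] y' x by auto
        have "m1 z = v1 x"
          by (rule joint_eqI[OF d(3) gmapsD(1)[OF m1(1) z(1)] wx(1)]) (use m1 z y' wx x ke[OF x(2)] in auto)
        then have "m2 z = x"
          by (intro joint_eqI[OF Xb mV(2)[OF z(1)] x(1)]) (use m2 z x in auto)
        then show ?thesis using z m(3)[OF z(1)] by (intro image_eqI[of _ _ z]) auto
      qed
      ultimately show "(\<lambda>w. (gcomp V u2 m w, o2 w)) ` pts V = {(x, y). x \<in> pts X' \<and> y \<in> pts E \<and> v2 x = e y}"
        by auto
    qed
    then show "is_pullback G V X' E A (gcomp V u2 m) o2 v2 e"
      using gcomp_gmaps[OF m(1) Ad(2)] od(2) Xd(2) ed(3) by (simp add: is_pullback_def)
    fix b s assume b: "b \<in> pts A"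
      and s: "s \<in> (\<Pi>\<^sub>E x\<in>{x \<in> pts X'. v2 x = b}. {a \<in> pts A'. u2 a = x})"
    have s': "s x \<in> pts A'" "u2 (s x) = x" if "x \<in> pts X'" "v2 x = b" for x
      using PiE_mem[OF s, of x] that by auto
    have hb: "h b \<in> pts X" by (rule gmapsD(1)[OF ed(1) b])
    have "\<exists>x'. x' \<in> pts X' \<and> d1 (v1 x') = x \<and> v2 x' = b" if x: "x \<in> pts X" "x \<noteq> h b" "g x = g (h b)" for x
    proof -
      obtain w where w: "w \<in> pts W" "d1 w = x" "d2 w = h b"
        by (rule joint_point[OF d(3), of x "h b"]) (use x hb in auto)
      show ?thesis by (rule joint_point[OF Xb, of w b]) (use w b in auto)
    qed
    note ex_\<xi> = this
    \<comment> \<open>\<open>\<xi> x\<close> is the pair of \<open>b\<close> and \<open>x\<close>, as a point of \<open>X'\<close>.\<close>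
    define \<xi> where "\<xi> x = (SOME x'. x' \<in> pts X' \<and> d1 (v1 x') = x \<and> v2 x' = b)" for x
    have \<xi>: "\<xi> x \<in> pts X' \<and> d1 (v1 (\<xi> x)) = x \<and> v2 (\<xi> x) = b"
      if "x \<in> pts X" "x \<noteq> h b" "g x = g (h b)" for x
      unfolding \<xi>_def by (rule someI_ex[OF ex_\<xi>[OF that]])
    have \<xi>_eq: "x' = \<xi> (d1 (v1 x'))" if x': "x' \<in> pts X'" "v2 x' = b" for x'
    proof -
      note wx = vX[OF x'(1)] dW[OF vX(1)[OF x'(1)]]
      let ?x = "\<xi> (d1 (v1 x'))"
      have 1: "?x \<in> pts X'" "d1 (v1 ?x) = d1 (v1 x')" "v2 ?x = b"
        using \<xi>[of "d1 (v1 x')"] wx x' by auto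
      have "d2 (v1 x') = d2 (v1 ?x)" using vX(3)[OF 1(1)] 1(3) wx(3) x'(2) by simp
      then have "v1 x' = v1 ?x" by (rule joint_eqI[OF d(3) wx(1) vX(1)[OF 1(1)] 1(2)[symmetric]])
      then show ?thesis using 1(3) x'(2) by (intro joint_eqI[OF Xb x'(1) 1(1)]) simp_all
    qed
    \<comment> \<open>\<open>s\<close> is a section away from \<open>h b\<close>; the value \<open>b\<close> at \<open>h b\<close> completes it to a section of the whole fibre.\<close>
    define \<sigma> where "\<sigma> = (\<lambda>x\<in>{x \<in> pts X. g x = g (h b)}. if x = h b then b else u1 (s (\<xi> x)))"
    have \<sigma>: "\<sigma> \<in> (\<Pi>\<^sub>E x\<in>{x \<in> pts X. g x = g (h b)}. {a \<in> pts A. h a = x})"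
    proof (rule PiE_I)
      fix x assume x: "x \<in> {x \<in> pts X. g x = g (h b)}"
      show "\<sigma> x \<in> {a \<in> pts A. h a = x}"
      proof (cases "x = h b")
        case True then show ?thesis using x b by (simp add: \<sigma>_def)
      next
        case False
        have 1: "\<xi> x \<in> pts X'" "d1 (v1 (\<xi> x)) = x" "v2 (\<xi> x) = b" using \<xi>[of x] x False by auto
        show ?thesis using x False uA[OF s'(1)[OF 1(1,3)]] s'(2)[OF 1(1,3)] 1(2) by (simp add: \<sigma>_def)
      qed
    qed (auto simp: \<sigma>_def)
    have gY: "g (h b) \<in> pts Y" by (rule gmapsD(1)[OF ed(2) hb])
    obtain c where c: "c \<in> pts D" "h' c = g (h b)" "\<And>p. p \<in> pts E \<Longrightarrow> g' p = c \<Longrightarrow> e p = \<sigma> (h (e p))"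
      and cu: "\<And>c'. c' \<in> pts D \<and> h' c' = g (h b) \<and> (\<forall>p\<in>pts E. g' p = c' \<longrightarrow> e p = \<sigma> (h (e p))) \<Longrightarrow> c' = c"
      using sec[OF gY \<sigma>] by (elim ex1E) blast
    have ck: "e p = \<sigma> (k p)" if p: "p \<in> pts E" "g' p = c" for p
      unfolding ke[OF p(1)] by (rule c(3)[OF p])
    have \<sigma>b: "\<sigma> (h b) = b" using hb by (simp add: \<sigma>_def)
    have \<sigma>n: "\<sigma> x = u1 (s (\<xi> x))" if "x \<in> pts X" "g x = g (h b)" "x \<noteq> h b" for x
      using that by (simp add: \<sigma>_def)
    obtain \<epsilon> where \<epsilon>: "\<epsilon> \<in> pts E" "k \<epsilon> = h b" "g' \<epsilon> = c"
      by (rule joint_point[OF Eb, of "h b" c]) (use c hb in auto)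

    have mp: "u1 (m p) = e (o1 p)" "u2 (m p) = \<xi> (k (o1 p))" "m p \<in> pts A'" "u2 (m p) \<in> pts X'" "v2 (u2 (m p)) = b"
      if p: "p \<in> pts V" "e (o2 p) = b" for p
    proof -
      show "u1 (m p) = e (o1 p)" "m p \<in> pts A'" using m(2)[OF p(1)] mV(1) p by simp_all
      have 2: "u2 (m p) = m2 p" "m2 p \<in> pts X'" using m(3)[OF p(1)] mV(2)[OF p(1)] by simp_all
      have 3: "v2 (m2 p) = b" "d1 (v1 (m2 p)) = k (o1 p)"
        using m2(3)[OF p(1)] m2(2)[OF p(1)] m1(2)[OF p(1)] p by simp_all
      show "u2 (m p) = \<xi> (k (o1 p))" using \<xi>_eq[OF 2(2) 3(1)] 2(1) 3(2) by simp
      show "u2 (m p) \<in> pts X'" "v2 (u2 (m p)) = b" using 2 3 by simp_all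
    qed
    show "\<exists>!d. d \<in> pts E \<and> e d = b \<and> (\<forall>p\<in>pts V. o2 p = d \<longrightarrow> m p = s (u2 (m p)))"
    proof (rule ex1I[of _ \<epsilon>])
      have eb: "e \<epsilon> = b" unfolding ck[OF \<epsilon>(1,3)] \<epsilon>(2) by (rule \<sigma>b)
      have "m p = s (u2 (m p))" if p: "p \<in> pts V" "o2 p = \<epsilon>" for p
      proof -
        have p2: "e (o2 p) = b" using p eb by simp
        note mp' = mp[OF p(1) p2] and o1 = oV(1)[OF p(1)]
        have "e (o1 p) = \<sigma> (k (o1 p))"
          by (rule ck[OF o1]) (use oV(4)[OF p(1)] p \<epsilon> in simp)
        also have "\<dots> = u1 (s (u2 (m p)))"
          using \<sigma>n[of "k (o1 p)"] kE[OF o1] ko[OF p(1)] p \<epsilon>(2) mp'(2) by simp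
        finally show ?thesis
          using s'[OF mp'(4,5)] mp'(1) by (intro joint_eqI[OF Ab mp'(3) s'(1)[OF mp'(4,5)]]) simp_all
      qed
      then show "\<epsilon> \<in> pts E \<and> e \<epsilon> = b \<and> (\<forall>p\<in>pts V. o2 p = \<epsilon> \<longrightarrow> m p = s (u2 (m p)))"
        using \<epsilon>(1) eb by blast
      fix \<delta> assume \<delta>: "\<delta> \<in> pts E \<and> e \<delta> = b \<and> (\<forall>p\<in>pts V. o2 p = \<delta> \<longrightarrow> m p = s (u2 (m p)))"
      have kd: "k \<delta> = h b" using ke[of \<delta>] \<delta> by simp
      have "e p = \<sigma> (h (e p))" if p: "p \<in> pts E" "g' p = g' \<delta>" for p
      proof (cases "p = \<delta>")
        case True then show ?thesis using \<delta> \<sigma>b by simp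
      next
        case False
        obtain z where z: "z \<in> pts V" "o1 z = p" "o2 z = \<delta>"
          by (rule joint_point[OF od(3), of p \<delta>]) (use p \<delta> False in auto)
        have ez: "e (o2 z) = b" using z \<delta> by simp
        have "m z = s (u2 (m z))" using \<delta> z by blast
        then have "e p = u1 (s (u2 (m z)))" using mp(1)[OF z(1) ez] z(2) by metis
        also have "\<dots> = \<sigma> (k p)"
          using \<sigma>n[of "k p"] mp(2)[OF z(1) ez] ko[OF z(1)] z kd kE(1)[OF p(1)] by simp
        finally show ?thesis using ke[OF p(1)] by simp
      qed
      then have "g' \<delta> = c" using cu[of "g' \<delta>"] kE[of \<delta>] \<delta> kd by simp
      then show "\<delta> = \<epsilon>" using \<delta> kd \<epsilon> by (intro joint_eqI[OF Eb conjunct1[OF \<delta>] \<epsilon>(1)]) simp_all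
    qed
  qed (use Ad Xd m in auto)
  note ta = tr_closed[OF ed(1) a] and ra = res_closed[OF ed(3) a]
  have "res R A X h (cofactor G R X g (tr R A X h a)) = nm R X' A v2 (res R X' X (gcomp X' d1 v1) (tr R A X h a))"
    using nm_base_change[OF X' res_closed[OF d(1) ta]] cofactor_eq[OF W ta] res_comp[OF Xd(1) d(1) ta] by simp
  also have "\<dots> = nm R X' A v2 (tr R A' X' u2 (res R A' A u1 a))"
    using tr_base_change[OF A' a] by simp
  also have "\<dots> = tr R E A e (nm R V E o2 (res R V A' m (res R A' A u1 a)))"
    by (rule nm_tr[OF ex' res_closed[OF Ad(1) a]])
  also have "res R V A' m (res R A' A u1 a) = res R V E o1 (res R E A e a)"
    using res_comp[OF m(1) Ad(1) a] res_comp[OF od(1) ed(3) a] m(4) by simp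
  finally show ?thesis by (simp add: cofactor_eq[OF V ra])
qed

section \<open>The square-zero extension\<close>

text \<open>
  The ring \<open>R \<oplus> M\<close> in which products of elements of \<open>M\<close> vanish.  Its norms are forced by the expansion of
  \<open>N\<^sub>f (a + m)\<close>, in which only the terms of order at most one in \<open>m\<close> survive.
\<close>

definition square_zero :: "('g, 'k) monoid_scheme \<Rightarrow> ('g, 'r) tambara \<Rightarrow> ('g, 'r, 'm) gmodule \<Rightarrow> ('g, 'r \<times> 'm) tambara" where
  "square_zero G R M =
    \<lparr>lev = \<lambda>X. \<lparr>carrier = carrier (lev R X) \<times> carrier (mlev M X),
       mult = \<lambda>(a, m) (b, n). (a \<otimes>\<^bsub>lev R X\<^esub> b, a \<odot>\<^bsub>mlev M X\<^esub> n \<oplus>\<^bsub>mlev M X\<^esub> b \<odot>\<^bsub>mlev M X\<^esub> m),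
       one = (\<one>\<^bsub>lev R X\<^esub>, \<zero>\<^bsub>mlev M X\<^esub>),
       zero = (\<zero>\<^bsub>lev R X\<^esub>, \<zero>\<^bsub>mlev M X\<^esub>),
       add = \<lambda>(a, m) (b, n). (a \<oplus>\<^bsub>lev R X\<^esub> b, m \<oplus>\<^bsub>mlev M X\<^esub> n)\<rparr>,
     res = \<lambda>X Y f (a, m). (res R X Y f a, mres M X Y f m),
     tr = \<lambda>X Y f (a, m). (tr R X Y f a, mtr M X Y f m),
     nm = \<lambda>X Y f (a, m). (nm R X Y f a, mtr M X Y f (cofactor G R X f a \<odot>\<^bsub>mlev M X\<^esub> m))\<rparr>"

lemma square_zero_simps:
  "carrier (lev (square_zero G R M) X) = carrier (lev R X) \<times> carrier (mlev M X)"
  "(a, m) \<otimes>\<^bsub>lev (square_zero G R M) X\<^esub> (b, n) =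
     (a \<otimes>\<^bsub>lev R X\<^esub> b, a \<odot>\<^bsub>mlev M X\<^esub> n \<oplus>\<^bsub>mlev M X\<^esub> b \<odot>\<^bsub>mlev M X\<^esub> m)"
  "\<one>\<^bsub>lev (square_zero G R M) X\<^esub> = (\<one>\<^bsub>lev R X\<^esub>, \<zero>\<^bsub>mlev M X\<^esub>)"
  "\<zero>\<^bsub>lev (square_zero G R M) X\<^esub> = (\<zero>\<^bsub>lev R X\<^esub>, \<zero>\<^bsub>mlev M X\<^esub>)"
  "(a, m) \<oplus>\<^bsub>lev (square_zero G R M) X\<^esub> (b, n) = (a \<oplus>\<^bsub>lev R X\<^esub> b, m \<oplus>\<^bsub>mlev M X\<^esub> n)"
  "res (square_zero G R M) X Y f (a, m) = (res R X Y f a, mres M X Y f m)"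
  "tr (square_zero G R M) X Y f (a, m) = (tr R X Y f a, mtr M X Y f m)"
  "nm (square_zero G R M) X Y f (a, m) = (nm R X Y f a, mtr M X Y f (cofactor G R X f a \<odot>\<^bsub>mlev M X\<^esub> m))"
  by (simp_all add: square_zero_def)

context green_module begin

lemma smult_closed: "\<lbrakk>finite_gset G X; a \<in> carrier (lev R X); m \<in> carrier (mlev M X)\<rbrakk> \<Longrightarrow>
    a \<odot>\<^bsub>mlev M X\<^esub> m \<in> carrier (mlev M X)"
  using module.smult_closed[OF module_lev] by blast

lemma smult_zero: "\<lbrakk>finite_gset G X; a \<in> carrier (lev R X)\<rbrakk> \<Longrightarrow> a \<odot>\<^bsub>mlev M X\<^esub> \<zero>\<^bsub>mlev M X\<^esub> = \<zero>\<^bsub>mlev M X\<^esub>"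
  using module.smult_r_null[OF module_lev] by blast

lemma square_zero_cring:
  assumes X: "finite_gset G X"
  shows "cring (lev (square_zero G R M) X)"
proof -
  interpret m: module "lev R X" "mlev M X" by (rule module_lev[OF X])
  show ?thesis
  proof (rule cringI)
    show "abelian_group (lev (square_zero G R M) X)"
    proof (rule abelian_groupI)
      fix x assume "x \<in> carrier (lev (square_zero G R M) X)"
      then obtain a n where x: "x = (a, n)" "a \<in> carrier (lev R X)" "n \<in> carrier (mlev M X)"
        by (auto simp: square_zero_simps)
      then show "\<exists>y\<in>carrier (lev (square_zero G R M) X). y \<oplus>\<^bsub>lev (square_zero G R M) X\<^esub> x = \<zero>\<^bsub>lev (square_zero G R M) X\<^esub>"
        by (intro bexI[of _ "(\<ominus>\<^bsub>lev R X\<^esub> a, \<ominus>\<^bsub>mlev M X\<^esub> n)"]) (auto simp: square_zero_simps m.R.l_neg m.M.l_neg)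
    qed (auto simp: square_zero_simps m.R.a_ac m.M.a_ac)
    show "comm_monoid (lev (square_zero G R M) X)"
    proof (rule comm_monoidI)
      fix x y z assume "x \<in> carrier (lev (square_zero G R M) X)" "y \<in> carrier (lev (square_zero G R M) X)"
        "z \<in> carrier (lev (square_zero G R M) X)"
      then obtain a n b p c q where xyz: "x = (a, n)" "a \<in> carrier (lev R X)" "n \<in> carrier (mlev M X)"
        "y = (b, p)" "b \<in> carrier (lev R X)" "p \<in> carrier (mlev M X)"
        "z = (c, q)" "c \<in> carrier (lev R X)" "q \<in> carrier (mlev M X)"
        by (auto simp: square_zero_simps)
      have 1: "c \<odot>\<^bsub>mlev M X\<^esub> (a \<odot>\<^bsub>mlev M X\<^esub> p) = a \<odot>\<^bsub>mlev M X\<^esub> (c \<odot>\<^bsub>mlev M X\<^esub> p)"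
        using xyz by (simp add: m.smult_assoc1[symmetric] m.R.m_comm)
      have 2: "(b \<otimes>\<^bsub>lev R X\<^esub> c) \<odot>\<^bsub>mlev M X\<^esub> n = c \<odot>\<^bsub>mlev M X\<^esub> (b \<odot>\<^bsub>mlev M X\<^esub> n)"
        using xyz by (simp add: m.smult_assoc1[symmetric] m.R.m_comm)
      show "x \<otimes>\<^bsub>lev (square_zero G R M) X\<^esub> y \<otimes>\<^bsub>lev (square_zero G R M) X\<^esub> z =
          x \<otimes>\<^bsub>lev (square_zero G R M) X\<^esub> (y \<otimes>\<^bsub>lev (square_zero G R M) X\<^esub> z)"
        using xyz by (simp add: square_zero_simps m.R.m_assoc m.smult_r_distr 1 2 m.smult_assoc1[of a b q] m.M.a_assoc)
    qed (auto simp: square_zero_simps m.R.m_comm m.M.a_comm)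
  next
    fix x y z assume "x \<in> carrier (lev (square_zero G R M) X)" "y \<in> carrier (lev (square_zero G R M) X)"
        "z \<in> carrier (lev (square_zero G R M) X)"
    then obtain a n b p c q where xyz: "x = (a, n)" "a \<in> carrier (lev R X)" "n \<in> carrier (mlev M X)"
        "y = (b, p)" "b \<in> carrier (lev R X)" "p \<in> carrier (mlev M X)"
        "z = (c, q)" "c \<in> carrier (lev R X)" "q \<in> carrier (mlev M X)"
        by (auto simp: square_zero_simps)
    then show "(x \<oplus>\<^bsub>lev (square_zero G R M) X\<^esub> y) \<otimes>\<^bsub>lev (square_zero G R M) X\<^esub> z =
        x \<otimes>\<^bsub>lev (square_zero G R M) X\<^esub> z \<oplus>\<^bsub>lev (square_zero G R M) X\<^esub> y \<otimes>\<^bsub>lev (square_zero G R M) X\<^esub> z"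
      by (simp add: square_zero_simps m.R.l_distr m.smult_l_distr m.smult_r_distr m.M.a_ac)
  qed
qed

end

text \<open>
  Each axiom for norms is an identity for cofactors: multiplicativity is \<open>R\<^sub>f N\<^sub>f a = a \<cdot> cofactor a\<close> (\<open>res_nm\<close>),
  functoriality is the chain rule \<open>cofactor_comp\<close>, base change is \<open>cofactor_base_change\<close>, and the exponential
  relation is \<open>cofactor_tr\<close>.  Except for base change, Frobenius reciprocity in \<open>M\<close> moves a scalar past a transfer.
\<close>

theorem square_zero_tambara:
  fixes G :: "('g, 'k) monoid_scheme"
  assumes R: "tambara_functor G R" and M: "green_module G R M"
  shows "tambara_functor G (square_zero G R M)"
proof -
  interpret R: tambara_functor G R by (rule R)
  interpret M: green_module G R M by (rule M)
  let ?Q = "square_zero G R M"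
  note sz = square_zero_simps
  have Rm: "cring (lev R X)" "module (lev R X) (mlev M X)" if "finite_gset G X" for X
    using R.cring_lev[OF that] M.module_lev[OF that] by auto
  have ab: "abelian_group (lev ?Q X)" if "finite_gset G X" for X
    using M.square_zero_cring[OF that] by (simp add: cring_def ring_def)
  have rh: "res ?Q X Y f \<in> ring_hom (lev ?Q Y) (lev ?Q X)" if f: "f \<in> gmaps G X Y" for X Y f
  proof (rule ring_hom_memI)
    show "res ?Q X Y f \<one>\<^bsub>lev ?Q Y\<^esub> = \<one>\<^bsub>lev ?Q X\<^esub>" by (simp add: sz R.res_one[OF f] M.res_zero[OF f])
  qed (auto simp: sz R.res_closed[OF f] M.res_closed[OF f] R.res_mult[OF f] R.res_add[OF f] M.res_add[OF f]
      M.res_smult[OF f] M.smult_closed[OF gmaps_gset(2)[OF f]])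
  have th: "tr ?Q X Y f \<in> hom (add_monoid (lev ?Q X)) (add_monoid (lev ?Q Y))" if f: "f \<in> gmaps G X Y" for X Y f
    by (rule homI) (auto simp: sz R.tr_closed[OF f] M.tr_closed[OF f] R.tr_add[OF f] M.tr_add[OF f])
  have ra: "res ?Q X Y f \<in> hom (add_monoid (lev ?Q Y)) (add_monoid (lev ?Q X))" if f: "f \<in> gmaps G X Y" for X Y f
    by (rule ring_hom_add_hom[OF rh[OF f]])
  have bc: "res ?Q Y Z g (tr ?Q X Z f a) = tr ?Q P Y q (res ?Q P X p a)"
    if "is_pullback G P X Y Z p q f g" "a \<in> carrier (lev ?Q X)" for P X Y Z p q f g a
    using R.tr_base_change[OF that(1)] M.tr_base_change[OF that(1)] that(2) by (auto simp: sz)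
  have em: "carrier (lev ?Q X) = {\<zero>\<^bsub>lev ?Q X\<^esub>}" if "finite_gset G X" "pts X = {}" for X
    using R.empty_lev[OF that] M.empty_lev[OF that] by (simp add: sz)
  have ids: "res ?Q X X (gid X) a = a" "tr ?Q X X (gid X) a = a" if "finite_gset G X" "a \<in> carrier (lev ?Q X)" for X a
    using that R.res_id[OF that(1)] M.res_id[OF that(1)] R.tr_id[OF that(1)] M.tr_id[OF that(1)] by (auto simp: sz)
  have nmc: "nm ?Q X Y f a \<in> carrier (lev ?Q Y)" if f: "f \<in> gmaps G X Y" and a: "a \<in> carrier (lev ?Q X)" for X Y f a
    using a by (auto simp: sz R.nm_closed[OF f] intro!: M.tr_closed[OF f] M.smult_closed[OF gmaps_gset(1)[OF f]]
        R.cofactor_closed[OF f])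
  show ?thesis
  proof (intro tambara_functor.intro mackey_functor.intro tambara_functor_axioms.intro)
    fix X1 X2 X j1 j2 assume c: "is_coproduct G X1 X2 X j1 j2"
    show "bij_betw (\<lambda>a. (res ?Q X1 X j1 a, res ?Q X2 X j2 a)) (carrier (lev ?Q X)) (carrier (lev ?Q X1) \<times> carrier (lev ?Q X2))"
    proof (rule coproduct_levI[where t = "tr ?Q" and G = G, OF R.group_G _ _ _ _ _ _ _ c])
      fix X Y :: "'g gset" and f assume f: "f \<in> gmaps G X Y"
      show "res ?Q X Y f \<in> hom (add_monoid (lev ?Q Y)) (add_monoid (lev ?Q X))" by (rule ra[OF f])
      show "tr ?Q X Y f \<in> hom (add_monoid (lev ?Q X)) (add_monoid (lev ?Q Y))" by (rule th[OF f])
    next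
      fix P X Y Z :: "'g gset" and p q f g a
      assume "is_pullback G P X Y Z p q f g" "a \<in> carrier (lev ?Q X)"
      then show "res ?Q Y Z g (tr ?Q X Z f a) = tr ?Q P Y q (res ?Q P X p a)" by (rule bc)
    next
      fix a b assume "a \<in> carrier (lev ?Q X)" "b \<in> carrier (lev ?Q X)"
        "res ?Q X1 X j1 a = res ?Q X1 X j1 b" "res ?Q X2 X j2 a = res ?Q X2 X j2 b"
      then show "a = b" by (auto simp: sz intro: R.coproduct_eqI[OF c] M.coproduct_eqI[OF c])
    qed (simp_all add: ab ids em)
  next
    fix X Y Z :: "'g gset" and f g a
    assume f: "f \<in> gmaps G X Y" and g: "g \<in> gmaps G Y Z"
    show "res ?Q X Z (gcomp X g f) a = res ?Q X Y f (res ?Q Y Z g a)" if "a \<in> carrier (lev ?Q Z)"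
      using that by (auto simp: sz R.res_comp[OF f g] M.res_comp[OF f g])
    show "tr ?Q X Z (gcomp X g f) a = tr ?Q Y Z g (tr ?Q X Y f a)" if "a \<in> carrier (lev ?Q X)"
      using that by (auto simp: sz R.tr_comp[OF f g] M.tr_comp[OF f g])
    show "nm ?Q X Z (gcomp X g f) a = nm ?Q Y Z g (nm ?Q X Y f a)" if a: "a \<in> carrier (lev ?Q X)"
    proof -
      obtain b m where bm: "a = (b, m)" "b \<in> carrier (lev R X)" "m \<in> carrier (mlev M X)" using a by (auto simp: sz)
      note X = gmaps_gset(1)[OF f] and Y = gmaps_gset(2)[OF f]
      interpret m: module "lev R X" "mlev M X" by (rule Rm[OF X])
      let ?c = "cofactor G R X f b" and ?c' = "cofactor G R Y g (nm R X Y f b)"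
      have cl: "?c \<in> carrier (lev R X)" "?c' \<in> carrier (lev R Y)"
        using bm by (auto intro!: R.cofactor_closed[OF f] R.cofactor_closed[OF g] R.nm_closed[OF f])
      have cm: "?c \<odot>\<^bsub>mlev M X\<^esub> m \<in> carrier (mlev M X)" using cl bm by simp
      note rc = R.res_closed[OF f cl(2)]
      have "mtr M X Z (gcomp X g f) (cofactor G R X (gcomp X g f) b \<odot>\<^bsub>mlev M X\<^esub> m) =
          mtr M Y Z g (mtr M X Y f ((?c \<otimes>\<^bsub>lev R X\<^esub> res R X Y f ?c') \<odot>\<^bsub>mlev M X\<^esub> m))"
        using bm cl rc by (simp add: M.tr_comp[OF f g] R.cofactor_comp[OF f g])
      also have "(?c \<otimes>\<^bsub>lev R X\<^esub> res R X Y f ?c') \<odot>\<^bsub>mlev M X\<^esub> m = res R X Y f ?c' \<odot>\<^bsub>mlev M X\<^esub> (?c \<odot>\<^bsub>mlev M X\<^esub> m)"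
        using bm cl rc by (simp add: m.smult_assoc1[symmetric] m.R.m_comm)
      also have "mtr M X Y f \<dots> = ?c' \<odot>\<^bsub>mlev M Y\<^esub> mtr M X Y f (?c \<odot>\<^bsub>mlev M X\<^esub> m)"
        by (rule M.frobenius_right[OF f cl(2) cm])
      finally show ?thesis using bm by (simp add: sz R.nm_comp[OF f g])
    qed
  next
    fix X Y :: "'g gset" and f assume f: "f \<in> gmaps G X Y"
    note X = gmaps_gset(1)[OF f] and Y = gmaps_gset(2)[OF f]
    interpret m: module "lev R X" "mlev M X" by (rule Rm[OF X])
    interpret n: module "lev R Y" "mlev M Y" by (rule Rm[OF Y])
    show "res ?Q X Y f \<in> hom (add_monoid (lev ?Q Y)) (add_monoid (lev ?Q X))" by (rule ra[OF f])
    show "res ?Q X Y f \<in> ring_hom (lev ?Q Y) (lev ?Q X)" by (rule rh[OF f])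
    show "tr ?Q X Y f \<in> hom (add_monoid (lev ?Q X)) (add_monoid (lev ?Q Y))" by (rule th[OF f])
    show "nm ?Q X Y f \<one>\<^bsub>lev ?Q X\<^esub> = \<one>\<^bsub>lev ?Q Y\<^esub>"
      using R.cofactor_closed[OF f, of "\<one>\<^bsub>lev R X\<^esub>"] by (simp add: sz R.nm_one[OF f] M.tr_zero[OF f])
    show "nm ?Q X Y f \<in> hom (lev ?Q X) (lev ?Q Y)"
    proof (rule homI)
      fix x y assume "x \<in> carrier (lev ?Q X)" "y \<in> carrier (lev ?Q X)"
      then obtain a p b q where xy: "x = (a, p)" "a \<in> carrier (lev R X)" "p \<in> carrier (mlev M X)"
          "y = (b, q)" "b \<in> carrier (lev R X)" "q \<in> carrier (mlev M X)"
        by (auto simp: sz)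
      have key: "mtr M X Y f ((cofactor G R X f a \<otimes>\<^bsub>lev R X\<^esub> cofactor G R X f b) \<odot>\<^bsub>mlev M X\<^esub> (a \<odot>\<^bsub>mlev M X\<^esub> q)) =
          nm R X Y f a \<odot>\<^bsub>mlev M Y\<^esub> mtr M X Y f (cofactor G R X f b \<odot>\<^bsub>mlev M X\<^esub> q)"
        if a: "a \<in> carrier (lev R X)" and b: "b \<in> carrier (lev R X)" and q: "q \<in> carrier (mlev M X)" for a b q
      proof -
        let ?a = "cofactor G R X f a" and ?b = "cofactor G R X f b"
        note cl = R.cofactor_closed[OF f a] R.cofactor_closed[OF f b]
        have cq: "?b \<odot>\<^bsub>mlev M X\<^esub> q \<in> carrier (mlev M X)" using cl q by simp
        have "(?a \<otimes>\<^bsub>lev R X\<^esub> ?b) \<odot>\<^bsub>mlev M X\<^esub> (a \<odot>\<^bsub>mlev M X\<^esub> q) = (a \<otimes>\<^bsub>lev R X\<^esub> ?a) \<odot>\<^bsub>mlev M X\<^esub> (?b \<odot>\<^bsub>mlev M X\<^esub> q)"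
          using cl a q by (simp add: m.smult_assoc1[symmetric] m.R.m_ac)
        then show ?thesis
          using M.frobenius_right[OF f R.nm_closed[OF f a] cq] R.res_nm[OF f a] by simp
      qed
      let ?a = "cofactor G R X f a" and ?b = "cofactor G R X f b"
      note cl = R.cofactor_closed[OF f xy(2)] R.cofactor_closed[OF f xy(5)]
      have "mtr M X Y f (cofactor G R X f (a \<otimes>\<^bsub>lev R X\<^esub> b) \<odot>\<^bsub>mlev M X\<^esub> (a \<odot>\<^bsub>mlev M X\<^esub> q \<oplus>\<^bsub>mlev M X\<^esub> b \<odot>\<^bsub>mlev M X\<^esub> p)) =
          mtr M X Y f ((?a \<otimes>\<^bsub>lev R X\<^esub> ?b) \<odot>\<^bsub>mlev M X\<^esub> (a \<odot>\<^bsub>mlev M X\<^esub> q)) \<oplus>\<^bsub>mlev M Y\<^esub>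
          mtr M X Y f ((?b \<otimes>\<^bsub>lev R X\<^esub> ?a) \<odot>\<^bsub>mlev M X\<^esub> (b \<odot>\<^bsub>mlev M X\<^esub> p))"
        using xy cl by (simp add: R.cofactor_mult[OF f] m.smult_r_distr M.tr_add[OF f] m.R.m_comm)
      then show "nm ?Q X Y f (x \<otimes>\<^bsub>lev ?Q X\<^esub> y) = nm ?Q X Y f x \<otimes>\<^bsub>lev ?Q Y\<^esub> nm ?Q X Y f y"
        using xy by (simp add: sz R.nm_mult[OF f] key)
    qed (rule nmc[OF f])
  next
    fix X :: "'g gset" assume X: "finite_gset G X"
    interpret m: module "lev R X" "mlev M X" by (rule Rm[OF X])
    show "cring (lev ?Q X)" by (rule M.square_zero_cring[OF X])
    show "abelian_group (lev ?Q X)" by (rule ab[OF X])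
    show "carrier (lev ?Q X) = {\<zero>\<^bsub>lev ?Q X\<^esub>}" if "pts X = {}" by (rule em[OF X that])
    fix a assume a: "a \<in> carrier (lev ?Q X)"
    show "res ?Q X X (gid X) a = a" "tr ?Q X X (gid X) a = a" by (rule ids[OF X a])+
    have "inj_on (gid X) (pts X)" by (simp add: inj_on_def)
    then show "nm ?Q X X (gid X) a = a"
      using a by (auto simp: sz R.nm_id[OF X] R.cofactor_inj[OF gid_gmaps[OF X]] M.tr_id[OF X])
  next
    fix P X Y Z :: "'g gset" and p q f g a
    assume pb: "is_pullback G P X Y Z p q f g" and a: "a \<in> carrier (lev ?Q X)"
    show "res ?Q Y Z g (tr ?Q X Z f a) = tr ?Q P Y q (res ?Q P X p a)" by (rule bc[OF pb a])
    note d = is_pullbackD[OF pb]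
    obtain b m where bm: "a = (b, m)" "b \<in> carrier (lev R X)" "m \<in> carrier (mlev M X)" using a by (auto simp: sz)
    note cb = R.cofactor_closed[OF d(3) bm(2)]
    show "res ?Q Y Z g (nm ?Q X Z f a) = nm ?Q P Y q (res ?Q P X p a)"
      using bm R.nm_base_change[OF pb bm(2)]
        M.tr_base_change[OF pb M.smult_closed[OF gmaps_gset(1)[OF d(3)] cb bm(3)]]
        M.res_smult[OF d(1) cb bm(3)] R.cofactor_base_change[OF pb bm(2)] by (simp add: sz)
  next
    fix A X Y E D :: "'g gset" and h g e g' h' a
    assume ex: "is_exponential G A X Y E D h g e g' h'" and a: "a \<in> carrier (lev ?Q A)"
    note d = is_exponentialD[OF ex]
    obtain b m where bm: "a = (b, m)" "b \<in> carrier (lev R A)" "m \<in> carrier (mlev M A)" using a by (auto simp: sz)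
    note gA = gmaps_gset(1)[OF d(1)] and gE = gmaps_gset(1)[OF d(3)]
    let ?c = "cofactor G R E g' (res R E A e b)" and ?C = "cofactor G R X g (tr R A X h b)"
    note rb = R.res_closed[OF d(3) bm(2)] and tb = R.tr_closed[OF d(1) bm(2)]
    have cl: "?c \<in> carrier (lev R E)" "?C \<in> carrier (lev R X)"
      by (rule R.cofactor_closed[OF d(4) rb], rule R.cofactor_closed[OF d(2) tb])
    have hC: "res R A X h ?C \<in> carrier (lev R A)" by (rule R.res_closed[OF d(1) cl(2)])
    have cm: "?c \<odot>\<^bsub>mlev M E\<^esub> mres M E A e m \<in> carrier (mlev M E)"
      by (rule M.smult_closed[OF gE cl(1) M.res_closed[OF d(3) bm(3)]])
    have Cm: "res R A X h ?C \<odot>\<^bsub>mlev M A\<^esub> m \<in> carrier (mlev M A)" by (rule M.smult_closed[OF gA hC bm(3)])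
    have pb: "is_pullback G E X D Y (gcomp E h e) g' g h'" using ex by (simp add: is_exponential_def)
    have "gcomp E (gcomp A g h) e = gcomp E h' g'"
      using is_pullback_commute[OF pb] gcomp_assoc[OF d(3), of g h] by simp
    then have tt: "mtr M D Y h' (mtr M E D g' z) = mtr M X Y g (mtr M A X h (mtr M E A e z))"
      if z: "z \<in> carrier (mlev M E)" for z
      using M.tr_comp[OF d(4,5) z] M.tr_comp[OF d(3) gcomp_gmaps[OF d(1,2)] z] M.tr_comp[OF d(1,2) M.tr_closed[OF d(3) z]]
      by simp
    have "mtr M X Y g (?C \<odot>\<^bsub>mlev M X\<^esub> mtr M A X h m) = mtr M X Y g (mtr M A X h (res R A X h ?C \<odot>\<^bsub>mlev M A\<^esub> m))"
      using M.frobenius_right[OF d(1) cl(2) bm(3)] by simp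
    also have "res R A X h ?C \<odot>\<^bsub>mlev M A\<^esub> m = mtr M E A e (?c \<odot>\<^bsub>mlev M E\<^esub> mres M E A e m)"
      using R.cofactor_tr[OF ex bm(2)] M.frobenius_left[OF d(3) cl(1) bm(3)] by simp
    also have "mtr M X Y g (mtr M A X h \<dots>) = mtr M D Y h' (mtr M E D g' (?c \<odot>\<^bsub>mlev M E\<^esub> mres M E A e m))"
      by (rule tt[OF cm, symmetric])
    finally show "nm ?Q X Y g (tr ?Q A X h a) = tr ?Q D Y h' (nm ?Q E D g' (res ?Q E A e a))"
      using bm R.nm_tr[OF ex bm(2)] by (simp add: sz)
  qed (use R.group_G R.finite_G in simp_all)
qed


section \<open>Norms are determined by the norms between orbits\<close>

lemma coset_pt_eqD:
  assumes "group G" "finite (carrier G)" "subgroup H G" "g \<in> carrier G" "g' \<in> carrier G"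
    and eq: "coset_pt (g <#\<^bsub>G\<^esub> H) = coset_pt (g' <#\<^bsub>G\<^esub> H)"
  obtains h where "h \<in> H" "g = g' \<otimes>\<^bsub>G\<^esub> h"
proof -
  interpret group G by fact
  note H = subgroup.subset[OF assms(3)]
  have "g <#\<^bsub>G\<^esub> H = g' <#\<^bsub>G\<^esub> H"
    using eq finite_lcos[OF assms(1,2) H] elts_coset_pt by metis
  moreover have "g \<in> g <#\<^bsub>G\<^esub> H"
    using subgroup.one_closed[OF assms(3)] assms(4) by (force simp: l_coset_def)
  ultimately show thesis using that by (auto simp: l_coset_def)
qed

lemma orbit_map:
  fixes G :: "('g, 'k) monoid_scheme" and X :: "'g gset"
  assumes fin: "finite (carrier G)" and X: "finite_gset G X" and x: "x \<in> pts X"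
  defines "H \<equiv> stabilizer G (act X) x"
  obtains i where "subgroup H G" "i \<in> gmaps G (orbit_set G H) X" "inj_on i (pts (orbit_set G H))"
    "\<forall>g\<in>carrier G. i (coset_pt (g <#\<^bsub>G\<^esub> H)) = act X g x"
proof -
  interpret group_action G "pts X" "act X" using X by (simp add: finite_gset_def)
  note D = finite_gsetD[OF X]
  interpret group G by (rule D(1))
  have H: "subgroup H G" unfolding H_def by (rule stabilizer_subgroup[OF x])
  have stab: "h \<in> H \<longleftrightarrow> h \<in> carrier G \<and> act X h x = x" for h by (auto simp: H_def stabilizer_def)
  note Hc = subgroup.subset[OF H] and pts = orbit_pts[OF D(1) fin, of H]
  define i where "i = (\<lambda>c\<in>pts (orbit_set G H). act X (SOME g. g \<in> carrier G \<and> c = coset_pt (g <#\<^bsub>G\<^esub> H)) x)"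
  have i: "i (coset_pt (g <#\<^bsub>G\<^esub> H)) = act X g x" if g: "g \<in> carrier G" for g
  proof -
    define g' where "g' = (SOME g'. g' \<in> carrier G \<and> coset_pt (g <#\<^bsub>G\<^esub> H) = coset_pt (g' <#\<^bsub>G\<^esub> H))"
    have g': "g' \<in> carrier G" "coset_pt (g <#\<^bsub>G\<^esub> H) = coset_pt (g' <#\<^bsub>G\<^esub> H)"
      using someI[of "\<lambda>g'. g' \<in> carrier G \<and> coset_pt (g <#\<^bsub>G\<^esub> H) = coset_pt (g' <#\<^bsub>G\<^esub> H)" g] g
      by (auto simp: g'_def)
    obtain h where h: "h \<in> H" "g = g' \<otimes>\<^bsub>G\<^esub> h" by (rule coset_pt_eqD[OF D(1) fin H g g'])
    then have "act X g x = act X g' x" using D(5)[OF g'(1), of h x] x stab[of h] by simp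
    then show ?thesis using g by (auto simp: i_def pts g'_def)
  qed
  show thesis
  proof (rule that[OF H _ _ ballI[OF i]])
    show "i \<in> gmaps G (orbit_set G H) X"
    proof (rule gmapsI[OF orbit_set_gset[OF D(1) fin H] X])
      show "i c \<in> pts X" if "c \<in> pts (orbit_set G H)" for c using that D(3) x by (auto simp: pts i)
      fix g c assume "g \<in> carrier G" "c \<in> pts (orbit_set G H)"
      then show "i (act (orbit_set G H) g c) = act X g (i c)"
        using D(5) x by (auto simp: pts orbit_act[OF D(1) fin Hc] i)
    qed (simp add: i_def)
    show "inj_on i (pts (orbit_set G H))"
    proof (rule inj_onI)
      fix c c' assume c: "c \<in> pts (orbit_set G H)" "c' \<in> pts (orbit_set G H)" and eq: "i c = i c'"
      obtain g g' where g: "g \<in> carrier G" "c = coset_pt (g <#\<^bsub>G\<^esub> H)" "g' \<in> carrier G" "c' = coset_pt (g' <#\<^bsub>G\<^esub> H)"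
        using c by (auto simp: pts)
      have "act X (inv\<^bsub>G\<^esub> g \<otimes>\<^bsub>G\<^esub> g') x = act X (inv\<^bsub>G\<^esub> g) (act X g x)"
        using D(5) g eq x i by simp
      also have "\<dots> = act X (inv\<^bsub>G\<^esub> g \<otimes>\<^bsub>G\<^esub> g) x" by (rule D(5)[symmetric]) (use g x in auto)
      finally have "inv\<^bsub>G\<^esub> g \<otimes>\<^bsub>G\<^esub> g' \<in> H" using g x D(4) by (simp add: stab)
      then have "(inv\<^bsub>G\<^esub> g \<otimes>\<^bsub>G\<^esub> g') <#\<^bsub>G\<^esub> H = H" by (intro coset_join3[OF _ H]) (use Hc in auto)
      then have "g <#\<^bsub>G\<^esub> ((inv\<^bsub>G\<^esub> g \<otimes>\<^bsub>G\<^esub> g') <#\<^bsub>G\<^esub> H) = g <#\<^bsub>G\<^esub> H" by simp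
      moreover have "g <#\<^bsub>G\<^esub> ((inv\<^bsub>G\<^esub> g \<otimes>\<^bsub>G\<^esub> g') <#\<^bsub>G\<^esub> H) = g' <#\<^bsub>G\<^esub> H"
        using g Hc by (simp add: lcos_m_assoc m_assoc[symmetric])
      ultimately show "c = c'" using g by simp
    qed
  qed
qed

text \<open>
  Split an orbit \<open>G/H\<close> off \<open>X\<close>.  The restriction of \<open>f : X \<rightarrow> Y\<close> to it is the projection
  \<open>G/H \<rightarrow> G/K\<close> of stabilisers followed by an injection \<open>G/K \<rightarrow> Y\<close>; norms along injections are given by
  extension by \<open>1\<close> and are respected by any ring maps compatible with restrictions, and the norm of a
  disjoint union is a product.
\<close>

lemma tambara_map_orbitsI:
  fixes G :: "('g, 'k) monoid_scheme"
  assumes R: "tambara_functor G R" and Q: "tambara_functor G Q"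
    and hom: "\<And>X. finite_gset G X \<Longrightarrow> \<delta> X \<in> ring_hom (lev R X) (lev Q X)"
    and res: "\<And>X Y f b. \<lbrakk>f \<in> gmaps G X Y; b \<in> carrier (lev R Y)\<rbrakk> \<Longrightarrow> \<delta> X (res R X Y f b) = res Q X Y f (\<delta> Y b)"
    and tr: "\<And>X Y f a. \<lbrakk>f \<in> gmaps G X Y; a \<in> carrier (lev R X)\<rbrakk> \<Longrightarrow> \<delta> Y (tr R X Y f a) = tr Q X Y f (\<delta> X a)"
    and orb: "\<And>H K a. \<lbrakk>subgroup H G; subgroup K G; H \<subseteq> K; a \<in> carrier (lev R (orbit_set G H))\<rbrakk> \<Longrightarrow>
      \<delta> (orbit_set G K) (nm R (orbit_set G H) (orbit_set G K) (orbit_proj G H K) a) =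
      nm Q (orbit_set G H) (orbit_set G K) (orbit_proj G H K) (\<delta> (orbit_set G H) a)"
  shows "tambara_map G R Q \<delta>"
proof -
  interpret R: tambara_functor G R by (rule R)
  interpret Q: tambara_functor G Q by (rule Q)
  interpret group G by (rule R.group_G)
  have cl: "\<delta> X a \<in> carrier (lev Q X)" if "finite_gset G X" "a \<in> carrier (lev R X)" for X a
    using ring_hom_closed[OF hom] that by blast
  have one: "\<delta> X \<one>\<^bsub>lev R X\<^esub> = \<one>\<^bsub>lev Q X\<^esub>" if "finite_gset G X" for X
    by (rule ring_hom_one[OF hom[OF that]])
  have mult: "\<delta> X (a \<otimes>\<^bsub>lev R X\<^esub> b) = \<delta> X a \<otimes>\<^bsub>lev Q X\<^esub> \<delta> X b"
    if "finite_gset G X" "a \<in> carrier (lev R X)" "b \<in> carrier (lev R X)" for X a b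
    by (rule ring_hom_mult[OF hom[OF that(1)] that(2,3)])
  have inj: "\<delta> Y (nm R Z Y m a) = nm Q Z Y m (\<delta> Z a)"
    if m: "m \<in> gmaps G Z Y" "inj_on m (pts Z)" and a: "a \<in> carrier (lev R Z)" for Z Y m a
  proof -
    obtain W w where c: "is_coproduct G Z W Y m w" by (rule complement_coproduct[OF m])
    note w = is_coproductD(2)[OF c] and gs = gmaps_gset[OF m(1)]
    note ca = cl[OF gs(1) a] and na = R.nm_closed[OF m(1) a]
    show ?thesis
    proof (rule Q.coproduct_eqI[OF c])
      show "\<delta> Y (nm R Z Y m a) \<in> carrier (lev Q Y)" "nm Q Z Y m (\<delta> Z a) \<in> carrier (lev Q Y)"
        by (rule cl[OF gs(2) na], rule Q.nm_closed[OF m(1) ca])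
      show "res Q Z Y m (\<delta> Y (nm R Z Y m a)) = res Q Z Y m (nm Q Z Y m (\<delta> Z a))"
        using res[OF m(1) na] R.res_nm_coproduct(1)[OF c a] Q.res_nm_coproduct(1)[OF c ca] by simp
      show "res Q W Y w (\<delta> Y (nm R Z Y m a)) = res Q W Y w (nm Q Z Y m (\<delta> Z a))"
        using res[OF w na] R.res_nm_coproduct(2)[OF c a] Q.res_nm_coproduct(2)[OF c ca]
          one[OF gmaps_gset(1)[OF w]] by simp
    qed
  qed
  have nm: "\<delta> Y (nm R X Y f a) = nm Q X Y f (\<delta> X a)"
    if "f \<in> gmaps G X Y" "a \<in> carrier (lev R X)" for X Y f a
    using that
  proof (induction "card (pts X)" arbitrary: X f a rule: less_induct)
    case less
    note f = less.prems(1) and a = less.prems(2)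
    note X = gmaps_gset(1)[OF f] and Y = gmaps_gset(2)[OF f]
    note ca = cl[OF X a]
    show ?case
    proof (cases "pts X = {}")
      case True
      then show ?thesis
        using R.nm_empty[OF f True a] Q.nm_empty[OF f True ca] one[OF Y] by simp
    next
      case False
      then obtain x where x: "x \<in> pts X" by blast
      define H where "H = stabilizer G (act X) x"
      define K where "K = stabilizer G (act Y) (f x)"
      obtain i where i: "subgroup H G" "i \<in> gmaps G (orbit_set G H) X" "inj_on i (pts (orbit_set G H))"
        "\<forall>g\<in>carrier G. i (coset_pt (g <#\<^bsub>G\<^esub> H)) = act X g x"
        by (rule orbit_map[OF R.finite_G X x, folded H_def])
      obtain m where m: "subgroup K G" "m \<in> gmaps G (orbit_set G K) Y" "inj_on m (pts (orbit_set G K))"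
        "\<forall>g\<in>carrier G. m (coset_pt (g <#\<^bsub>G\<^esub> K)) = act Y g (f x)"
        by (rule orbit_map[OF R.finite_G Y gmapsD(1)[OF f x], folded K_def])
      have HK: "H \<subseteq> K"
        using gmapsD(3)[OF f _ x] by (auto simp: H_def K_def stabilizer_def) metis
      note pr = orbit_proj[OF R.group_G R.finite_G i(1) m(1) HK]
      have fi: "gcomp (orbit_set G H) f i = gcomp (orbit_set G H) m (orbit_proj G H K)"
      proof (rule gmaps_eqI[OF gcomp_gmaps[OF i(2) f] gcomp_gmaps[OF pr(1) m(2)]])
        fix c assume "c \<in> pts (orbit_set G H)"
        then show "gcomp (orbit_set G H) f i c = gcomp (orbit_set G H) m (orbit_proj G H K) c"
          using gmapsD(3)[OF f _ x] by (auto simp: orbit_pts[OF R.group_G R.finite_G] i(4) m(4) pr(2))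
      qed
      obtain W w where c: "is_coproduct G (orbit_set G H) W X i w"
        and card: "card (pts W) + card (pts (orbit_set G H)) = card (pts X)"
        by (rule complement_coproduct[OF i(2,3)])
      have "pts (orbit_set G H) \<noteq> {}" by (auto simp: orbit_pts[OF R.group_G R.finite_G])
      then have "card (pts (orbit_set G H)) \<noteq> 0"
        using finite_gsetD(2)[OF gmaps_gset(1)[OF i(2)]] by simp
      then have lt: "card (pts W) < card (pts X)" using card by simp
      note w = is_coproductD(2)[OF c]
      note ri = R.res_closed[OF i(2) a] and rw = R.res_closed[OF w a]
      note fi' = gcomp_gmaps[OF i(2) f] and fw = gcomp_gmaps[OF w f]
      note O = gmaps_gset(1)[OF i(2)]
      have 1: "\<delta> Y (nm R W Y (gcomp W f w) (res R W X w a)) = nm Q W Y (gcomp W f w) (res Q W X w (\<delta> X a))"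
        using less.hyps[OF lt fw rw] res[OF w a] by simp
      have 2: "\<delta> Y (nm R (orbit_set G H) Y (gcomp (orbit_set G H) f i) (res R (orbit_set G H) X i a)) =
          nm Q (orbit_set G H) Y (gcomp (orbit_set G H) f i) (res Q (orbit_set G H) X i (\<delta> X a))"
        unfolding fi R.nm_comp[OF pr(1) m(2) ri] Q.nm_comp[OF pr(1) m(2) Q.res_closed[OF i(2) ca]]
          inj[OF m(2,3) R.nm_closed[OF pr(1) ri]] orb[OF i(1) m(1) HK ri] res[OF i(2) a] ..
      show ?thesis
        unfolding R.nm_coproduct[OF c f a] Q.nm_coproduct[OF c f ca]
          mult[OF Y R.nm_closed[OF fi' ri] R.nm_closed[OF fw rw]] 1 2 ..
    qed
  qed
  show ?thesis unfolding tambara_map_def using hom res tr nm by blast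
qed

section \<open>The cofactor of a projection of orbits\<close>

context
  fixes G :: "('g, 'k) monoid_scheme" (structure) and K :: "'g set"
  assumes grp: "group G" and fin: "finite (carrier G)" and K: "subgroup K G"
begin

interpretation group G by (rule grp)

lemma ind_pt_eqD:
  assumes T: "finite_gset (subgrp G K) T" and t': "t' \<in> pts T" and g': "g' \<in> carrier G"
    and eq: "ind_pt G K T g t = ind_pt G K T g' t'"
  obtains k where "k \<in> K" "g' = g \<otimes> inv k" "t' = act T k t"
proof -
  have 1: "\<one> \<in> K" by (rule subgroup.one_closed[OF K])
  have "HPair (HElt g') t' \<in> members (ind_pt G K T g' t')"
    unfolding members_ind_pt[OF grp fin K] using g' finite_gsetD(4)[OF T t']
    by (intro image_eqI[OF _ 1]) simp
  then have "HPair (HElt g') t' \<in> members (ind_pt G K T g t)" using eq by simp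
  then show thesis using that by (auto simp: members_ind_pt[OF grp fin K])
qed

text \<open>
  The induction functor from \<open>K\<close>-sets to \<open>G\<close>-sets takes the complement of the diagonal of the \<open>K\<close>-set \<open>K/H\<close> to that of the relative
  diagonal of \<open>G/H \<rightarrow> G/K\<close>.
\<close>

lemma off_diag_orbit:
  assumes H: "subgroup H G" and HK: "H \<subseteq> K"
  defines "T \<equiv> orbit_set (subgrp G K) H"
  defines "W \<equiv> ind G K (off_diag T)"
  shows "is_off_diag G W (orbit_set G H) (orbit_proj G H K)
    (gcomp W (ind_orbit G H K) (ind_map G K (off_diag T) (off_fst T)))
    (gcomp W (ind_orbit G H K) (ind_map G K (off_diag T) (off_snd T)))"
proof -
  let ?D = "off_diag T"
  note finK = finite_K[OF grp fin K] and grpK = subgrp_group[OF grp fin K]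
  have finK': "finite (carrier (subgrp G K))" using finK by simp
  have T: "finite_gset (subgrp G K) T"
    unfolding T_def by (rule orbit_sub_gset[OF grp fin K H HK])
  note OD = off_diag_gset[OF grpK finK' T]
  note m1 = ind_map[OF grp fin K OD(2)] and m2 = ind_map[OF grp fin K OD(3)]
  note io = ind_orbit_iso[OF grp fin K H HK, folded T_def]
  note ie = ind_orbit_eq[OF grp fin K H HK, folded T_def]
  note Kc = K_carrier[OF grp fin K]
  let ?p = "gcomp W (ind_orbit G H K) (ind_map G K ?D (off_fst T))"
  let ?q = "gcomp W (ind_orbit G H K) (ind_map G K ?D (off_snd T))"
  have pq: "?p \<in> gmaps G W (orbit_set G H)" "?q \<in> gmaps G W (orbit_set G H)"
    unfolding W_def using gcomp_gmaps[OF m1(2) io(1)] gcomp_gmaps[OF m2(2) io(1)] by auto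
  have Dpts: "pts ?D = {HPair x y | x y. x \<in> pts T \<and> y \<in> pts T \<and> x \<noteq> y}"
    by (simp add: off_diag_def Let_def)
  have Dact: "act ?D g (HPair x y) = HPair (act T g x) (act T g y)"
    if "x \<in> pts T" "y \<in> pts T" "x \<noteq> y" for g x y
    using that by (auto simp: off_diag_def Let_def)
  have of: "off_fst T (HPair x y) = x" "off_snd T (HPair x y) = y" "HPair x y \<in> pts ?D"
    if "x \<in> pts T" "y \<in> pts T" "x \<noteq> y" for x y
    using that by (auto simp: off_fst_def off_snd_def Dpts)
  have Wpts: "pts W = {ind_pt G K ?D g z | g z. g \<in> carrier G \<and> z \<in> pts ?D}"
    unfolding W_def by (rule ind_pts[OF grp fin K])
  have Ipts: "ind_pt G K T g t \<in> pts (ind G K T)" if "g \<in> carrier G" "t \<in> pts T" for g t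
    using that by (auto simp: ind_pts[OF grp fin K])
  have Wpt: "ind_pt G K ?D g (HPair x y) \<in> pts W"
    "?p (ind_pt G K ?D g (HPair x y)) = ind_orbit G H K (ind_pt G K T g x)"
    "?q (ind_pt G K ?D g (HPair x y)) = ind_orbit G H K (ind_pt G K T g y)"
    if g: "g \<in> carrier G" and xy: "x \<in> pts T" "y \<in> pts T" "x \<noteq> y" for g x y
  proof -
    show W: "ind_pt G K ?D g (HPair x y) \<in> pts W" using of(3)[OF xy] g unfolding Wpts by blast
    show "?p (ind_pt G K ?D g (HPair x y)) = ind_orbit G H K (ind_pt G K T g x)"
      "?q (ind_pt G K ?D g (HPair x y)) = ind_orbit G H K (ind_pt G K T g y)"
      using W m1(1)[OF g of(3)[OF xy]] m2(1)[OF g of(3)[OF xy]] of[OF xy] by simp_all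
  qed
  have Wcase: "\<exists>g x y. g \<in> carrier G \<and> x \<in> pts T \<and> y \<in> pts T \<and> x \<noteq> y \<and> w = ind_pt G K ?D g (HPair x y)"
    if "w \<in> pts W" for w using that unfolding Wpts Dpts by blast
  have ioinj: "u = v" if "ind_orbit G H K u = ind_orbit G H K v" "u \<in> pts (ind G K T)" "v \<in> pts (ind G K T)" for u v
    using io(2) that by (auto simp: bij_betw_def inj_on_def)
  have Tpts: "pts T = (\<lambda>k. coset_pt (k <#\<^bsub>G\<^esub> H)) ` K"
    unfolding T_def by (rule orbit_sub_pts[OF grp fin K H HK])
  have proj: "orbit_proj G H K (ind_orbit G H K (ind_pt G K T g x)) = coset_pt (g <#\<^bsub>G\<^esub> K)"
    if g: "g \<in> carrier G" and x: "x \<in> pts T" for g x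
  proof -
    obtain k where k: "k \<in> K" "x = coset_pt (k <#\<^bsub>G\<^esub> H)" using x by (auto simp: Tpts)
    have "(g \<otimes> k) <#\<^bsub>G\<^esub> K = g <#\<^bsub>G\<^esub> (k <#\<^bsub>G\<^esub> K)"
      using g Kc[OF k(1)] subgroup.subset[OF K] by (simp add: lcos_m_assoc)
    also have "k <#\<^bsub>G\<^esub> K = K" by (rule coset_join3[OF Kc[OF k(1)] K k(1)])
    finally show ?thesis using orbit_proj(2)[OF grp fin H K HK] g k Kc ie by simp
  qed
  have "bij_betw (\<lambda>w. (?p w, ?q w)) (pts W)
      {(x, x'). x \<in> pts (orbit_set G H) \<and> x' \<in> pts (orbit_set G H) \<and> x \<noteq> x' \<and> orbit_proj G H K x = orbit_proj G H K x'}"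
  proof (rule bij_betw_imageI)
    show "inj_on (\<lambda>w. (?p w, ?q w)) (pts W)"
    proof (rule inj_onI)
      fix w w' assume w: "w \<in> pts W" "w' \<in> pts W" and eq: "(?p w, ?q w) = (?p w', ?q w')"
      obtain g x y where g: "g \<in> carrier G" and xy: "x \<in> pts T" "y \<in> pts T" "x \<noteq> y" and w1: "w = ind_pt G K ?D g (HPair x y)"
        using Wcase[OF w(1)] by blast
      obtain g' x' y' where g': "g' \<in> carrier G" and xy': "x' \<in> pts T" "y' \<in> pts T" "x' \<noteq> y'" and w2: "w' = ind_pt G K ?D g' (HPair x' y')"
        using Wcase[OF w(2)] by blast
      have e1: "ind_pt G K T g x = ind_pt G K T g' x'"
        by (rule ioinj[OF _ Ipts[OF g xy(1)] Ipts[OF g' xy'(1)]])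
          (use eq Wpt(2)[OF g xy] Wpt(2)[OF g' xy'] w1 w2 in simp)
      have e2: "ind_pt G K T g y = ind_pt G K T g' y'"
        by (rule ioinj[OF _ Ipts[OF g xy(2)] Ipts[OF g' xy'(2)]])
          (use eq Wpt(3)[OF g xy] Wpt(3)[OF g' xy'] w1 w2 in simp)
      obtain k where k: "k \<in> K" "g' = g \<otimes> inv k" "x' = act T k x" by (rule ind_pt_eqD[OF T xy'(1) g' e1])
      obtain l where l: "l \<in> K" "g' = g \<otimes> inv l" "y' = act T l y" by (rule ind_pt_eqD[OF T xy'(2) g' e2])
      have "inv l = inv k" using k(2) l(2) g Kc[OF k(1)] Kc[OF l(1)] by simp
      then have "l = k" using inv_inv Kc[OF k(1)] Kc[OF l(1)] by metis
      then have "HPair x' y' = act ?D k (HPair x y)" using k l Dact[OF xy] by simp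
      then have "ind_pt G K ?D (g' \<otimes> k) (HPair x y) = ind_pt G K ?D g' (HPair x' y')"
        using ind_pt_shift[OF grp fin K OD(1) g' k(1) of(3)[OF xy]] by simp
      moreover have "g' \<otimes> k = g" using k(2) g Kc[OF k(1)] by (simp add: m_assoc)
      ultimately show "w = w'" using w1 w2 by simp
    qed
    have mem: "?p w \<noteq> ?q w \<and> orbit_proj G H K (?p w) = orbit_proj G H K (?q w)" if w: "w \<in> pts W" for w
    proof -
      obtain g x y where g: "g \<in> carrier G" and xy: "x \<in> pts T" "y \<in> pts T" "x \<noteq> y" and w1: "w = ind_pt G K ?D g (HPair x y)"
        using Wcase[OF w] by blast
      have "ind_pt G K T g x \<noteq> ind_pt G K T g y"
      proof
        assume e: "ind_pt G K T g x = ind_pt G K T g y"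
        obtain k where k: "k \<in> K" "g = g \<otimes> inv k" "y = act T k x" by (rule ind_pt_eqD[OF T xy(2) g e])
        have "g \<otimes> inv k = g \<otimes> \<one>" using k(2) g by simp
        then have "inv k = \<one>" using g Kc[OF k(1)] by (simp del: r_one)
        then have "k = \<one>" using Kc[OF k(1)] inv_eq_1_iff by blast
        then show False using k(3) xy finite_gsetD(4)[OF T xy(1)] by simp
      qed
      then have "?p w \<noteq> ?q w" using ioinj Ipts g xy Wpt(2,3)[OF g xy] w1 by metis
      then show ?thesis using Wpt(2,3)[OF g xy] w1 proj g xy by simp
    qed
    \<comment> \<open>Two cosets \<open>u H\<close>, \<open>v H\<close> with \<open>v = u k\<close>, \<open>k \<in> K\<close>, are the image of the class of \<open>u\<close> and \<open>(H, k H)\<close>.\<close>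
    have sur: "(c, c') \<in> (\<lambda>w. (?p w, ?q w)) ` pts W"
      if c: "c \<in> pts (orbit_set G H)" "c' \<in> pts (orbit_set G H)" "c \<noteq> c'" "orbit_proj G H K c = orbit_proj G H K c'" for c c'
    proof -
      obtain u v where u: "u \<in> carrier G" "c = coset_pt (u <#\<^bsub>G\<^esub> H)" and v: "v \<in> carrier G" "c' = coset_pt (v <#\<^bsub>G\<^esub> H)"
        using c by (auto simp: orbit_pts[OF grp fin])
      have "coset_pt (v <#\<^bsub>G\<^esub> K) = coset_pt (u <#\<^bsub>G\<^esub> K)"
        using c(4) u v orbit_proj(2)[OF grp fin H K HK] by simp
      then obtain k where k: "k \<in> K" "v = u \<otimes> k" by (rule coset_pt_eqD[OF grp fin K v(1) u(1)])
      have 1: "\<one> \<in> K" by (rule subgroup.one_closed[OF K])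
      let ?x = "coset_pt (\<one> <#\<^bsub>G\<^esub> H)" and ?y = "coset_pt (k <#\<^bsub>G\<^esub> H)"
      have xy: "?x \<in> pts T" "?y \<in> pts T" using 1 k by (auto simp: Tpts)
      have e: "ind_orbit G H K (ind_pt G K T u ?x) = c" "ind_orbit G H K (ind_pt G K T u ?y) = c'"
        using ie[OF u(1) 1] ie[OF u(1) k(1)] u v k by simp_all
      then have "?x \<noteq> ?y" using c(3) by auto
      then show ?thesis using Wpt[OF u(1) xy] e by (intro image_eqI[of _ _ "ind_pt G K ?D u (HPair ?x ?y)"]) auto
    qed
    show "(\<lambda>w. (?p w, ?q w)) ` pts W = {(x, x'). x \<in> pts (orbit_set G H) \<and> x' \<in> pts (orbit_set G H) \<and> x \<noteq> x' \<and>
        orbit_proj G H K x = orbit_proj G H K x'}"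
      using mem sur gmapsD(1)[OF pq(1)] gmapsD(1)[OF pq(2)] by auto
  qed
  then show ?thesis using pq by (simp add: is_off_diag_def)
qed

lemma conorm_cofactor:
  assumes R: "tambara_functor G R" and H: "subgroup H G" and HK: "H \<subseteq> K"
    and a: "a \<in> carrier (lev R (orbit_set G H))"
  shows "conorm G R H K a = cofactor G R (orbit_set G H) (orbit_proj G H K) a"
proof -
  interpret R: tambara_functor G R by (rule R)
  define T where "T = orbit_set (subgrp G K) H"
  let ?D = "off_diag T" and ?I = "ind G K T" and ?O = "orbit_set G H" and ?\<iota> = "ind_orbit G H K"
    and ?W = "ind G K (off_diag T)"
  have finK': "finite (carrier (subgrp G K))" using finite_K[OF grp fin K] by simp
  have T: "finite_gset (subgrp G K) T"
    unfolding T_def by (rule orbit_sub_gset[OF grp fin K H HK])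
  note OD = off_diag_gset[OF subgrp_group[OF grp fin K] finK' T]
  note m1 = ind_map(2)[OF grp fin K OD(2)] and m2 = ind_map(2)[OF grp fin K OD(3)]
  note io = ind_orbit_iso[OF grp fin K H HK, folded T_def]
  note O = gmaps_gset(2)[OF io(1)]
  have inv: "ind_orbit_inv G H K \<in> gmaps G ?O ?I" "gcomp ?O ?\<iota> (ind_orbit_inv G H K) = gid ?O"
  proof -
    have ii: "?\<iota> (ind_orbit_inv G H K c) = c" "ind_orbit_inv G H K c \<in> pts ?I" if "c \<in> pts ?O" for c
      using that io(2) by (auto simp: ind_orbit_inv_def T_def bij_betw_def f_inv_into_f inv_into_into)
    have ij: "u = v" if "?\<iota> u = ?\<iota> v" "u \<in> pts ?I" "v \<in> pts ?I" for u v
      using io(2) that by (auto simp: bij_betw_def inj_on_def)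
    note gI = gmaps_gset(1)[OF io(1)]
    show g: "ind_orbit_inv G H K \<in> gmaps G ?O ?I"
    proof (rule gmapsI[OF O gI])
      fix g c assume gc: "g \<in> carrier G" "c \<in> pts ?O"
      note ac = finite_gsetD(3)[OF O gc] and ai = finite_gsetD(3)[OF gI gc(1) ii(2)[OF gc(2)]]
      show "ind_orbit_inv G H K (act ?O g c) = act ?I g (ind_orbit_inv G H K c)"
        by (rule ij[OF _ ii(2)[OF ac] ai])
          (simp add: ii(1)[OF ac] gmapsD(3)[OF io(1) gc(1) ii(2)[OF gc(2)]] ii(1)[OF gc(2)])
    qed (simp_all add: ii(2), simp add: ind_orbit_inv_def)
    show "gcomp ?O ?\<iota> (ind_orbit_inv G H K) = gid ?O"
      by (rule gmaps_eqI[OF gcomp_gmaps[OF g io(1)] gid_gmaps[OF O]]) (simp add: ii)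
  qed
  note W = off_diag_orbit[OF H HK, folded T_def]
  define b where "b = res R ?W ?I (ind_map G K ?D (off_fst T)) (res R ?I ?O ?\<iota> a)"
  define y where "y = nm R ?W ?I (ind_map G K ?D (off_snd T)) b"
  have b: "b \<in> carrier (lev R ?W)" unfolding b_def by (rule R.res_closed[OF m1 R.res_closed[OF io(1) a]])
  have y: "y \<in> carrier (lev R ?I)" unfolding y_def by (rule R.nm_closed[OF m2 b])
  have "cofactor G R ?O (orbit_proj G H K) a = nm R ?I ?O ?\<iota> y"
    using R.cofactor_eq[OF W a] R.res_comp[OF m1 io(1) a] R.nm_comp[OF m2 io(1) b] by (simp add: y_def b_def)
  \<comment> \<open>The norm along the isomorphism \<open>\<iota>\<close> is the restriction along its inverse.\<close>
  also have "\<dots> = res R ?O ?I (ind_orbit_inv G H K) (res R ?I ?O ?\<iota> (nm R ?I ?O ?\<iota> y))"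
    using R.res_comp[OF inv(1) io(1) R.nm_closed[OF io(1) y]] inv(2) R.res_id[OF O R.nm_closed[OF io(1) y]] by simp
  also have "res R ?I ?O ?\<iota> (nm R ?I ?O ?\<iota> y) = y"
    using R.nm_base_change[OF iso_pullback(2)[OF io] y] R.nm_id R.res_id gmaps_gset(1)[OF io(1)] y by simp
  finally show ?thesis
    by (simp add: conorm_def Let_def res_sub_def T_def y_def b_def)
qed

end


section \<open>The norm of a sum\<close>

text \<open>
  An exponential diagram for the fold map \<open>X \<squnion> X \<rightarrow> X\<close> and \<open>f : X \<rightarrow> Y\<close>: a point of \<open>D\<close> over \<open>y\<close> is
  a subset of the fibre of \<open>f\<close> at \<open>y\<close>, namely the part of the fibre on which a section takes values in
  the second copy of \<open>X\<close>.  \<open>Sub d\<close> is the subset belonging to the point \<open>d\<close>.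
\<close>

lemma fold_exponential:
  fixes G :: "('g, 'k) monoid_scheme" and X Y Z :: "'g gset"
  assumes f: "f \<in> gmaps G X Y" and c: "is_coproduct G X X Z i j"
    and fold: "n \<in> gmaps G Z X" "\<And>x. x \<in> pts X \<Longrightarrow> n (i x) = x" "\<And>x. x \<in> pts X \<Longrightarrow> n (j x) = x"
  obtains E D :: "'g gset" and e g' h' Sub where
    "is_exponential G Z X Y E D n f e g' h'"
    "\<forall>z\<in>pts E. e z = (if n (e z) \<in> Sub (g' z) then j (n (e z)) else i (n (e z)))"
    "\<forall>d\<in>pts D. Sub d \<subseteq> {x \<in> pts X. f x = h' d}"
    "\<forall>g\<in>carrier G. \<forall>d\<in>pts D. Sub (act D g d) = act X g ` Sub d"
    "bij_betw (\<lambda>d. (h' d, Sub d)) (pts D) {(y, A). y \<in> pts Y \<and> A \<subseteq> {x \<in> pts X. f x = y}}"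
proof -
  note X = gmaps_gset(1)[OF f] and Y = gmaps_gset(2)[OF f]
  note DX = finite_gsetD[OF X] and DY = finite_gsetD[OF Y] and ij = is_coproductD(1,2)[OF c]
  interpret group G by (rule DX(1))
  let ?P = "{(y, A). y \<in> pts Y \<and> A \<subseteq> {x \<in> pts X. f x = y}}"
  define a where "a g p = (act Y g (fst p), act X g ` snd p)" for g and p :: "'g hf \<times> 'g hf set"
  have "?P \<subseteq> pts Y \<times> Pow (pts X)" by auto
  then have fP: "finite ?P" using DX(2) DY(2) by (meson finite_Pow_iff finite_SigmaI finite_subset)
  obtain D :: "'g gset" and b where D: "finite_gset G D" "bij_betw b (pts D) ?P"
    "\<And>g w. g \<in> carrier G \<Longrightarrow> w \<in> pts D \<Longrightarrow> b (act D g w) = a g (b w)"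
  proof (rule realize_gset[of G ?P a, OF DX(1) fP])
    show "a g p \<in> ?P" if "g \<in> carrier G" "p \<in> ?P" for g p
      using that DX(3) DY(3) gmapsD(3)[OF f] by (auto simp: a_def)
    show "a \<one>\<^bsub>G\<^esub> p = p" if "p \<in> ?P" for p
    proof -
      have "act X \<one>\<^bsub>G\<^esub> ` snd p = (\<lambda>x. x) ` snd p" by (rule image_cong) (use that DX(4) in auto)
      then show ?thesis using that DY(4) by (auto simp: a_def)
    qed
    show "a (g \<otimes>\<^bsub>G\<^esub> h) p = a g (a h p)" if "g \<in> carrier G" "h \<in> carrier G" "p \<in> ?P" for g h p
    proof -
      have "act X (g \<otimes>\<^bsub>G\<^esub> h) ` snd p = (\<lambda>x. act X g (act X h x)) ` snd p"
        by (rule image_cong) (use that DX(5) in auto)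
      then show ?thesis using that DY(5) by (auto simp: a_def image_image)
    qed
  next
    fix W :: "'g gset" and b
    assume "finite_gset G W" "bij_betw b (pts W) ?P" "\<And>g w. g \<in> carrier G \<Longrightarrow> w \<in> pts W \<Longrightarrow> b (act W g w) = a g (b w)"
    then show thesis by (rule that)
  qed
  define h' where "h' = (\<lambda>d\<in>pts D. fst (b d))"
  define Sub where "Sub d = snd (b d)" for d
  have bD: "b d = (h' d, Sub d)" if "d \<in> pts D" for d using that by (simp add: h'_def Sub_def)
  have bij: "bij_betw (\<lambda>d. (h' d, Sub d)) (pts D) ?P"
    using D(2) by (rule bij_betw_cong[THEN iffD1, rotated]) (rule bD)
  have memD: "h' d \<in> pts Y" "Sub d \<subseteq> {x \<in> pts X. f x = h' d}" if "d \<in> pts D" for d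
    using bij_betwE[OF bij] that by auto
  have actD: "h' (act D g d) = act Y g (h' d)" "Sub (act D g d) = act X g ` Sub d"
    if "g \<in> carrier G" "d \<in> pts D" for g d
    using D(3)[OF that] bD[OF that(2)] bD[OF finite_gsetD(3)[OF D(1) that]] by (auto simp: a_def)
  have h': "h' \<in> gmaps G D Y"
    by (rule gmapsI[OF D(1) Y]) (auto simp: memD actD, simp add: h'_def)
  obtain E pX g' where E: "is_pullback G E X D Y pX g' f h'" by (rule pullback_exists[OF f h'])
  note Ed = is_pullbackD[OF E]
  have Eb: "bij_betw (\<lambda>w. (pX w, g' w)) (pts E) {(x, y). x \<in> pts X \<and> y \<in> pts D \<and> f x = h' y}"
    using E by (simp add: is_pullback_def)
  have Em: "pX z \<in> pts X" "g' z \<in> pts D" "f (pX z) = h' (g' z)" if "z \<in> pts E" for z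
    using joint_mem[OF Eb that] by auto
  define e where "e = (\<lambda>z\<in>pts E. if pX z \<in> Sub (g' z) then j (pX z) else i (pX z))"
  have ne: "n (e z) = pX z" if "z \<in> pts E" for z using that Em fold(2,3) by (simp add: e_def)
  have e: "e \<in> gmaps G E Z"
  proof (rule gmapsI)
    show "e z \<in> pts Z" if "z \<in> pts E" for z using that Em gmapsD(1)[OF ij(1)] gmapsD(1)[OF ij(2)] by (simp add: e_def)
    fix g z assume gz: "g \<in> carrier G" "z \<in> pts E"
    have "act X g (pX z) \<in> act X g ` Sub (g' z) \<longleftrightarrow> pX z \<in> Sub (g' z)"
    proof
      assume "act X g (pX z) \<in> act X g ` Sub (g' z)"
      then obtain x where x: "x \<in> Sub (g' z)" "act X g (pX z) = act X g x" by (elim imageE)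
      have "x \<in> pts X" using x(1) memD(2)[OF Em(2)[OF gz(2)]] by auto
      then have "pX z = x" by (rule act_inj[OF X gz(1) Em(1)[OF gz(2)] _ x(2)])
      then show "pX z \<in> Sub (g' z)" using x by simp
    qed (rule imageI)
    then show "e (act E g z) = act Z g (e z)"
      using gz finite_gsetD(3)[OF gmaps_gset(1)[OF Ed(1)] gz] Em[OF gz(2)]
      by (simp add: e_def gmapsD(3)[OF Ed(1) gz] gmapsD(3)[OF Ed(2) gz] actD
          gmapsD(3)[OF ij(1) gz(1)] gmapsD(3)[OF ij(2) gz(1)])
  qed (auto simp: e_def gmaps_gset(1)[OF Ed(1)] gmaps_gset(2)[OF ij(1)])
  have ge: "gcomp E n e = pX"
    by (rule gmaps_eqI[OF gcomp_gmaps[OF e fold(1)] Ed(1)]) (simp add: ne)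
  have ij_ne: "i x \<noteq> j x" if "x \<in> pts X" for x
  proof
    assume "i x = j x"
    moreover have "i x \<in> i ` pts X" "j x \<in> j ` pts X" using that by (auto intro: imageI)
    ultimately have "i x \<in> i ` pts X \<inter> j ` pts X" by simp
    moreover have "i ` pts X \<inter> j ` pts X = {}" using c by (simp add: is_coproduct_def)
    ultimately show False by (metis empty_iff)
  qed
  have Zc: "z = i (n z) \<or> z = j (n z)" if "z \<in> pts Z" for z
  proof -
    have "z \<in> i ` pts X \<union> j ` pts X" using c that by (simp add: is_coproduct_def)
    then show ?thesis using fold(2,3) by auto
  qed
  have ex: "is_exponential G Z X Y E D n f e g' h'"
    unfolding is_exponential_def ge
  proof (intro conjI ballI fold(1) f e E)
    fix y s assume y: "y \<in> pts Y" and s: "s \<in> (\<Pi>\<^sub>E x\<in>{x \<in> pts X. f x = y}. {z \<in> pts Z. n z = x})"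
    let ?A = "{x \<in> pts X. f x = y \<and> s x = j x}"
    have s': "s x \<in> pts Z" "n (s x) = x" if "x \<in> pts X" "f x = y" for x
      using PiE_mem[OF s, of x] that by auto
    obtain d where d: "d \<in> pts D" "h' d = y" "Sub d = ?A"
      by (rule joint_point[OF bij, of y ?A]) (use y in auto)
    show "\<exists>!d. d \<in> pts D \<and> h' d = y \<and> (\<forall>p\<in>pts E. g' p = d \<longrightarrow> e p = s (n (e p)))"
    proof (rule ex1I[of _ d])
      have "e p = s (n (e p))" if p: "p \<in> pts E" "g' p = d" for p
      proof -
        have fp: "f (pX p) = y" using Em[OF p(1)] p d by simp
        have "s (pX p) = i (pX p) \<or> s (pX p) = j (pX p)"
          using Zc[OF s'(1)[OF Em(1)[OF p(1)] fp]] unfolding s'(2)[OF Em(1)[OF p(1)] fp] .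
        moreover have "pX p \<in> Sub (g' p) \<longleftrightarrow> s (pX p) = j (pX p)"
          using Em(1)[OF p(1)] fp unfolding p(2) d(3) by simp
        ultimately show ?thesis unfolding ne[OF p(1)] using p(1) by (auto simp: e_def)
      qed
      then show "d \<in> pts D \<and> h' d = y \<and> (\<forall>p\<in>pts E. g' p = d \<longrightarrow> e p = s (n (e p)))" using d by simp
      fix d' assume d': "d' \<in> pts D \<and> h' d' = y \<and> (\<forall>p\<in>pts E. g' p = d' \<longrightarrow> e p = s (n (e p)))"
      have "x \<in> Sub d' \<longleftrightarrow> s x = j x" if x: "x \<in> pts X" "f x = y" for x
      proof -
        obtain p where p: "p \<in> pts E" "pX p = x" "g' p = d'"
          by (rule joint_point[OF Eb, of x d']) (use x d' in auto)
        have "e p = s x" using d' p ne[OF p(1)] by metis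
        then show ?thesis using p ij_ne[OF x(1)] by (auto simp: e_def split: if_splits)
      qed
      then have "Sub d' = ?A" using memD(2)[of d'] d' by auto
      then show "d' = d" using d d' by (intro joint_eqI[OF bij conjunct1[OF d'] d(1)]) simp_all
    qed
  qed
  show thesis
  proof (rule that[OF ex])
    show "\<forall>z\<in>pts E. e z = (if n (e z) \<in> Sub (g' z) then j (n (e z)) else i (n (e z)))"
    proof
      fix z assume z: "z \<in> pts E"
      show "e z = (if n (e z) \<in> Sub (g' z) then j (n (e z)) else i (n (e z)))"
        unfolding ne[OF z] using z by (simp add: e_def)
    qed
    show "\<forall>d\<in>pts D. Sub d \<subseteq> {x \<in> pts X. f x = h' d}" using memD(2) by blast
  qed (auto simp: memD actD bij)
qed

context tambara_functor begin

lemma tr_three_parts: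
  assumes i: "i0 \<in> gmaps G D0 D" "i1 \<in> gmaps G D1 D" "i2 \<in> gmaps G D2 D"
    and inj: "inj_on i0 (pts D0)" "inj_on i1 (pts D1)" "inj_on i2 (pts D2)"
    and disj: "i0 ` pts D0 \<inter> i1 ` pts D1 = {}" "(i0 ` pts D0 \<union> i1 ` pts D1) \<inter> i2 ` pts D2 = {}"
    and un: "i0 ` pts D0 \<union> i1 ` pts D1 \<union> i2 ` pts D2 = pts D"
    and h: "h \<in> gmaps G D Y" and z: "z \<in> carrier (lev R D)"
  shows "tr R D Y h z =
    tr R D0 Y (gcomp D0 h i0) (res R D0 D i0 z) \<oplus>\<^bsub>lev R Y\<^esub> tr R D1 Y (gcomp D1 h i1) (res R D1 D i1 z) \<oplus>\<^bsub>lev R Y\<^esub>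
    tr R D2 Y (gcomp D2 h i2) (res R D2 D i2 z)"
proof -
  obtain Q l r where c: "is_coproduct G D0 D1 Q l r"
    by (rule coproduct_exists[OF gmaps_gset(1)[OF i(1)] gmaps_gset(1)[OF i(2)]])
  note lr = is_coproductD(1,2)[OF c]
  obtain k where k: "k \<in> gmaps G Q D" "gcomp D0 k l = i0" "gcomp D1 k r = i1"
    by (rule copair_gmap[OF c i(1,2)])
  have kl: "k (l x) = i0 x" if "x \<in> pts D0" for x using fun_cong[OF k(2), of x] that by simp
  have kr: "k (r x) = i1 x" if "x \<in> pts D1" for x using fun_cong[OF k(3), of x] that by simp
  have "bij_betw k (pts Q) (i0 ` pts D0 \<union> i1 ` pts D1)"
  proof (rule coproduct_bij[OF c _ _ disj(1)])
    have "bij_betw i0 (pts D0) (i0 ` pts D0)" using inj by (simp add: bij_betw_def)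
    then show "bij_betw (\<lambda>x. k (l x)) (pts D0) (i0 ` pts D0)"
      by (rule bij_betw_cong[THEN iffD1, rotated]) (simp add: kl)
    have "bij_betw i1 (pts D1) (i1 ` pts D1)" using inj by (simp add: bij_betw_def)
    then show "bij_betw (\<lambda>x. k (r x)) (pts D1) (i1 ` pts D1)"
      by (rule bij_betw_cong[THEN iffD1, rotated]) (simp add: kr)
  qed
  then have c': "is_coproduct G Q D2 D k i2"
    using k(1) i(3) inj(3) disj(2) un by (simp add: is_coproduct_def bij_betw_def)
  note rk = res_closed[OF k(1) z]
  have "gcomp D0 (gcomp Q h k) l = gcomp D0 h i0" "gcomp D1 (gcomp Q h k) r = gcomp D1 h i1"
    using gcomp_assoc[OF lr(1), of h k] gcomp_assoc[OF lr(2), of h k] k by simp_all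
  then show ?thesis
    using tr_coproduct[OF c' h z] tr_coproduct[OF c gcomp_gmaps[OF k(1) h] rk]
      res_comp[OF lr(1) k(1) z] res_comp[OF lr(2) k(1) z] k by simp
qed

text \<open>
  The exponential formula for \<open>N\<^sub>f (a + x)\<close>, split according to the number of points at which \<open>x\<close> is
  taken: none, exactly one, or at least two.
\<close>

theorem nm_add:
  fixes X Y :: "'g gset"
  assumes f: "f \<in> gmaps G X Y" and a: "a \<in> carrier (lev R X)" and x: "x \<in> carrier (lev R X)"
  obtains D U V :: "'g gset" and k u e v e' where
    "k \<in> gmaps G D Y" "u \<in> gmaps G U D" "e \<in> gmaps G U X" "v \<in> gmaps G V D" "e' \<in> gmaps G V X"
    "\<forall>d\<in>pts D. 1 < card {z \<in> pts U. u z = d}"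
    "nm R X Y f (a \<oplus>\<^bsub>lev R X\<^esub> x) =
      nm R X Y f a \<oplus>\<^bsub>lev R Y\<^esub> tr R X Y f (cofactor G R X f a \<otimes>\<^bsub>lev R X\<^esub> x) \<oplus>\<^bsub>lev R Y\<^esub>
      tr R D Y k (nm R U D u (res R U X e x) \<otimes>\<^bsub>lev R D\<^esub> nm R V D v (res R V X e' a))"
proof -
  note X = gmaps_gset(1)[OF f] and Y = gmaps_gset(2)[OF f]
  interpret X: cring "lev R X" by (rule cring_lev[OF X])
  interpret Y: cring "lev R Y" by (rule cring_lev[OF Y])
  obtain Z i j where c: "is_coproduct G X X Z i j" by (rule coproduct_exists[OF X X])
  note ij = is_coproductD(1,2)[OF c]
  obtain n where n: "n \<in> gmaps G Z X" "gcomp X n i = gid X" "gcomp X n j = gid X"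
    by (rule copair_gmap[OF c gid_gmaps[OF X] gid_gmaps[OF X]])
  have ni: "n (i y) = y" if "y \<in> pts X" for y using fun_cong[OF n(2), of y] that by simp
  have nj: "n (j y) = y" if "y \<in> pts X" for y using fun_cong[OF n(3), of y] that by simp
  obtain w where w: "w \<in> carrier (lev R Z)" "res R X Z i w = a" "res R X Z j w = x"
    by (rule coproduct_elem[OF c a x])
  have sum: "tr R Z X n w = a \<oplus>\<^bsub>lev R X\<^esub> x"
    using tr_coproduct[OF c n(1) w(1)] w(2,3) n(2,3) tr_id[OF X a] tr_id[OF X x] by simp
  obtain E D :: "'g gset" and e g' h' Sub where ex: "is_exponential G Z X Y E D n f e g' h'"
    and e_eq': "\<forall>z\<in>pts E. e z = (if n (e z) \<in> Sub (g' z) then j (n (e z)) else i (n (e z)))"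
    and Sub': "\<forall>d\<in>pts D. Sub d \<subseteq> {x \<in> pts X. f x = h' d}"
    and Sub_act': "\<forall>g\<in>carrier G. \<forall>d\<in>pts D. Sub (act D g d) = act X g ` Sub d"
    and bij: "bij_betw (\<lambda>d. (h' d, Sub d)) (pts D) {(y, A). y \<in> pts Y \<and> A \<subseteq> {x \<in> pts X. f x = y}}"
    by (rule fold_exponential[OF f c n(1) ni nj])
  note e_eq = bspec[OF e_eq'] and Sub = bspec[OF Sub'] and Sub_act = bspec[OF bspec[OF Sub_act']]
  note ed = is_exponentialD[OF ex]
  define pX where "pX = gcomp E n e"
  have pX: "pX \<in> gmaps G E X" unfolding pX_def by (rule gcomp_gmaps[OF ed(3,1)])
  have pXe: "n (e z) = pX z" if "z \<in> pts E" for z using that by (simp add: pX_def)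
  have Eb: "bij_betw (\<lambda>w. (pX w, g' w)) (pts E) {(x, y). x \<in> pts X \<and> y \<in> pts D \<and> f x = h' y}"
    using ex by (simp add: is_exponential_def is_pullback_def pX_def)
  define \<nu> where "\<nu> = nm R E D g' (res R E Z e w)"
  have \<nu>: "\<nu> \<in> carrier (lev R D)" unfolding \<nu>_def by (rule nm_closed[OF ed(4) res_closed[OF ed(3) w(1)]])
  have main: "nm R X Y f (a \<oplus>\<^bsub>lev R X\<^esub> x) = tr R D Y h' \<nu>"
    unfolding sum[symmetric] \<nu>_def by (rule nm_tr[OF ex w(1)])
  \<comment> \<open>Over a \<open>G\<close>-set \<open>B\<close> mapping to \<open>D\<close>, the norm multiplies \<open>x\<close> over the points in the subset (\<open>U\<close>) and \<open>a\<close> over the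
    points of the fibre outside it (\<open>V\<close>).\<close>
  have part: "res R B D k \<nu> = nm R U B u (res R U X eU x) \<otimes>\<^bsub>lev R B\<^esub> nm R V B v (res R V X eV a)"
    if k: "k \<in> gmaps G B D"
      and U: "eU \<in> gmaps G U X" "u \<in> gmaps G U B"
        "bij_betw (\<lambda>z. (eU z, u z)) (pts U) {(y, d). y \<in> pts X \<and> d \<in> pts B \<and> y \<in> Sub (k d)}"
      and V: "eV \<in> gmaps G V X" "v \<in> gmaps G V B"
        "bij_betw (\<lambda>z. (eV z, v z)) (pts V) {(y, d). y \<in> pts X \<and> d \<in> pts B \<and> f y = h' (k d) \<and> y \<notin> Sub (k d)}"
    for B U V :: "'g gset" and k u v eU eV
  proof -
    have Uin: "eU z \<in> Sub (k (u z))" if "z \<in> pts U" for z using joint_mem[OF U(3) that] by simp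
    have Vin: "eV z \<notin> Sub (k (v z))" if "z \<in> pts V" for z using joint_mem[OF V(3) that] by simp
    obtain P l r where P: "is_coproduct G U V P l r"
      by (rule coproduct_exists[OF gmaps_gset(1)[OF U(1)] gmaps_gset(1)[OF V(1)]])
    note lr = is_coproductD(1,2)[OF P]
    obtain \<pi> where \<pi>: "\<pi> \<in> gmaps G P X" "gcomp U \<pi> l = eU" "gcomp V \<pi> r = eV" by (rule copair_gmap[OF P U(1) V(1)])
    obtain \<rho> where \<rho>: "\<rho> \<in> gmaps G P B" "gcomp U \<rho> l = u" "gcomp V \<rho> r = v" by (rule copair_gmap[OF P U(2) V(2)])
    have l: "\<pi> (l z) = eU z" "\<rho> (l z) = u z" if "z \<in> pts U" for z
      using fun_cong[OF \<pi>(2), of z] fun_cong[OF \<rho>(2), of z] that by simp_all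
    have r: "\<pi> (r z) = eV z" "\<rho> (r z) = v z" if "z \<in> pts V" for z
      using fun_cong[OF \<pi>(3), of z] fun_cong[OF \<rho>(3), of z] that by simp_all
    have "bij_betw (\<lambda>z. (\<pi> z, \<rho> z)) (pts P) ({(y, d). y \<in> pts X \<and> d \<in> pts B \<and> y \<in> Sub (k d)} \<union>
        {(y, d). y \<in> pts X \<and> d \<in> pts B \<and> f y = h' (k d) \<and> y \<notin> Sub (k d)})"
    proof (rule coproduct_bij[OF P])
      show "bij_betw (\<lambda>z. (\<pi> (l z), \<rho> (l z))) (pts U) {(y, d). y \<in> pts X \<and> d \<in> pts B \<and> y \<in> Sub (k d)}"
        using U(3) by (rule bij_betw_cong[THEN iffD1, rotated]) (simp add: l)
      show "bij_betw (\<lambda>z. (\<pi> (r z), \<rho> (r z))) (pts V) {(y, d). y \<in> pts X \<and> d \<in> pts B \<and> f y = h' (k d) \<and> y \<notin> Sub (k d)}"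
        using V(3) by (rule bij_betw_cong[THEN iffD1, rotated]) (simp add: r)
    qed auto
    also have "{(y, d). y \<in> pts X \<and> d \<in> pts B \<and> y \<in> Sub (k d)} \<union>
        {(y, d). y \<in> pts X \<and> d \<in> pts B \<and> f y = h' (k d) \<and> y \<notin> Sub (k d)} =
        {(y, d). y \<in> pts X \<and> d \<in> pts B \<and> f y = h' (k d)}"
      using Sub[OF gmapsD(1)[OF k]] by auto
    finally have Pb: "bij_betw (\<lambda>z. (\<pi> z, \<rho> z)) (pts P) {(y, d). y \<in> pts X \<and> d \<in> pts B \<and> f y = h' (k d)}" .
    have Pm: "\<pi> z \<in> pts X" "\<rho> z \<in> pts B" "f (\<pi> z) = h' (k (\<rho> z))" if "z \<in> pts P" for z
      using joint_mem[OF Pb that] by auto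
    obtain q where q: "q \<in> gmaps G P E" "\<And>z. z \<in> pts P \<Longrightarrow> pX (q z) = \<pi> z" "\<And>z. z \<in> pts P \<Longrightarrow> g' (q z) = gcomp P k \<rho> z"
      by (rule joint_lift[OF pX ed(4) Eb \<pi>(1) gcomp_gmaps[OF \<rho>(1) k]]) (auto simp: Pm gmapsD(1)[OF k])
    have qE: "q z \<in> pts E" if "z \<in> pts P" for z by (rule gmapsD(1)[OF q(1) that])
    have "bij_betw (\<lambda>z. (q z, \<rho> z)) (pts P) {(y, d). y \<in> pts E \<and> d \<in> pts B \<and> g' y = k d}"
    proof (rule bij_betw_imageI)
      show "inj_on (\<lambda>z. (q z, \<rho> z)) (pts P)"
      proof (rule inj_onI)
        fix z z' assume z: "z \<in> pts P" "z' \<in> pts P" "(q z, \<rho> z) = (q z', \<rho> z')"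
        have "\<pi> z = \<pi> z'" using z q(2)[OF z(1)] q(2)[OF z(2)] by simp
        then show "z = z'" using z(3) by (intro joint_eqI[OF Pb z(1,2)]) simp_all
      qed
      have "(y, d) \<in> (\<lambda>z. (q z, \<rho> z)) ` pts P" if y: "y \<in> pts E" "d \<in> pts B" "g' y = k d" for y d
      proof -
        have ym: "pX y \<in> pts X" "f (pX y) = h' (g' y)" using joint_mem[OF Eb y(1)] by auto
        obtain z where z: "z \<in> pts P" "\<pi> z = pX y" "\<rho> z = d"
          by (rule joint_point[OF Pb, of "pX y" d]) (use y ym in auto)
        have "q z = y" using q(2)[OF z(1)] q(3)[OF z(1)] z y by (intro joint_eqI[OF Eb qE[OF z(1)] y(1)]) simp_all
        then show ?thesis using z by (intro image_eqI[of _ _ z]) simp_all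
      qed
      then show "(\<lambda>z. (q z, \<rho> z)) ` pts P = {(y, d). y \<in> pts E \<and> d \<in> pts B \<and> g' y = k d}"
        using qE Pm(2) q(3) by auto
    qed
    then have pb: "is_pullback G P E B D q \<rho> g' k" using q(1) \<rho>(1) ed(4) k by (simp add: is_pullback_def)
    have lP: "l z \<in> pts P" if "z \<in> pts U" for z by (rule gmapsD(1)[OF lr(1) that])
    have rP: "r z \<in> pts P" if "z \<in> pts V" for z by (rule gmapsD(1)[OF lr(2) that])
    note eq = gcomp_gmaps[OF q(1) ed(3)]
    have el: "gcomp U (gcomp P e q) l = gcomp U j eU"
    proof (rule gmaps_eqI[OF gcomp_gmaps[OF lr(1) eq] gcomp_gmaps[OF U(1) ij(2)]])
      fix z assume z: "z \<in> pts U"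
      have "n (e (q (l z))) = eU z" "g' (q (l z)) = k (u z)"
        using pXe[OF qE[OF lP[OF z]]] q(2,3)[OF lP[OF z]] l[OF z] lP[OF z] by simp_all
      then have "e (q (l z)) = j (eU z)" using e_eq[OF qE[OF lP[OF z]]] Uin[OF z] by simp
      then show "gcomp U (gcomp P e q) l z = gcomp U j eU z" using z lP[OF z] by simp
    qed
    have er: "gcomp V (gcomp P e q) r = gcomp V i eV"
    proof (rule gmaps_eqI[OF gcomp_gmaps[OF lr(2) eq] gcomp_gmaps[OF V(1) ij(1)]])
      fix z assume z: "z \<in> pts V"
      have "n (e (q (r z))) = eV z" "g' (q (r z)) = k (v z)"
        using pXe[OF qE[OF rP[OF z]]] q(2,3)[OF rP[OF z]] r[OF z] rP[OF z] by simp_all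
      then have "e (q (r z)) = i (eV z)" using e_eq[OF qE[OF rP[OF z]]] Vin[OF z] by simp
      then show "gcomp V (gcomp P e q) r z = gcomp V i eV z" using z rP[OF z] by simp
    qed
    note rw = res_closed[OF ed(3) w(1)]
    have 1: "res R P E q (res R E Z e w) = res R P Z (gcomp P e q) w"
      using res_comp[OF q(1) ed(3) w(1)] by simp
    have 2: "res R U P l (res R P Z (gcomp P e q) w) = res R U X eU x"
      using res_comp[OF lr(1) eq w(1)] res_comp[OF U(1) ij(2) w(1)] w(3) by (simp add: el)
    have 3: "res R V P r (res R P Z (gcomp P e q) w) = res R V X eV a"
      using res_comp[OF lr(2) eq w(1)] res_comp[OF V(1) ij(1) w(1)] w(2) by (simp add: er)
    have "res R B D k \<nu> = nm R P B \<rho> (res R P Z (gcomp P e q) w)"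
      unfolding \<nu>_def 1[symmetric] by (rule nm_base_change[OF pb rw])
    then show ?thesis using nm_coproduct[OF P \<rho>(1) res_closed[OF eq w(1)]] \<rho>(2,3) 2 3 by simp
  qed
  have joint_into: "\<exists>m. m \<in> gmaps G B D \<and> (\<forall>z\<in>pts B. h' (m z) = s z \<and> Sub (m z) = A z)"
    if s: "s \<in> gmaps G B Y" and A: "\<And>z. z \<in> pts B \<Longrightarrow> A z \<subseteq> {x \<in> pts X. f x = s z}"
      "\<And>g z. g \<in> carrier G \<Longrightarrow> z \<in> pts B \<Longrightarrow> A (act B g z) = act X g ` A z"
    for B :: "'g gset" and s A
  proof -
    define m where "m = (\<lambda>z\<in>pts B. SOME d. d \<in> pts D \<and> h' d = s z \<and> Sub d = A z)"
    have m: "m z \<in> pts D \<and> h' (m z) = s z \<and> Sub (m z) = A z" if z: "z \<in> pts B" for z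
    proof -
      have "(s z, A z) \<in> {(y, A). y \<in> pts Y \<and> A \<subseteq> {x \<in> pts X. f x = y}}"
        using A(1)[OF z] gmapsD(1)[OF s z] by simp
      then obtain d where "d \<in> pts D" "h' d = s z" "Sub d = A z" by (rule joint_point[OF bij])
      then have "d \<in> pts D \<and> h' d = s z \<and> Sub d = A z" by simp
      then show ?thesis unfolding m_def using z by (simp add: someI[of "\<lambda>d. d \<in> pts D \<and> h' d = s z \<and> Sub d = A z"])
    qed
    note B = gmaps_gset(1)[OF s] and Dg = gmaps_gset(1)[OF ed(5)]
    have "m \<in> gmaps G B D"
    proof (rule gmapsI[OF B Dg])
      fix g z assume gz: "g \<in> carrier G" "z \<in> pts B"
      have mz: "m z \<in> pts D" using m[OF gz(2)] by simp
      show "m (act B g z) = act D g (m z)"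
      proof (rule joint_eqI[OF bij])
        show "m (act B g z) \<in> pts D" "act D g (m z) \<in> pts D"
          using m[OF finite_gsetD(3)[OF B gz]] finite_gsetD(3)[OF Dg gz(1) mz] by simp_all
        show "h' (m (act B g z)) = h' (act D g (m z))"
          using m[OF finite_gsetD(3)[OF B gz]] m[OF gz(2)] gmapsD(3)[OF s gz] gmapsD(3)[OF ed(5) gz(1) mz] by simp
        show "Sub (m (act B g z)) = Sub (act D g (m z))"
          using m[OF finite_gsetD(3)[OF B gz]] m[OF gz(2)] A(2)[OF gz] Sub_act[OF gz(1) mz] by simp
      qed
    qed (simp_all add: m, simp add: m_def)
    then show ?thesis using m by blast
  qed
  \<comment> \<open>\<open>D\<close> is the disjoint union of the empty subsets (a copy of \<open>Y\<close>), the singletons (a copy of \<open>X\<close>) and the larger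
    subsets (\<open>D2\<close>).\<close>
  have "\<exists>m. m \<in> gmaps G Y D \<and> (\<forall>z\<in>pts Y. h' (m z) = gid Y z \<and> Sub (m z) = {})"
    by (rule joint_into[OF gid_gmaps[OF Y]]) auto
  then obtain i0 where i0: "i0 \<in> gmaps G Y D" and i0': "\<forall>z\<in>pts Y. h' (i0 z) = gid Y z \<and> Sub (i0 z) = {}" by (elim exE conjE)
  have "\<exists>m. m \<in> gmaps G X D \<and> (\<forall>z\<in>pts X. h' (m z) = f z \<and> Sub (m z) = {z})"
    by (rule joint_into[OF f]) auto
  then obtain i1 where i1: "i1 \<in> gmaps G X D" and i1': "\<forall>z\<in>pts X. h' (i1 z) = f z \<and> Sub (i1 z) = {z}" by (elim exE conjE)
  let ?B = "{d \<in> pts D. 1 < card (Sub d)}"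
  note Dg = gmaps_gset(1)[OF ed(5)]
  have card_act: "card (Sub (act D g d)) = card (Sub d)" if "g \<in> carrier G" "d \<in> pts D" for g d
    unfolding Sub_act[OF that]
    by (rule card_image, rule inj_onI) (use act_inj[OF X that(1)] Sub[OF that(2)] in auto)
  obtain D2 :: "'g gset" and i2 where i2: "i2 \<in> gmaps G D2 D" "inj_on i2 (pts D2)" "i2 ` pts D2 = ?B"
    by (rule sub_gset[OF Dg, of ?B]) (auto simp: card_act finite_gsetD(3)[OF Dg])
  have fSub: "finite (Sub d)" if "d \<in> pts D" for d
    using finite_subset[OF Sub[OF that]] finite_gsetD(2)[OF X] by simp
  have im0: "i0 ` pts Y = {d \<in> pts D. Sub d = {}}"
  proof (intro equalityI subsetI)
    fix d assume "d \<in> {d \<in> pts D. Sub d = {}}"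
    then have d: "d \<in> pts D" "Sub d = {}" by auto
    have y: "h' d \<in> pts Y" by (rule gmapsD(1)[OF ed(5) d(1)])
    have "d = i0 (h' d)" by (rule joint_eqI[OF bij d(1) gmapsD(1)[OF i0 y]]) (use i0' y d in simp_all)
    then show "d \<in> i0 ` pts Y" using y by (rule image_eqI)
  qed (use i0' gmapsD(1)[OF i0] in auto)
  have im1: "i1 ` pts X = {d \<in> pts D. card (Sub d) = 1}"
  proof (intro equalityI subsetI)
    fix d assume "d \<in> {d \<in> pts D. card (Sub d) = 1}"
    then have d: "d \<in> pts D" "card (Sub d) = 1" by auto
    then obtain y where y: "Sub d = {y}" by (elim card_1_singletonE)
    then have y': "y \<in> pts X" "f y = h' d" using Sub[OF d(1)] by auto
    have "d = i1 y" by (rule joint_eqI[OF bij d(1) gmapsD(1)[OF i1 y'(1)]]) (use i1' y' y in simp_all)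
    then show "d \<in> i1 ` pts X" using y'(1) by (rule image_eqI)
  qed (use i1' gmapsD(1)[OF i1] in auto)
  have inj0: "inj_on i0 (pts Y)"
  proof (rule inj_onI)
    fix y y' assume y: "y \<in> pts Y" "y' \<in> pts Y" "i0 y = i0 y'"
    have e: "h' (i0 y) = y" "h' (i0 y') = y'" using i0' y(1,2) by simp_all
    show "y = y'" using e(1) unfolding y(3) e(2) by (rule sym)
  qed
  have inj1: "inj_on i1 (pts X)"
  proof (rule inj_onI)
    fix y y' assume y: "y \<in> pts X" "y' \<in> pts X" "i1 y = i1 y'"
    have e: "Sub (i1 y) = {y}" "Sub (i1 y') = {y'}" using i1' y(1,2) by simp_all
    have "{y'} = {y}" using e(1) unfolding y(3) e(2) .
    then show "y = y'" by simp
  qed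
  have un: "i0 ` pts Y \<union> i1 ` pts X \<union> i2 ` pts D2 = pts D"
  proof -
    have "Sub d = {} \<or> card (Sub d) = 1 \<or> 1 < card (Sub d)" if "d \<in> pts D" for d
      using fSub[OF that] by (cases "card (Sub d)") auto
    then show ?thesis unfolding im0 im1 i2(3) by auto
  qed
  have split: "tr R D Y h' \<nu> =
    tr R Y Y (gcomp Y h' i0) (res R Y D i0 \<nu>) \<oplus>\<^bsub>lev R Y\<^esub> tr R X Y (gcomp X h' i1) (res R X D i1 \<nu>) \<oplus>\<^bsub>lev R Y\<^esub>
    tr R D2 Y (gcomp D2 h' i2) (res R D2 D i2 \<nu>)"
    by (rule tr_three_parts[OF i0 i1 i2(1) inj0 inj1 i2(2) _ _ un ed(5) \<nu>]) (auto simp: im0 im1 i2(3))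
  have h0: "gcomp Y h' i0 = gid Y"
    by (rule gmaps_eqI[OF gcomp_gmaps[OF i0 ed(5)] gid_gmaps[OF Y]]) (use i0' in simp)
  have h1: "gcomp X h' i1 = f"
    by (rule gmaps_eqI[OF gcomp_gmaps[OF i1 ed(5)] f]) (use i1' in simp)
  have t0: "tr R Y Y (gcomp Y h' i0) (res R Y D i0 \<nu>) = nm R X Y f a"
  proof -
    note em = gempty_gmaps[OF group_G X] gempty_gmaps[OF group_G Y]
    have "res R Y D i0 \<nu> = nm R gempty Y (\<lambda>x. undefined) (res R gempty X (\<lambda>x. undefined) x) \<otimes>\<^bsub>lev R Y\<^esub> nm R X Y f (res R X X (gid X) a)"
    proof (rule part[OF i0 em _ gid_gmaps[OF X] f])
      show "bij_betw (\<lambda>z. (undefined, undefined)) (pts gempty) {(y, d). y \<in> pts X \<and> d \<in> pts Y \<and> y \<in> Sub (i0 d)}"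
        using i0' by (auto simp: bij_betw_def gempty_def)
      show "bij_betw (\<lambda>z. (gid X z, f z)) (pts X) {(y, d). y \<in> pts X \<and> d \<in> pts Y \<and> f y = h' (i0 d) \<and> y \<notin> Sub (i0 d)}"
        using i0' gmapsD(1)[OF f] by (auto simp: bij_betw_def inj_on_def)
    qed
    also have "\<dots> = nm R X Y f a"
      using nm_empty[OF em(2) _ res_closed[OF em(1) x]] res_id[OF X a] nm_closed[OF f a] by (simp add: gempty_def)
    finally show ?thesis unfolding h0 by (simp add: tr_id[OF Y] nm_closed[OF f a])
  qed
  have t1: "res R X D i1 \<nu> = cofactor G R X f a \<otimes>\<^bsub>lev R X\<^esub> x"
  proof -
    obtain W p q where W: "is_off_diag G W X f p q" by (rule off_diag_exists[OF f])
    note d = is_off_diagD[OF W]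
    have "res R X D i1 \<nu> = nm R X X (gid X) (res R X X (gid X) x) \<otimes>\<^bsub>lev R X\<^esub> nm R W X q (res R W X p a)"
    proof (rule part[OF i1 gid_gmaps[OF X] gid_gmaps[OF X] _ d(1,2)])
      show "bij_betw (\<lambda>z. (gid X z, gid X z)) (pts X) {(y, d). y \<in> pts X \<and> d \<in> pts X \<and> y \<in> Sub (i1 d)}"
        using i1' by (auto simp: bij_betw_def inj_on_def)
      have "{(y, d). y \<in> pts X \<and> d \<in> pts X \<and> f y = h' (i1 d) \<and> y \<notin> Sub (i1 d)} =
          {(x, x'). x \<in> pts X \<and> x' \<in> pts X \<and> x \<noteq> x' \<and> f x = f x'}"
        using i1' by auto
      then show "bij_betw (\<lambda>z. (p z, q z)) (pts W) {(y, d). y \<in> pts X \<and> d \<in> pts X \<and> f y = h' (i1 d) \<and> y \<notin> Sub (i1 d)}"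
        using d(3) by simp
    qed
    then show ?thesis
      using res_id[OF X x] nm_id[OF X x] cofactor_eq[OF W a] X.m_comm[OF x cofactor_closed[OF f a]] by simp
  qed
  note D2g = gmaps_gset(1)[OF i2(1)]
  have i2D: "i2 d \<in> pts D" if "d \<in> pts D2" for d by (rule gmapsD(1)[OF i2(1) that])
  have Sub2: "act X g y \<in> Sub (i2 (act D2 g d)) \<longleftrightarrow> y \<in> Sub (i2 d)"
    if g: "g \<in> carrier G" and y: "y \<in> pts X" and d: "d \<in> pts D2" for g y d
  proof -
    have "Sub (i2 (act D2 g d)) = act X g ` Sub (i2 d)"
      using gmapsD(3)[OF i2(1) g d] Sub_act[OF g i2D[OF d]] by simp
    moreover have "inj_on (act X g) (pts X)" by (rule inj_onI) (rule act_inj[OF X g])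
    ultimately show ?thesis using inj_on_image_mem_iff[OF _ y] Sub[OF i2D[OF d]] by auto
  qed
  obtain U :: "'g gset" and eU u where U: "eU \<in> gmaps G U X" "u \<in> gmaps G U D2"
    "bij_betw (\<lambda>z. (eU z, u z)) (pts U) {(y, d). y \<in> pts X \<and> d \<in> pts D2 \<and> y \<in> Sub (i2 d)}"
  proof -
    let ?U = "{(y, d). y \<in> pts X \<and> d \<in> pts D2 \<and> y \<in> Sub (i2 d)}"
    have 1: "?U \<subseteq> pts X \<times> pts D2" by auto
    have 2: "(act X g y, act D2 g d) \<in> ?U" if "g \<in> carrier G" "(y, d) \<in> ?U" for g y d
      using that by (simp add: Sub2 finite_gsetD(3)[OF X] finite_gsetD(3)[OF D2g])
    show thesis by (rule pair_gset[OF X D2g 1 2]) (assumption, assumption, erule (2) that)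
  qed
  obtain V :: "'g gset" and eV v where V: "eV \<in> gmaps G V X" "v \<in> gmaps G V D2"
    "bij_betw (\<lambda>z. (eV z, v z)) (pts V) {(y, d). y \<in> pts X \<and> d \<in> pts D2 \<and> f y = h' (i2 d) \<and> y \<notin> Sub (i2 d)}"
  proof -
    let ?V = "{(y, d). y \<in> pts X \<and> d \<in> pts D2 \<and> f y = h' (i2 d) \<and> y \<notin> Sub (i2 d)}"
    have 1: "?V \<subseteq> pts X \<times> pts D2" by auto
    have 2: "(act X g y, act D2 g d) \<in> ?V" if "g \<in> carrier G" "(y, d) \<in> ?V" for g y d
    proof -
      have "h' (i2 (act D2 g d)) = act Y g (h' (i2 d))"
        using that gmapsD(3)[OF i2(1), of g d] gmapsD(3)[OF ed(5), of g "i2 d"] i2D by simp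
      then show ?thesis
        using that by (simp add: Sub2 finite_gsetD(3)[OF X] finite_gsetD(3)[OF D2g] gmapsD(3)[OF f])
    qed
    show thesis by (rule pair_gset[OF X D2g 1 2]) (assumption, assumption, erule (2) that)
  qed
  have big: "\<forall>d\<in>pts D2. 1 < card {z \<in> pts U. u z = d}"
  proof
    fix d assume d: "d \<in> pts D2"
    have "eU ` {z \<in> pts U. u z = d} = Sub (i2 d)"
    proof (intro equalityI subsetI)
      fix y assume y: "y \<in> Sub (i2 d)"
      then have "(y, d) \<in> {(y, d). y \<in> pts X \<and> d \<in> pts D2 \<and> y \<in> Sub (i2 d)}" using Sub[OF i2D[OF d]] d by auto
      then obtain z where "z \<in> pts U" "eU z = y" "u z = d" by (rule joint_point[OF U(3)])
      then show "y \<in> eU ` {z \<in> pts U. u z = d}" by auto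
    next
      fix y assume "y \<in> eU ` {z \<in> pts U. u z = d}"
      then show "y \<in> Sub (i2 d)" using joint_mem[OF U(3)] by auto
    qed
    moreover have "1 < card (Sub (i2 d))" using i2(3) d by auto
    ultimately have "1 < card (eU ` {z \<in> pts U. u z = d})" by simp
    moreover have "finite {z \<in> pts U. u z = d}" using finite_gsetD(2)[OF gmaps_gset(1)[OF U(1)]] by simp
    ultimately show "1 < card {z \<in> pts U. u z = d}" using card_image_le[of "{z \<in> pts U. u z = d}" eU] by linarith
  qed
  show thesis
    by (rule that[OF gcomp_gmaps[OF i2(1) ed(5)] U(2,1) V(2,1) big])
      (simp only: main split t0 t1 h1 part[OF i2(1) U V])
qed

end

section \<open>Induction on the elements of a coproduct of Tambara functors\<close>

text \<open>
  The coproduct is generated by its two factors under the operations of a Tambara functor, since its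
  elements are classes of expressions in these operations.
\<close>

lemma coprod_induct:
  fixes G :: "('g, 'k) monoid_scheme" and R1 :: "('g, 'a) tambara" and R2 :: "('g, 'b) tambara"
  assumes alg: "tambara_algebra G S R1 \<eta>1" "tambara_algebra G S R2 \<eta>2"
  defines "P \<equiv> coprod G S R1 \<eta>1 R2 \<eta>2"
  assumes inl: "\<And>X a. finite_gset G X \<Longrightarrow> a \<in> carrier (lev R1 X) \<Longrightarrow> Q X (coprod_inl G S R1 \<eta>1 R2 \<eta>2 X a)"
    and inr: "\<And>X b. finite_gset G X \<Longrightarrow> b \<in> carrier (lev R2 X) \<Longrightarrow> Q X (coprod_inr G S R1 \<eta>1 R2 \<eta>2 X b)"
    and zero: "\<And>X. finite_gset G X \<Longrightarrow> Q X \<zero>\<^bsub>lev P X\<^esub>"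
    and one: "\<And>X. finite_gset G X \<Longrightarrow> Q X \<one>\<^bsub>lev P X\<^esub>"
    and neg: "\<And>X c. \<lbrakk>finite_gset G X; c \<in> carrier (lev P X); Q X c\<rbrakk> \<Longrightarrow> Q X (\<ominus>\<^bsub>lev P X\<^esub> c)"
    and add: "\<And>X c d. \<lbrakk>finite_gset G X; c \<in> carrier (lev P X); d \<in> carrier (lev P X); Q X c; Q X d\<rbrakk> \<Longrightarrow> Q X (c \<oplus>\<^bsub>lev P X\<^esub> d)"
    and mult: "\<And>X c d. \<lbrakk>finite_gset G X; c \<in> carrier (lev P X); d \<in> carrier (lev P X); Q X c; Q X d\<rbrakk> \<Longrightarrow> Q X (c \<otimes>\<^bsub>lev P X\<^esub> d)"
    and res: "\<And>X Y f c. \<lbrakk>f \<in> gmaps G X Y; c \<in> carrier (lev P Y); Q Y c\<rbrakk> \<Longrightarrow> Q X (res P X Y f c)"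
    and tr: "\<And>X Y f c. \<lbrakk>f \<in> gmaps G X Y; c \<in> carrier (lev P X); Q X c\<rbrakk> \<Longrightarrow> Q Y (tr P X Y f c)"
    and nm: "\<And>X Y f c. \<lbrakk>f \<in> gmaps G X Y; c \<in> carrier (lev P X); Q X c\<rbrakk> \<Longrightarrow> Q Y (nm P X Y f c)"
    and c: "c \<in> carrier (lev P X)"
  shows "Q X c"
proof -
  interpret R1: tambara_functor G R1 using alg(1) by (simp add: tambara_algebra_def)
  interpret R2: tambara_functor G R2 using alg(2) by (simp add: tambara_algebra_def)
  interpret P: tambara_functor G P unfolding P_def by (rule coprod_tambara[OF R1.group_G R1.finite_G])
  let ?teq = "teq G S R1 \<eta>1 R2 \<eta>2" and ?cls = "tcls G S R1 \<eta>1 R2 \<eta>2"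
  have cl: "?cls X u \<in> carrier (lev P X)" if "?teq X u u" for X u
    unfolding P_def by (rule coprod_carrierI[OF that])
  have L: "Q X (?cls X (TL X a))" if "finite_gset G X" "a \<in> carrier (lev R1 X)" for X a
    using inl[OF that] by (simp add: coprod_inl_def)
  have R: "Q X (?cls X (TR X b))" if "finite_gset G X" "b \<in> carrier (lev R2 X)" for X b
    using inr[OF that] by (simp add: coprod_inr_def)
  have Z: "Q X (?cls X (TZero X))" "Q X (?cls X (TOne X))" if "finite_gset G X" for X
    using zero[OF that] one[OF that] by (simp_all add: P_def coprod_zero coprod_one)
  have A: "Q X (?cls X (TAdd X u v))" "Q X (?cls X (TMul X u v))"
    if "?teq X u u" "?teq X v v" "Q X (?cls X u)" "Q X (?cls X v)" for X u v
    using add[OF teq_gset[OF that(1)] cl[OF that(1)] cl[OF that(2)] that(3,4)]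
      mult[OF teq_gset[OF that(1)] cl[OF that(1)] cl[OF that(2)] that(3,4)]
    by (simp_all add: P_def coprod_add[OF that(1,2)] coprod_mult[OF that(1,2)])
  have N: "Q X (?cls X (TNeg X u))" if u: "?teq X u u" "Q X (?cls X u)" for X u
  proof -
    note X = teq_gset[OF u(1)]
    have "?cls X (TNeg X u) \<oplus>\<^bsub>lev P X\<^esub> ?cls X u = \<zero>\<^bsub>lev P X\<^esub>"
      using coprod_add[OF teq_wf_ops(3)[OF u(1)] u(1)] tcls_eqI[OF teq_add_neg[OF u(1)]] by (simp add: P_def coprod_zero)
    then have "\<ominus>\<^bsub>lev P X\<^esub> ?cls X u = ?cls X (TNeg X u)"
      by (rule abelian_group.minus_equality[OF P.abelian_lev[OF X]]) (rule cl[OF u(1)], rule cl[OF teq_wf_ops(3)[OF u(1)]])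
    then show ?thesis using neg[OF X cl[OF u(1)] u(2)] by simp
  qed
  have S: "Q X (?cls X (TRes X Y f u))" if "f \<in> gmaps G X Y" "?teq Y u u" "Q Y (?cls Y u)" for X Y f u
    using res[OF that(1) cl[OF that(2)] that(3)] by (simp add: P_def coprod_res[OF that(1,2)])
  have T: "Q Y (?cls Y (TTr X Y f u))" "Q Y (?cls Y (TNm X Y f u))" if "f \<in> gmaps G X Y" "?teq X u u" "Q X (?cls X u)" for X Y f u
    using tr[OF that(1) cl[OF that(2)] that(3)] nm[OF that(1) cl[OF that(2)] that(3)]
    by (simp_all add: P_def coprod_tr[OF that(1,2)] coprod_nm[OF that(1,2)])
  have c1: "a \<oplus>\<^bsub>lev R1 X\<^esub> b \<in> carrier (lev R1 X)" "a \<otimes>\<^bsub>lev R1 X\<^esub> b \<in> carrier (lev R1 X)"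
    if "finite_gset G X" "a \<in> carrier (lev R1 X)" "b \<in> carrier (lev R1 X)" for X a b
    using cring.cring_simprules(1,5)[OF R1.cring_lev[OF that(1)] that(2,3)] by auto
  have c2: "a \<oplus>\<^bsub>lev R2 X\<^esub> b \<in> carrier (lev R2 X)" "a \<otimes>\<^bsub>lev R2 X\<^esub> b \<in> carrier (lev R2 X)"
    if "finite_gset G X" "a \<in> carrier (lev R2 X)" "b \<in> carrier (lev R2 X)" for X a b
    using cring.cring_simprules(1,5)[OF R2.cring_lev[OF that(1)] that(2,3)] by auto
  have o: "\<one>\<^bsub>lev R1 X\<^esub> \<in> carrier (lev R1 X)" "\<one>\<^bsub>lev R2 X\<^esub> \<in> carrier (lev R2 X)" if "finite_gset G X" for X
    using cring.cring_simprules(6)[OF R1.cring_lev[OF that]] cring.cring_simprules(6)[OF R2.cring_lev[OF that]] by auto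
  have e: "\<eta>1 X s \<in> carrier (lev R1 X)" "\<eta>2 X s \<in> carrier (lev R2 X)" if "finite_gset G X" "s \<in> carrier (lev S X)" for X s
    using alg that tambara_mapD(5) by (auto simp: tambara_algebra_def)
  note closed = c1 c2 o e R1.res_closed R1.tr_closed R1.nm_closed R2.res_closed R2.tr_closed R2.nm_closed
  have main: "Q X (?cls X u) \<and> Q X (?cls X v)" if "?teq X u v" for X u v
    using that
  proof (induction rule: teq.induct)
    case (teq_coproduct X1 X2 X j1 j2 u v) then show ?case by simp
  next
    case (teq_tr_base_change P X Y Z p q f g u)
    note d = is_pullbackD[OF teq_tr_base_change.hyps(1)]
    show ?case using teq_tr_base_change d by (simp add: S T teq_wf_ops)
  next
    case (teq_nm_base_change P X Y Z p q f g u)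
    note d = is_pullbackD[OF teq_nm_base_change.hyps(1)]
    show ?case using teq_nm_base_change d by (simp add: S T teq_wf_ops)
  next
    case (teq_nm_tr A X Y E D h g e g' h' u)
    note d = is_exponentialD[OF teq_nm_tr.hyps(1)]
    show ?case using teq_nm_tr d by (simp add: S T teq_wf_ops)
  next
    case (teq_cong_neg X u v) then show ?case using teq_refl[OF teq_cong_neg.hyps(1)] by (simp add: N)
  next
    case (teq_cong_add X u v u' v') then show ?case
      using teq_refl[OF teq_cong_add.hyps(1)] teq_refl[OF teq_cong_add.hyps(2)] by (simp add: A)
  next
    case (teq_cong_mul X u v u' v') then show ?case
      using teq_refl[OF teq_cong_mul.hyps(1)] teq_refl[OF teq_cong_mul.hyps(2)] by (simp add: A)
  next
    case (teq_cong_res f X Y u v) then show ?case using teq_refl[OF teq_cong_res.hyps(2)] by (simp add: S)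
  next
    case (teq_cong_tr f X Y u v) then show ?case using teq_refl[OF teq_cong_tr.hyps(2)] by (simp add: T)
  next
    case (teq_cong_nm f X Y u v) then show ?case using teq_refl[OF teq_cong_nm.hyps(2)] by (simp add: T)
  qed (simp_all add: Z A N S T L R closed gid_gmaps gcomp_gmaps teq_gset teq_wf_ops gmaps_gset teq_wf_zero teq_wf_one
      teq_wf_L teq_wf_R)
  obtain u where "c = ?cls X u" "?teq X u u" using c unfolding P_def by (rule coprod_carrierE)
  then show "Q X c" using main by simp
qed


section \<open>The augmentation ideal\<close>

locale relative_tambara =
  fixes G :: "('g, 'k) monoid_scheme"
    and S :: "('g, 's) tambara"
    and R :: "('g, 'r) tambara"
    and \<eta> :: "'g gset \<Rightarrow> 's \<Rightarrow> 'r"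
  assumes algebra: "tambara_algebra G S R \<eta>"
begin

abbreviation "P \<equiv> box_square G S R \<eta>"
abbreviation "left \<equiv> coprod_inl G S R \<eta> R \<eta>"
abbreviation "right \<equiv> coprod_inr G S R \<eta> R \<eta>"
abbreviation "\<mu> \<equiv> mult_map R"
abbreviation "I \<equiv> aug_ideal G S R \<eta>"
abbreviation "big \<equiv> big_norms G S R \<eta>"
abbreviation "\<Omega> \<equiv> genuine_Kahler G S R \<eta>"

sublocale R: tambara_functor G R
  using algebra by (simp add: tambara_algebra_def)

sublocale P: tambara_functor G P
  unfolding box_square_def by (rule coprod_tambara[OF R.group_G R.finite_G])

lemma left_map: "tambara_map G R P left" and right_map: "tambara_map G R P right"
  unfolding box_square_def
  by (rule coprod_inl_map[OF R.tambara_functor_axioms], rule coprod_inr_map[OF R.tambara_functor_axioms])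

lemma id_map: "tambara_map G R R (\<lambda>X a. a)"
  by (auto simp: tambara_map_def intro!: ring_hom_memI cring.cring_simprules(1,5)[OF R.cring_lev])

lemma \<mu>_map: "tambara_map G P R \<mu>"
  and \<mu>_left: "finite_gset G X \<Longrightarrow> a \<in> carrier (lev R X) \<Longrightarrow> \<mu> X (left X a) = a"
  and \<mu>_right: "finite_gset G X \<Longrightarrow> a \<in> carrier (lev R X) \<Longrightarrow> \<mu> X (right X a) = a"
  unfolding box_square_def mult_map_def
  by (rule coprod_universal[OF algebra algebra R.tambara_functor_axioms id_map id_map refl]; assumption)+

lemma left_right_unit: "finite_gset G X \<Longrightarrow> s \<in> carrier (lev S X) \<Longrightarrow> left X (\<eta> X s) = right X (\<eta> X s)"
  by (rule coprod_agree)

lemmas leftD = tambara_mapD[OF left_map] and rightD = tambara_mapD[OF right_map] and \<mu>D = tambara_mapD[OF \<mu>_map]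

lemma left_add: "\<lbrakk>finite_gset G X; a \<in> carrier (lev R X); b \<in> carrier (lev R X)\<rbrakk> \<Longrightarrow>
    left X (a \<oplus>\<^bsub>lev R X\<^esub> b) = left X a \<oplus>\<^bsub>lev P X\<^esub> left X b"
  and left_mult: "\<lbrakk>finite_gset G X; a \<in> carrier (lev R X); b \<in> carrier (lev R X)\<rbrakk> \<Longrightarrow>
    left X (a \<otimes>\<^bsub>lev R X\<^esub> b) = left X a \<otimes>\<^bsub>lev P X\<^esub> left X b"
  and left_one: "finite_gset G X \<Longrightarrow> left X \<one>\<^bsub>lev R X\<^esub> = \<one>\<^bsub>lev P X\<^esub>"
  using ring_hom_add[OF leftD(1)] ring_hom_mult[OF leftD(1)] ring_hom_one[OF leftD(1)] by auto

lemma right_add: "\<lbrakk>finite_gset G X; a \<in> carrier (lev R X); b \<in> carrier (lev R X)\<rbrakk> \<Longrightarrow>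
    right X (a \<oplus>\<^bsub>lev R X\<^esub> b) = right X a \<oplus>\<^bsub>lev P X\<^esub> right X b"
  and right_mult: "\<lbrakk>finite_gset G X; a \<in> carrier (lev R X); b \<in> carrier (lev R X)\<rbrakk> \<Longrightarrow>
    right X (a \<otimes>\<^bsub>lev R X\<^esub> b) = right X a \<otimes>\<^bsub>lev P X\<^esub> right X b"
  using ring_hom_add[OF rightD(1)] ring_hom_mult[OF rightD(1)] by auto

lemma \<mu>_add: "\<lbrakk>finite_gset G X; x \<in> carrier (lev P X); y \<in> carrier (lev P X)\<rbrakk> \<Longrightarrow>
    \<mu> X (x \<oplus>\<^bsub>lev P X\<^esub> y) = \<mu> X x \<oplus>\<^bsub>lev R X\<^esub> \<mu> X y"
  and \<mu>_mult: "\<lbrakk>finite_gset G X; x \<in> carrier (lev P X); y \<in> carrier (lev P X)\<rbrakk> \<Longrightarrow>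
    \<mu> X (x \<otimes>\<^bsub>lev P X\<^esub> y) = \<mu> X x \<otimes>\<^bsub>lev R X\<^esub> \<mu> X y"
  using ring_hom_add[OF \<mu>D(1)] ring_hom_mult[OF \<mu>D(1)] by auto

lemma left_zero: "finite_gset G X \<Longrightarrow> left X \<zero>\<^bsub>lev R X\<^esub> = \<zero>\<^bsub>lev P X\<^esub>"
  and \<mu>_zero: "finite_gset G X \<Longrightarrow> \<mu> X \<zero>\<^bsub>lev P X\<^esub> = \<zero>\<^bsub>lev R X\<^esub>"
  using hom_zero[OF R.abelian_lev P.abelian_lev ring_hom_add_hom[OF leftD(1)]]
    hom_zero[OF P.abelian_lev R.abelian_lev ring_hom_add_hom[OF \<mu>D(1)]] by auto

lemma I_simps:
  "carrier (mlev I X) = {x \<in> carrier (lev P X). \<mu> X x = \<zero>\<^bsub>lev R X\<^esub>}"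
  "x \<oplus>\<^bsub>mlev I X\<^esub> y = x \<oplus>\<^bsub>lev P X\<^esub> y" "\<zero>\<^bsub>mlev I X\<^esub> = \<zero>\<^bsub>lev P X\<^esub>"
  "a \<odot>\<^bsub>mlev I X\<^esub> x = left X a \<otimes>\<^bsub>lev P X\<^esub> x"
  "mres I X Y f = res P X Y f" "mtr I X Y f = tr P X Y f"
  by (auto simp: aug_ideal_def Let_def a_kernel_def')

lemma I_carrierD: "x \<in> carrier (mlev I X) \<Longrightarrow> x \<in> carrier (lev P X)" "x \<in> carrier (mlev I X) \<Longrightarrow> \<mu> X x = \<zero>\<^bsub>lev R X\<^esub>"
  by (simp_all add: I_simps)

lemma I_closed:
  assumes X: "finite_gset G X"
  shows "\<zero>\<^bsub>lev P X\<^esub> \<in> carrier (mlev I X)"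
    "x \<in> carrier (mlev I X) \<Longrightarrow> y \<in> carrier (mlev I X) \<Longrightarrow> x \<oplus>\<^bsub>lev P X\<^esub> y \<in> carrier (mlev I X)"
    "z \<in> carrier (lev P X) \<Longrightarrow> y \<in> carrier (mlev I X) \<Longrightarrow> z \<otimes>\<^bsub>lev P X\<^esub> y \<in> carrier (mlev I X)"
    "x \<in> carrier (mlev I X) \<Longrightarrow> \<ominus>\<^bsub>lev P X\<^esub> x \<in> carrier (mlev I X)"
proof -
  interpret p: cring "lev P X" by (rule P.cring_lev[OF X])
  interpret r: cring "lev R X" by (rule R.cring_lev[OF X])
  show "\<zero>\<^bsub>lev P X\<^esub> \<in> carrier (mlev I X)" by (simp add: I_simps \<mu>_zero X)
  show "x \<in> carrier (mlev I X) \<Longrightarrow> y \<in> carrier (mlev I X) \<Longrightarrow> x \<oplus>\<^bsub>lev P X\<^esub> y \<in> carrier (mlev I X)"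
    by (simp add: I_simps \<mu>_add X)
  show mul: "z \<in> carrier (lev P X) \<Longrightarrow> y \<in> carrier (mlev I X) \<Longrightarrow> z \<otimes>\<^bsub>lev P X\<^esub> y \<in> carrier (mlev I X)" for z y
    by (simp add: I_simps \<mu>_mult X \<mu>D(5)[OF X])
  show "\<ominus>\<^bsub>lev P X\<^esub> x \<in> carrier (mlev I X)" if x: "x \<in> carrier (mlev I X)"
    using mul[of "\<ominus>\<^bsub>lev P X\<^esub> \<one>\<^bsub>lev P X\<^esub>", OF _ x] I_carrierD(1)[OF x] by (simp add: p.l_minus)
qed

lemma I_res: "f \<in> gmaps G X Y \<Longrightarrow> x \<in> carrier (mlev I Y) \<Longrightarrow> res P X Y f x \<in> carrier (mlev I X)"
  by (simp add: I_simps P.res_closed \<mu>D(2) R.res_zero)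

lemma I_tr: "f \<in> gmaps G X Y \<Longrightarrow> x \<in> carrier (mlev I X) \<Longrightarrow> tr P X Y f x \<in> carrier (mlev I Y)"
  by (simp add: I_simps P.tr_closed \<mu>D(3) R.tr_zero)

lemma I_module:
  assumes X: "finite_gset G X"
  shows "module (lev R X) (mlev I X)"
proof -
  interpret p: cring "lev P X" by (rule P.cring_lev[OF X])
  note c = I_carrierD(1) I_closed[OF X] leftD(5)[OF X]
  show ?thesis
  proof (rule moduleI)
    show "cring (lev R X)" by (rule R.cring_lev[OF X])
    show "abelian_group (mlev I X)"
    proof (rule abelian_groupI)
      fix x assume x: "x \<in> carrier (mlev I X)"
      then show "\<exists>y\<in>carrier (mlev I X). y \<oplus>\<^bsub>mlev I X\<^esub> x = \<zero>\<^bsub>mlev I X\<^esub>"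
        by (intro bexI[of _ "\<ominus>\<^bsub>lev P X\<^esub> x"]) (simp_all add: I_simps(2,3) c p.l_neg)
    qed (simp_all add: I_simps(2,3) c p.a_ac)
  qed (simp_all add: I_simps(2,3,4) c left_add left_mult left_one X p.l_distr p.r_distr p.m_assoc)
qed

text \<open>A map all of whose fibres have more than one point is surjective, so that its norm preserves \<open>0\<close>.\<close>

lemma big_subset: "big Y \<subseteq> carrier (mlev I Y)"
proof
  fix z assume "z \<in> big Y"
  then obtain X f x where f: "f \<in> gmaps G X Y" "\<forall>y\<in>pts Y. 1 < card {z \<in> pts X. f z = y}"
    and x: "x \<in> carrier (mlev I X)" and z: "z = nm P X Y f x"
    by (auto simp: big_norms_def)
  have "y \<in> f ` pts X" if "y \<in> pts Y" for y
  proof -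
    have "{z \<in> pts X. f z = y} \<noteq> {}" using bspec[OF f(2) that] by (metis card.empty not_less_zero)
    then show ?thesis by auto
  qed
  then have "f ` pts X = pts Y" using gmapsD(1)[OF f(1)] by (intro equalityI subsetI) auto
  then show "z \<in> carrier (mlev I Y)"
    using f x z by (simp add: I_simps P.nm_closed \<mu>D(4) R.nm_zero)
qed

lemma is_submoduleD:
  assumes N: "is_submodule G R I N"
  shows "finite_gset G X \<Longrightarrow> x \<in> N X \<Longrightarrow> x \<in> carrier (mlev I X)"
    "finite_gset G X \<Longrightarrow> \<zero>\<^bsub>lev P X\<^esub> \<in> N X"
    "finite_gset G X \<Longrightarrow> x \<in> N X \<Longrightarrow> y \<in> N X \<Longrightarrow> x \<oplus>\<^bsub>lev P X\<^esub> y \<in> N X"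
    "finite_gset G X \<Longrightarrow> a \<in> carrier (lev R X) \<Longrightarrow> x \<in> N X \<Longrightarrow> left X a \<otimes>\<^bsub>lev P X\<^esub> x \<in> N X"
    "finite_gset G X \<Longrightarrow> x \<in> N X \<Longrightarrow> \<ominus>\<^bsub>lev P X\<^esub> x \<in> N X"
    "f \<in> gmaps G X Y \<Longrightarrow> x \<in> N Y \<Longrightarrow> res P X Y f x \<in> N X"
    "f \<in> gmaps G X Y \<Longrightarrow> x \<in> N X \<Longrightarrow> tr P X Y f x \<in> N Y"
proof -
  have sub: "submodule (N X) (lev R X) (mlev I X)" if "finite_gset G X" for X
    using N that by (simp add: is_submodule_def)
  note E = module.submoduleE[OF I_module sub]
  show c: "finite_gset G X \<Longrightarrow> x \<in> N X \<Longrightarrow> x \<in> carrier (mlev I X)" for X x using E(1) by blast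
  show "finite_gset G X \<Longrightarrow> \<zero>\<^bsub>lev P X\<^esub> \<in> N X"
    using subgroup.one_closed[OF submodule.axioms(1)[OF sub]] by (simp add: I_simps)
  show "finite_gset G X \<Longrightarrow> x \<in> N X \<Longrightarrow> y \<in> N X \<Longrightarrow> x \<oplus>\<^bsub>lev P X\<^esub> y \<in> N X"
    using E(5) by (simp add: I_simps)
  show sm: "finite_gset G X \<Longrightarrow> a \<in> carrier (lev R X) \<Longrightarrow> x \<in> N X \<Longrightarrow> left X a \<otimes>\<^bsub>lev P X\<^esub> x \<in> N X" for X a x
    using E(4) by (simp add: I_simps)
  show "\<ominus>\<^bsub>lev P X\<^esub> x \<in> N X" if X: "finite_gset G X" and x: "x \<in> N X"
  proof -
    interpret p: cring "lev P X" by (rule P.cring_lev[OF X])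
    interpret r: cring "lev R X" by (rule R.cring_lev[OF X])
    have "left X (\<ominus>\<^bsub>lev R X\<^esub> \<one>\<^bsub>lev R X\<^esub>) \<oplus>\<^bsub>lev P X\<^esub> \<one>\<^bsub>lev P X\<^esub> = \<zero>\<^bsub>lev P X\<^esub>"
      using left_add[OF X, of "\<ominus>\<^bsub>lev R X\<^esub> \<one>\<^bsub>lev R X\<^esub>" "\<one>\<^bsub>lev R X\<^esub>"] by (simp add: r.l_neg left_zero left_one X)
    then have "\<ominus>\<^bsub>lev P X\<^esub> \<one>\<^bsub>lev P X\<^esub> = left X (\<ominus>\<^bsub>lev R X\<^esub> \<one>\<^bsub>lev R X\<^esub>)"
      by (rule p.minus_equality) (simp_all add: leftD(5)[OF X])
    then have "\<ominus>\<^bsub>lev P X\<^esub> x = left X (\<ominus>\<^bsub>lev R X\<^esub> \<one>\<^bsub>lev R X\<^esub>) \<otimes>\<^bsub>lev P X\<^esub> x"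
      using I_carrierD(1)[OF c[OF X x]] by (metis p.l_minus p.l_one p.one_closed)
    then show ?thesis using sm[OF X _ x] by simp
  qed
  show "f \<in> gmaps G X Y \<Longrightarrow> x \<in> N Y \<Longrightarrow> res P X Y f x \<in> N X"
    "f \<in> gmaps G X Y \<Longrightarrow> x \<in> N X \<Longrightarrow> tr P X Y f x \<in> N Y"
    using N unfolding is_submodule_def I_simps(5,6) by blast+
qed

lemma is_submoduleI:
  assumes c: "\<And>X. finite_gset G X \<Longrightarrow> N X \<subseteq> carrier (mlev I X)"
    and z: "\<And>X. finite_gset G X \<Longrightarrow> \<zero>\<^bsub>lev P X\<^esub> \<in> N X"
    and a: "\<And>X x y. finite_gset G X \<Longrightarrow> x \<in> N X \<Longrightarrow> y \<in> N X \<Longrightarrow> x \<oplus>\<^bsub>lev P X\<^esub> y \<in> N X"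
    and m: "\<And>X a x. finite_gset G X \<Longrightarrow> a \<in> carrier (lev R X) \<Longrightarrow> x \<in> N X \<Longrightarrow> left X a \<otimes>\<^bsub>lev P X\<^esub> x \<in> N X"
    and r: "\<And>X Y f x. f \<in> gmaps G X Y \<Longrightarrow> x \<in> N Y \<Longrightarrow> res P X Y f x \<in> N X"
    and t: "\<And>X Y f x. f \<in> gmaps G X Y \<Longrightarrow> x \<in> N X \<Longrightarrow> tr P X Y f x \<in> N Y"
  shows "is_submodule G R I N"
  unfolding is_submodule_def
proof (intro conjI allI impI ballI)
  fix X :: "'g gset" assume X: "finite_gset G X"
  interpret m: module "lev R X" "mlev I X" by (rule I_module[OF X])
  show "submodule (N X) (lev R X) (mlev I X)"
  proof (rule m.submoduleI)
    fix x assume x: "x \<in> N X"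
    then have xc: "x \<in> carrier (mlev I X)" using c[OF X] by blast
    have "\<ominus>\<^bsub>mlev I X\<^esub> x = (\<ominus>\<^bsub>lev R X\<^esub> \<one>\<^bsub>lev R X\<^esub>) \<odot>\<^bsub>mlev I X\<^esub> x"
      using xc by (simp add: m.smult_l_minus)
    then show "\<ominus>\<^bsub>mlev I X\<^esub> x \<in> N X" using m[OF X _ x] by (simp add: I_simps(4))
  qed (use c[OF X] z[OF X] a[OF X] m[OF X] in \<open>auto simp: I_simps(2-4)\<close>)
qed (auto simp: I_simps(5,6) r t)

lemma gen_submodule_big:
  defines "N \<equiv> gen_submodule G R I big"
  shows "is_submodule G R I N" "finite_gset G X \<Longrightarrow> big X \<subseteq> N X"
    "\<lbrakk>is_submodule G R I N'; \<And>Y. finite_gset G Y \<Longrightarrow> big Y \<subseteq> N' Y\<rbrakk> \<Longrightarrow> N X \<subseteq> N' X"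
proof -
  have N: "x \<in> N X \<longleftrightarrow> (\<forall>N'. is_submodule G R I N' \<and> (\<forall>Y. finite_gset G Y \<longrightarrow> big Y \<subseteq> N' Y) \<longrightarrow> x \<in> N' X)" for x X
    by (auto simp: N_def gen_submodule_def)
  have top: "is_submodule G R I (\<lambda>X. carrier (mlev I X))"
    by (rule is_submoduleI) (auto simp: I_closed I_res I_tr leftD(5))
  show "is_submodule G R I N"
  proof (rule is_submoduleI)
    show "N X \<subseteq> carrier (mlev I X)" if "finite_gset G X" for X
    proof
      fix x assume "x \<in> N X"
      then show "x \<in> carrier (mlev I X)" unfolding N using top big_subset by blast
    qed
  qed (auto simp: N is_submoduleD)
  show "finite_gset G X \<Longrightarrow> big X \<subseteq> N X" unfolding subset_iff N by blast
  show "\<lbrakk>is_submodule G R I N'; \<And>Y. finite_gset G Y \<Longrightarrow> big Y \<subseteq> N' Y\<rbrakk> \<Longrightarrow> N X \<subseteq> N' X" by (auto simp: N)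
qed

text \<open>The product of \<open>x\<close> and \<open>y\<close> is the norm of \<open>(x, y)\<close> along the fold map \<open>X \<squnion> X \<rightarrow> X\<close>.\<close>

lemma mult_mem_big:
  assumes X: "finite_gset G X" and x: "x \<in> carrier (mlev I X)" and y: "y \<in> carrier (mlev I X)"
  shows "x \<otimes>\<^bsub>lev P X\<^esub> y \<in> big X"
proof -
  obtain Z i j where c: "is_coproduct G X X Z i j" by (rule coproduct_exists[OF X X])
  note ij = is_coproductD(1,2)[OF c]
  obtain n where n: "n \<in> gmaps G Z X" "gcomp X n i = gid X" "gcomp X n j = gid X"
    by (rule copair_gmap[OF c gid_gmaps[OF X] gid_gmaps[OF X]])
  note xy = I_carrierD(1)[OF x] I_carrierD(1)[OF y]
  obtain z where z: "z \<in> carrier (lev P Z)" "res P X Z i z = x" "res P X Z j z = y"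
    by (rule P.coproduct_elem[OF c xy])
  note Z = gmaps_gset(1)[OF n(1)]
  have "\<mu> Z z = \<zero>\<^bsub>lev R Z\<^esub>"
  proof (rule R.coproduct_eqI[OF c])
    show "\<mu> Z z \<in> carrier (lev R Z)" by (rule \<mu>D(5)[OF Z z(1)])
    show "\<zero>\<^bsub>lev R Z\<^esub> \<in> carrier (lev R Z)" using cring.cring_simprules(2)[OF R.cring_lev[OF Z]] .
    show "res R X Z i (\<mu> Z z) = res R X Z i \<zero>\<^bsub>lev R Z\<^esub>"
      using \<mu>D(2)[OF ij(1) z(1)] z(2) I_carrierD(2)[OF x] R.res_zero[OF ij(1)] by simp
    show "res R X Z j (\<mu> Z z) = res R X Z j \<zero>\<^bsub>lev R Z\<^esub>"
      using \<mu>D(2)[OF ij(2) z(1)] z(3) I_carrierD(2)[OF y] R.res_zero[OF ij(2)] by simp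
  qed
  then have zI: "z \<in> carrier (mlev I Z)" using z(1) by (simp add: I_simps)
  have "1 < card {w \<in> pts Z. n w = u}" if u: "u \<in> pts X" for u
  proof -
    have "i u \<in> i ` pts X" "j u \<in> j ` pts X" using u by (auto intro: imageI)
    moreover have "i ` pts X \<inter> j ` pts X = {}" using c by (simp add: is_coproduct_def)
    ultimately have ne: "i u \<noteq> j u" by (metis IntI empty_iff)
    have "{i u, j u} \<subseteq> {w \<in> pts Z. n w = u}"
      using u gmapsD(1)[OF ij(1) u] gmapsD(1)[OF ij(2) u] fun_cong[OF n(2), of u] fun_cong[OF n(3), of u] by simp
    moreover have "finite {w \<in> pts Z. n w = u}" using finite_gsetD(2)[OF Z] by simp
    ultimately have "card {i u, j u} \<le> card {w \<in> pts Z. n w = u}" by (intro card_mono)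
    then show ?thesis using ne by simp
  qed
  moreover have "nm P Z X n z = x \<otimes>\<^bsub>lev P X\<^esub> y"
    using P.nm_coproduct[OF c n(1) z(1)] z(2,3) n(2,3) P.nm_id[OF X] xy by simp
  ultimately show ?thesis unfolding big_norms_def using n(1) zI by blast
qed

text \<open>
  Modulo norms along maps with large fibres, the norm of \<open>left a + x\<close> is affine in \<open>x\<close>: in the exponential
  formula the terms in which \<open>x\<close> occurs at two or more points are transfers of multiples of such norms.
\<close>

lemma nm_left_add:
  assumes N: "is_submodule G R I N" "\<And>Y. finite_gset G Y \<Longrightarrow> big Y \<subseteq> N Y"
    and f: "f \<in> gmaps G X Y" and a: "a \<in> carrier (lev R X)" and x: "x \<in> carrier (mlev I X)"
  obtains w where "w \<in> N Y" "nm P X Y f (left X a \<oplus>\<^bsub>lev P X\<^esub> x) =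
    left Y (nm R X Y f a) \<oplus>\<^bsub>lev P Y\<^esub> tr P X Y f (left X (cofactor G R X f a) \<otimes>\<^bsub>lev P X\<^esub> x) \<oplus>\<^bsub>lev P Y\<^esub> w"
proof -
  note X = gmaps_gset(1)[OF f]
  note la = leftD(5)[OF X a] and xP = I_carrierD(1)[OF x]
  obtain D U V :: "'g gset" and k u e v e' where k: "k \<in> gmaps G D Y" and u: "u \<in> gmaps G U D" "e \<in> gmaps G U X"
    and v: "v \<in> gmaps G V D" "e' \<in> gmaps G V X" and b: "\<forall>d\<in>pts D. 1 < card {z \<in> pts U. u z = d}"
    and eq: "nm P X Y f (left X a \<oplus>\<^bsub>lev P X\<^esub> x) =
      nm P X Y f (left X a) \<oplus>\<^bsub>lev P Y\<^esub> tr P X Y f (cofactor G P X f (left X a) \<otimes>\<^bsub>lev P X\<^esub> x) \<oplus>\<^bsub>lev P Y\<^esub>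
      tr P D Y k (nm P U D u (res P U X e x) \<otimes>\<^bsub>lev P D\<^esub> nm P V D v (res P V X e' (left X a)))"
    by (rule P.nm_add[OF f la xP])
  note Dg = gmaps_gset(1)[OF k]
  interpret d: cring "lev P D" by (rule P.cring_lev[OF Dg])
  let ?n = "nm P U D u (res P U X e x)" and ?m = "nm R V D v (res R V X e' a)"
  have m: "?m \<in> carrier (lev R D)" by (rule R.nm_closed[OF v(1) R.res_closed[OF v(2) a]])
  have "?n \<in> big D"
    unfolding big_norms_def using u(1) b I_res[OF u(2) x] by blast
  then have n: "?n \<in> N D" using N(2)[OF Dg] by blast
  then have nP: "?n \<in> carrier (lev P D)" using is_submoduleD(1)[OF N(1) Dg] I_carrierD(1) by blast
  have "nm P V D v (res P V X e' (left X a)) = left D ?m"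
    using leftD(2)[OF v(2) a] leftD(4)[OF v(1) R.res_closed[OF v(2) a]] by simp
  then have "?n \<otimes>\<^bsub>lev P D\<^esub> nm P V D v (res P V X e' (left X a)) = left D ?m \<otimes>\<^bsub>lev P D\<^esub> ?n"
    using d.m_comm[OF nP leftD(5)[OF Dg m]] by simp
  then have "tr P D Y k (?n \<otimes>\<^bsub>lev P D\<^esub> nm P V D v (res P V X e' (left X a))) \<in> N Y"
    using is_submoduleD(7)[OF N(1) k is_submoduleD(4)[OF N(1) Dg m n]] by simp
  then show thesis
    using that eq leftD(4)[OF f a]
      cofactor_tambara_map[OF R.tambara_functor_axioms P.tambara_functor_axioms left_map f a] by simp
qed

text \<open>In the classical case this is the element \<open>1 \<otimes> a - a \<otimes> 1\<close> of the tensor product.\<close>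

definition diff :: "'g gset \<Rightarrow> 'r \<Rightarrow> ('g, 'r, 'r) texp set" where
  "diff X a = right X a \<ominus>\<^bsub>lev P X\<^esub> left X a"

lemma right_eq_left_diff:
  assumes X: "finite_gset G X" and a: "a \<in> carrier (lev R X)"
  shows "right X a = left X a \<oplus>\<^bsub>lev P X\<^esub> diff X a" "diff X a \<in> carrier (mlev I X)"
proof -
  interpret p: cring "lev P X" by (rule P.cring_lev[OF X])
  interpret r: cring "lev R X" by (rule R.cring_lev[OF X])
  note c = leftD(5)[OF X a] rightD(5)[OF X a]
  have d: "diff X a \<in> carrier (lev P X)" using c by (simp add: diff_def)
  show eq: "right X a = left X a \<oplus>\<^bsub>lev P X\<^esub> diff X a"
    using c by (simp add: diff_def p.minus_eq p.a_comm[of "left X a"] p.a_assoc p.l_neg)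
  have "a = a \<oplus>\<^bsub>lev R X\<^esub> \<mu> X (diff X a)"
    using arg_cong[OF eq, of "\<mu> X"] \<mu>_add[OF X c(1) d] \<mu>_left[OF X a] \<mu>_right[OF X a] by simp
  then have "\<mu> X (diff X a) = \<zero>\<^bsub>lev R X\<^esub>"
    using a \<mu>D(5)[OF X d] r.add.l_cancel_one'[of a "\<mu> X (diff X a)"] by simp
  then show "diff X a \<in> carrier (mlev I X)" using d by (simp add: I_simps)
qed

lemma diff_eqI:
  assumes X: "finite_gset G X" and a: "a \<in> carrier (lev R X)" and x: "x \<in> carrier (lev P X)"
    and eq: "right X a = left X a \<oplus>\<^bsub>lev P X\<^esub> x"
  shows "diff X a = x"
proof -
  interpret p: cring "lev P X" by (rule P.cring_lev[OF X])
  note d = I_carrierD(1)[OF right_eq_left_diff(2)[OF X a]] and l = leftD(5)[OF X a]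
  have "diff X a \<oplus>\<^bsub>lev P X\<^esub> left X a = x \<oplus>\<^bsub>lev P X\<^esub> left X a"
    using eq right_eq_left_diff(1)[OF X a] p.a_comm[OF d l] p.a_comm[OF x l] by simp
  then show ?thesis using p.add.right_cancel[OF l d x] by simp
qed

text \<open>
  The elements of the form \<open>left a + x\<close> with \<open>x \<in> N\<close> include the two copies of \<open>R\<close> and are closed under all
  operations of a Tambara functor, for products and norms because \<open>N\<close> contains the norms along maps with
  large fibres.  Hence they are all of \<open>P\<close>; and if \<open>left a + x\<close> lies in \<open>I\<close>, then \<open>a = 0\<close>.
\<close>

lemma I_generated:
  assumes N: "is_submodule G R I N" "\<And>Y. finite_gset G Y \<Longrightarrow> big Y \<subseteq> N Y"
    and diff: "\<And>Y a. finite_gset G Y \<Longrightarrow> a \<in> carrier (lev R Y) \<Longrightarrow> diff Y a \<in> N Y"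
    and X: "finite_gset G X" and x: "x \<in> carrier (mlev I X)"
  shows "x \<in> N X"
proof -
  let ?Q = "\<lambda>X c. \<exists>a\<in>carrier (lev R X). \<exists>x\<in>N X. c = left X a \<oplus>\<^bsub>lev P X\<^esub> x"
  note ND = is_submoduleD[OF N(1)]
  have NP: "x \<in> carrier (lev P X)" "x \<in> carrier (mlev I X)" if "finite_gset G X" "x \<in> N X" for X x
    using I_carrierD(1)[OF ND(1)[OF that]] ND(1)[OF that] by simp_all
  have QI: "?Q X c" if "a \<in> carrier (lev R X)" "x \<in> N X" "c = left X a \<oplus>\<^bsub>lev P X\<^esub> x" for X a x c
    using that by blast
  have "?Q X x"
  proof (rule coprod_induct[OF algebra algebra, where Q = ?Q, folded box_square_def])
    fix X :: "'g gset" assume X: "finite_gset G X"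
    interpret p: cring "lev P X" by (rule P.cring_lev[OF X])
    interpret r: cring "lev R X" by (rule R.cring_lev[OF X])
    note c = leftD(5)[OF X] NP[OF X] ND(2-5)[OF X]
    show "?Q X (left X a)" if "a \<in> carrier (lev R X)" for a
      by (rule QI[of a _ "\<zero>\<^bsub>lev P X\<^esub>"]) (use that c in simp_all)
    show "?Q X (right X a)" if "a \<in> carrier (lev R X)" for a
      by (rule QI[OF that diff[OF X that] right_eq_left_diff(1)[OF X that]])
    show "?Q X \<zero>\<^bsub>lev P X\<^esub>"
      by (rule QI[of "\<zero>\<^bsub>lev R X\<^esub>" _ "\<zero>\<^bsub>lev P X\<^esub>"]) (simp_all add: c left_zero X)
    show "?Q X \<one>\<^bsub>lev P X\<^esub>"
      by (rule QI[of "\<one>\<^bsub>lev R X\<^esub>" _ "\<zero>\<^bsub>lev P X\<^esub>"]) (simp_all add: c left_one X)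
    fix c' assume "?Q X c'"
    then obtain a x where ax: "a \<in> carrier (lev R X)" "x \<in> N X" "c' = left X a \<oplus>\<^bsub>lev P X\<^esub> x" by blast
    have neg: "left X (\<ominus>\<^bsub>lev R X\<^esub> a) = \<ominus>\<^bsub>lev P X\<^esub> left X a"
      using left_add[OF X, of "\<ominus>\<^bsub>lev R X\<^esub> a" a] ax(1) c(1) left_zero[OF X]
      by (intro p.minus_equality[symmetric]) (simp_all add: r.l_neg)
    show "?Q X (\<ominus>\<^bsub>lev P X\<^esub> c')"
      by (rule QI[of "\<ominus>\<^bsub>lev R X\<^esub> a" _ "\<ominus>\<^bsub>lev P X\<^esub> x"]) (use ax c in \<open>simp_all add: neg p.minus_add\<close>)
    fix c'' assume "?Q X c''"
    then obtain b y where bY: "b \<in> carrier (lev R X)" "y \<in> N X" "c'' = left X b \<oplus>\<^bsub>lev P X\<^esub> y" by blast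
    show "?Q X (c' \<oplus>\<^bsub>lev P X\<^esub> c'')"
      by (rule QI[of "a \<oplus>\<^bsub>lev R X\<^esub> b" _ "x \<oplus>\<^bsub>lev P X\<^esub> y"]) (use ax bY c in \<open>simp_all add: left_add X p.a_ac\<close>)
    have xy: "x \<otimes>\<^bsub>lev P X\<^esub> y \<in> N X"
      using mult_mem_big[OF X c(3)[OF ax(2)] c(3)[OF bY(2)]] N(2)[OF X] by blast
    show "?Q X (c' \<otimes>\<^bsub>lev P X\<^esub> c'')"
      by (rule QI[of "a \<otimes>\<^bsub>lev R X\<^esub> b" _ "(left X a \<otimes>\<^bsub>lev P X\<^esub> y \<oplus>\<^bsub>lev P X\<^esub> left X b \<otimes>\<^bsub>lev P X\<^esub> x) \<oplus>\<^bsub>lev P X\<^esub> x \<otimes>\<^bsub>lev P X\<^esub> y"])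
        (use ax bY c xy in \<open>simp_all add: left_mult X p.l_distr p.r_distr p.a_ac p.m_ac\<close>)
  next
    fix X Y :: "'g gset" and f c assume f: "f \<in> gmaps G X Y"
    note X = gmaps_gset(1)[OF f] and Y = gmaps_gset(2)[OF f]
    show "?Q X (res P X Y f c)" if "?Q Y c"
    proof -
      from that obtain a x where ax: "a \<in> carrier (lev R Y)" "x \<in> N Y" "c = left Y a \<oplus>\<^bsub>lev P Y\<^esub> x" by blast
      show ?thesis
        by (rule QI[OF R.res_closed[OF f ax(1)] ND(6)[OF f ax(2)]])
          (simp add: ax(3) P.res_add[OF f leftD(5)[OF Y ax(1)] NP(1)[OF Y ax(2)]] leftD(2)[OF f ax(1)])
    qed
    assume "?Q X c"
    then obtain a x where ax: "a \<in> carrier (lev R X)" "x \<in> N X" "c = left X a \<oplus>\<^bsub>lev P X\<^esub> x" by blast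
    show "?Q Y (tr P X Y f c)"
      by (rule QI[OF R.tr_closed[OF f ax(1)] ND(7)[OF f ax(2)]])
        (simp add: ax(3) P.tr_add[OF f leftD(5)[OF X ax(1)] NP(1)[OF X ax(2)]] leftD(3)[OF f ax(1)])
    obtain w where w: "w \<in> N Y" "nm P X Y f c =
        left Y (nm R X Y f a) \<oplus>\<^bsub>lev P Y\<^esub> tr P X Y f (left X (cofactor G R X f a) \<otimes>\<^bsub>lev P X\<^esub> x) \<oplus>\<^bsub>lev P Y\<^esub> w"
      unfolding ax(3) by (rule nm_left_add[OF N f ax(1) NP(2)[OF X ax(2)]])
    have t: "tr P X Y f (left X (cofactor G R X f a) \<otimes>\<^bsub>lev P X\<^esub> x) \<in> N Y"
      by (rule ND(7)[OF f ND(4)[OF X R.cofactor_closed[OF f ax(1)] ax(2)]])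
    interpret p: cring "lev P Y" by (rule P.cring_lev[OF Y])
    show "?Q Y (nm P X Y f c)"
      by (rule QI[OF R.nm_closed[OF f ax(1)] ND(3)[OF Y t w(1)]])
        (use w t in \<open>simp add: p.a_assoc leftD(5)[OF Y R.nm_closed[OF f ax(1)]] NP(1)[OF Y]\<close>)
  next
    show "x \<in> carrier (lev P X)" by (rule I_carrierD(1)[OF x])
  qed
  then obtain a y where ay: "a \<in> carrier (lev R X)" "y \<in> N X" "x = left X a \<oplus>\<^bsub>lev P X\<^esub> y" by blast
  interpret p: cring "lev P X" by (rule P.cring_lev[OF X])
  interpret r: cring "lev R X" by (rule R.cring_lev[OF X])
  have "a = \<zero>\<^bsub>lev R X\<^esub>"
    using arg_cong[OF ay(3), of "\<mu> X"] \<mu>_add[OF X leftD(5)[OF X ay(1)] NP(1)[OF X ay(2)]] \<mu>_left[OF X ay(1)]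
      I_carrierD(2)[OF x] I_carrierD(2)[OF NP(2)[OF X ay(2)]] ay(1) by simp
  then have "x = y" using ay NP(1)[OF X ay(2)] left_zero[OF X] by simp
  then show ?thesis using ay(2) by simp
qed

end


section \<open>Module maps out of the genuine Kaehler differentials\<close>

lemma module_HomD:
  assumes "\<phi> \<in> module_Hom G R M N"
  shows "lev_extensional G (mlev M) \<phi>"
    "finite_gset G X \<Longrightarrow> m \<in> carrier (mlev M X) \<Longrightarrow> \<phi> X m \<in> carrier (mlev N X)"
    "finite_gset G X \<Longrightarrow> m \<in> carrier (mlev M X) \<Longrightarrow> m' \<in> carrier (mlev M X) \<Longrightarrow>
      \<phi> X (m \<oplus>\<^bsub>mlev M X\<^esub> m') = \<phi> X m \<oplus>\<^bsub>mlev N X\<^esub> \<phi> X m'"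
    "f \<in> gmaps G X Y \<Longrightarrow> m \<in> carrier (mlev M Y) \<Longrightarrow> \<phi> X (mres M X Y f m) = mres N X Y f (\<phi> Y m)"
    "f \<in> gmaps G X Y \<Longrightarrow> m \<in> carrier (mlev M X) \<Longrightarrow> \<phi> Y (mtr M X Y f m) = mtr N X Y f (\<phi> X m)"
    "finite_gset G X \<Longrightarrow> a \<in> carrier (lev R X) \<Longrightarrow> m \<in> carrier (mlev M X) \<Longrightarrow>
      \<phi> X (a \<odot>\<^bsub>mlev M X\<^esub> m) = a \<odot>\<^bsub>mlev N X\<^esub> \<phi> X m"
proof -
  have h: "\<phi> X \<in> hom (add_monoid (mlev M X)) (add_monoid (mlev N X))" if "finite_gset G X" for X
    using assms that by (simp add: module_Hom_def mackey_map_def)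
  show "finite_gset G X \<Longrightarrow> m \<in> carrier (mlev M X) \<Longrightarrow> \<phi> X m \<in> carrier (mlev N X)"
    using hom_in_carrier[OF h] by fastforce
  show "finite_gset G X \<Longrightarrow> m \<in> carrier (mlev M X) \<Longrightarrow> m' \<in> carrier (mlev M X) \<Longrightarrow>
      \<phi> X (m \<oplus>\<^bsub>mlev M X\<^esub> m') = \<phi> X m \<oplus>\<^bsub>mlev N X\<^esub> \<phi> X m'"
    using hom_mult[OF h] by fastforce
qed (use assms in \<open>simp_all add: module_Hom_def mackey_map_def\<close>)

lemma module_HomI:
  assumes "lev_extensional G (mlev M) \<phi>"
    "\<And>X m. finite_gset G X \<Longrightarrow> m \<in> carrier (mlev M X) \<Longrightarrow> \<phi> X m \<in> carrier (mlev N X)"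
    "\<And>X m m'. finite_gset G X \<Longrightarrow> m \<in> carrier (mlev M X) \<Longrightarrow> m' \<in> carrier (mlev M X) \<Longrightarrow>
      \<phi> X (m \<oplus>\<^bsub>mlev M X\<^esub> m') = \<phi> X m \<oplus>\<^bsub>mlev N X\<^esub> \<phi> X m'"
    "\<And>X Y f m. f \<in> gmaps G X Y \<Longrightarrow> m \<in> carrier (mlev M Y) \<Longrightarrow> \<phi> X (mres M X Y f m) = mres N X Y f (\<phi> Y m)"
    "\<And>X Y f m. f \<in> gmaps G X Y \<Longrightarrow> m \<in> carrier (mlev M X) \<Longrightarrow> \<phi> Y (mtr M X Y f m) = mtr N X Y f (\<phi> X m)"
    "\<And>X a m. finite_gset G X \<Longrightarrow> a \<in> carrier (lev R X) \<Longrightarrow> m \<in> carrier (mlev M X) \<Longrightarrow>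
      \<phi> X (a \<odot>\<^bsub>mlev M X\<^esub> m) = a \<odot>\<^bsub>mlev N X\<^esub> \<phi> X m"
  shows "\<phi> \<in> module_Hom G R M N"
  using assms by (auto simp: module_Hom_def mackey_map_def intro!: homI)

lemma lev_extensional_eqI:
  assumes "lev_extensional G A \<phi>" "lev_extensional G A \<phi>'"
    and "\<And>X a. finite_gset G X \<Longrightarrow> a \<in> carrier (A X) \<Longrightarrow> \<phi> X a = \<phi>' X a"
  shows "\<phi> = \<phi>'"
proof
  fix X
  show "\<phi> X = \<phi>' X"
    by (rule extensionalityI[of _ "if finite_gset G X then carrier (A X) else {}"])
      (use assms in \<open>auto simp: lev_extensional_def split: if_splits\<close>)
qed

lemma lev_comp_extensional: "lev_extensional G A (lev_comp G A \<psi> \<phi>)"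
  by (simp add: lev_extensional_def lev_comp_def)

lemma lev_comp_apply: "finite_gset G X \<Longrightarrow> a \<in> carrier (A X) \<Longrightarrow> lev_comp G A \<psi> \<phi> X a = \<psi> X (\<phi> X a)"
  by (simp add: lev_comp_def compose_def)

lemma module_Hom_comp:
  assumes h: "h \<in> module_Hom G R M N" and \<phi>: "\<phi> \<in> module_Hom G R L M"
    and L: "\<And>X m m'. finite_gset G X \<Longrightarrow> m \<in> carrier (mlev L X) \<Longrightarrow> m' \<in> carrier (mlev L X) \<Longrightarrow> m \<oplus>\<^bsub>mlev L X\<^esub> m' \<in> carrier (mlev L X)"
      "\<And>X Y f m. f \<in> gmaps G X Y \<Longrightarrow> m \<in> carrier (mlev L Y) \<Longrightarrow> mres L X Y f m \<in> carrier (mlev L X)"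
      "\<And>X Y f m. f \<in> gmaps G X Y \<Longrightarrow> m \<in> carrier (mlev L X) \<Longrightarrow> mtr L X Y f m \<in> carrier (mlev L Y)"
      "\<And>X a m. finite_gset G X \<Longrightarrow> a \<in> carrier (lev R X) \<Longrightarrow> m \<in> carrier (mlev L X) \<Longrightarrow> a \<odot>\<^bsub>mlev L X\<^esub> m \<in> carrier (mlev L X)"
  shows "lev_comp G (mlev L) h \<phi> \<in> module_Hom G R L N"
proof (rule module_HomI)
  note H = module_HomD(2-6)[OF h] and F = module_HomD(2-6)[OF \<phi>]
  show "lev_extensional G (mlev L) (lev_comp G (mlev L) h \<phi>)" by (rule lev_comp_extensional)
  fix X Y :: "'a gset" and f m assume f: "f \<in> gmaps G X Y"
  note X = gmaps_gset(1)[OF f] and Y = gmaps_gset(2)[OF f]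
  show "lev_comp G (mlev L) h \<phi> X (mres L X Y f m) = mres N X Y f (lev_comp G (mlev L) h \<phi> Y m)"
    if m: "m \<in> carrier (mlev L Y)"
    by (simp add: lev_comp_apply X Y m L(2)[OF f m] F(3)[OF f m] H(3)[OF f F(1)[OF Y m]])
  show "lev_comp G (mlev L) h \<phi> Y (mtr L X Y f m) = mtr N X Y f (lev_comp G (mlev L) h \<phi> X m)"
    if m: "m \<in> carrier (mlev L X)"
    by (simp add: lev_comp_apply X Y m L(3)[OF f m] F(4)[OF f m] H(4)[OF f F(1)[OF X m]])
qed (simp_all add: lev_comp_apply L module_HomD(2,3,6)[OF h] module_HomD(2,3,6)[OF \<phi>])

context relative_tambara begin

text \<open>
  Unlike in \<open>module_Hom\<close>, no condition is put on the values of a map \<open>I \<rightarrow> M\<close> outside the carriers, so that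
  maps given by formulas qualify.
\<close>

definition is_hom :: "('g, 'r, 'm) gmodule \<Rightarrow> ('g gset \<Rightarrow> ('g, 'r, 'r) texp set \<Rightarrow> 'm) \<Rightarrow> bool" where
  "is_hom M \<psi> \<longleftrightarrow>
     (\<forall>X. finite_gset G X \<longrightarrow> (\<forall>x\<in>carrier (mlev I X).
        \<psi> X x \<in> carrier (mlev M X) \<and>
        (\<forall>y\<in>carrier (mlev I X). \<psi> X (x \<oplus>\<^bsub>lev P X\<^esub> y) = \<psi> X x \<oplus>\<^bsub>mlev M X\<^esub> \<psi> X y) \<and>
        (\<forall>a\<in>carrier (lev R X). \<psi> X (left X a \<otimes>\<^bsub>lev P X\<^esub> x) = a \<odot>\<^bsub>mlev M X\<^esub> \<psi> X x))) \<and>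
     (\<forall>X Y. \<forall>f\<in>gmaps G X Y.
        (\<forall>x\<in>carrier (mlev I Y). \<psi> X (res P X Y f x) = mres M X Y f (\<psi> Y x)) \<and>
        (\<forall>x\<in>carrier (mlev I X). \<psi> Y (tr P X Y f x) = mtr M X Y f (\<psi> X x)))"

lemma is_homD:
  assumes "is_hom M \<psi>"
  shows "finite_gset G X \<Longrightarrow> x \<in> carrier (mlev I X) \<Longrightarrow> \<psi> X x \<in> carrier (mlev M X)"
    "finite_gset G X \<Longrightarrow> x \<in> carrier (mlev I X) \<Longrightarrow> y \<in> carrier (mlev I X) \<Longrightarrow>
      \<psi> X (x \<oplus>\<^bsub>lev P X\<^esub> y) = \<psi> X x \<oplus>\<^bsub>mlev M X\<^esub> \<psi> X y"
    "finite_gset G X \<Longrightarrow> a \<in> carrier (lev R X) \<Longrightarrow> x \<in> carrier (mlev I X) \<Longrightarrow>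
      \<psi> X (left X a \<otimes>\<^bsub>lev P X\<^esub> x) = a \<odot>\<^bsub>mlev M X\<^esub> \<psi> X x"
    "f \<in> gmaps G X Y \<Longrightarrow> z \<in> carrier (mlev I Y) \<Longrightarrow> \<psi> X (res P X Y f z) = mres M X Y f (\<psi> Y z)"
    "f \<in> gmaps G X Y \<Longrightarrow> x \<in> carrier (mlev I X) \<Longrightarrow> \<psi> Y (tr P X Y f x) = mtr M X Y f (\<psi> X x)"
  using assms by (simp_all add: is_hom_def)

lemma is_hom_zero:
  assumes M: "green_module G R M" and \<psi>: "is_hom M \<psi>" and X: "finite_gset G X"
  shows "\<psi> X \<zero>\<^bsub>lev P X\<^esub> = \<zero>\<^bsub>mlev M X\<^esub>"
proof -
  interpret M: green_module G R M by (rule M)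
  interpret m: abelian_group "mlev M X" by (rule M.abelian_lev[OF X])
  interpret p: cring "lev P X" by (rule P.cring_lev[OF X])
  note z = I_closed(1)[OF X]
  have "\<psi> X \<zero>\<^bsub>lev P X\<^esub> = \<psi> X \<zero>\<^bsub>lev P X\<^esub> \<oplus>\<^bsub>mlev M X\<^esub> \<psi> X \<zero>\<^bsub>lev P X\<^esub>"
    using is_homD(2)[OF \<psi> X z z] by simp
  then show ?thesis using is_homD(1)[OF \<psi> X z] m.add.l_cancel_one' by blast
qed

lemma equalizer_submodule:
  assumes M: "green_module G R M" and \<psi>: "is_hom M \<psi>" "is_hom M \<psi>'"
  shows "is_submodule G R I (\<lambda>X. {x \<in> carrier (mlev I X). \<psi> X x = \<psi>' X x})"
proof (rule is_submoduleI)
  show "\<zero>\<^bsub>lev P X\<^esub> \<in> {x \<in> carrier (mlev I X). \<psi> X x = \<psi>' X x}" if "finite_gset G X" for X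
    using that I_closed(1) is_hom_zero[OF M \<psi>(1)] is_hom_zero[OF M \<psi>(2)] by simp
qed (use is_homD[OF \<psi>(1)] is_homD[OF \<psi>(2)] I_closed I_res I_tr leftD(5) in \<open>auto simp: gmaps_gset\<close>)

lemma zero_is_hom:
  assumes M: "green_module G R M"
  shows "is_hom M (\<lambda>X x. \<zero>\<^bsub>mlev M X\<^esub>)"
proof -
  interpret M: green_module G R M by (rule M)
  have "abelian_group (mlev M X)" if "finite_gset G X" for X by (rule M.abelian_lev[OF that])
  then show ?thesis
    using M.res_zero M.tr_zero M.smult_zero
    by (simp add: is_hom_def abelian_group_def abelian_monoid.zero_closed abelian_monoid.l_zero)
qed

lemma hom_vanishes:
  assumes M: "green_module G R M" and \<psi>: "is_hom M \<psi>"
    and big: "\<And>Y x. finite_gset G Y \<Longrightarrow> x \<in> big Y \<Longrightarrow> \<psi> Y x = \<zero>\<^bsub>mlev M Y\<^esub>"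
    and x: "x \<in> gen_submodule G R I big X"
  shows "\<psi> X x = \<zero>\<^bsub>mlev M X\<^esub>"
  using gen_submodule_big(3)[OF equalizer_submodule[OF M \<psi> zero_is_hom[OF M]], of X] big big_subset x by blast


abbreviation "I1 \<equiv> gen_submodule G R I big"

definition cls :: "'g gset \<Rightarrow> ('g, 'r, 'r) texp set \<Rightarrow> ('g, 'r, 'r) texp set set" where
  "cls X x = I1 X +>\<^bsub>mlev I X\<^esub> x"

lemmas I1D = is_submoduleD[OF gen_submodule_big(1)]

lemma cls_mem: "y \<in> cls X x \<longleftrightarrow> (\<exists>n\<in>I1 X. y = n \<oplus>\<^bsub>lev P X\<^esub> x)"
  by (auto simp: cls_def a_r_coset_def' I_simps)

lemma cls_eqI:
  assumes X: "finite_gset G X" and x: "x \<in> carrier (mlev I X)" and n: "n \<in> I1 X"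
  shows "cls X (n \<oplus>\<^bsub>lev P X\<^esub> x) = cls X x"
proof -
  interpret p: cring "lev P X" by (rule P.cring_lev[OF X])
  note xP = I_carrierD(1)[OF x] and c = I_carrierD(1)[OF I1D(1)[OF X]]
  show ?thesis
  proof (intro equalityI subsetI)
    fix y assume "y \<in> cls X (n \<oplus>\<^bsub>lev P X\<^esub> x)"
    then obtain k where k: "k \<in> I1 X" "y = k \<oplus>\<^bsub>lev P X\<^esub> (n \<oplus>\<^bsub>lev P X\<^esub> x)" by (auto simp: cls_mem)
    have "y = (k \<oplus>\<^bsub>lev P X\<^esub> n) \<oplus>\<^bsub>lev P X\<^esub> x" using k xP c n by (simp add: p.a_assoc)
    then show "y \<in> cls X x" using I1D(3)[OF X k(1) n] unfolding cls_mem by blast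
  next
    fix y assume "y \<in> cls X x"
    then obtain k where k: "k \<in> I1 X" "y = k \<oplus>\<^bsub>lev P X\<^esub> x" by (auto simp: cls_mem)
    have "y = (k \<oplus>\<^bsub>lev P X\<^esub> \<ominus>\<^bsub>lev P X\<^esub> n) \<oplus>\<^bsub>lev P X\<^esub> (n \<oplus>\<^bsub>lev P X\<^esub> x)"
      using k xP c[OF k(1)] c[OF n] by (simp add: p.a_assoc p.r_neg1)
    then show "y \<in> cls X (n \<oplus>\<^bsub>lev P X\<^esub> x)" using I1D(3)[OF X k(1) I1D(5)[OF X n]] unfolding cls_mem by blast
  qed
qed

lemma cls_self: "finite_gset G X \<Longrightarrow> x \<in> carrier (mlev I X) \<Longrightarrow> x \<in> cls X x"
  unfolding cls_mem using I1D(2) abelian_group.axioms(1)[OF P.abelian_lev] I_carrierD(1)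
  by (intro bexI[of _ "\<zero>\<^bsub>lev P X\<^esub>"]) (simp_all add: abelian_monoid.l_zero)

lemma \<Omega>_carrier: "carrier (mlev \<Omega> X) = cls X ` carrier (mlev I X)"
  by (auto simp: genuine_Kahler_def quot_module_def A_RCOSETS_def' cls_def)

lemma cls_closed: "x \<in> carrier (mlev I X) \<Longrightarrow> cls X x \<in> carrier (mlev \<Omega> X)"
  by (simp add: \<Omega>_carrier)

lemma \<Omega>_add:
  assumes X: "finite_gset G X" and x: "x \<in> carrier (mlev I X)" and y: "y \<in> carrier (mlev I X)"
  shows "cls X x \<oplus>\<^bsub>mlev \<Omega> X\<^esub> cls X y = cls X (x \<oplus>\<^bsub>lev P X\<^esub> y)"
proof -
  interpret p: cring "lev P X" by (rule P.cring_lev[OF X])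
  note c = I_carrierD(1)[OF I1D(1)[OF X]] I_carrierD(1)[OF x] I_carrierD(1)[OF y]
  have "cls X x <+>\<^bsub>mlev I X\<^esub> cls X y = cls X (x \<oplus>\<^bsub>lev P X\<^esub> y)"
  proof (intro equalityI subsetI)
    fix z assume "z \<in> cls X x <+>\<^bsub>mlev I X\<^esub> cls X y"
    then obtain m n where mn: "m \<in> I1 X" "n \<in> I1 X" "z = (m \<oplus>\<^bsub>lev P X\<^esub> x) \<oplus>\<^bsub>lev P X\<^esub> (n \<oplus>\<^bsub>lev P X\<^esub> y)"
      by (auto simp: set_add_def' cls_mem I_simps)
    have "z = (m \<oplus>\<^bsub>lev P X\<^esub> n) \<oplus>\<^bsub>lev P X\<^esub> (x \<oplus>\<^bsub>lev P X\<^esub> y)" using mn c by (simp add: p.a_ac)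
    then show "z \<in> cls X (x \<oplus>\<^bsub>lev P X\<^esub> y)" using I1D(3)[OF X mn(1,2)] unfolding cls_mem by blast
  next
    fix z assume "z \<in> cls X (x \<oplus>\<^bsub>lev P X\<^esub> y)"
    then obtain n where n: "n \<in> I1 X" "z = n \<oplus>\<^bsub>lev P X\<^esub> (x \<oplus>\<^bsub>lev P X\<^esub> y)" by (auto simp: cls_mem)
    have z: "z = (n \<oplus>\<^bsub>lev P X\<^esub> x) \<oplus>\<^bsub>lev P X\<^esub> y" using n c by (simp add: p.a_assoc)
    have "n \<oplus>\<^bsub>lev P X\<^esub> x \<in> cls X x" using n(1) by (auto simp: cls_mem)
    then show "z \<in> cls X x <+>\<^bsub>mlev I X\<^esub> cls X y"
      using cls_self[OF X y] z unfolding set_add_def' I_simps(2) by blast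
  qed
  then show ?thesis by (simp add: genuine_Kahler_def quot_module_def)
qed

lemma \<Omega>_smult:
  assumes X: "finite_gset G X" and a: "a \<in> carrier (lev R X)" and x: "x \<in> carrier (mlev I X)"
  shows "a \<odot>\<^bsub>mlev \<Omega> X\<^esub> cls X x = cls X (left X a \<otimes>\<^bsub>lev P X\<^esub> x)"
proof -
  interpret p: cring "lev P X" by (rule P.cring_lev[OF X])
  have "(\<Union>m\<in>cls X x. cls X (left X a \<otimes>\<^bsub>lev P X\<^esub> m)) = cls X (left X a \<otimes>\<^bsub>lev P X\<^esub> x)"
  proof (rule UN_const[OF cls_self[OF X x]])
    fix m assume "m \<in> cls X x"
    then obtain n where n: "n \<in> I1 X" "m = n \<oplus>\<^bsub>lev P X\<^esub> x" by (auto simp: cls_mem)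
    then show "cls X (left X a \<otimes>\<^bsub>lev P X\<^esub> m) = cls X (left X a \<otimes>\<^bsub>lev P X\<^esub> x)"
      using cls_eqI[OF X I_closed(3)[OF X leftD(5)[OF X a] x] I1D(4)[OF X a n(1)]]
      by (simp add: p.r_distr leftD(5)[OF X a] I_carrierD(1)[OF x] I_carrierD(1)[OF I1D(1)[OF X n(1)]])
  qed
  then show ?thesis by (simp add: genuine_Kahler_def quot_module_def I_simps(4) cls_def)
qed

lemma \<Omega>_res:
  assumes f: "f \<in> gmaps G X Y" and x: "x \<in> carrier (mlev I Y)"
  shows "mres \<Omega> X Y f (cls Y x) = cls X (res P X Y f x)"
proof -
  note X = gmaps_gset(1)[OF f] and Y = gmaps_gset(2)[OF f]
  have "(\<Union>m\<in>cls Y x. cls X (res P X Y f m)) = cls X (res P X Y f x)"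
  proof (rule UN_const[OF cls_self[OF Y x]])
    fix m assume "m \<in> cls Y x"
    then obtain n where n: "n \<in> I1 Y" "m = n \<oplus>\<^bsub>lev P Y\<^esub> x" by (auto simp: cls_mem)
    then show "cls X (res P X Y f m) = cls X (res P X Y f x)"
      using cls_eqI[OF X I_res[OF f x] I1D(6)[OF f n(1)]]
      by (simp add: P.res_add[OF f I_carrierD(1)[OF I1D(1)[OF Y n(1)]] I_carrierD(1)[OF x]])
  qed
  then show ?thesis by (simp add: genuine_Kahler_def quot_module_def I_simps(5) cls_def)
qed

lemma \<Omega>_tr:
  assumes f: "f \<in> gmaps G X Y" and x: "x \<in> carrier (mlev I X)"
  shows "mtr \<Omega> X Y f (cls X x) = cls Y (tr P X Y f x)"
proof -
  note X = gmaps_gset(1)[OF f] and Y = gmaps_gset(2)[OF f]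
  have "(\<Union>m\<in>cls X x. cls Y (tr P X Y f m)) = cls Y (tr P X Y f x)"
  proof (rule UN_const[OF cls_self[OF X x]])
    fix m assume "m \<in> cls X x"
    then obtain n where n: "n \<in> I1 X" "m = n \<oplus>\<^bsub>lev P X\<^esub> x" by (auto simp: cls_mem)
    then show "cls Y (tr P X Y f m) = cls Y (tr P X Y f x)"
      using cls_eqI[OF Y I_tr[OF f x] I1D(7)[OF f n(1)]]
      by (simp add: P.tr_add[OF f I_carrierD(1)[OF I1D(1)[OF X n(1)]] I_carrierD(1)[OF x]])
  qed
  then show ?thesis by (simp add: genuine_Kahler_def quot_module_def I_simps(6) cls_def)
qed

lemma Hom_\<Omega>_is_hom:
  assumes M: "green_module G R M" and \<phi>: "\<phi> \<in> module_Hom G R \<Omega> M"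
  shows "is_hom M (\<lambda>X x. \<phi> X (cls X x))"
    "finite_gset G X \<Longrightarrow> n \<in> I1 X \<Longrightarrow> \<phi> X (cls X n) = \<zero>\<^bsub>mlev M X\<^esub>"
proof -
  note D = module_HomD[OF \<phi>]
  show hom: "is_hom M (\<lambda>X x. \<phi> X (cls X x))"
    unfolding is_hom_def
  proof (intro conjI allI impI ballI)
    fix X x assume X: "finite_gset G X" and x: "x \<in> carrier (mlev I X)"
    show "\<phi> X (cls X x) \<in> carrier (mlev M X)" by (rule D(2)[OF X cls_closed[OF x]])
    show "\<phi> X (cls X (x \<oplus>\<^bsub>lev P X\<^esub> y)) = \<phi> X (cls X x) \<oplus>\<^bsub>mlev M X\<^esub> \<phi> X (cls X y)" if "y \<in> carrier (mlev I X)" for y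
      using D(3)[OF X cls_closed[OF x] cls_closed[OF that]] \<Omega>_add[OF X x that] by simp
    show "\<phi> X (cls X (left X a \<otimes>\<^bsub>lev P X\<^esub> x)) = a \<odot>\<^bsub>mlev M X\<^esub> \<phi> X (cls X x)" if "a \<in> carrier (lev R X)" for a
      using D(6)[OF X that cls_closed[OF x]] \<Omega>_smult[OF X that x] by simp
  next
    fix X Y :: "'g gset" and f assume f: "f \<in> gmaps G X Y"
    show "\<phi> X (cls X (res P X Y f x)) = mres M X Y f (\<phi> Y (cls Y x))" if "x \<in> carrier (mlev I Y)" for x
      using D(4)[OF f cls_closed[OF that]] \<Omega>_res[OF f that] by simp
    show "\<phi> Y (cls Y (tr P X Y f x)) = mtr M X Y f (\<phi> X (cls X x))" if "x \<in> carrier (mlev I X)" for x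
      using D(5)[OF f cls_closed[OF that]] \<Omega>_tr[OF f that] by simp
  qed
  show "\<phi> X (cls X n) = \<zero>\<^bsub>mlev M X\<^esub>" if X: "finite_gset G X" and n: "n \<in> I1 X"
  proof -
    interpret p: cring "lev P X" by (rule P.cring_lev[OF X])
    have "cls X n = cls X \<zero>\<^bsub>lev P X\<^esub>"
      using cls_eqI[OF X I_closed(1)[OF X] n] I_carrierD(1)[OF I1D(1)[OF X n]] by simp
    then show ?thesis using is_hom_zero[OF M hom X] by simp
  qed
qed

lemma is_hom_lift:
  assumes M: "green_module G R M" and \<psi>: "is_hom M \<psi>"
    and van: "\<And>X n. finite_gset G X \<Longrightarrow> n \<in> I1 X \<Longrightarrow> \<psi> X n = \<zero>\<^bsub>mlev M X\<^esub>"
  obtains \<phi> where "\<phi> \<in> module_Hom G R \<Omega> M"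
    "\<forall>X. finite_gset G X \<longrightarrow> (\<forall>x\<in>carrier (mlev I X). \<phi> X (cls X x) = \<psi> X x)"
proof -
  interpret M: green_module G R M by (rule M)
  note D = is_homD[OF \<psi>]
  define \<phi> where "\<phi> X = restrict (\<lambda>c. \<psi> X (SOME x. x \<in> c)) (if finite_gset G X then carrier (mlev \<Omega> X) else {})" for X
  have \<phi>: "\<phi> X (cls X x) = \<psi> X x" if X: "finite_gset G X" and x: "x \<in> carrier (mlev I X)" for X x
  proof -
    interpret m: abelian_group "mlev M X" by (rule M.abelian_lev[OF X])
    have "(SOME y. y \<in> cls X x) \<in> cls X x" by (rule someI[of _ x]) (rule cls_self[OF X x])
    then obtain n where "n \<in> I1 X" "(SOME y. y \<in> cls X x) = n \<oplus>\<^bsub>lev P X\<^esub> x" by (auto simp: cls_mem)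
    then show ?thesis
      using D(2)[OF X I1D(1)[OF X] x, of n] van[OF X, of n] D(1)[OF X x] X cls_closed[OF x] by (simp add: \<phi>_def)
  qed
  have "\<phi> \<in> module_Hom G R \<Omega> M"
    by (rule module_HomI)
      (auto simp: \<Omega>_carrier \<phi> D \<Omega>_add \<Omega>_smult \<Omega>_res \<Omega>_tr I_closed I_res I_tr leftD(5) gmaps_gset,
        auto simp: lev_extensional_def \<phi>_def \<Omega>_carrier)
  then show thesis using \<phi> by (intro that) auto
qed

section \<open>The universal derivation\<close>

lemma diff_add:
  assumes X: "finite_gset G X" and a: "a \<in> carrier (lev R X)" and b: "b \<in> carrier (lev R X)"
  shows "diff X (a \<oplus>\<^bsub>lev R X\<^esub> b) = diff X a \<oplus>\<^bsub>lev P X\<^esub> diff X b"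
proof (rule diff_eqI[OF X])
  interpret p: cring "lev P X" by (rule P.cring_lev[OF X])
  interpret r: cring "lev R X" by (rule R.cring_lev[OF X])
  note c = leftD(5)[OF X a] leftD(5)[OF X b] I_carrierD(1)[OF right_eq_left_diff(2)[OF X a]]
    I_carrierD(1)[OF right_eq_left_diff(2)[OF X b]]
  show "a \<oplus>\<^bsub>lev R X\<^esub> b \<in> carrier (lev R X)" "diff X a \<oplus>\<^bsub>lev P X\<^esub> diff X b \<in> carrier (lev P X)" using a b c by auto
  show "right X (a \<oplus>\<^bsub>lev R X\<^esub> b) = left X (a \<oplus>\<^bsub>lev R X\<^esub> b) \<oplus>\<^bsub>lev P X\<^esub> (diff X a \<oplus>\<^bsub>lev P X\<^esub> diff X b)"
    using c by (simp add: right_add[OF X a b] left_add[OF X a b] right_eq_left_diff(1)[OF X a] right_eq_left_diff(1)[OF X b] p.a_ac)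
qed

lemma diff_mult:
  assumes X: "finite_gset G X" and a: "a \<in> carrier (lev R X)" and b: "b \<in> carrier (lev R X)"
  shows "diff X (a \<otimes>\<^bsub>lev R X\<^esub> b) =
    left X a \<otimes>\<^bsub>lev P X\<^esub> diff X b \<oplus>\<^bsub>lev P X\<^esub> left X b \<otimes>\<^bsub>lev P X\<^esub> diff X a \<oplus>\<^bsub>lev P X\<^esub> diff X a \<otimes>\<^bsub>lev P X\<^esub> diff X b"
proof (rule diff_eqI[OF X])
  interpret p: cring "lev P X" by (rule P.cring_lev[OF X])
  interpret r: cring "lev R X" by (rule R.cring_lev[OF X])
  note c = leftD(5)[OF X a] leftD(5)[OF X b] I_carrierD(1)[OF right_eq_left_diff(2)[OF X a]]
    I_carrierD(1)[OF right_eq_left_diff(2)[OF X b]]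
  show "a \<otimes>\<^bsub>lev R X\<^esub> b \<in> carrier (lev R X)" using a b by simp
  show "left X a \<otimes>\<^bsub>lev P X\<^esub> diff X b \<oplus>\<^bsub>lev P X\<^esub> left X b \<otimes>\<^bsub>lev P X\<^esub> diff X a \<oplus>\<^bsub>lev P X\<^esub> diff X a \<otimes>\<^bsub>lev P X\<^esub> diff X b
      \<in> carrier (lev P X)" using c by simp
  show "right X (a \<otimes>\<^bsub>lev R X\<^esub> b) = left X (a \<otimes>\<^bsub>lev R X\<^esub> b) \<oplus>\<^bsub>lev P X\<^esub>
      (left X a \<otimes>\<^bsub>lev P X\<^esub> diff X b \<oplus>\<^bsub>lev P X\<^esub> left X b \<otimes>\<^bsub>lev P X\<^esub> diff X a \<oplus>\<^bsub>lev P X\<^esub> diff X a \<otimes>\<^bsub>lev P X\<^esub> diff X b)"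
    using c by (simp add: right_mult[OF X a b] left_mult[OF X a b] right_eq_left_diff(1)[OF X a]
        right_eq_left_diff(1)[OF X b] p.l_distr p.r_distr p.a_ac p.m_ac)
qed

lemma diff_res:
  assumes f: "f \<in> gmaps G X Y" and a: "a \<in> carrier (lev R Y)"
  shows "diff X (res R X Y f a) = res P X Y f (diff Y a)"
proof (rule diff_eqI[OF gmaps_gset(1)[OF f] R.res_closed[OF f a]])
  note Y = gmaps_gset(2)[OF f]
  note d = I_carrierD(1)[OF right_eq_left_diff(2)[OF Y a]]
  show "res P X Y f (diff Y a) \<in> carrier (lev P X)" by (rule P.res_closed[OF f d])
  show "right X (res R X Y f a) = left X (res R X Y f a) \<oplus>\<^bsub>lev P X\<^esub> res P X Y f (diff Y a)"
    unfolding rightD(2)[OF f a] leftD(2)[OF f a] right_eq_left_diff(1)[OF Y a]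
    by (rule P.res_add[OF f leftD(5)[OF Y a] d])
qed

lemma diff_tr:
  assumes f: "f \<in> gmaps G X Y" and a: "a \<in> carrier (lev R X)"
  shows "diff Y (tr R X Y f a) = tr P X Y f (diff X a)"
proof (rule diff_eqI[OF gmaps_gset(2)[OF f] R.tr_closed[OF f a]])
  note X = gmaps_gset(1)[OF f]
  note d = I_carrierD(1)[OF right_eq_left_diff(2)[OF X a]]
  show "tr P X Y f (diff X a) \<in> carrier (lev P Y)" by (rule P.tr_closed[OF f d])
  show "right Y (tr R X Y f a) = left Y (tr R X Y f a) \<oplus>\<^bsub>lev P Y\<^esub> tr P X Y f (diff X a)"
    unfolding rightD(3)[OF f a] leftD(3)[OF f a] right_eq_left_diff(1)[OF X a]
    by (rule P.tr_add[OF f leftD(5)[OF X a] d])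
qed

lemma diff_nm:
  assumes f: "f \<in> gmaps G X Y" and a: "a \<in> carrier (lev R X)"
  obtains w where "w \<in> I1 Y"
    "diff Y (nm R X Y f a) = tr P X Y f (left X (cofactor G R X f a) \<otimes>\<^bsub>lev P X\<^esub> diff X a) \<oplus>\<^bsub>lev P Y\<^esub> w"
proof -
  note X = gmaps_gset(1)[OF f] and Y = gmaps_gset(2)[OF f]
  interpret p: cring "lev P Y" by (rule P.cring_lev[OF Y])
  note d = right_eq_left_diff(2)[OF X a]
  let ?t = "tr P X Y f (left X (cofactor G R X f a) \<otimes>\<^bsub>lev P X\<^esub> diff X a)"
  obtain w where w: "w \<in> I1 Y" "nm P X Y f (left X a \<oplus>\<^bsub>lev P X\<^esub> diff X a) =
      left Y (nm R X Y f a) \<oplus>\<^bsub>lev P Y\<^esub> ?t \<oplus>\<^bsub>lev P Y\<^esub> w"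
    by (rule nm_left_add[OF gen_submodule_big(1,2) f a d])
  note na = R.nm_closed[OF f a]
  have t: "?t \<in> carrier (lev P Y)"
    by (rule I_carrierD(1)[OF I_tr[OF f I_closed(3)[OF X leftD(5)[OF X R.cofactor_closed[OF f a]] d]]])
  have wP: "w \<in> carrier (lev P Y)" by (rule I_carrierD(1)[OF I1D(1)[OF Y w(1)]])
  have "diff Y (nm R X Y f a) = ?t \<oplus>\<^bsub>lev P Y\<^esub> w"
  proof (rule diff_eqI[OF Y na])
    show "?t \<oplus>\<^bsub>lev P Y\<^esub> w \<in> carrier (lev P Y)" using t wP by simp
    have "right Y (nm R X Y f a) = nm P X Y f (left X a \<oplus>\<^bsub>lev P X\<^esub> diff X a)"
      unfolding rightD(4)[OF f a] right_eq_left_diff(1)[OF X a] ..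
    then show "right Y (nm R X Y f a) = left Y (nm R X Y f a) \<oplus>\<^bsub>lev P Y\<^esub> (?t \<oplus>\<^bsub>lev P Y\<^esub> w)"
      unfolding w(2) using leftD(5)[OF Y na] t wP by (simp add: p.a_assoc)
  qed
  then show thesis using w(1) by (rule that[rotated])
qed

lemma diff_unit:
  assumes X: "finite_gset G X" and s: "s \<in> carrier (lev S X)"
  shows "diff X (\<eta> X s) = \<zero>\<^bsub>lev P X\<^esub>"
proof (rule diff_eqI[OF X])
  interpret p: cring "lev P X" by (rule P.cring_lev[OF X])
  show e: "\<eta> X s \<in> carrier (lev R X)"
    using algebra tambara_mapD(5) X s by (auto simp: tambara_algebra_def)
  show "right X (\<eta> X s) = left X (\<eta> X s) \<oplus>\<^bsub>lev P X\<^esub> \<zero>\<^bsub>lev P X\<^esub>"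
    using leftD(5)[OF X e] left_right_unit[OF X s] by simp
qed (simp add: I_carrierD(1)[OF I_closed(1)[OF X]])

definition univ_der :: "'g gset \<Rightarrow> 'r \<Rightarrow> ('g, 'r, 'r) texp set set" where
  "univ_der X a = cls X (diff X a)"

lemma univ_der_closed: "finite_gset G X \<Longrightarrow> a \<in> carrier (lev R X) \<Longrightarrow> univ_der X a \<in> carrier (mlev \<Omega> X)"
  unfolding univ_der_def by (rule cls_closed[OF right_eq_left_diff(2)])

lemma genuine_DerD:
  assumes "d \<in> genuine_Der G S R \<eta> M"
  shows "lev_extensional G (lev R) d"
    "finite_gset G X \<Longrightarrow> d X \<in> hom (add_monoid (lev R X)) (add_monoid (mlev M X))"
    "f \<in> gmaps G X Y \<Longrightarrow> b \<in> carrier (lev R Y) \<Longrightarrow> d X (res R X Y f b) = mres M X Y f (d Y b)"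
    "f \<in> gmaps G X Y \<Longrightarrow> a \<in> carrier (lev R X) \<Longrightarrow> d Y (tr R X Y f a) = mtr M X Y f (d X a)"
    "finite_gset G X \<Longrightarrow> a \<in> carrier (lev R X) \<Longrightarrow> c \<in> carrier (lev R X) \<Longrightarrow>
      d X (a \<otimes>\<^bsub>lev R X\<^esub> c) = a \<odot>\<^bsub>mlev M X\<^esub> d X c \<oplus>\<^bsub>mlev M X\<^esub> c \<odot>\<^bsub>mlev M X\<^esub> d X a"
    "subgroup H G \<Longrightarrow> subgroup K G \<Longrightarrow> H \<subseteq> K \<Longrightarrow> e \<in> carrier (lev R (orbit_set G H)) \<Longrightarrow>
      d (orbit_set G K) (nm R (orbit_set G H) (orbit_set G K) (orbit_proj G H K) e) =
      mtr M (orbit_set G H) (orbit_set G K) (orbit_proj G H K)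
        (conorm G R H K e \<odot>\<^bsub>mlev M (orbit_set G H)\<^esub> d (orbit_set G H) e)"
    "finite_gset G X \<Longrightarrow> s \<in> carrier (lev S X) \<Longrightarrow> d X (\<eta> X s) = \<zero>\<^bsub>mlev M X\<^esub>"
  using assms by (simp_all add: genuine_Der_def mackey_map_def)

text \<open>
  The Leibniz rule and the condition on norms hold for \<open>diff\<close> up to elements of \<open>I\<^sup>>\<^sup>1\<close>, which are the product of two
  differences in the first case and the higher terms of the norm of a sum in the second.
\<close>

lemma univ_comp_Der:
  assumes M: "green_module G R M" and \<phi>: "\<phi> \<in> module_Hom G R \<Omega> M"
  shows "lev_comp G (lev R) \<phi> univ_der \<in> genuine_Der G S R \<eta> M"
proof -
  interpret M: green_module G R M by (rule M)
  define \<psi> where "\<psi> X x = \<phi> X (cls X x)" for X x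
  have \<psi>: "is_hom M \<psi>" unfolding \<psi>_def by (rule Hom_\<Omega>_is_hom(1)[OF M \<phi>])
  have van: "\<psi> X n = \<zero>\<^bsub>mlev M X\<^esub>" if "finite_gset G X" "n \<in> I1 X" for X n
    unfolding \<psi>_def by (rule Hom_\<Omega>_is_hom(2)[OF M \<phi> that])
  note H = is_homD[OF \<psi>] and d = right_eq_left_diff(2)
  have d_eq: "lev_comp G (lev R) \<phi> univ_der X a = \<psi> X (diff X a)" if "finite_gset G X" "a \<in> carrier (lev R X)" for X a
    using that by (simp add: lev_comp_apply univ_der_def \<psi>_def)
  have prod: "diff X a \<otimes>\<^bsub>lev P X\<^esub> diff X b \<in> I1 X"
    if "finite_gset G X" "a \<in> carrier (lev R X)" "b \<in> carrier (lev R X)" for X a b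
    using gen_submodule_big(2)[OF that(1)] mult_mem_big[OF that(1) d[OF that(1,2)] d[OF that(1,3)]] by blast
  show ?thesis
    unfolding genuine_Der_def mackey_map_def
  proof (intro CollectI conjI allI impI ballI)
    show "lev_extensional G (lev R) (lev_comp G (lev R) \<phi> univ_der)" by (rule lev_comp_extensional)
  next
    fix X :: "'g gset" assume X: "finite_gset G X"
    interpret r: cring "lev R X" by (rule R.cring_lev[OF X])
    interpret m: module "lev R X" "mlev M X" by (rule M.module_lev[OF X])
    show "lev_comp G (lev R) \<phi> univ_der X \<in> hom (add_monoid (lev R X)) (add_monoid (mlev M X))"
      by (rule homI) (simp_all add: d_eq X diff_add H d)
    show "lev_comp G (lev R) \<phi> univ_der X (\<eta> X s) = \<zero>\<^bsub>mlev M X\<^esub>" if s: "s \<in> carrier (lev S X)" for s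
    proof -
      have "\<eta> X s \<in> carrier (lev R X)"
        using algebra tambara_mapD(5) X s by (auto simp: tambara_algebra_def)
      then show ?thesis by (simp add: d_eq X diff_unit[OF X s] is_hom_zero[OF M \<psi> X])
    qed
    fix a b assume a: "a \<in> carrier (lev R X)" and b: "b \<in> carrier (lev R X)"
    note c = I_closed(3)[OF X leftD(5)[OF X a] d[OF X b]] I_closed(3)[OF X leftD(5)[OF X b] d[OF X a]]
    show "lev_comp G (lev R) \<phi> univ_der X (a \<otimes>\<^bsub>lev R X\<^esub> b) =
        a \<odot>\<^bsub>mlev M X\<^esub> lev_comp G (lev R) \<phi> univ_der X b \<oplus>\<^bsub>mlev M X\<^esub> b \<odot>\<^bsub>mlev M X\<^esub> lev_comp G (lev R) \<phi> univ_der X a"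
      using a b by (simp add: d_eq X diff_mult H(2)[OF X I_closed(2)[OF X c] I1D(1)[OF X prod[OF X a b]]] H(2)[OF X c]
          H(3)[OF X a d[OF X b]] H(3)[OF X b d[OF X a]] van[OF X prod[OF X a b]] H(1)[OF X d[OF X a]] H(1)[OF X d[OF X b]])
  next
    fix X Y :: "'g gset" and f a assume f: "f \<in> gmaps G X Y"
    note X = gmaps_gset(1)[OF f] and Y = gmaps_gset(2)[OF f]
    show "lev_comp G (lev R) \<phi> univ_der X (res R X Y f a) = mres M X Y f (lev_comp G (lev R) \<phi> univ_der Y a)"
      if "a \<in> carrier (lev R Y)"
      by (simp add: d_eq X Y that R.res_closed[OF f that] diff_res[OF f that] H(4)[OF f d[OF Y that]])
    show "lev_comp G (lev R) \<phi> univ_der Y (tr R X Y f a) = mtr M X Y f (lev_comp G (lev R) \<phi> univ_der X a)"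
      if "a \<in> carrier (lev R X)"
      by (simp add: d_eq X Y that R.tr_closed[OF f that] diff_tr[OF f that] H(5)[OF f d[OF X that]])
  next
    fix H' K a assume HK: "subgroup H' G \<and> subgroup K G \<and> H' \<subseteq> K" and a: "a \<in> carrier (lev R (orbit_set G H'))"
    let ?X = "orbit_set G H'" and ?Y = "orbit_set G K" and ?f = "orbit_proj G H' K"
    have f: "?f \<in> gmaps G ?X ?Y" using orbit_proj(1)[OF R.group_G R.finite_G] HK by blast
    note X = gmaps_gset(1)[OF f] and Y = gmaps_gset(2)[OF f]
    interpret m: module "lev R ?Y" "mlev M ?Y" by (rule M.module_lev[OF Y])
    have cn: "conorm G R H' K a = cofactor G R ?X ?f a"
      using conorm_cofactor[OF R.group_G R.finite_G _ R.tambara_functor_axioms] HK a by blast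
    note ca = R.cofactor_closed[OF f a]
    note t = I_closed(3)[OF X leftD(5)[OF X ca] d[OF X a]]
    obtain w where w: "w \<in> I1 ?Y" "diff ?Y (nm R ?X ?Y ?f a) =
        tr P ?X ?Y ?f (left ?X (cofactor G R ?X ?f a) \<otimes>\<^bsub>lev P ?X\<^esub> diff ?X a) \<oplus>\<^bsub>lev P ?Y\<^esub> w"
      by (rule diff_nm[OF f a])
    have "\<psi> ?Y (diff ?Y (nm R ?X ?Y ?f a)) = mtr M ?X ?Y ?f (cofactor G R ?X ?f a \<odot>\<^bsub>mlev M ?X\<^esub> \<psi> ?X (diff ?X a))"
      using H(2)[OF Y I_tr[OF f t] I1D(1)[OF Y w(1)]] H(5)[OF f t] H(3)[OF X ca d[OF X a]] van[OF Y w(1)]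
        M.tr_closed[OF f M.smult_closed[OF X ca H(1)[OF X d[OF X a]]]] w(2) by simp
    then show "lev_comp G (lev R) \<phi> univ_der ?Y (nm R ?X ?Y ?f a) =
        mtr M ?X ?Y ?f (conorm G R H' K a \<odot>\<^bsub>mlev M ?X\<^esub> lev_comp G (lev R) \<phi> univ_der ?X a)"
      by (simp add: d_eq X Y a R.nm_closed[OF f a] cn)
  qed
qed

text \<open>
  The submodule of \<open>I\<close> on which \<open>\<phi>\<close> and \<open>\<phi>'\<close> agree contains the norms with large fibres, where both vanish, and the
  elements \<open>diff a\<close>; these generate \<open>I\<close>.
\<close>

lemma univ_comp_inj:
  assumes M: "green_module G R M" and \<phi>: "\<phi> \<in> module_Hom G R \<Omega> M" "\<phi>' \<in> module_Hom G R \<Omega> M"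
    and eq: "lev_comp G (lev R) \<phi> univ_der = lev_comp G (lev R) \<phi>' univ_der"
  shows "\<phi> = \<phi>'"
proof (rule lev_extensional_eqI[OF module_HomD(1)[OF \<phi>(1)] module_HomD(1)[OF \<phi>(2)]])
  fix X c assume X: "finite_gset G X" and "c \<in> carrier (mlev \<Omega> X)"
  then obtain x where x: "c = cls X x" "x \<in> carrier (mlev I X)" by (auto simp: \<Omega>_carrier)
  let ?N = "\<lambda>X. {x \<in> carrier (mlev I X). \<phi> X (cls X x) = \<phi>' X (cls X x)}"
  have "x \<in> ?N X"
  proof (rule I_generated[OF _ _ _ X x(2)])
    show "is_submodule G R I ?N"
      by (rule equalizer_submodule[OF M Hom_\<Omega>_is_hom(1)[OF M \<phi>(1)] Hom_\<Omega>_is_hom(1)[OF M \<phi>(2)]])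
    show "big Y \<subseteq> ?N Y" if Y: "finite_gset G Y" for Y
    proof
      fix y assume y: "y \<in> big Y"
      then have "y \<in> I1 Y" using gen_submodule_big(2)[OF Y] by blast
      then show "y \<in> ?N Y"
        using Hom_\<Omega>_is_hom(2)[OF M \<phi>(1) Y] Hom_\<Omega>_is_hom(2)[OF M \<phi>(2) Y] I1D(1)[OF Y] by simp
    qed
    show "diff Y a \<in> ?N Y" if Y: "finite_gset G Y" and a: "a \<in> carrier (lev R Y)" for Y a
      using fun_cong[OF fun_cong[OF eq, of Y], of a] right_eq_left_diff(2)[OF Y a] Y a
      by (simp add: lev_comp_apply univ_der_def)
  qed
  then show "\<phi> X c = \<phi>' X c" using x(1) by simp
qed

end

section \<open>Derivations as sections of the square-zero extension\<close>

lemma tambara_map_comp: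
  assumes "tambara_map G R Q \<phi>" "tambara_map G Q T \<psi>"
  shows "tambara_map G R T (\<lambda>X a. \<psi> X (\<phi> X a))"
proof -
  note D = tambara_mapD[OF assms(1)] tambara_mapD[OF assms(2)]
  have "(\<lambda>a. \<psi> X (\<phi> X a)) \<in> ring_hom (lev R X) (lev T X)" if "finite_gset G X" for X
    using ring_hom_trans[OF D(1)[OF that] D(6)[OF that]] by (simp add: comp_def)
  then show ?thesis
    unfolding tambara_map_def by (auto simp: D(2-4,7-9) D(5) gmaps_gset)
qed

lemma square_zero_fst: "tambara_map G (square_zero G R M) R (\<lambda>X. fst)"
  by (auto simp: tambara_map_def square_zero_simps intro!: ring_hom_memI)

lemma square_zero_inl:
  assumes R: "tambara_functor G R" and M: "green_module G R M"
  shows "tambara_map G R (square_zero G R M) (\<lambda>X a. (a, \<zero>\<^bsub>mlev M X\<^esub>))"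
proof -
  interpret R: tambara_functor G R by (rule R)
  interpret M: green_module G R M by (rule M)
  have z: "\<zero>\<^bsub>mlev M X\<^esub> \<in> carrier (mlev M X)" "\<zero>\<^bsub>mlev M X\<^esub> \<oplus>\<^bsub>mlev M X\<^esub> \<zero>\<^bsub>mlev M X\<^esub> = \<zero>\<^bsub>mlev M X\<^esub>"
    if "finite_gset G X" for X
    using abelian_group.axioms(1)[OF M.abelian_lev[OF that]] by (simp_all add: abelian_monoid.zero_closed abelian_monoid.l_zero)
  show ?thesis
    unfolding tambara_map_def
  proof (intro conjI allI impI ballI)
    fix X :: "'a gset" assume X: "finite_gset G X"
    show "(\<lambda>a. (a, \<zero>\<^bsub>mlev M X\<^esub>)) \<in> ring_hom (lev R X) (lev (square_zero G R M) X)"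
      by (rule ring_hom_memI) (simp_all add: square_zero_simps z X M.smult_zero)
  qed (simp_all add: square_zero_simps M.res_zero M.tr_zero M.smult_zero R.cofactor_closed gmaps_gset)
qed

context relative_tambara begin

text \<open>
  The condition on \<open>d\<close> for norms between orbits says exactly that \<open>a \<mapsto> (a, d a)\<close> preserves these norms; then it
  preserves all norms.
\<close>

lemma Der_section:
  assumes M: "green_module G R M" and d: "d \<in> genuine_Der G S R \<eta> M"
  shows "tambara_map G R (square_zero G R M) (\<lambda>X a. (a, d X a))"
proof (rule tambara_map_orbitsI[OF R.tambara_functor_axioms square_zero_tambara[OF R.tambara_functor_axioms M]])
  interpret M: green_module G R M by (rule M)
  note D = genuine_DerD[OF d]
  have dc: "d X a \<in> carrier (mlev M X)" if "finite_gset G X" "a \<in> carrier (lev R X)" for X a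
    using hom_in_carrier[OF D(2)[OF that(1)]] that(2) by simp
  show "(\<lambda>a. (a, d X a)) \<in> ring_hom (lev R X) (lev (square_zero G R M) X)" if X: "finite_gset G X" for X
  proof (rule ring_hom_memI)
    interpret r: cring "lev R X" by (rule R.cring_lev[OF X])
    interpret m: module "lev R X" "mlev M X" by (rule M.module_lev[OF X])
    have "d X \<one>\<^bsub>lev R X\<^esub> = d X \<one>\<^bsub>lev R X\<^esub> \<oplus>\<^bsub>mlev M X\<^esub> d X \<one>\<^bsub>lev R X\<^esub>"
      using D(5)[OF X r.one_closed r.one_closed] dc[OF X r.one_closed] by simp
    then have "d X \<one>\<^bsub>lev R X\<^esub> = \<zero>\<^bsub>mlev M X\<^esub>"
      using dc[OF X r.one_closed] m.M.add.l_cancel_one' by blast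
    then show "(\<one>\<^bsub>lev R X\<^esub>, d X \<one>\<^bsub>lev R X\<^esub>) = \<one>\<^bsub>lev (square_zero G R M) X\<^esub>" by (simp add: square_zero_simps)
    show "(a \<oplus>\<^bsub>lev R X\<^esub> b, d X (a \<oplus>\<^bsub>lev R X\<^esub> b)) = (a, d X a) \<oplus>\<^bsub>lev (square_zero G R M) X\<^esub> (b, d X b)"
      if "a \<in> carrier (lev R X)" "b \<in> carrier (lev R X)" for a b
      using hom_mult[OF D(2)[OF X], of a b] that by (simp add: square_zero_simps)
  qed (simp_all add: square_zero_simps dc X D(5))
  show "(res R X Y f b, d X (res R X Y f b)) = res (square_zero G R M) X Y f (b, d Y b)"
    if "f \<in> gmaps G X Y" "b \<in> carrier (lev R Y)" for X Y f b
    by (simp add: square_zero_simps D(3)[OF that])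
  show "(tr R X Y f a, d Y (tr R X Y f a)) = tr (square_zero G R M) X Y f (a, d X a)"
    if "f \<in> gmaps G X Y" "a \<in> carrier (lev R X)" for X Y f a
    by (simp add: square_zero_simps D(4)[OF that])
  show "(nm R (orbit_set G H) (orbit_set G K) (orbit_proj G H K) a,
         d (orbit_set G K) (nm R (orbit_set G H) (orbit_set G K) (orbit_proj G H K) a)) =
      nm (square_zero G R M) (orbit_set G H) (orbit_set G K) (orbit_proj G H K) (a, d (orbit_set G H) a)"
    if "subgroup H G" "subgroup K G" "H \<subseteq> K" "a \<in> carrier (lev R (orbit_set G H))" for H K a
    by (simp add: square_zero_simps D(6)[OF that]
        conorm_cofactor[OF R.group_G R.finite_G that(2) R.tambara_functor_axioms that(1,3,4)])
qed

text \<open>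
  The map \<open>\<Theta> : P \<rightarrow> R \<oplus> M\<close> induced by \<open>a \<mapsto> (a, 0)\<close> and \<open>a \<mapsto> (a, d a)\<close> has first component \<open>\<mu>\<close>, so on \<open>I\<close> it
  is a map \<open>\<psi>\<close> to \<open>M\<close>, and \<open>right a = left a + diff a\<close> becomes \<open>(a, d a) = (a, 0) + (0, \<psi> (diff a))\<close>.  The norm of
  \<open>(0, m)\<close> along a map with large fibres is \<open>0\<close>, as the cofactor of \<open>0\<close> is.
\<close>

lemma Der_factors:
  assumes M: "green_module G R M" and d: "d \<in> genuine_Der G S R \<eta> M"
  obtains \<phi> where "\<phi> \<in> module_Hom G R \<Omega> M" "lev_comp G (lev R) \<phi> univ_der = d"
proof -
  interpret M: green_module G R M by (rule M)
  let ?Q = "square_zero G R M"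
  have Q: "tambara_functor G ?Q" by (rule square_zero_tambara[OF R.tambara_functor_axioms M])
  interpret Q: tambara_functor G ?Q by (rule Q)
  note D = genuine_DerD[OF d] and inl = square_zero_inl[OF R.tambara_functor_axioms M] and sec = Der_section[OF M d]
  have ag: "(\<eta> X s, \<zero>\<^bsub>mlev M X\<^esub>) = (\<eta> X s, d X (\<eta> X s))" if "finite_gset G X" "s \<in> carrier (lev S X)" for X s
    using D(7)[OF that] by simp
  define \<Theta> where "\<Theta> = copair ?Q (\<lambda>X a. (a, \<zero>\<^bsub>mlev M X\<^esub>)) (\<lambda>X a. (a, d X a))"
  note U = coprod_universal[OF algebra algebra Q inl sec ag, folded box_square_def \<Theta>_def]
  have \<Theta>: "tambara_map G P ?Q \<Theta>" by (rule U(1); assumption)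
  have \<Theta>l: "\<Theta> X (left X a) = (a, \<zero>\<^bsub>mlev M X\<^esub>)" if "finite_gset G X" "a \<in> carrier (lev R X)" for X a
    by (rule U(2)) (use that in simp_all)
  have \<Theta>r: "\<Theta> X (right X a) = (a, d X a)" if "finite_gset G X" "a \<in> carrier (lev R X)" for X a
    by (rule U(3)) (use that in simp_all)
  note T = tambara_mapD[OF \<Theta>]
  have fst: "fst (\<Theta> X c) = \<mu> X c" if "c \<in> carrier (lev P X)" for X c
    unfolding mult_map_def
    by (rule coprod_universal(4)[OF algebra algebra R.tambara_functor_axioms id_map id_map refl
          tambara_map_comp[OF \<Theta> square_zero_fst, unfolded box_square_def] _ _ that[unfolded box_square_def]])
      (simp_all add: \<Theta>l \<Theta>r)
  define \<psi> where "\<psi> X x = snd (\<Theta> X x)" for X x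
  have \<Theta>I: "\<Theta> X x = (\<zero>\<^bsub>lev R X\<^esub>, \<psi> X x)" "\<psi> X x \<in> carrier (mlev M X)"
    if "finite_gset G X" "x \<in> carrier (mlev I X)" for X x
  proof -
    note x = I_carrierD[OF that(2)]
    show "\<Theta> X x = (\<zero>\<^bsub>lev R X\<^esub>, \<psi> X x)" using fst[OF x(1)] x(2) by (simp add: \<psi>_def prod_eq_iff)
    show "\<psi> X x \<in> carrier (mlev M X)" using T(5)[OF that(1) x(1)] by (auto simp: \<psi>_def square_zero_simps)
  qed
  have \<Theta>add: "\<Theta> X (x \<oplus>\<^bsub>lev P X\<^esub> y) = \<Theta> X x \<oplus>\<^bsub>lev ?Q X\<^esub> \<Theta> X y"
    if "finite_gset G X" "x \<in> carrier (lev P X)" "y \<in> carrier (lev P X)" for X x y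
    by (rule ring_hom_add[OF T(1)[OF that(1)] that(2,3)])
  have \<psi>: "is_hom M \<psi>"
    unfolding is_hom_def
  proof (intro conjI allI impI ballI)
    fix X :: "'g gset" and x assume X: "finite_gset G X" and x: "x \<in> carrier (mlev I X)"
    interpret r: cring "lev R X" by (rule R.cring_lev[OF X])
    interpret m: module "lev R X" "mlev M X" by (rule M.module_lev[OF X])
    show "\<psi> X x \<in> carrier (mlev M X)" by (rule \<Theta>I(2)[OF X x])
    show "\<psi> X (x \<oplus>\<^bsub>lev P X\<^esub> y) = \<psi> X x \<oplus>\<^bsub>mlev M X\<^esub> \<psi> X y" if y: "y \<in> carrier (mlev I X)" for y
      using \<Theta>add[OF X I_carrierD(1)[OF x] I_carrierD(1)[OF y]] \<Theta>I(1)[OF X x] \<Theta>I(1)[OF X y]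
        \<Theta>I(1)[OF X I_closed(2)[OF X x y]] by (simp add: square_zero_simps)
    show "\<psi> X (left X a \<otimes>\<^bsub>lev P X\<^esub> x) = a \<odot>\<^bsub>mlev M X\<^esub> \<psi> X x" if a: "a \<in> carrier (lev R X)" for a
      using ring_hom_mult[OF T(1)[OF X] leftD(5)[OF X a] I_carrierD(1)[OF x]] \<Theta>l[OF X a] \<Theta>I[OF X x]
        \<Theta>I(1)[OF X I_closed(3)[OF X leftD(5)[OF X a] x]] a by (simp add: square_zero_simps)
  next
    fix X Y :: "'g gset" and f assume f: "f \<in> gmaps G X Y"
    note X = gmaps_gset(1)[OF f] and Y = gmaps_gset(2)[OF f]
    show "\<psi> X (res P X Y f x) = mres M X Y f (\<psi> Y x)" if x: "x \<in> carrier (mlev I Y)" for x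
      using T(2)[OF f I_carrierD(1)[OF x]] \<Theta>I(1)[OF Y x] \<Theta>I(1)[OF X I_res[OF f x]] by (simp add: square_zero_simps)
    show "\<psi> Y (tr P X Y f x) = mtr M X Y f (\<psi> X x)" if x: "x \<in> carrier (mlev I X)" for x
      using T(3)[OF f I_carrierD(1)[OF x]] \<Theta>I(1)[OF X x] \<Theta>I(1)[OF Y I_tr[OF f x]] by (simp add: square_zero_simps)
  qed
  have van: "\<psi> Y y = \<zero>\<^bsub>mlev M Y\<^esub>" if Y: "finite_gset G Y" and y: "y \<in> big Y" for Y y
  proof -
    obtain X f x where f: "f \<in> gmaps G X Y" "\<forall>y\<in>pts Y. 1 < card {z \<in> pts X. f z = y}"
      and x: "x \<in> carrier (mlev I X)" and y': "y = nm P X Y f x"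
      using y by (auto simp: big_norms_def)
    note X = gmaps_gset(1)[OF f(1)]
    interpret m: module "lev R X" "mlev M X" by (rule M.module_lev[OF X])
    have "\<Theta> Y y = nm ?Q X Y f (\<zero>\<^bsub>lev R X\<^esub>, \<psi> X x)"
      using T(4)[OF f(1) I_carrierD(1)[OF x]] \<Theta>I(1)[OF X x] y' by simp
    also have "snd \<dots> = \<zero>\<^bsub>mlev M Y\<^esub>"
      using R.cofactor_zero[OF f(1)] f(2) \<Theta>I(2)[OF X x] by (simp add: square_zero_simps M.tr_zero[OF f(1)])
    finally show ?thesis by (simp add: \<psi>_def)
  qed
  have van1: "\<psi> X n = \<zero>\<^bsub>mlev M X\<^esub>" if "finite_gset G X" "n \<in> I1 X" for X n
    by (rule hom_vanishes[OF M \<psi> van that(2)])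
  obtain \<phi> where \<phi>: "\<phi> \<in> module_Hom G R \<Omega> M"
    "\<forall>X. finite_gset G X \<longrightarrow> (\<forall>x\<in>carrier (mlev I X). \<phi> X (cls X x) = \<psi> X x)"
    by (rule is_hom_lift[OF M \<psi> van1])
  have "lev_comp G (lev R) \<phi> univ_der = d"
  proof (rule lev_extensional_eqI[OF lev_comp_extensional D(1)])
    fix X a assume X: "finite_gset G X" and a: "a \<in> carrier (lev R X)"
    interpret r: cring "lev R X" by (rule R.cring_lev[OF X])
    interpret m: module "lev R X" "mlev M X" by (rule M.module_lev[OF X])
    note da = right_eq_left_diff[OF X a]
    have "(a, d X a) = (a, \<zero>\<^bsub>mlev M X\<^esub>) \<oplus>\<^bsub>lev ?Q X\<^esub> (\<zero>\<^bsub>lev R X\<^esub>, \<psi> X (diff X a))"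
      using \<Theta>add[OF X leftD(5)[OF X a] I_carrierD(1)[OF da(2)]] da(1) \<Theta>r[OF X a] \<Theta>l[OF X a] \<Theta>I(1)[OF X da(2)]
      by simp
    then have "d X a = \<psi> X (diff X a)" using \<Theta>I(2)[OF X da(2)] by (simp add: square_zero_simps)
    then show "lev_comp G (lev R) \<phi> univ_der X a = d X a"
      using \<phi>(2) X a da(2) by (simp add: lev_comp_apply univ_der_def)
  qed
  with \<phi>(1) show thesis by (rule that)
qed

lemma univ_comp_bij:
  assumes M: "green_module G R M"
  shows "bij_betw (\<lambda>\<phi>. lev_comp G (lev R) \<phi> univ_der) (module_Hom G R \<Omega> M) (genuine_Der G S R \<eta> M)"
proof (rule bij_betw_imageI)
  show "inj_on (\<lambda>\<phi>. lev_comp G (lev R) \<phi> univ_der) (module_Hom G R \<Omega> M)"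
    by (rule inj_onI) (rule univ_comp_inj[OF M])
  show "(\<lambda>\<phi>. lev_comp G (lev R) \<phi> univ_der) ` module_Hom G R \<Omega> M = genuine_Der G S R \<eta> M"
  proof (intro equalityI subsetI)
    fix d assume "d \<in> genuine_Der G S R \<eta> M"
    then obtain \<phi> where "\<phi> \<in> module_Hom G R \<Omega> M" "lev_comp G (lev R) \<phi> univ_der = d" by (rule Der_factors[OF M])
    then show "d \<in> (\<lambda>\<phi>. lev_comp G (lev R) \<phi> univ_der) ` module_Hom G R \<Omega> M" by blast
  qed (use univ_comp_Der[OF M] in blast)
qed

lemma Hom_\<Omega>_comp:
  assumes "h \<in> module_Hom G R M N" "\<phi> \<in> module_Hom G R \<Omega> M"
  shows "lev_comp G (mlev \<Omega>) h \<phi> \<in> module_Hom G R \<Omega> N"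
  by (rule module_Hom_comp[OF assms])
    (auto simp: \<Omega>_carrier \<Omega>_add \<Omega>_smult \<Omega>_res \<Omega>_tr intro!: imageI I_closed I_res I_tr leftD(5))

end

theorem theorem5p7:
  fixes G :: "('g, 'k) monoid_scheme"
    and S :: "('g, 's) tambara"
    and R :: "('g, 'r) tambara"
    and \<eta> :: "'g gset \<Rightarrow> 's \<Rightarrow> 'r"
  assumes "group G" and "finite (carrier G)"
    and "tambara_functor G S"
    and "tambara_algebra G S R \<eta>"
  shows "\<exists>\<Phi> :: ('g, 'r, 'm) gmodule \<Rightarrow> ('g gset \<Rightarrow> 'r \<Rightarrow> 'm) \<Rightarrow>
                 ('g gset \<Rightarrow> ('g, 'r, 'r) texp set set \<Rightarrow> 'm).
      (\<forall>M. green_module G R M \<longrightarrow>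
         bij_betw (\<Phi> M) (genuine_Der G S R \<eta> M) (module_Hom G R (genuine_Kahler G S R \<eta>) M)) \<and>
      (\<forall>M M' h d. green_module G R M \<longrightarrow> green_module G R M' \<longrightarrow>
         h \<in> module_Hom G R M M' \<longrightarrow> d \<in> genuine_Der G S R \<eta> M \<longrightarrow>
         \<Phi> M' (lev_comp G (lev R) h d) =
           lev_comp G (mlev (genuine_Kahler G S R \<eta>)) h (\<Phi> M d))"
proof -
  interpret relative_tambara G S R \<eta> by (rule relative_tambara.intro) fact
  \<comment> \<open>The inverse \<open>\<Psi>\<close> of the isomorphism is the one given by a formula, and its naturality is immediate.\<close>
  define \<Psi> :: "('g gset \<Rightarrow> ('g, 'r, 'r) texp set set \<Rightarrow> 'm) \<Rightarrow> 'g gset \<Rightarrow> 'r \<Rightarrow> 'm"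
    where "\<Psi> \<phi> = lev_comp G (lev R) \<phi> univ_der" for \<phi>
  define \<Phi> :: "('g, 'r, 'm) gmodule \<Rightarrow> ('g gset \<Rightarrow> 'r \<Rightarrow> 'm) \<Rightarrow> 'g gset \<Rightarrow> ('g, 'r, 'r) texp set set \<Rightarrow> 'm"
    where "\<Phi> M = inv_into (module_Hom G R \<Omega> M) \<Psi>" for M
  have \<Psi>: "bij_betw \<Psi> (module_Hom G R \<Omega> M) (genuine_Der G S R \<eta> M)" if "green_module G R M" for M
    using univ_comp_bij[OF that] unfolding \<Psi>_def[abs_def] .
  show ?thesis
  proof (intro exI[of _ \<Phi>] conjI allI impI)
    show "bij_betw (\<Phi> M) (genuine_Der G S R \<eta> M) (module_Hom G R \<Omega> M)" if "green_module G R M" for M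
      unfolding \<Phi>_def by (rule bij_betw_inv_into[OF \<Psi>[OF that]])
    fix M M' :: "('g, 'r, 'm) gmodule" and h d
    assume M: "green_module G R M" and M': "green_module G R M'" and h: "h \<in> module_Hom G R M M'"
      and d: "d \<in> genuine_Der G S R \<eta> M"
    obtain \<phi> where \<phi>: "\<phi> \<in> module_Hom G R \<Omega> M" "d = \<Psi> \<phi>"
      using \<Psi>[OF M] d by (auto simp: bij_betw_def)
    have "lev_comp G (lev R) h d = \<Psi> (lev_comp G (mlev \<Omega>) h \<phi>)"
      unfolding \<phi>(2) \<Psi>_def
      by (rule lev_extensional_eqI[OF lev_comp_extensional lev_comp_extensional])
        (simp add: lev_comp_apply univ_der_closed)
    then have "\<Phi> M' (lev_comp G (lev R) h d) = lev_comp G (mlev \<Omega>) h \<phi>"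
      using bij_betw_inv_into_left[OF \<Psi>[OF M'] Hom_\<Omega>_comp[OF h \<phi>(1)]] by (simp add: \<Phi>_def)
    also have "\<phi> = \<Phi> M d"
      using bij_betw_inv_into_left[OF \<Psi>[OF M] \<phi>(1)] \<phi>(2) by (simp add: \<Phi>_def)
    finally show "\<Phi> M' (lev_comp G (lev R) h d) = lev_comp G (mlev \<Omega>) h (\<Phi> M d)" .
  qed
qed

end
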